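(* There is an equivalence of categories $\mathbf{Mnd}_f(\mathbf{Set})\simeq\mathbf{Law}$, which commutes, to within pseudonatural equivalence, with the (contravariant) functors to $\mathbf{CAT}$ sending a finitary monad $\mathsf T$ to its category of algebras $\mathsf T\text{-}\mathbf{Alg}$ and a Lawvere theory $\mathbf T$ to its category of models $\mathbf T\text{-}\mathbf{Mod}$. That is, the composite of $\mathbf{Mnd}_f(\mathbf{Set})\to\mathbf{Law}$ with $(-)\text{-}\mathbf{Mod}$ is pseudonaturally equivalent to $(-)\text{-}\mathbf{Alg}$.
   Context: $\mathbf{Mnd}_f(\mathbf{Set})$ is the category of finitary monads on $\mathbf{Set}$ (those whose underlying endofunctor preserves filtered colimits) and monad morphisms. $\mathsf T\text{-}\mathbf{Alg}$ is the category of $\mathsf T$-algebras; a monad morphism $\mathsf S\to\mathsf T$ induces $\mathsf T\text{-}\mathbf{Alg}\to\mathsf S\text{-}\mathbf{Alg}$. A Lawvere theory is a category $\mathbf T$ with finite products whose objects are the distinct finite powers $X^n$ ($n\in\mathbb N$) of a distinguished object $X$ (the powers $X^n$ with their projections $X^n\to X$ being part of the structure, with $X^1=X$ and identity projection). A morphism of Lawvere theories is a functor strictly preserving finite products and the distinguished object (i.e. strictly preserving $X$ and the chosen powers with their projections); $\mathbf{Law}$ is the resulting category. A model of $\mathbf T$ is a finite-product-preserving functor $\mathbf T\to\mathbf{Set}$; $\mathbf T\text{-}\mathbf{Mod}$ is the category of models and natural transformations, and a morphism $\mathbf S\to\mathbf T$ induces $\mathbf T\text{-}\mathbf{Mod}\to\mathbf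 S\text{-}\mathbf{Mod}$ by precomposition. *)

theory Defs
  imports "HOL-Library.FuncSet"
begin

section \<open>Categories, functors, natural transformations\<close>

record ('o, 'a) category =
  Obj :: "'o set"
  Arr :: "'a set"
  Dom :: "'a \<Rightarrow> 'o"
  Cod :: "'a \<Rightarrow> 'o"
  Idn :: "'o \<Rightarrow> 'a"
  Cmp :: "'a \<Rightarrow> 'a \<Rightarrow> 'a"

text \<open>\<open>Cmp C g f\<close> is the composite of first \<open>f\<close>, then \<open>g\<close>. The values of the operations outside
  their domains (non-objects, non-composable pairs) carry no meaning.\<close>

definition hom :: "('o, 'a) category \<Rightarrow> 'o \<Rightarrow> 'o \<Rightarrow> 'a set" where
  "hom C x y = {f \<in> Arr C. Dom C f = x \<and> Cod C f = y}"

definition is_category :: "('o, 'a) category \<Rightarrow> bool" where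
  "is_category C \<longleftrightarrow>
     (\<forall>f\<in>Arr C. Dom C f \<in> Obj C \<and> Cod C f \<in> Obj C) \<and>
     (\<forall>x\<in>Obj C. Idn C x \<in> hom C x x) \<and>
     (\<forall>f\<in>Arr C. \<forall>g\<in>Arr C. Cod C f = Dom C g \<longrightarrow> Cmp C g f \<in> hom C (Dom C f) (Cod C g)) \<and>
     (\<forall>f\<in>Arr C. Cmp C f (Idn C (Dom C f)) = f \<and> Cmp C (Idn C (Cod C f)) f = f) \<and>
     (\<forall>f\<in>Arr C. \<forall>g\<in>Arr C. \<forall>h\<in>Arr C. Cod C f = Dom C g \<longrightarrow> Cod C g = Dom C h \<longrightarrow>
        Cmp C h (Cmp C g f) = Cmp C (Cmp C h g) f)"

definition full_subcategory :: "('o, 'a) category \<Rightarrow> 'o set \<Rightarrow> ('o, 'a) category" where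
  "full_subcategory C S =
     C\<lparr>Obj := Obj C \<inter> S, Arr := {f \<in> Arr C. Dom C f \<in> S \<and> Cod C f \<in> S}\<rparr>"

definition is_iso :: "('o, 'a) category \<Rightarrow> 'a \<Rightarrow> bool" where
  "is_iso C f \<longleftrightarrow> f \<in> Arr C \<and>
     (\<exists>g\<in>hom C (Cod C f) (Dom C f). Cmp C g f = Idn C (Dom C f) \<and> Cmp C f g = Idn C (Cod C f))"

record ('o, 'a, 'p, 'b) cfunctor =
  FO :: "'o \<Rightarrow> 'p"
  FA :: "'a \<Rightarrow> 'b"

text \<open>Functors and natural transformations are extensional (\<^term>\<open>undefined\<close> off the objects and
  arrows of the source), so that HOL equality is equality of functors and of transformations.\<close>

definition is_functor ::
    "('o, 'a) category \<Rightarrow> ('p, 'b) category \<Rightarrow> ('o, 'a, 'p, 'b) cfunctor \<Rightarrow> bool" where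
  "is_functor C D F \<longleftrightarrow>
     FO F \<in> Obj C \<rightarrow>\<^sub>E Obj D \<and> FA F \<in> Arr C \<rightarrow>\<^sub>E Arr D \<and>
     (\<forall>f\<in>Arr C. FA F f \<in> hom D (FO F (Dom C f)) (FO F (Cod C f))) \<and>
     (\<forall>x\<in>Obj C. FA F (Idn C x) = Idn D (FO F x)) \<and>
     (\<forall>f\<in>Arr C. \<forall>g\<in>Arr C. Cod C f = Dom C g \<longrightarrow> FA F (Cmp C g f) = Cmp D (FA F g) (FA F f))"

definition id_functor :: "('o, 'a) category \<Rightarrow> ('o, 'a, 'o, 'a) cfunctor" where
  "id_functor C = \<lparr>FO = (\<lambda>x\<in>Obj C. x), FA = (\<lambda>f\<in>Arr C. f)\<rparr>"

text \<open>\<open>comp_functor C G F\<close> is \<open>G \<circ> F\<close>, where \<open>C\<close> is the source of \<open>F\<close>.\<close>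

definition comp_functor ::
    "('o, 'a) category \<Rightarrow> ('p, 'b, 'q, 'c) cfunctor \<Rightarrow> ('o, 'a, 'p, 'b) cfunctor
      \<Rightarrow> ('o, 'a, 'q, 'c) cfunctor" where
  "comp_functor C G F = \<lparr>FO = compose (Obj C) (FO G) (FO F), FA = compose (Arr C) (FA G) (FA F)\<rparr>"

definition is_nat_trans ::
    "('o, 'a) category \<Rightarrow> ('p, 'b) category \<Rightarrow> ('o, 'a, 'p, 'b) cfunctor
      \<Rightarrow> ('o, 'a, 'p, 'b) cfunctor \<Rightarrow> ('o \<Rightarrow> 'b) \<Rightarrow> bool" where
  "is_nat_trans C D F G \<tau> \<longleftrightarrow>
     is_functor C D F \<and> is_functor C D G \<and> \<tau> \<in> extensional (Obj C) \<and>
     (\<forall>x\<in>Obj C. \<tau> x \<in> hom D (FO F x) (FO G x)) \<and>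
     (\<forall>f\<in>Arr C. Cmp D (\<tau> (Cod C f)) (FA F f) = Cmp D (FA G f) (\<tau> (Dom C f)))"

definition is_nat_iso ::
    "('o, 'a) category \<Rightarrow> ('p, 'b) category \<Rightarrow> ('o, 'a, 'p, 'b) cfunctor
      \<Rightarrow> ('o, 'a, 'p, 'b) cfunctor \<Rightarrow> ('o \<Rightarrow> 'b) \<Rightarrow> bool" where
  "is_nat_iso C D F G \<tau> \<longleftrightarrow> is_nat_trans C D F G \<tau> \<and> (\<forall>x\<in>Obj C. is_iso D (\<tau> x))"

definition is_equivalence ::
    "('o, 'a) category \<Rightarrow> ('p, 'b) category \<Rightarrow> ('o, 'a, 'p, 'b) cfunctor \<Rightarrow> bool" where
  "is_equivalence C D F \<longleftrightarrow>
     is_category C \<and> is_category D \<and> is_functor C D F \<and>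
     (\<exists>G \<eta> \<epsilon>. is_functor D C G \<and>
        is_nat_iso C C (id_functor C) (comp_functor C G F) \<eta> \<and>
        is_nat_iso D D (comp_functor D F G) (id_functor D) \<epsilon>)"

text \<open>In the concrete categories below an arrow records its source and target.\<close>

datatype ('o, 'm) arrow = Arrow (src: 'o) (trg: 'o) (fn: 'm)

definition functor_category ::
    "('o, 'a) category \<Rightarrow> ('p, 'b) category
      \<Rightarrow> (('o, 'a, 'p, 'b) cfunctor, (('o, 'a, 'p, 'b) cfunctor, 'o \<Rightarrow> 'b) arrow) category" where
  "functor_category C D =
     \<lparr>Obj = {F. is_functor C D F},
      Arr = {Arrow F G \<tau> |F G \<tau>. is_nat_trans C D F G \<tau>},
      Dom = src, Cod = trg,
      Idn = (\<lambda>F. Arrow F F (\<lambda>x\<in>Obj C. Idn D (FO F x))),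
      Cmp = (\<lambda>\<beta> \<alpha>. Arrow (src \<alpha>) (trg \<beta>) (\<lambda>x\<in>Obj C. Cmp D (fn \<beta> x) (fn \<alpha> x)))\<rparr>"


section \<open>Finite products\<close>

definition is_product ::
    "('o, 'a) category \<Rightarrow> nat \<Rightarrow> (nat \<Rightarrow> 'o) \<Rightarrow> 'o \<Rightarrow> (nat \<Rightarrow> 'a) \<Rightarrow> bool" where
  "is_product C n A P \<pi> \<longleftrightarrow>
     P \<in> Obj C \<and> (\<forall>i<n. A i \<in> Obj C \<and> \<pi> i \<in> hom C P (A i)) \<and>
     (\<forall>Q\<in>Obj C. \<forall>f. (\<forall>i<n. f i \<in> hom C Q (A i)) \<longrightarrow>
        (\<exists>!h. h \<in> hom C Q P \<and> (\<forall>i<n. Cmp C (\<pi> i) h = f i)))"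

definition has_finite_products :: "('o, 'a) category \<Rightarrow> bool" where
  "has_finite_products C \<longleftrightarrow>
     (\<forall>n A. (\<forall>i<n. A i \<in> Obj C) \<longrightarrow> (\<exists>P \<pi>. is_product C n A P \<pi>))"

definition preserves_finite_products ::
    "('o, 'a) category \<Rightarrow> ('p, 'b) category \<Rightarrow> ('o, 'a, 'p, 'b) cfunctor \<Rightarrow> bool" where
  "preserves_finite_products C D F \<longleftrightarrow>
     (\<forall>n A P \<pi>. is_product C n A P \<pi> \<longrightarrow>
        is_product D n (\<lambda>i. FO F (A i)) (FO F P) (\<lambda>i. FA F (\<pi> i)))"


section \<open>The category of sets\<close>

text \<open>Sets are the small subsets of a type \<open>'u\<close>, for a notion of smallness satisfying the axioms
  below. If \<open>'u\<close> is the class of all sets of a model of set theory, and a subset is small when it is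
  the extension of a set, this is the usual category of sets; if \<open>'u\<close> is any infinite type, all
  subsets may be taken to be small. Closure of small sets under function spaces is not assumed.\<close>

locale set_universe =
  fixes small :: "'u set \<Rightarrow> bool"
  assumes small_infinite: "\<exists>A. small A \<and> infinite A"
    and small_subset: "small A \<Longrightarrow> B \<subseteq> A \<Longrightarrow> small B"
    and small_image: "small A \<Longrightarrow> small (f ` A)"
    and small_UN: "small I \<Longrightarrow> (\<And>i. i \<in> I \<Longrightarrow> small (X i)) \<Longrightarrow> small (\<Union>i\<in>I. X i)"

lemma set_universe_all_subsets:
  assumes "infinite (UNIV :: 'u set)"
  shows "set_universe (\<lambda>A :: 'u set. True)"
  using assms by unfold_locales auto

type_synonym 'u set_arrow = "('u set, 'u \<Rightarrow> 'u) arrow"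

definition set_cat :: "('u set \<Rightarrow> bool) \<Rightarrow> ('u set, 'u set_arrow) category" where
  "set_cat small =
     \<lparr>Obj = {A. small A},
      Arr = {Arrow A B f |A B f. small A \<and> small B \<and> f \<in> A \<rightarrow>\<^sub>E B},
      Dom = src, Cod = trg,
      Idn = (\<lambda>A. Arrow A A (\<lambda>x\<in>A. x)),
      Cmp = (\<lambda>g f. Arrow (src f) (trg g) (compose (src f) (fn g) (fn f)))\<rparr>"


section \<open>Filtered colimits\<close>

definition is_filtered :: "('o, 'a) category \<Rightarrow> bool" where
  "is_filtered J \<longleftrightarrow>
     Obj J \<noteq> {} \<and>
     (\<forall>x\<in>Obj J. \<forall>y\<in>Obj J. \<exists>z\<in>Obj J. hom J x z \<noteq> {} \<and> hom J y z \<noteq> {}) \<and>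
     (\<forall>x\<in>Obj J. \<forall>y\<in>Obj J. \<forall>f\<in>hom J x y. \<forall>g\<in>hom J x y.
        \<exists>z\<in>Obj J. \<exists>h\<in>hom J y z. Cmp J h f = Cmp J h g)"

definition is_cocone ::
    "('j, 'k) category \<Rightarrow> ('o, 'a) category \<Rightarrow> ('j, 'k, 'o, 'a) cfunctor \<Rightarrow> 'o \<Rightarrow> ('j \<Rightarrow> 'a)
      \<Rightarrow> bool" where
  "is_cocone J C D L c \<longleftrightarrow>
     L \<in> Obj C \<and> (\<forall>j\<in>Obj J. c j \<in> hom C (FO D j) L) \<and>
     (\<forall>u\<in>Arr J. Cmp C (c (Cod J u)) (FA D u) = c (Dom J u))"

definition is_colimit ::
    "('j, 'k) category \<Rightarrow> ('o, 'a) category \<Rightarrow> ('j, 'k, 'o, 'a) cfunctor \<Rightarrow> 'o \<Rightarrow> ('j \<Rightarrow> 'a)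
      \<Rightarrow> bool" where
  "is_colimit J C D L c \<longleftrightarrow>
     is_cocone J C D L c \<and>
     (\<forall>M d. is_cocone J C D M d \<longrightarrow>
        (\<exists>!h. h \<in> hom C L M \<and> (\<forall>j\<in>Obj J. Cmp C h (c j) = d j)))"

text \<open>A small category is taken to have its objects and arrows in the universe \<open>'u\<close>; up to
  isomorphism every small category is of this form.\<close>

definition preserves_filtered_colimits ::
    "('u set \<Rightarrow> bool) \<Rightarrow> ('o, 'a) category \<Rightarrow> ('p, 'b) category \<Rightarrow> ('o, 'a, 'p, 'b) cfunctor
      \<Rightarrow> bool" where
  "preserves_filtered_colimits small C D F \<longleftrightarrow>
     (\<forall>J :: ('u, 'u) category.
        is_category J \<and> small (Obj J) \<and> small (Arr J) \<and> is_filtered J \<longrightarrow>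
        (\<forall>K L c. is_functor J C K \<and> is_colimit J C K L c \<longrightarrow>
           is_colimit J D (comp_functor J F K) (FO F L) (\<lambda>j. FA F (c j))))"


section \<open>Monads and their algebras\<close>

record ('o, 'a) monad =
  endo :: "('o, 'a, 'o, 'a) cfunctor"
  unit :: "'o \<Rightarrow> 'a"
  mult :: "'o \<Rightarrow> 'a"

definition is_monad :: "('o, 'a) category \<Rightarrow> ('o, 'a) monad \<Rightarrow> bool" where
  "is_monad C T \<longleftrightarrow>
     is_functor C C (endo T) \<and>
     is_nat_trans C C (id_functor C) (endo T) (unit T) \<and>
     is_nat_trans C C (comp_functor C (endo T) (endo T)) (endo T) (mult T) \<and>
     (\<forall>x\<in>Obj C.
        Cmp C (mult T x) (unit T (FO (endo T) x)) = Idn C (FO (endo T) x) \<and>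
        Cmp C (mult T x) (FA (endo T) (unit T x)) = Idn C (FO (endo T) x) \<and>
        Cmp C (mult T x) (mult T (FO (endo T) x)) = Cmp C (mult T x) (FA (endo T) (mult T x)))"

definition is_monad_morphism ::
    "('o, 'a) category \<Rightarrow> ('o, 'a) monad \<Rightarrow> ('o, 'a) monad \<Rightarrow> ('o \<Rightarrow> 'a) \<Rightarrow> bool" where
  "is_monad_morphism C S T \<sigma> \<longleftrightarrow>
     is_nat_trans C C (endo S) (endo T) \<sigma> \<and>
     (\<forall>x\<in>Obj C.
        Cmp C (\<sigma> x) (unit S x) = unit T x \<and>
        Cmp C (\<sigma> x) (mult S x)
          = Cmp C (mult T x) (Cmp C (\<sigma> (FO (endo T) x)) (FA (endo S) (\<sigma> x))))"

type_synonym ('o, 'a) monad_arrow = "(('o, 'a) monad, 'o \<Rightarrow> 'a) arrow"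

definition monad_category ::
    "('o, 'a) category \<Rightarrow> (('o, 'a) monad, ('o, 'a) monad_arrow) category" where
  "monad_category C =
     \<lparr>Obj = {T. is_monad C T},
      Arr = {Arrow S T \<sigma> |S T \<sigma>. is_monad C S \<and> is_monad C T \<and> is_monad_morphism C S T \<sigma>},
      Dom = src, Cod = trg,
      Idn = (\<lambda>T. Arrow T T (\<lambda>x\<in>Obj C. Idn C (FO (endo T) x))),
      Cmp = (\<lambda>\<tau> \<sigma>. Arrow (src \<sigma>) (trg \<tau>) (\<lambda>x\<in>Obj C. Cmp C (fn \<tau> x) (fn \<sigma> x)))\<rparr>"

definition Mnd\<^sub>f ::
    "('u set \<Rightarrow> bool)
      \<Rightarrow> (('u set, 'u set_arrow) monad, ('u set, 'u set_arrow) monad_arrow) category" where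
  "Mnd\<^sub>f small = full_subcategory (monad_category (set_cat small))
     {T. preserves_filtered_colimits small (set_cat small) (set_cat small) (endo T)}"

text \<open>An algebra is a pair of a carrier object and a structure arrow.\<close>

definition is_algebra :: "('o, 'a) category \<Rightarrow> ('o, 'a) monad \<Rightarrow> 'o \<times> 'a \<Rightarrow> bool" where
  "is_algebra C T = (\<lambda>(x, a).
     x \<in> Obj C \<and> a \<in> hom C (FO (endo T) x) x \<and>
     Cmp C a (unit T x) = Idn C x \<and>
     Cmp C a (FA (endo T) a) = Cmp C a (mult T x))"

type_synonym ('o, 'a) alg_arrow = "('o \<times> 'a, 'a) arrow"

definition Alg ::
    "('o, 'a) category \<Rightarrow> ('o, 'a) monad \<Rightarrow> ('o \<times> 'a, ('o, 'a) alg_arrow) category" where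
  "Alg C T =
     \<lparr>Obj = {X. is_algebra C T X},
      Arr = {Arrow X Y f |X Y f. is_algebra C T X \<and> is_algebra C T Y \<and>
               f \<in> hom C (fst X) (fst Y) \<and> Cmp C f (snd X) = Cmp C (snd Y) (FA (endo T) f)},
      Dom = src, Cod = trg,
      Idn = (\<lambda>X. Arrow X X (Idn C (fst X))),
      Cmp = (\<lambda>g f. Arrow (src f) (trg g) (Cmp C (fn g) (fn f)))\<rparr>"

text \<open>The functor from \<open>T\<close>-algebras to \<open>S\<close>-algebras induced by a monad morphism from \<open>S\<close> to \<open>T\<close>.\<close>

definition alg_restrict ::
    "('o, 'a) category \<Rightarrow> ('o, 'a) monad_arrow
      \<Rightarrow> ('o \<times> 'a, ('o, 'a) alg_arrow, 'o \<times> 'a, ('o, 'a) alg_arrow) cfunctor" where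
  "alg_restrict C m =
     (let r = (\<lambda>(x, a). (x, Cmp C a (fn m x)))
      in \<lparr>FO = (\<lambda>X\<in>Obj (Alg C (trg m)). r X),
          FA = (\<lambda>f\<in>Arr (Alg C (trg m)). Arrow (r (src f)) (r (trg f)) (fn f))\<rparr>)"


section \<open>Lawvere theories and their models\<close>

record 'u lawvere =
  lcat :: "('u, 'u) category"
  pow :: "nat \<Rightarrow> 'u"
  proj :: "nat \<Rightarrow> nat \<Rightarrow> 'u"

text \<open>\<open>pow L n\<close> is the power \<open>X\<^sup>n\<close> of the distinguished object \<open>X = pow L 1\<close>, and \<open>proj L n i\<close>, for
  \<open>i < n\<close>, its projections. Theories are locally small.\<close>

definition is_lawvere_theory :: "('u set \<Rightarrow> bool) \<Rightarrow> 'u lawvere \<Rightarrow> bool" where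
  "is_lawvere_theory small L \<longleftrightarrow>
     is_category (lcat L) \<and>
     (\<forall>x\<in>Obj (lcat L). \<forall>y\<in>Obj (lcat L). small (hom (lcat L) x y)) \<and>
     has_finite_products (lcat L) \<and>
     inj (pow L) \<and> Obj (lcat L) = range (pow L) \<and>
     (\<forall>n. is_product (lcat L) n (\<lambda>_. pow L 1) (pow L n) (proj L n)) \<and>
     proj L 1 0 = Idn (lcat L) (pow L 1)"

definition is_law_morphism :: "'u lawvere \<Rightarrow> 'u lawvere \<Rightarrow> ('u, 'u, 'u, 'u) cfunctor \<Rightarrow> bool" where
  "is_law_morphism S T H \<longleftrightarrow>
     is_functor (lcat S) (lcat T) H \<and>
     (\<forall>n. FO H (pow S n) = pow T n) \<and>
     (\<forall>n. \<forall>i<n. FA H (proj S n i) = proj T n i)"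

type_synonym 'u law_arrow = "('u lawvere, ('u, 'u, 'u, 'u) cfunctor) arrow"

definition Law :: "('u set \<Rightarrow> bool) \<Rightarrow> ('u lawvere, 'u law_arrow) category" where
  "Law small =
     \<lparr>Obj = {L. is_lawvere_theory small L},
      Arr = {Arrow S T H |S T H. is_lawvere_theory small S \<and> is_lawvere_theory small T \<and>
               is_law_morphism S T H},
      Dom = src, Cod = trg,
      Idn = (\<lambda>L. Arrow L L (id_functor (lcat L))),
      Cmp = (\<lambda>K H. Arrow (src H) (trg K) (comp_functor (lcat (src H)) (fn K) (fn H)))\<rparr>"

type_synonym 'u model = "('u, 'u, 'u set, 'u set_arrow) cfunctor"
type_synonym 'u model_arrow = "('u model, 'u \<Rightarrow> 'u set_arrow) arrow"

definition Mod :: "('u set \<Rightarrow> bool) \<Rightarrow> 'u lawvere \<Rightarrow> ('u model, 'u model_arrow) category" where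
  "Mod small L = full_subcategory (functor_category (lcat L) (set_cat small))
     {M. preserves_finite_products (lcat L) (set_cat small) M}"

text \<open>Precomposition with a morphism of theories, from models of its target to models of its
  source.\<close>

definition mod_restrict ::
    "('u set \<Rightarrow> bool) \<Rightarrow> 'u law_arrow
      \<Rightarrow> ('u model, 'u model_arrow, 'u model, 'u model_arrow) cfunctor" where
  "mod_restrict small h =
     (let r = (\<lambda>M. comp_functor (lcat (src h)) M (fn h))
      in \<lparr>FO = (\<lambda>M\<in>Obj (Mod small (trg h)). r M),
          FA = (\<lambda>t\<in>Arr (Mod small (trg h)). Arrow (r (src t)) (r (trg t))
                  (compose (Obj (lcat (src h))) (fn t) (FO (fn h))))\<rparr>)"


section \<open>Contravariant functors to CAT and pseudonatural equivalence\<close>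

record ('o, 'a, 'x, 'y) cat_valued =
  fiber :: "'o \<Rightarrow> ('x, 'y) category"
  reindex :: "'a \<Rightarrow> ('x, 'y, 'x, 'y) cfunctor"

definition is_cat_valued_functor ::
    "('o, 'a) category \<Rightarrow> ('o, 'a, 'x, 'y) cat_valued \<Rightarrow> bool" where
  "is_cat_valued_functor C \<Phi> \<longleftrightarrow>
     is_category C \<and>
     (\<forall>x\<in>Obj C. is_category (fiber \<Phi> x)) \<and>
     (\<forall>f\<in>Arr C. is_functor (fiber \<Phi> (Cod C f)) (fiber \<Phi> (Dom C f)) (reindex \<Phi> f)) \<and>
     (\<forall>x\<in>Obj C. reindex \<Phi> (Idn C x) = id_functor (fiber \<Phi> x)) \<and>
     (\<forall>f\<in>Arr C. \<forall>g\<in>Arr C. Cod C f = Dom C g \<longrightarrow>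
        reindex \<Phi> (Cmp C g f) = comp_functor (fiber \<Phi> (Cod C g)) (reindex \<Phi> f) (reindex \<Phi> g))"

definition precomp_cat_valued ::
    "('p, 'b, 'x, 'y) cat_valued \<Rightarrow> ('o, 'a, 'p, 'b) cfunctor \<Rightarrow> ('o, 'a, 'x, 'y) cat_valued" where
  "precomp_cat_valued \<Phi> F =
     \<lparr>fiber = (\<lambda>x. fiber \<Phi> (FO F x)), reindex = (\<lambda>f. reindex \<Phi> (FA F f))\<rparr>"

text \<open>Components \<open>E x : \<Phi> x \<rightarrow> \<Psi> x\<close> and, for \<open>f : x \<rightarrow> y\<close>, invertible cells
  \<open>\<theta> f : \<Psi> f \<circ> E y \<Rightarrow> E x \<circ> \<Phi> f\<close>, compatible with identities and composites. As \<open>C\<close> has no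
  nontrivial 2-cells, there is no further naturality condition on \<open>\<theta>\<close>.\<close>

definition is_pseudonatural ::
    "('o, 'a) category \<Rightarrow> ('o, 'a, 'x, 'y) cat_valued \<Rightarrow> ('o, 'a, 'z, 'w) cat_valued
      \<Rightarrow> ('o \<Rightarrow> ('x, 'y, 'z, 'w) cfunctor) \<Rightarrow> ('a \<Rightarrow> 'x \<Rightarrow> 'w) \<Rightarrow> bool" where
  "is_pseudonatural C \<Phi> \<Psi> E \<theta> \<longleftrightarrow>
     is_cat_valued_functor C \<Phi> \<and> is_cat_valued_functor C \<Psi> \<and>
     (\<forall>x\<in>Obj C. is_functor (fiber \<Phi> x) (fiber \<Psi> x) (E x)) \<and>
     (\<forall>f\<in>Arr C. is_nat_iso (fiber \<Phi> (Cod C f)) (fiber \<Psi> (Dom C f))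
        (comp_functor (fiber \<Phi> (Cod C f)) (reindex \<Psi> f) (E (Cod C f)))
        (comp_functor (fiber \<Phi> (Cod C f)) (E (Dom C f)) (reindex \<Phi> f)) (\<theta> f)) \<and>
     (\<forall>x\<in>Obj C. \<forall>a\<in>Obj (fiber \<Phi> x). \<theta> (Idn C x) a = Idn (fiber \<Psi> x) (FO (E x) a)) \<and>
     (\<forall>f\<in>Arr C. \<forall>g\<in>Arr C. Cod C f = Dom C g \<longrightarrow>
        (\<forall>a\<in>Obj (fiber \<Phi> (Cod C g)).
           \<theta> (Cmp C g f) a
             = Cmp (fiber \<Psi> (Dom C f)) (\<theta> f (FO (reindex \<Phi> g) a)) (FA (reindex \<Psi> f) (\<theta> g a))))"

definition pseudonaturally_equivalent ::
    "('o, 'a) category \<Rightarrow> ('o, 'a, 'x, 'y) cat_valued \<Rightarrow> ('o, 'a, 'z, 'w) cat_valued \<Rightarrow> bool" where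
  "pseudonaturally_equivalent C \<Phi> \<Psi> \<longleftrightarrow>
     (\<exists>E \<theta>. is_pseudonatural C \<Phi> \<Psi> E \<theta> \<and>
        (\<forall>x\<in>Obj C. is_equivalence (fiber \<Phi> x) (fiber \<Psi> x) (E x)))"

definition Alg_functor ::
    "('u set \<Rightarrow> bool)
      \<Rightarrow> (('u set, 'u set_arrow) monad, ('u set, 'u set_arrow) monad_arrow,
          'u set \<times> 'u set_arrow, ('u set, 'u set_arrow) alg_arrow) cat_valued" where
  "Alg_functor small = \<lparr>fiber = Alg (set_cat small), reindex = alg_restrict (set_cat small)\<rparr>"

definition Mod_functor ::
    "('u set \<Rightarrow> bool) \<Rightarrow> ('u lawvere, 'u law_arrow, 'u model, 'u model_arrow) cat_valued" where
  "Mod_functor small = \<lparr>fiber = Mod small, reindex = mod_restrict small\<rparr>"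

end

theory Submission
  imports Defs
begin

text \<open>Only the values of a finitary monad \<open>T\<close> on the finite sets \<open>fin n\<close> matter: finitariness says
  exactly that every element of \<open>T A\<close> has the form \<open>T xs s\<close> for some \<open>xs : fin n \<rightarrow> A\<close> and
  \<open>s \<in> T (fin n)\<close>, and compatible assignments on such representations extend to \<open>T A\<close>.
  The theory of \<open>T\<close> is the opposite of its Kleisli category on the sets \<open>fin n\<close>. Extension along
  representations shows that a morphism of theories comes from a unique monad morphism, and that a
  model \<open>M\<close> comes from an algebra structure on \<open>M X\<close>. A theory is recovered from its monad of
  terms. The model of an algebra \<open>A\<close> sends \<open>X\<^sup>n\<close> to the set of codes of \<open>n\<close>-tuples in \<open>A\<close>, which does
  not depend on \<open>T\<close>, so the family of equivalences is strictly natural.\<close>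

section \<open>Categories and functors\<close>

text \<open>Two obstacles shape the constructions. First, arrows of a theory and elements of the
  values of a monad must be elements of \<open>'u\<close>, and small sets are not assumed closed
  under function spaces. So a tuple is the code of a list and not a function on
  \<open>fin n\<close>, and an element of the monad of terms is a chosen representative and not an
  equivalence class. Second, the empty set: when a set is retracted onto finitely many of its
  elements, the remaining ones must be sent somewhere. Each retraction argument therefore either
  secures one spare element or treats the empty set by itself, where the elements of
  \<open>T A\<close> are the nullary operations. Both equivalences come from one criterion (full,
  faithful, essentially surjective) with a quasi-inverse given by choice. So no functor from
  theories to monads, or from models to algebras, is written down: on objects it is enough to
  exhibit one preimage up to isomorphism. Strict naturality also rests on all theories
  \<open>law_of T\<close> sharing the same objects \<open>\<iota> n\<close>.\<close>

lemma hom_ArrD: "f \<in> hom C x y \<Longrightarrow> f \<in> Arr C"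
  by (simp add: hom_def)

lemma hom_self: "f \<in> Arr C \<Longrightarrow> f \<in> hom C (Dom C f) (Cod C f)"
  by (simp add: hom_def)

context
  fixes C :: "('o, 'a) category"
  assumes C: "is_category C"
begin

lemma hom_Obj: "f \<in> hom C x y \<Longrightarrow> x \<in> Obj C \<and> y \<in> Obj C"
  using C unfolding is_category_def hom_def by auto

lemma Idn_hom: "x \<in> Obj C \<Longrightarrow> Idn C x \<in> hom C x x"
  using C unfolding is_category_def by auto

lemma Cmp_hom: "f \<in> hom C x y \<Longrightarrow> g \<in> hom C y z \<Longrightarrow> Cmp C g f \<in> hom C x z"
  using C unfolding is_category_def hom_def by auto

lemma Cmp_Idn: "f \<in> hom C x y \<Longrightarrow> Cmp C f (Idn C x) = f"
  using C unfolding is_category_def hom_def by auto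

lemma Idn_Cmp: "f \<in> hom C x y \<Longrightarrow> Cmp C (Idn C y) f = f"
  using C unfolding is_category_def hom_def by auto

lemma Cmp_assoc:
  "f \<in> hom C x y \<Longrightarrow> g \<in> hom C y z \<Longrightarrow> h \<in> hom C z w \<Longrightarrow>
    Cmp C h (Cmp C g f) = Cmp C (Cmp C h g) f"
  using C unfolding is_category_def hom_def by auto

end

lemma is_categoryI:
  assumes "\<And>f. f \<in> Arr C \<Longrightarrow> Dom C f \<in> Obj C \<and> Cod C f \<in> Obj C"
    and "\<And>x. x \<in> Obj C \<Longrightarrow> Idn C x \<in> hom C x x"
    and "\<And>f g x y z. f \<in> hom C x y \<Longrightarrow> g \<in> hom C y z \<Longrightarrow> Cmp C g f \<in> hom C x z"
    and "\<And>f x y. f \<in> hom C x y \<Longrightarrow> Cmp C f (Idn C x) = f"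
    and "\<And>f x y. f \<in> hom C x y \<Longrightarrow> Cmp C (Idn C y) f = f"
    and "\<And>f g h x y z w. f \<in> hom C x y \<Longrightarrow> g \<in> hom C y z \<Longrightarrow> h \<in> hom C z w \<Longrightarrow>
      Cmp C h (Cmp C g f) = Cmp C (Cmp C h g) f"
  shows "is_category C"
  unfolding is_category_def using assms by (auto simp: hom_def)

lemma full_subcategory_sel [simp]:
  "Obj (full_subcategory C S) = Obj C \<inter> S"
  "Dom (full_subcategory C S) = Dom C"
  "Cod (full_subcategory C S) = Cod C"
  "Idn (full_subcategory C S) = Idn C"
  "Cmp (full_subcategory C S) = Cmp C"
  by (auto simp: full_subcategory_def)

lemma Arr_full_subcategory:
  "f \<in> Arr (full_subcategory C S) \<longleftrightarrow> f \<in> Arr C \<and> Dom C f \<in> S \<and> Cod C f \<in> S"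
  by (auto simp: full_subcategory_def)

lemma hom_full_subcategory:
  "f \<in> hom (full_subcategory C S) x y \<longleftrightarrow> f \<in> hom C x y \<and> x \<in> S \<and> y \<in> S"
  by (auto simp: hom_def Arr_full_subcategory)

lemma is_category_full_subcategory: "is_category C \<Longrightarrow> is_category (full_subcategory C S)"
  unfolding is_category_def by (auto simp: hom_full_subcategory Arr_full_subcategory)

lemma is_functorI:
  assumes "FO F \<in> extensional (Obj C)" "FA F \<in> extensional (Arr C)"
    and "\<And>x. x \<in> Obj C \<Longrightarrow> FO F x \<in> Obj D"
    and "\<And>f x y. f \<in> hom C x y \<Longrightarrow> FA F f \<in> hom D (FO F x) (FO F y)"
    and "\<And>x. x \<in> Obj C \<Longrightarrow> FA F (Idn C x) = Idn D (FO F x)"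
    and "\<And>f g x y z. f \<in> hom C x y \<Longrightarrow> g \<in> hom C y z \<Longrightarrow>
      FA F (Cmp C g f) = Cmp D (FA F g) (FA F f)"
  shows "is_functor C D F"
  using assms unfolding is_functor_def PiE_def hom_def by auto

context
  fixes C :: "('o, 'a) category" and D :: "('p, 'b) category" and F
  assumes F: "is_functor C D F"
begin

lemma functor_Obj: "x \<in> Obj C \<Longrightarrow> FO F x \<in> Obj D"
  using F unfolding is_functor_def by auto

lemma functor_hom: "f \<in> hom C x y \<Longrightarrow> FA F f \<in> hom D (FO F x) (FO F y)"
  using F unfolding is_functor_def hom_def by auto

lemma functor_Idn: "x \<in> Obj C \<Longrightarrow> FA F (Idn C x) = Idn D (FO F x)"
  using F unfolding is_functor_def by auto

lemma functor_Cmp: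
  "f \<in> hom C x y \<Longrightarrow> g \<in> hom C y z \<Longrightarrow> FA F (Cmp C g f) = Cmp D (FA F g) (FA F f)"
  using F unfolding is_functor_def hom_def by auto

lemma functor_FO_extensional: "FO F \<in> extensional (Obj C)"
  using F unfolding is_functor_def PiE_def by auto

lemma functor_FA_extensional: "FA F \<in> extensional (Arr C)"
  using F unfolding is_functor_def PiE_def by auto

end

lemma functor_eqI:
  fixes F G :: "('o, 'a, 'p, 'b) cfunctor"
  assumes "is_functor C D F" "is_functor C E G"
    and "\<And>x. x \<in> Obj C \<Longrightarrow> FO F x = FO G x"
    and "\<And>f. f \<in> Arr C \<Longrightarrow> FA F f = FA G f"
  shows "F = G"
proof (rule cfunctor.equality)
  show "FO F = FO G"
    by (rule extensionalityI[OF functor_FO_extensional[OF assms(1)]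
          functor_FO_extensional[OF assms(2)] assms(3)])
  show "FA F = FA G"
    by (rule extensionalityI[OF functor_FA_extensional[OF assms(1)]
          functor_FA_extensional[OF assms(2)] assms(4)])
qed simp

lemma id_functor_sel [simp]:
  "x \<in> Obj C \<Longrightarrow> FO (id_functor C) x = x"
  "f \<in> Arr C \<Longrightarrow> FA (id_functor C) f = f"
  by (auto simp: id_functor_def)

lemma comp_functor_sel [simp]:
  "x \<in> Obj C \<Longrightarrow> FO (comp_functor C G F) x = FO G (FO F x)"
  "f \<in> Arr C \<Longrightarrow> FA (comp_functor C G F) f = FA G (FA F f)"
  by (auto simp: comp_functor_def compose_def)

lemma is_functor_id_functor:
  assumes C: "is_category C"
  shows "is_functor C C (id_functor C)"
proof (rule is_functorI)
  fix f x y assume f: "f \<in> hom C x y"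
  then show "FA (id_functor C) f \<in> hom C (FO (id_functor C) x) (FO (id_functor C) y)"
    using hom_Obj[OF C f] hom_ArrD[OF f] by simp
next
  fix f g x y z assume fg: "f \<in> hom C x y" "g \<in> hom C y z"
  show "FA (id_functor C) (Cmp C g f) = Cmp C (FA (id_functor C) g) (FA (id_functor C) f)"
    using fg[THEN hom_ArrD] hom_ArrD[OF Cmp_hom[OF C fg]] by simp
next
  fix x assume x: "x \<in> Obj C"
  then show "FA (id_functor C) (Idn C x) = Idn C (FO (id_functor C) x)"
    using hom_ArrD[OF Idn_hom[OF C x]] by simp
qed (auto simp: id_functor_def)

lemma is_functor_comp_functor:
  assumes C: "is_category C" and F: "is_functor C D F" and G: "is_functor D E G"
  shows "is_functor C E (comp_functor C G F)"
proof (rule is_functorI)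
  fix x assume x: "x \<in> Obj C"
  show "FO (comp_functor C G F) x \<in> Obj E"
    using functor_Obj[OF G functor_Obj[OF F x]] x by simp
  show "FA (comp_functor C G F) (Idn C x) = Idn E (FO (comp_functor C G F) x)"
    using x hom_ArrD[OF Idn_hom[OF C x]]
    by (simp add: functor_Idn[OF F x] functor_Idn[OF G functor_Obj[OF F x]])
next
  fix f x y assume f: "f \<in> hom C x y"
  show "FA (comp_functor C G F) f \<in> hom E (FO (comp_functor C G F) x) (FO (comp_functor C G F) y)"
    using functor_hom[OF G functor_hom[OF F f]] hom_Obj[OF C f] hom_ArrD[OF f] by simp
next
  fix f g x y z assume fg: "f \<in> hom C x y" "g \<in> hom C y z"
  show "FA (comp_functor C G F) (Cmp C g f) =
      Cmp E (FA (comp_functor C G F) g) (FA (comp_functor C G F) f)"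
    using fg[THEN hom_ArrD] hom_ArrD[OF Cmp_hom[OF C fg]]
    by (simp add: functor_Cmp[OF F fg] functor_Cmp[OF G functor_hom[OF F fg(1)] functor_hom[OF F fg(2)]])
qed (auto simp: comp_functor_def compose_def)

lemma comp_functor_id_right:
  "is_functor C D F \<Longrightarrow> comp_functor C F (id_functor C) = F"
  using functor_FO_extensional[of C D F] functor_FA_extensional[of C D F]
  by (intro cfunctor.equality)
    (auto simp: comp_functor_def id_functor_def compose_def extensional_def fun_eq_iff)

lemma comp_functor_id_left:
  assumes "is_functor C D F"
  shows "comp_functor C (id_functor D) F = F"
proof (rule cfunctor.equality)
  have "\<And>f. f \<in> Arr C \<Longrightarrow> FA F f \<in> Arr D"
    using assms unfolding is_functor_def by auto
  then show "FA (comp_functor C (id_functor D) F) = FA F"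
    using functor_FA_extensional[OF assms]
    by (auto simp: comp_functor_def id_functor_def compose_def extensional_def fun_eq_iff)
  show "FO (comp_functor C (id_functor D) F) = FO F"
    using functor_FO_extensional[OF assms] functor_Obj[OF assms]
    by (auto simp: comp_functor_def id_functor_def compose_def extensional_def fun_eq_iff)
qed simp

lemma comp_functor_assoc:
  assumes "is_functor C D F"
  shows "comp_functor C H (comp_functor C G F) = comp_functor C (comp_functor D H G) F"
proof (rule cfunctor.equality)
  have "\<And>f. f \<in> Arr C \<Longrightarrow> FA F f \<in> Arr D"
    using assms unfolding is_functor_def by auto
  then show "FA (comp_functor C H (comp_functor C G F)) = FA (comp_functor C (comp_functor D H G) F)"
    by (auto simp: comp_functor_def compose_def fun_eq_iff)
  show "FO (comp_functor C H (comp_functor C G F)) = FO (comp_functor C (comp_functor D H G) F)"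
    using functor_Obj[OF assms] by (auto simp: comp_functor_def compose_def fun_eq_iff)
qed simp

lemma is_isoI:
  "f \<in> hom C x y \<Longrightarrow> g \<in> hom C y x \<Longrightarrow> Cmp C g f = Idn C x \<Longrightarrow> Cmp C f g = Idn C y \<Longrightarrow> is_iso C f"
  unfolding is_iso_def by (auto simp: hom_def)

lemma is_isoE:
  assumes "is_iso C f" "f \<in> hom C x y"
  obtains g where "g \<in> hom C y x" "Cmp C g f = Idn C x" "Cmp C f g = Idn C y"
  using assms unfolding is_iso_def by (auto simp: hom_def)

lemma is_iso_Idn: "is_category C \<Longrightarrow> x \<in> Obj C \<Longrightarrow> is_iso C (Idn C x)"
  by (rule is_isoI[OF Idn_hom Idn_hom]) (auto simp: Cmp_Idn[OF _ Idn_hom])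

text \<open>Serves twice: for the identities of functor categories, and for the cells of a strictly
  natural family of functors.\<close>

lemma is_nat_iso_identity:
  assumes C: "is_category C" and D: "is_category D" and F: "is_functor C D F"
  shows "is_nat_iso C D F F (\<lambda>x\<in>Obj C. Idn D (FO F x))"
proof -
  have "Cmp D (Idn D (FO F (Cod C f))) (FA F f) = Cmp D (FA F f) (Idn D (FO F (Dom C f)))"
    and "Dom C f \<in> Obj C" and "Cod C f \<in> Obj C" if "f \<in> Arr C" for f
    using functor_hom[OF F hom_self[OF that]] hom_Obj[OF C hom_self[OF that]]
    by (auto simp: Idn_Cmp[OF D] Cmp_Idn[OF D])
  then show ?thesis
    unfolding is_nat_iso_def is_nat_trans_def
    using F Idn_hom[OF D functor_Obj[OF F]] is_iso_Idn[OF D functor_Obj[OF F]] by auto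
qed

text \<open>Choice supplies a preimage \<open>G0 d\<close> and an isomorphism \<open>e d\<close> for
  every \<open>d\<close>. The quasi-inverse sends \<open>u\<close> to the unique lift of
  \<open>u\<close> conjugated by these isomorphisms; faithfulness then reduces every law for it to
  one about \<open>e\<close> in \<open>D\<close>.\<close>

lemma is_equivalence_fully_faithful_surj:
  assumes C: "is_category C" and D: "is_category D" and F: "is_functor C D F"
    and faithful: "\<And>x y. x \<in> Obj C \<Longrightarrow> y \<in> Obj C \<Longrightarrow> inj_on (FA F) (hom C x y)"
    and full: "\<And>x y g. x \<in> Obj C \<Longrightarrow> y \<in> Obj C \<Longrightarrow> g \<in> hom D (FO F x) (FO F y) \<Longrightarrow>
      \<exists>f\<in>hom C x y. FA F f = g"
    and surj: "\<And>d. d \<in> Obj D \<Longrightarrow> \<exists>c\<in>Obj C. \<exists>e\<in>hom D (FO F c) d. is_iso D e"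
  shows "is_equivalence C D F"
proof -
  obtain G0 where G0: "\<And>d. d \<in> Obj D \<Longrightarrow> G0 d \<in> Obj C \<and> (\<exists>e\<in>hom D (FO F (G0 d)) d. is_iso D e)"
    using surj by metis
  obtain e where e: "\<And>d. d \<in> Obj D \<Longrightarrow> e d \<in> hom D (FO F (G0 d)) d"
    and iso: "\<And>d. d \<in> Obj D \<Longrightarrow> is_iso D (e d)"
    using G0 by metis
  have "\<forall>d\<in>Obj D. \<exists>g\<in>hom D d (FO F (G0 d)). Cmp D g (e d) = Idn D (FO F (G0 d)) \<and>
      Cmp D (e d) g = Idn D d"
    using is_isoE[OF iso e] by metis
  then obtain e' where e': "\<And>d. d \<in> Obj D \<Longrightarrow> e' d \<in> hom D d (FO F (G0 d))"
    and e'e: "\<And>d. d \<in> Obj D \<Longrightarrow> Cmp D (e' d) (e d) = Idn D (FO F (G0 d))"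
    and ee': "\<And>d. d \<in> Obj D \<Longrightarrow> Cmp D (e d) (e' d) = Idn D d"
    by metis
  have Fobj: "\<And>x. x \<in> Obj C \<Longrightarrow> FO F x \<in> Obj D" by (rule functor_Obj[OF F])
  have G0C: "\<And>d. d \<in> Obj D \<Longrightarrow> G0 d \<in> Obj C" using G0 by blast
  define lift where "lift x y g = (SOME f. f \<in> hom C x y \<and> FA F f = g)" for x y g
  have lift: "lift x y g \<in> hom C x y" "FA F (lift x y g) = g"
    if "x \<in> Obj C" "y \<in> Obj C" "g \<in> hom D (FO F x) (FO F y)" for x y g
  proof -
    have "\<exists>f. f \<in> hom C x y \<and> FA F f = g" using full[OF that] by blast
    from someI_ex[OF this] show "lift x y g \<in> hom C x y" "FA F (lift x y g) = g"
      unfolding lift_def by auto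
  qed
  have eq: "f = g" if "f \<in> hom C x y" "g \<in> hom C x y" "FA F f = FA F g" for f g x y
    using faithful[of x y] that hom_Obj[OF C that(1)] by (auto simp: inj_on_def)
  \<comment> \<open>This is \<open>u\<close> transported to the chosen preimages; the arrow part of
    the quasi-inverse will be its lift.\<close>
  define conj where "conj u = Cmp D (e' (Cod D u)) (Cmp D u (e (Dom D u)))" for u
  have conj: "conj u \<in> hom D (FO F (G0 x)) (FO F (G0 y))"
    and e_conj: "Cmp D (e y) (conj u) = Cmp D u (e x)" if u: "u \<in> hom D x y" for u x y
  proof -
    have o: "x \<in> Obj D" "y \<in> Obj D" using hom_Obj[OF D u] by auto
    have DC: "Dom D u = x" "Cod D u = y" using u by (auto simp: hom_def)
    have 1: "Cmp D u (e x) \<in> hom D (FO F (G0 x)) y" by (rule Cmp_hom[OF D e[OF o(1)] u])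
    show "conj u \<in> hom D (FO F (G0 x)) (FO F (G0 y))"
      unfolding conj_def DC by (rule Cmp_hom[OF D 1 e'[OF o(2)]])
    show "Cmp D (e y) (conj u) = Cmp D u (e x)"
      unfolding conj_def DC using Cmp_assoc[OF D 1 e'[OF o(2)] e[OF o(2)]]
      by (simp add: ee'[OF o(2)] Idn_Cmp[OF D 1])
  qed
  \<comment> \<open>\<open>e y\<close> can be cancelled on the left because \<open>e' y\<close>
    inverts it. The functor laws for \<open>G\<close> and the naturality of the unit are proved by
    applying \<open>F\<close> and then \<open>e\<close>.\<close>
  have e_mono: "p = q" if "p \<in> hom D x (FO F (G0 y))" "q \<in> hom D x (FO F (G0 y))"
    "y \<in> Obj D" "Cmp D (e y) p = Cmp D (e y) q" for p q x y
  proof -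
    have "Cmp D (Cmp D (e' y) (e y)) p = Cmp D (Cmp D (e' y) (e y)) q"
      using Cmp_assoc[OF D that(1) e[OF that(3)] e'[OF that(3)]]
        Cmp_assoc[OF D that(2) e[OF that(3)] e'[OF that(3)]] that(4) by simp
    then show "p = q"
      by (simp add: e'e[OF that(3)] Idn_Cmp[OF D that(1)] Idn_Cmp[OF D that(2)])
  qed
  define G where "G = \<lparr>FO = (\<lambda>d\<in>Obj D. G0 d),
     FA = (\<lambda>u\<in>Arr D. lift (G0 (Dom D u)) (G0 (Cod D u)) (conj u))\<rparr>"
  have GO: "FO G d = G0 d" if "d \<in> Obj D" for d using that by (simp add: G_def)
  have GA: "FA G u \<in> hom C (G0 x) (G0 y)" and FG: "FA F (FA G u) = conj u"
    if u: "u \<in> hom D x y" for u x y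
    using lift[OF _ _ conj[OF u]] u hom_Obj[OF D u] G0C by (auto simp: G_def hom_def)
  have G: "is_functor D C G"
  proof (rule is_functorI)
    fix u x y assume u: "u \<in> hom D x y"
    then show "FA G u \<in> hom C (FO G x) (FO G y)" using GA[OF u] hom_Obj[OF D u] by (simp add: GO)
  next
    fix x assume x: "x \<in> Obj D"
    have i: "Idn D x \<in> hom D x x" by (rule Idn_hom[OF D x])
    have "FA F (FA G (Idn D x)) = FA F (Idn C (G0 x))"
      unfolding FG[OF i] functor_Idn[OF F G0C[OF x]]
    proof (rule e_mono[OF conj[OF i] Idn_hom[OF D Fobj[OF G0C[OF x]]] x])
      show "Cmp D (e x) (conj (Idn D x)) = Cmp D (e x) (Idn D (FO F (G0 x)))"
        unfolding e_conj[OF i] by (simp add: Cmp_Idn[OF D e[OF x]] Idn_Cmp[OF D e[OF x]])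
    qed
    then show "FA G (Idn D x) = Idn C (FO G x)"
      unfolding GO[OF x] by (rule eq[OF GA[OF i] Idn_hom[OF C G0C[OF x]]])
  next
    fix u v x y z assume u: "u \<in> hom D x y" and v: "v \<in> hom D y z"
    have o: "x \<in> Obj D" "y \<in> Obj D" "z \<in> Obj D" using hom_Obj[OF D u] hom_Obj[OF D v] by auto
    have vu: "Cmp D v u \<in> hom D x z" by (rule Cmp_hom[OF D u v])
    have "FA F (FA G (Cmp D v u)) = FA F (Cmp C (FA G v) (FA G u))"
      unfolding functor_Cmp[OF F GA[OF u] GA[OF v]] FG[OF u] FG[OF v] FG[OF vu]
    proof (rule e_mono[OF conj[OF vu] Cmp_hom[OF D conj[OF u] conj[OF v]] o(3)])
      show "Cmp D (e z) (conj (Cmp D v u)) = Cmp D (e z) (Cmp D (conj v) (conj u))"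
        unfolding e_conj[OF vu] Cmp_assoc[OF D conj[OF u] conj[OF v] e[OF o(3)]] e_conj[OF v]
          Cmp_assoc[OF D conj[OF u] e[OF o(2)] v, symmetric] e_conj[OF u]
        by (rule Cmp_assoc[OF D e[OF o(1)] u v, symmetric])
    qed
    then show "FA G (Cmp D v u) = Cmp C (FA G v) (FA G u)"
      by (rule eq[OF GA[OF vu] Cmp_hom[OF C GA[OF u] GA[OF v]]])
  qed (auto simp: G_def G0C)
  have FGf: "is_functor D D (comp_functor D F G)" by (rule is_functor_comp_functor[OF D G F])
  have GFf: "is_functor C C (comp_functor C G F)" by (rule is_functor_comp_functor[OF C F G])
  have eps: "is_nat_iso D D (comp_functor D F G) (id_functor D) (\<lambda>d\<in>Obj D. e d)"
    unfolding is_nat_iso_def is_nat_trans_def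
  proof (intro conjI ballI)
    fix u assume u: "u \<in> Arr D"
    have *: "Dom D u \<in> Obj D" "Cod D u \<in> Obj D" using hom_Obj[OF D hom_self[OF u]] by auto
    then show "Cmp D ((\<lambda>d\<in>Obj D. e d) (Cod D u)) (FA (comp_functor D F G) u) =
         Cmp D (FA (id_functor D) u) ((\<lambda>d\<in>Obj D. e d) (Dom D u))"
      using e_conj[OF hom_self[OF u]] FG[OF hom_self[OF u]] u by simp
  qed (use FGf is_functor_id_functor[OF D] e iso in \<open>auto simp: GO\<close>)
  \<comment> \<open>The unit is forced by a triangle identity: its image under \<open>F\<close> has
    to be the inverse of the counit at \<open>FO F x\<close>.\<close>
  define \<eta> where "\<eta> x = lift x (G0 (FO F x)) (e' (FO F x))" for x
  have \<eta>: "\<eta> x \<in> hom C x (G0 (FO F x))" "FA F (\<eta> x) = e' (FO F x)" if "x \<in> Obj C" for x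
    unfolding \<eta>_def by (rule lift[OF that G0C[OF Fobj[OF that]] e'[OF Fobj[OF that]]])+
  have eta: "is_nat_iso C C (id_functor C) (comp_functor C G F) (\<lambda>x\<in>Obj C. \<eta> x)"
    unfolding is_nat_iso_def is_nat_trans_def
  proof (intro conjI ballI)
    fix f assume f: "f \<in> Arr C"
    let ?x = "Dom C f" and ?y = "Cod C f"
    have o: "?x \<in> Obj C" "?y \<in> Obj C" using hom_Obj[OF C hom_self[OF f]] by auto
    have Ff: "FA F f \<in> hom D (FO F ?x) (FO F ?y)" by (rule functor_hom[OF F hom_self[OF f]])
    have l: "Cmp C (\<eta> ?y) f \<in> hom C ?x (G0 (FO F ?y))" by (rule Cmp_hom[OF C hom_self[OF f] \<eta>(1)[OF o(2)]])
    have r: "Cmp C (FA G (FA F f)) (\<eta> ?x) \<in> hom C ?x (G0 (FO F ?y))"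
      by (rule Cmp_hom[OF C \<eta>(1)[OF o(1)] GA[OF Ff]])
    have "Cmp C (\<eta> ?y) f = Cmp C (FA G (FA F f)) (\<eta> ?x)"
    proof (rule eq[OF l r], rule e_mono[OF functor_hom[OF F l] functor_hom[OF F r] Fobj[OF o(2)]])
      show "Cmp D (e (FO F ?y)) (FA F (Cmp C (\<eta> ?y) f)) =
        Cmp D (e (FO F ?y)) (FA F (Cmp C (FA G (FA F f)) (\<eta> ?x)))"
        unfolding functor_Cmp[OF F hom_self[OF f] \<eta>(1)[OF o(2)]]
          functor_Cmp[OF F \<eta>(1)[OF o(1)] GA[OF Ff]] \<eta>(2)[OF o(1)] \<eta>(2)[OF o(2)] FG[OF Ff]
          Cmp_assoc[OF D Ff e'[OF Fobj[OF o(2)]] e[OF Fobj[OF o(2)]]] ee'[OF Fobj[OF o(2)]] Idn_Cmp[OF D Ff]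
          Cmp_assoc[OF D e'[OF Fobj[OF o(1)]] conj[OF Ff] e[OF Fobj[OF o(2)]]] e_conj[OF Ff]
          Cmp_assoc[OF D e'[OF Fobj[OF o(1)]] e[OF Fobj[OF o(1)]] Ff, symmetric] ee'[OF Fobj[OF o(1)]]
          Cmp_Idn[OF D Ff] ..
    qed
    then show "Cmp C ((\<lambda>x\<in>Obj C. \<eta> x) ?y) (FA (id_functor C) f) =
         Cmp C (FA (comp_functor C G F) f) ((\<lambda>x\<in>Obj C. \<eta> x) ?x)"
      using o f by simp
  next
    fix x assume x: "x \<in> Obj C"
    let ?z = "G0 (FO F x)"
    note ox = Fobj[OF x]
    have z: "?z \<in> Obj C" by (rule G0C[OF ox])
    \<comment> \<open>The lift of the counit inverts \<open>\<eta> x\<close>: both equations hold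
      after applying \<open>F\<close>, which is faithful.\<close>
    define h where "h = lift ?z x (e (FO F x))"
    have h: "h \<in> hom C ?z x" "FA F h = e (FO F x)"
      unfolding h_def by (rule lift[OF z x e[OF ox]])+
    have "is_iso C (\<eta> x)"
    proof (rule is_isoI[OF \<eta>(1)[OF x] h(1)])
      show "Cmp C h (\<eta> x) = Idn C x"
        by (rule eq[OF Cmp_hom[OF C \<eta>(1)[OF x] h(1)] Idn_hom[OF C x]])
          (simp add: functor_Cmp[OF F \<eta>(1)[OF x] h(1)] functor_Idn[OF F x] h \<eta>[OF x] ee'[OF ox])
      show "Cmp C (\<eta> x) h = Idn C ?z"
        by (rule eq[OF Cmp_hom[OF C h(1) \<eta>(1)[OF x]] Idn_hom[OF C z]])
          (simp add: functor_Cmp[OF F h(1) \<eta>(1)[OF x]] functor_Idn[OF F z] h \<eta>[OF x] e'e[OF ox])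
    qed
    then show "is_iso C ((\<lambda>x\<in>Obj C. \<eta> x) x)" using x by simp
  qed (use GFf is_functor_id_functor[OF C] \<eta> in \<open>auto simp: GO Fobj\<close>)
  show ?thesis unfolding is_equivalence_def using C D F G eta eps by blast
qed

section \<open>The category of sets\<close>

lemma set_cat_sel [simp]:
  "Obj (set_cat small) = {A. small A}"
  "Dom (set_cat small) = src" "Cod (set_cat small) = trg"
  by (auto simp: set_cat_def)

lemma Idn_set_cat: "Idn (set_cat small) A = Arrow A A (\<lambda>x\<in>A. x)"
  by (simp add: set_cat_def)

lemma fn_Idn_set_cat [simp]: "x \<in> A \<Longrightarrow> fn (Idn (set_cat small) A) x = x"
  by (simp add: Idn_set_cat)

lemma Cmp_set_cat:
  "Cmp (set_cat small) g f = Arrow (src f) (trg g) (compose (src f) (fn g) (fn f))"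
  by (simp add: set_cat_def)

lemma Arr_set_cat: "f \<in> Arr (set_cat small) \<longleftrightarrow>
    small (src f) \<and> small (trg f) \<and> fn f \<in> src f \<rightarrow>\<^sub>E trg f"
  by (cases f) (auto simp: set_cat_def)

lemma hom_set_cat: "f \<in> hom (set_cat small) A B \<longleftrightarrow>
    (\<exists>g. f = Arrow A B g \<and> small A \<and> small B \<and> g \<in> A \<rightarrow>\<^sub>E B)"
  by (cases f) (auto simp: hom_def Arr_set_cat)

lemma Arrow_hom_set_cat [simp]: "Arrow A' B' g \<in> hom (set_cat small) A B \<longleftrightarrow>
    A' = A \<and> B' = B \<and> small A \<and> small B \<and> g \<in> A \<rightarrow>\<^sub>E B"
  by (auto simp: hom_set_cat)

lemma hom_set_catD:
  assumes "f \<in> hom (set_cat small) A B"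
  shows "src f = A" "trg f = B" "small A" "small B" "fn f \<in> A \<rightarrow>\<^sub>E B" "f = Arrow A B (fn f)"
    "x \<in> A \<Longrightarrow> fn f x \<in> B"
  using assms by (auto simp: hom_set_cat)

lemma set_arrow_eqI:
  assumes "f \<in> hom (set_cat small) A B" "g \<in> hom (set_cat small) A B"
    and "\<And>x. x \<in> A \<Longrightarrow> fn f x = fn g x"
  shows "f = g"
proof -
  have "fn f = fn g" using assms by (intro PiE_ext[of "fn f" A "\<lambda>_. B"]) (auto simp: hom_set_cat)
  then show ?thesis using assms(1,2) by (auto simp: hom_set_cat)
qed

lemma compose_PiE: "f \<in> A \<rightarrow>\<^sub>E B \<Longrightarrow> g \<in> B \<rightarrow>\<^sub>E C \<Longrightarrow> compose A g f \<in> A \<rightarrow>\<^sub>E C"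
  by (auto simp: compose_def)

lemma is_category_set_cat: "is_category (set_cat small)"
proof (rule is_categoryI)
  fix f g h x y z w
  assume *: "f \<in> hom (set_cat small) x y" "g \<in> hom (set_cat small) y z" "h \<in> hom (set_cat small) z w"
  show "Cmp (set_cat small) h (Cmp (set_cat small) g f) =
    Cmp (set_cat small) (Cmp (set_cat small) h g) f"
    using * by (auto simp: hom_set_cat Cmp_set_cat compose_def fun_eq_iff PiE_def Pi_def)
next
  fix f g x y z
  assume "f \<in> hom (set_cat small) x y" "g \<in> hom (set_cat small) y z"
  then show "Cmp (set_cat small) g f \<in> hom (set_cat small) x z"
    unfolding hom_set_cat by (elim exE conjE) (simp add: Cmp_set_cat compose_PiE)
next
  fix A assume "A \<in> Obj (set_cat small)"
  then show "Idn (set_cat small) A \<in> hom (set_cat small) A A" by (simp add: Idn_set_cat)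
qed (auto simp: Arr_set_cat Idn_set_cat Cmp_set_cat hom_set_cat compose_def fun_eq_iff PiE_def extensional_def)

lemma fn_Cmp_set_cat: "f \<in> hom (set_cat small) A B \<Longrightarrow> x \<in> A \<Longrightarrow>
    fn (Cmp (set_cat small) g f) x = fn g (fn f x)"
  by (auto simp: hom_set_cat Cmp_set_cat compose_def)

text \<open>An injection of \<open>'u \<times> 'u\<close> into \<open>'u\<close> codes the lists of each length; the length is recorded by
  one more pairing.\<close>

lemma ex_inj_list:
  assumes "infinite (UNIV :: 'u set)"
  shows "\<exists>c :: 'u list \<Rightarrow> 'u. inj c"
proof -
  have "(card_of ((UNIV :: 'u set) \<times> (UNIV :: 'u set)), card_of (UNIV :: 'u set)) \<in> ordIso"
    by (rule card_of_Times_same_infinite[OF assms])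
  then obtain p :: "'u \<times> 'u \<Rightarrow> 'u" where p: "inj p"
    unfolding card_of_ordIso[symmetric] bij_betw_def by auto
  obtain n :: "nat \<Rightarrow> 'u" where n: "inj n"
    using infinite_countable_subset[OF assms] by auto
  \<comment> \<open>The seed \<open>undefined\<close> is arbitrary: \<open>d\<close> has to be
    injective only among lists of equal length.\<close>
  define d where "d = rec_list (undefined :: 'u) (\<lambda>x _ y. p (x, y))"
  have d [simp]: "d [] = undefined" "d (x # xs) = p (x, d xs)" for x xs by (auto simp: d_def)
  have 1: "length xs = length ys \<Longrightarrow> d xs = d ys \<Longrightarrow> xs = ys" for xs ys
    by (induction xs ys rule: list_induct2) (auto dest: injD[OF p])
  have "inj (\<lambda>xs. p (n (length xs), d xs))"
    by (rule injI) (auto dest!: injD[OF p] dest: injD[OF n] intro: 1)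
  then show ?thesis by blast
qed

text \<open>The injections exist but are not canonical, so they are fixed as parameters. The theory
  of a monad and the model of an algebra depend on them; the categories in the final statement do
  not.\<close>

locale coded_universe = set_universe small for small :: "'u set \<Rightarrow> bool" +
  fixes code :: "'u list \<Rightarrow> 'u" and \<iota> :: "nat \<Rightarrow> 'u"
  assumes inj_code: "inj code" and inj_\<iota>: "inj \<iota>"
begin

abbreviation decode where "decode \<equiv> inv code"
abbreviation idx where "idx \<equiv> inv \<iota>"

definition fin :: "nat \<Rightarrow> 'u set" where "fin n = \<iota> ` {..<n}"

lemma code_eq [simp]: "code xs = code ys \<longleftrightarrow> xs = ys"
  using inj_code by (auto dest: injD)

lemma decode_code [simp]: "decode (code xs) = xs"
  using inj_code by simp

lemma \<iota>_eq [simp]: "\<iota> m = \<iota> n \<longleftrightarrow> m = n"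
  using inj_\<iota> by (auto dest: injD)

lemma idx_\<iota> [simp]: "idx (\<iota> n) = n"
  using inj_\<iota> by simp

lemma \<iota>_fin [simp]: "\<iota> i \<in> fin n \<longleftrightarrow> i < n"
  by (auto simp: fin_def)

lemma idx_fin [simp]: "u \<in> fin n \<Longrightarrow> idx u < n"
  by (auto simp: fin_def)

lemma finite_fin [simp]: "finite (fin n)"
  by (simp add: fin_def)

section \<open>Small sets of codes\<close>

text \<open>An infinite small set contains an injective copy of the naturals, and \<open>f\<close>
  factors through that copy.\<close>

lemma small_range_nat: "small (range (f :: nat \<Rightarrow> 'u))"
proof -
  obtain A :: "'u set" where A: "small A" "infinite A" using small_infinite by blast
  obtain g :: "nat \<Rightarrow> 'u" where g: "inj g" "range g \<subseteq> A"
    using infinite_countable_subset[OF A(2)] by auto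
  have "range f = (f \<circ> inv g) ` range g"
    using g(1) by (auto simp: image_image)
  then show ?thesis using small_image[OF small_subset[OF A(1) g(2)]] by metis
qed

lemma small_finite: assumes "finite A" shows "small A"
proof -
  obtain xs where xs: "set xs = A" using finite_list[OF assms] by auto
  show ?thesis
    by (rule small_subset[OF small_range_nat[of "\<lambda>i. xs ! i"]]) (auto simp: xs[symmetric] in_set_conv_nth)
qed

lemma small_fin [simp]: "small (fin n)"
  by (rule small_finite) simp

lemma small_UN_nat: assumes "\<And>n :: nat. small (X n)" shows "small (\<Union>n. X n)"
proof -
  have "(\<Union>n. X n) = (\<Union>u\<in>range \<iota>. X (idx u))" by auto
  then show ?thesis using small_UN[OF small_range_nat[of \<iota>], of "\<lambda>u. X (idx u)"] assms by simp
qed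

text \<open>Products of small sets are not among the axioms; the product is obtained as a union,
  over the heads \<open>x\<close>, of images of \<open>L\<close>.\<close>

lemma small_code_Cons:
  assumes "small A" "small (code ` L)" shows "small (code ` {x # xs |x xs. x \<in> A \<and> xs \<in> L})"
proof -
  have "code ` {x # xs |x xs. x \<in> A \<and> xs \<in> L} =
    (\<Union>x\<in>A. (\<lambda>u. code (x # decode u)) ` (code ` L))" by (auto simp: image_image)
  then show ?thesis using small_UN[OF assms(1) small_image[OF assms(2)]] by simp
qed

lemma small_code_lists_length:
  assumes "small A" shows "small (code ` {xs. set xs \<subseteq> A \<and> length xs = n})"
proof (induction n)
  case 0
  show ?case by (rule small_finite) simp
next
  case (Suc n)
  have "{xs. set xs \<subseteq> A \<and> length xs = Suc n} =
    {x # xs |x xs. x \<in> A \<and> xs \<in> {xs. set xs \<subseteq> A \<and> length xs = n}}"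
    by (auto simp: length_Suc_conv)
  then show ?case using small_code_Cons[OF assms Suc] by simp
qed

lemma small_code_lists: assumes "small A" shows "small (code ` {xs. set xs \<subseteq> A})"
proof -
  have "code ` {xs. set xs \<subseteq> A} = (\<Union>n. code ` {xs. set xs \<subseteq> A \<and> length xs = n})" by auto
  then show ?thesis using small_UN_nat[OF small_code_lists_length[OF assms]] by simp
qed

abbreviation SET :: "('u set, 'u set_arrow) category" where "SET \<equiv> set_cat small"

end

lemma (in set_universe) ex_coded_universe:
  "\<exists>code \<iota>. coded_universe small code \<iota>"
proof -
  obtain A where "small A" "infinite A" using small_infinite by auto
  then have inf: "infinite (UNIV :: 'u set)" using infinite_super[of A UNIV] by simp
  obtain n :: "nat \<Rightarrow> 'u" where n: "inj n"
    using infinite_countable_subset[OF inf] by blast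
  obtain c :: "'u list \<Rightarrow> 'u" where c: "inj c" using ex_inj_list[OF inf] by blast
  have "coded_universe small c n"
    by (intro coded_universe.intro set_universe_axioms coded_universe_axioms.intro n c)
  then show ?thesis by blast
qed

section \<open>Monads on sets as Kleisli triples\<close>

type_synonym 'u set_monad = "('u set, 'u set_arrow) monad"

definition TO :: "'u set_monad \<Rightarrow> 'u set \<Rightarrow> 'u set" where
  "TO T A = FO (endo T) A"

definition eta :: "'u set_monad \<Rightarrow> 'u set \<Rightarrow> 'u \<Rightarrow> 'u" where
  "eta T A x = fn (unit T A) x"

text \<open>The restriction makes the arrow extensional, so that \<open>f\<close> may be any HOL
  function whose values on \<open>A\<close> lie in \<open>B\<close>.\<close>

definition tmap :: "'u set_monad \<Rightarrow> 'u set \<Rightarrow> 'u set \<Rightarrow> ('u \<Rightarrow> 'u) \<Rightarrow> 'u \<Rightarrow> 'u" where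
  "tmap T A B f t = fn (FA (endo T) (Arrow A B (restrict f A))) t"

definition mu :: "'u set_monad \<Rightarrow> 'u set \<Rightarrow> 'u \<Rightarrow> 'u" where
  "mu T A t = fn (mult T A) t"

definition bind :: "'u set_monad \<Rightarrow> 'u set \<Rightarrow> 'u set \<Rightarrow> ('u \<Rightarrow> 'u) \<Rightarrow> 'u \<Rightarrow> 'u" where
  "bind T A B g t = mu T B (tmap T A (TO T B) g t)"

lemma tmap_cong: "(\<And>a. a \<in> A \<Longrightarrow> f a = g a) \<Longrightarrow> tmap T A B f t = tmap T A B g t"
  unfolding tmap_def by (metis restrict_ext)

lemma bind_cong: "(\<And>a. a \<in> A \<Longrightarrow> f a = g a) \<Longrightarrow> bind T A B f t = bind T A B g t"
  unfolding bind_def by (metis tmap_cong)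

context coded_universe
begin

context
  fixes T :: "'u set_monad"
  assumes T: "is_monad SET T"
begin

lemma endo_functor: "is_functor SET SET (endo T)"
  using T by (simp add: is_monad_def)

lemma small_TO: "small A \<Longrightarrow> small (TO T A)"
  using functor_Obj[OF endo_functor, of A] by (simp add: TO_def)

lemma unit_hom: "small A \<Longrightarrow> unit T A \<in> hom SET A (TO T A)"
  using T by (simp add: is_monad_def is_nat_trans_def TO_def)

lemma mult_hom: "small A \<Longrightarrow> mult T A \<in> hom SET (TO T (TO T A)) (TO T A)"
  using T by (simp add: is_monad_def is_nat_trans_def TO_def)

lemma endo_hom: "f \<in> hom SET A B \<Longrightarrow> FA (endo T) f \<in> hom SET (TO T A) (TO T B)"
  using functor_hom[OF endo_functor] by (simp add: TO_def)

lemma fn_endo: "f \<in> hom SET A B \<Longrightarrow> fn (FA (endo T) f) t = tmap T A B (fn f) t"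
  by (auto simp: tmap_def hom_set_cat)

lemma restrict_hom: "small A \<Longrightarrow> small B \<Longrightarrow> (\<And>a. a \<in> A \<Longrightarrow> f a \<in> B) \<Longrightarrow>
    Arrow A B (restrict f A) \<in> hom SET A B"
  by auto

lemma eta_in: "small A \<Longrightarrow> x \<in> A \<Longrightarrow> eta T A x \<in> TO T A"
  using hom_set_catD(7)[OF unit_hom] by (simp add: eta_def)

lemma mu_in: "small A \<Longrightarrow> t \<in> TO T (TO T A) \<Longrightarrow> mu T A t \<in> TO T A"
  using hom_set_catD(7)[OF mult_hom] by (simp add: mu_def)

lemma tmap_in: "small A \<Longrightarrow> small B \<Longrightarrow> (\<And>a. a \<in> A \<Longrightarrow> f a \<in> B) \<Longrightarrow> t \<in> TO T A \<Longrightarrow>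
    tmap T A B f t \<in> TO T B"
  unfolding tmap_def by (rule hom_set_catD(7)[OF endo_hom[OF restrict_hom]])

lemma tmap_id: assumes "small A" "t \<in> TO T A" shows "tmap T A A (\<lambda>a. a) t = t"
proof -
  have "FA (endo T) (Arrow A A (\<lambda>a\<in>A. a)) = Arrow (TO T A) (TO T A) (\<lambda>a\<in>TO T A. a)"
    using functor_Idn[OF endo_functor, of A] assms(1) by (simp add: TO_def Idn_set_cat)
  then show ?thesis using assms(2) by (simp add: tmap_def)
qed

lemma tmap_tmap:
  assumes "small A" "small B" "small C" "\<And>a. a \<in> A \<Longrightarrow> f a \<in> B" "\<And>b. b \<in> B \<Longrightarrow> g b \<in> C" "t \<in> TO T A"
  shows "tmap T B C g (tmap T A B f t) = tmap T A C (\<lambda>a. g (f a)) t"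
proof -
  have f: "Arrow A B (restrict f A) \<in> hom SET A B" and g: "Arrow B C (restrict g B) \<in> hom SET B C"
    using assms by (auto intro!: restrict_hom)
  have eq: "Arrow A C (\<lambda>a\<in>A. g (f a)) = Cmp SET (Arrow B C (restrict g B)) (Arrow A B (restrict f A))"
    using assms(4) by (auto simp: Cmp_set_cat compose_def fun_eq_iff)
  show ?thesis
    unfolding tmap_def eq functor_Cmp[OF endo_functor f g] fn_Cmp_set_cat[OF endo_hom[OF f] assms(6)] ..
qed

lemma tmap_eta:
  assumes "small A" "small B" "\<And>a. a \<in> A \<Longrightarrow> f a \<in> B" "x \<in> A"
  shows "tmap T A B f (eta T A x) = eta T B (f x)"
proof -
  let ?f = "Arrow A B (restrict f A)"
  have f: "?f \<in> hom SET A B" using assms by (auto intro!: restrict_hom)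
  have "Cmp SET (unit T B) ?f = Cmp SET (FA (endo T) ?f) (unit T A)"
    using T hom_ArrD[OF f] unfolding is_monad_def is_nat_trans_def by (auto)
  then have "fn (Cmp SET (unit T B) ?f) x = fn (Cmp SET (FA (endo T) ?f) (unit T A)) x" by simp
  then show ?thesis
    using assms(4) unfolding fn_Cmp_set_cat[OF f assms(4)] fn_Cmp_set_cat[OF unit_hom[OF assms(1)] assms(4)]
    by (simp add: eta_def tmap_def)
qed

lemma tmap_mu:
  assumes "small A" "small B" "\<And>a. a \<in> A \<Longrightarrow> f a \<in> B" "t \<in> TO T (TO T A)"
  shows "tmap T A B f (mu T A t) = mu T B (tmap T (TO T A) (TO T B) (tmap T A B f) t)"
proof -
  let ?f = "Arrow A B (restrict f A)"
  have f: "?f \<in> hom SET A B" using assms by (auto intro!: restrict_hom)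
  note Ff = endo_hom[OF f]
  have "Cmp SET (mult T B) (FA (endo T) (FA (endo T) ?f)) = Cmp SET (FA (endo T) ?f) (mult T A)"
    using T hom_ArrD[OF f] unfolding is_monad_def is_nat_trans_def by (auto)
  then have "fn (Cmp SET (mult T B) (FA (endo T) (FA (endo T) ?f))) t =
    fn (Cmp SET (FA (endo T) ?f) (mult T A)) t" by simp
  then have "mu T B (fn (FA (endo T) (FA (endo T) ?f)) t) = tmap T A B f (mu T A t)"
    using fn_Cmp_set_cat[OF endo_hom[OF Ff] assms(4)] fn_Cmp_set_cat[OF mult_hom[OF assms(1)] assms(4)]
    by (simp add: mu_def tmap_def)
  then show ?thesis unfolding fn_endo[OF Ff] using tmap_def[of T A B f] by (metis (no_types, lifting) tmap_cong)
qed

lemma mu_eta: assumes "small A" "t \<in> TO T A" shows "mu T A (eta T (TO T A) t) = t"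
proof -
  have "Cmp SET (mult T A) (unit T (TO T A)) = Idn SET (TO T A)"
    using T assms(1) unfolding is_monad_def TO_def by (auto)
  then have "fn (Cmp SET (mult T A) (unit T (TO T A))) t = fn (Idn SET (TO T A)) t" by simp
  then show ?thesis
    using fn_Cmp_set_cat[OF unit_hom[OF small_TO[OF assms(1)]] assms(2)] assms(2)
    by (simp add: mu_def eta_def)
qed

lemma mu_tmap_eta: assumes "small A" "t \<in> TO T A" shows "mu T A (tmap T A (TO T A) (eta T A) t) = t"
proof -
  have "Cmp SET (mult T A) (FA (endo T) (unit T A)) = Idn SET (TO T A)"
    using T assms(1) unfolding is_monad_def TO_def by (auto)
  then have "fn (Cmp SET (mult T A) (FA (endo T) (unit T A))) t = fn (Idn SET (TO T A)) t" by simp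
  then show ?thesis
    using fn_Cmp_set_cat[OF endo_hom[OF unit_hom[OF assms(1)]] assms(2)] assms(2)
      fn_endo[OF unit_hom[OF assms(1)]]
    by (simp add: mu_def eta_def[abs_def])
qed

lemma mu_mu:
  assumes "small A" "t \<in> TO T (TO T (TO T A))"
  shows "mu T A (mu T (TO T A) t) = mu T A (tmap T (TO T (TO T A)) (TO T A) (mu T A) t)"
proof -
  have "Cmp SET (mult T A) (mult T (TO T A)) = Cmp SET (mult T A) (FA (endo T) (mult T A))"
    using T assms(1) unfolding is_monad_def TO_def by (auto)
  then have "fn (Cmp SET (mult T A) (mult T (TO T A))) t = fn (Cmp SET (mult T A) (FA (endo T) (mult T A))) t"
    by simp
  then show ?thesis
    using fn_Cmp_set_cat[OF endo_hom[OF mult_hom[OF assms(1)]] assms(2)]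
      fn_Cmp_set_cat[OF mult_hom[OF small_TO[OF assms(1)]] assms(2)] fn_endo[OF mult_hom[OF assms(1)]]
    by (simp add: mu_def[abs_def])
qed

lemma bind_in: "small A \<Longrightarrow> small B \<Longrightarrow> (\<And>a. a \<in> A \<Longrightarrow> g a \<in> TO T B) \<Longrightarrow> t \<in> TO T A \<Longrightarrow>
    bind T A B g t \<in> TO T B"
  unfolding bind_def by (intro mu_in tmap_in small_TO)

lemma bind_eta: "small A \<Longrightarrow> small B \<Longrightarrow> (\<And>a. a \<in> A \<Longrightarrow> g a \<in> TO T B) \<Longrightarrow> x \<in> A \<Longrightarrow>
    bind T A B g (eta T A x) = g x"
  unfolding bind_def by (simp add: tmap_eta small_TO mu_eta)

lemma bind_tmap:
  assumes "small A" "small B" "small C" "\<And>a. a \<in> A \<Longrightarrow> f a \<in> B" "\<And>b. b \<in> B \<Longrightarrow> g b \<in> TO T C" "t \<in> TO T A"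
  shows "bind T B C g (tmap T A B f t) = bind T A C (\<lambda>a. g (f a)) t"
  unfolding bind_def using tmap_tmap[of A B "TO T C" f g t] assms small_TO by simp

lemma tmap_bind:
  assumes "small A" "small B" "small C" "\<And>a. a \<in> A \<Longrightarrow> g a \<in> TO T B" "\<And>b. b \<in> B \<Longrightarrow> f b \<in> C" "t \<in> TO T A"
  shows "tmap T B C f (bind T A B g t) = bind T A C (\<lambda>a. tmap T B C f (g a)) t"
  unfolding bind_def using assms
  by (subst tmap_mu) (auto simp: tmap_in small_TO tmap_tmap)

lemma bind_bind:
  assumes "small A" "small B" "small C" "\<And>a. a \<in> A \<Longrightarrow> g a \<in> TO T B" "\<And>b. b \<in> B \<Longrightarrow> h b \<in> TO T C" "t \<in> TO T A"
  shows "bind T B C h (bind T A B g t) = bind T A C (\<lambda>a. bind T B C h (g a)) t"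
proof -
  have "bind T B C h (bind T A B g t) =
      mu T C (mu T (TO T C) (tmap T A (TO T (TO T C)) (\<lambda>a. tmap T B (TO T C) h (g a)) t))"
    unfolding bind_def using assms
    by (subst tmap_mu) (auto simp: tmap_in small_TO tmap_tmap)
  also have "\<dots> = bind T A C (\<lambda>a. bind T B C h (g a)) t"
    unfolding bind_def using assms by (subst mu_mu) (auto simp: tmap_in small_TO tmap_tmap mu_in)
  finally show ?thesis .
qed

lemma bind_eta_tmap:
  assumes "small A" "small B" "\<And>a. a \<in> A \<Longrightarrow> f a \<in> B" "t \<in> TO T A"
  shows "bind T A B (\<lambda>a. eta T B (f a)) t = tmap T A B f t"
  unfolding bind_def using assms tmap_tmap[of A B "TO T B" f "eta T B" t]
    mu_tmap_eta[of B "tmap T A B f t"] by (simp add: eta_in small_TO tmap_in)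

lemma bind_id: "small A \<Longrightarrow> t \<in> TO T (TO T A) \<Longrightarrow> bind T (TO T A) A (\<lambda>x. x) t = mu T A t"
  unfolding bind_def by (simp add: tmap_id small_TO)

end

section \<open>Monads from Kleisli triples\<close>

text \<open>Functor and multiplication are those determined by a unit \<open>e\<close> and an
  extension operation \<open>b\<close>. The monad of terms of a theory is built this way, because
  there substitution is more direct to describe than multiplication.\<close>

definition kleisli_monad ::
    "('u set \<Rightarrow> 'u set) \<Rightarrow> ('u set \<Rightarrow> 'u \<Rightarrow> 'u) \<Rightarrow> ('u set \<Rightarrow> 'u set \<Rightarrow> ('u \<Rightarrow> 'u) \<Rightarrow> 'u \<Rightarrow> 'u)
      \<Rightarrow> 'u set_monad" where
  "kleisli_monad K e b =
     \<lparr>endo = \<lparr>FO = (\<lambda>A\<in>Obj SET. K A),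
        FA = (\<lambda>f\<in>Arr SET. Arrow (K (src f)) (K (trg f))
               (\<lambda>t\<in>K (src f). b (src f) (trg f) (\<lambda>x. e (trg f) (fn f x)) t))\<rparr>,
      unit = (\<lambda>A\<in>Obj SET. Arrow A (K A) (\<lambda>x\<in>A. e A x)),
      mult = (\<lambda>A\<in>Obj SET. Arrow (K (K A)) (K A) (\<lambda>t\<in>K (K A). b (K A) A (\<lambda>x. x) t))\<rparr>"

text \<open>Beside the usual laws of a Kleisli triple, \<open>b_cong\<close> is required because
  \<open>b\<close> receives a total HOL function, of which only the values on \<open>A\<close> may
  count.\<close>

context
  fixes K e b
  assumes small_K: "\<And>A. small A \<Longrightarrow> small (K A)"
    and e_in: "\<And>A x. small A \<Longrightarrow> x \<in> A \<Longrightarrow> e A x \<in> K A"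
    and b_in: "\<And>A B g t. small A \<Longrightarrow> small B \<Longrightarrow> (\<And>a. a \<in> A \<Longrightarrow> g a \<in> K B) \<Longrightarrow> t \<in> K A \<Longrightarrow> b A B g t \<in> K B"
    and b_cong: "\<And>A B g h t. small A \<Longrightarrow> t \<in> K A \<Longrightarrow> (\<And>a. a \<in> A \<Longrightarrow> g a = h a) \<Longrightarrow> b A B g t = b A B h t"
    and b_e: "\<And>A B g x. small A \<Longrightarrow> small B \<Longrightarrow> (\<And>a. a \<in> A \<Longrightarrow> g a \<in> K B) \<Longrightarrow> x \<in> A \<Longrightarrow> b A B g (e A x) = g x"
    and e_b: "\<And>A t. small A \<Longrightarrow> t \<in> K A \<Longrightarrow> b A A (e A) t = t"
    and b_b: "\<And>A B C g h t. small A \<Longrightarrow> small B \<Longrightarrow> small C \<Longrightarrow> (\<And>a. a \<in> A \<Longrightarrow> g a \<in> K B) \<Longrightarrow>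
        (\<And>a. a \<in> B \<Longrightarrow> h a \<in> K C) \<Longrightarrow> t \<in> K A \<Longrightarrow> b B C h (b A B g t) = b A C (\<lambda>a. b B C h (g a)) t"
begin

abbreviation (input) kmap where "kmap A B f \<equiv> b A B (\<lambda>x. e B (f x))"

lemma kmap_in: "small A \<Longrightarrow> small B \<Longrightarrow> (\<And>a. a \<in> A \<Longrightarrow> f a \<in> B) \<Longrightarrow> t \<in> K A \<Longrightarrow> kmap A B f t \<in> K B"
  by (simp add: b_in e_in)

lemma kleisli_FO: "small A \<Longrightarrow> FO (endo (kleisli_monad K e b)) A = K A"
  by (simp add: kleisli_monad_def)

lemma kleisli_FA: "f \<in> hom SET A B \<Longrightarrow> FA (endo (kleisli_monad K e b)) f =
    Arrow (K A) (K B) (\<lambda>t\<in>K A. kmap A B (fn f) t)"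
  by (auto simp add: kleisli_monad_def hom_def)

lemma kleisli_FA_hom: "f \<in> hom SET A B \<Longrightarrow> FA (endo (kleisli_monad K e b)) f \<in> hom SET (K A) (K B)"
  using hom_set_catD[of f small A B] by (simp add: kleisli_FA small_K kmap_in)

lemma kleisli_unit: "small A \<Longrightarrow> unit (kleisli_monad K e b) A = Arrow A (K A) (\<lambda>x\<in>A. e A x)"
  by (simp add: kleisli_monad_def)

lemma kleisli_mult: "small A \<Longrightarrow> mult (kleisli_monad K e b) A =
    Arrow (K (K A)) (K A) (\<lambda>t\<in>K (K A). b (K A) A (\<lambda>x. x) t)"
  by (simp add: kleisli_monad_def)

lemma kleisli_functor: "is_functor SET SET (endo (kleisli_monad K e b))"
proof (rule is_functorI)
  fix A assume A: "A \<in> Obj SET"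
  then show "FO (endo (kleisli_monad K e b)) A \<in> Obj SET" by (simp add: kleisli_FO small_K)
  have i: "Idn SET A \<in> hom SET A A" by (rule Idn_hom[OF is_category_set_cat A])
  show "FA (endo (kleisli_monad K e b)) (Idn SET A) = Idn SET (FO (endo (kleisli_monad K e b)) A)"
    using A unfolding kleisli_FA[OF i]
    by (auto simp: kleisli_FO Idn_set_cat restrict_def fun_eq_iff b_cong[of A _ "\<lambda>x. e A (if x \<in> A then x else undefined)" "e A"] e_b)
next
  fix f A B assume f: "f \<in> hom SET A B"
  then show "FA (endo (kleisli_monad K e b)) f \<in> hom SET (FO (endo (kleisli_monad K e b)) A) (FO (endo (kleisli_monad K e b)) B)"
    using kleisli_FA_hom[OF f] hom_set_catD(3,4)[OF f] by (simp add: kleisli_FO)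
next
  fix f g A B C assume f: "f \<in> hom SET A B" and g: "g \<in> hom SET B C"
  note d = hom_set_catD[OF f] hom_set_catD[OF g]
  note gf = Cmp_hom[OF is_category_set_cat f g]
  show "FA (endo (kleisli_monad K e b)) (Cmp SET g f) =
    Cmp SET (FA (endo (kleisli_monad K e b)) g) (FA (endo (kleisli_monad K e b)) f)"
  proof (rule set_arrow_eqI[OF kleisli_FA_hom[OF gf] Cmp_hom[OF is_category_set_cat kleisli_FA_hom[OF f] kleisli_FA_hom[OF g]]])
    fix t assume t: "t \<in> K A"
    have 1: "fn (FA (endo (kleisli_monad K e b)) f) t = kmap A B (fn f) t"
      using t unfolding kleisli_FA[OF f] by simp
    have 2: "fn (FA (endo (kleisli_monad K e b)) g) (kmap A B (fn f) t) = kmap B C (fn g) (kmap A B (fn f) t)"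
      unfolding kleisli_FA[OF g] using kmap_in[OF d(3,4,7) t] by simp
    also have "\<dots> = b A C (\<lambda>a. kmap B C (fn g) (e B (fn f a))) t"
      by (rule b_b) (use d t e_in in auto)
    also have "\<dots> = kmap A C (fn (Cmp SET g f)) t"
    proof (rule b_cong[OF d(3) t])
      fix a assume a: "a \<in> A"
      have "kmap B C (fn g) (e B (fn f a)) = e C (fn g (fn f a))"
        by (rule b_e) (use d a e_in in auto)
      then show "kmap B C (fn g) (e B (fn f a)) = e C (fn (Cmp SET g f) a)"
        unfolding fn_Cmp_set_cat[OF f a] .
    qed
    finally show "fn (FA (endo (kleisli_monad K e b)) (Cmp SET g f)) t =
      fn (Cmp SET (FA (endo (kleisli_monad K e b)) g) (FA (endo (kleisli_monad K e b)) f)) t"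
      unfolding fn_Cmp_set_cat[OF kleisli_FA_hom[OF f] t] 1 kleisli_FA[OF gf] using t by simp
  qed
qed (simp_all add: kleisli_monad_def)

lemma kleisli_unit_hom: "small A \<Longrightarrow> unit (kleisli_monad K e b) A \<in> hom SET A (K A)"
  by (simp add: kleisli_unit small_K e_in)

lemma kleisli_mult_hom: "small A \<Longrightarrow> mult (kleisli_monad K e b) A \<in> hom SET (K (K A)) (K A)"
  by (simp add: kleisli_mult small_K b_in)

lemma is_monad_kleisli: "is_monad SET (kleisli_monad K e b)"
proof -
  let ?T = "kleisli_monad K e b"
  note C = is_category_set_cat
  have TT: "is_functor SET SET (comp_functor SET (endo ?T) (endo ?T))"
    by (rule is_functor_comp_functor[OF C kleisli_functor kleisli_functor])
  have FA_fn: "fn (FA (endo ?T) f) t = kmap A B (fn f) t" if "f \<in> hom SET A B" "t \<in> K A" for f t A B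
    unfolding kleisli_FA[OF that(1)] using that(2) by simp
  have mu_fn: "fn (mult ?T A) t = b (K A) A (\<lambda>x. x) t" if "small A" "t \<in> K (K A)" for t A
    unfolding kleisli_mult[OF that(1)] using that(2) by simp
  have un_fn: "fn (unit ?T A) t = e A t" if "small A" "t \<in> A" for t A
    unfolding kleisli_unit[OF that(1)] using that(2) by simp
  \<comment> \<open>Extension is multiplication after the functor. With this, naturality and
    associativity of \<open>mult\<close> become instances of \<open>b_b\<close>.\<close>
  have bb: "b (K B) B (\<lambda>x. x) (kmap A (K B) g t) = b A B g t"
    if "small A" "small B" "\<And>a. a \<in> A \<Longrightarrow> g a \<in> K B" "t \<in> K A" for A B g t
  proof -
    have "b (K B) B (\<lambda>x. x) (kmap A (K B) g t) = b A B (\<lambda>a. b (K B) B (\<lambda>x. x) (e (K B) (g a))) t"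
      by (rule b_b) (use that small_K e_in in auto)
    also have "\<dots> = b A B g t"
      by (rule b_cong) (use that small_K b_e in auto)
    finally show ?thesis .
  qed
  have un_nat: "Cmp SET (unit ?T B) f = Cmp SET (FA (endo ?T) f) (unit ?T A)" if f: "f \<in> hom SET A B" for f A B
  proof (rule set_arrow_eqI[OF Cmp_hom[OF C f kleisli_unit_hom] Cmp_hom[OF C kleisli_unit_hom kleisli_FA_hom[OF f]]])
    fix x assume x: "x \<in> A"
    note d = hom_set_catD[OF f]
    show "fn (Cmp SET (unit ?T B) f) x = fn (Cmp SET (FA (endo ?T) f) (unit ?T A)) x"
      unfolding fn_Cmp_set_cat[OF f x] fn_Cmp_set_cat[OF kleisli_unit_hom[OF d(3)] x] un_fn[OF d(4) d(7)[OF x]]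
        un_fn[OF d(3) x] FA_fn[OF f e_in[OF d(3) x]]
      by (rule sym, rule b_e) (use d x e_in in auto)
  qed (use hom_set_catD[OF f] in auto)
  have mu_nat: "Cmp SET (mult ?T B) (FA (endo ?T) (FA (endo ?T) f)) = Cmp SET (FA (endo ?T) f) (mult ?T A)"
    if f: "f \<in> hom SET A B" for f A B
  proof (rule set_arrow_eqI[OF Cmp_hom[OF C kleisli_FA_hom[OF kleisli_FA_hom[OF f]] kleisli_mult_hom]
        Cmp_hom[OF C kleisli_mult_hom kleisli_FA_hom[OF f]]])
    fix t assume t: "t \<in> K (K A)"
    note d = hom_set_catD[OF f] and Ff = kleisli_FA_hom[OF f]
    have "b (K B) B (\<lambda>x. x) (kmap (K A) (K B) (fn (FA (endo ?T) f)) t) = b (K A) B (fn (FA (endo ?T) f)) t"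
      by (rule bb) (use d t small_K hom_set_catD[OF Ff] in auto)
    also have "\<dots> = b (K A) B (\<lambda>x. kmap A B (fn f) x) t"
      by (rule b_cong) (use d t small_K FA_fn[OF f] in auto)
    also have "\<dots> = kmap A B (fn f) (b (K A) A (\<lambda>x. x) t)"
      by (rule b_b[symmetric]) (use d t small_K e_in in auto)
    finally show "fn (Cmp SET (mult ?T B) (FA (endo ?T) (FA (endo ?T) f))) t =
      fn (Cmp SET (FA (endo ?T) f) (mult ?T A)) t"
      unfolding fn_Cmp_set_cat[OF kleisli_FA_hom[OF Ff] t] fn_Cmp_set_cat[OF kleisli_mult_hom[OF d(3)] t]
        FA_fn[OF Ff t] mu_fn[OF d(3) t]
      using kmap_in[OF small_K[OF d(3)] small_K[OF d(4)] hom_set_catD(7)[OF Ff] t]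
        b_in[OF small_K[OF d(3)] d(3) _ t, of "\<lambda>x. x"]
      by (simp add: mu_fn[OF d(4)] FA_fn[OF f])
  qed (use hom_set_catD[OF f] in auto)
  have "is_nat_trans SET SET (id_functor SET) (endo ?T) (unit ?T)"
    unfolding is_nat_trans_def
  proof (intro conjI ballI)
    fix f assume f: "f \<in> Arr SET"
    show "Cmp SET (unit ?T (Cod SET f)) (FA (id_functor SET) f) = Cmp SET (FA (endo ?T) f) (unit ?T (Dom SET f))"
      using un_nat[OF hom_self[OF f]] f by (simp del: set_cat_sel)
  qed (use kleisli_functor is_functor_id_functor[OF C] kleisli_unit_hom in
      \<open>auto simp: kleisli_FO, simp add: kleisli_monad_def\<close>)
  moreover have "is_nat_trans SET SET (comp_functor SET (endo ?T) (endo ?T)) (endo ?T) (mult ?T)"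
    unfolding is_nat_trans_def
  proof (intro conjI ballI)
    fix f assume f: "f \<in> Arr SET"
    show "Cmp SET (mult ?T (Cod SET f)) (FA (comp_functor SET (endo ?T) (endo ?T)) f) =
        Cmp SET (FA (endo ?T) f) (mult ?T (Dom SET f))"
      using mu_nat[OF hom_self[OF f]] f by (simp del: set_cat_sel)
  qed (use kleisli_functor TT kleisli_mult_hom in
      \<open>auto simp: kleisli_FO small_K, simp add: kleisli_monad_def\<close>)
  moreover have "Cmp SET (mult ?T A) (unit ?T (K A)) = Idn SET (K A)" if A: "small A" for A
    by (rule set_arrow_eqI[OF Cmp_hom[OF C kleisli_unit_hom[OF small_K[OF A]] kleisli_mult_hom[OF A]] Idn_hom[OF C]])
      (use A small_K e_in in \<open>auto
        simp: fn_Cmp_set_cat[OF kleisli_unit_hom[OF small_K[OF A]]] un_fn mu_fn b_e\<close>)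
  moreover have "Cmp SET (mult ?T A) (FA (endo ?T) (unit ?T A)) = Idn SET (K A)" if A: "small A" for A
  proof (rule set_arrow_eqI[OF Cmp_hom[OF C kleisli_FA_hom[OF kleisli_unit_hom[OF A]] kleisli_mult_hom[OF A]] Idn_hom[OF C]])
    fix t assume t: "t \<in> K A"
    have 1: "fn (FA (endo ?T) (unit ?T A)) t = kmap A (K A) (fn (unit ?T A)) t"
      by (rule FA_fn[OF kleisli_unit_hom[OF A] t])
    have 2: "fn (unit ?T A) a \<in> K A" if "a \<in> A" for a
      using that un_fn[OF A that] e_in[OF A that] by simp
    have "b (K A) A (\<lambda>x. x) (kmap A (K A) (fn (unit ?T A)) t) = b A A (fn (unit ?T A)) t"
      by (rule bb[OF A A 2 t])
    also have "\<dots> = b A A (e A) t" by (rule b_cong[OF A t un_fn[OF A]])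
    finally show "fn (Cmp SET (mult ?T A) (FA (endo ?T) (unit ?T A))) t = fn (Idn SET (K A)) t"
      unfolding fn_Cmp_set_cat[OF kleisli_FA_hom[OF kleisli_unit_hom[OF A]] t] 1
      using kmap_in[OF A small_K[OF A] 2 t] t e_b[OF A t] by (simp add: mu_fn[OF A])
  qed (use A small_K in auto)
  moreover have "Cmp SET (mult ?T A) (mult ?T (K A)) = Cmp SET (mult ?T A) (FA (endo ?T) (mult ?T A))"
    if A: "small A" for A
  proof (rule set_arrow_eqI[OF Cmp_hom[OF C kleisli_mult_hom[OF small_K[OF A]] kleisli_mult_hom[OF A]]
        Cmp_hom[OF C kleisli_FA_hom[OF kleisli_mult_hom[OF A]] kleisli_mult_hom[OF A]]])
    fix t assume t: "t \<in> K (K (K A))"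
    note m = kleisli_mult_hom[OF A]
    have "b (K A) A (\<lambda>x. x) (kmap (K (K A)) (K A) (fn (mult ?T A)) t) = b (K (K A)) A (fn (mult ?T A)) t"
      by (rule bb) (use A t small_K hom_set_catD[OF m] in auto)
    also have "\<dots> = b (K (K A)) A (\<lambda>x. b (K A) A (\<lambda>x. x) x) t"
      by (rule b_cong) (use A t small_K mu_fn in auto)
    also have "\<dots> = b (K A) A (\<lambda>x. x) (b (K (K A)) (K A) (\<lambda>x. x) t)"
      by (rule b_b[symmetric]) (use A t small_K in auto)
    finally show "fn (Cmp SET (mult ?T A) (mult ?T (K A))) t = fn (Cmp SET (mult ?T A) (FA (endo ?T) (mult ?T A))) t"
      unfolding fn_Cmp_set_cat[OF kleisli_mult_hom[OF small_K[OF A]] t] fn_Cmp_set_cat[OF kleisli_FA_hom[OF m] t]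
        mu_fn[OF small_K[OF A] t] FA_fn[OF m t]
      using kmap_in[OF small_K[OF small_K[OF A]] small_K[OF A] hom_set_catD(7)[OF m] t]
      by (simp add: mu_fn[OF A] mu_fn[OF A b_in[OF small_K[OF small_K[OF A]] small_K[OF A] _ t]])
  qed
  ultimately show ?thesis
    unfolding is_monad_def using kleisli_functor by (simp add: kleisli_FO)
qed

lemma kleisli_TO: "small A \<Longrightarrow> TO (kleisli_monad K e b) A = K A"
  by (simp add: TO_def kleisli_FO)

lemma kleisli_eta: "small A \<Longrightarrow> x \<in> A \<Longrightarrow> eta (kleisli_monad K e b) A x = e A x"
  by (simp add: eta_def kleisli_unit)

lemma kleisli_bind:
  assumes A: "small A" and B: "small B" and g: "\<And>a. a \<in> A \<Longrightarrow> g a \<in> K B" and t: "t \<in> K A"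
  shows "bind (kleisli_monad K e b) A B g t = b A B g t"
proof -
  have f: "Arrow A (K B) (restrict g A) \<in> hom SET A (K B)" using A B g small_K by auto
  have "tmap (kleisli_monad K e b) A (K B) g t = kmap A (K B) (fn (Arrow A (K B) (restrict g A))) t"
    unfolding tmap_def kleisli_FA[OF f] using t by simp
  also have "\<dots> = kmap A (K B) g t" by (rule b_cong[OF A t]) simp
  finally have 1: "tmap (kleisli_monad K e b) A (K B) g t = kmap A (K B) g t" .
  have "bind (kleisli_monad K e b) A B g t = b (K B) B (\<lambda>x. x) (kmap A (K B) g t)"
    unfolding bind_def kleisli_TO[OF B] 1 mu_def kleisli_mult[OF B]
    using kmap_in[OF A small_K[OF B] g t] by simp
  also have "\<dots> = b A B (\<lambda>a. b (K B) B (\<lambda>x. x) (e (K B) (g a))) t"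
    by (rule b_b) (use A B g t small_K e_in in auto)
  also have "\<dots> = b A B g t"
    by (rule b_cong) (use A B g t small_K b_e in auto)
  finally show ?thesis .
qed

end

section \<open>Monad morphisms on elements\<close>

lemma monad_morphism_hom:
  "is_monad_morphism SET S T \<sigma> \<Longrightarrow> small A \<Longrightarrow> \<sigma> A \<in> hom SET (TO S A) (TO T A)"
  by (simp add: is_monad_morphism_def is_nat_trans_def TO_def)

lemma monad_morphism_in:
  "is_monad_morphism SET S T \<sigma> \<Longrightarrow> small A \<Longrightarrow> t \<in> TO S A \<Longrightarrow> fn (\<sigma> A) t \<in> TO T A"
  by (rule hom_set_catD(7)[OF monad_morphism_hom])

lemma monad_morphism_tmap:
  assumes S: "is_monad SET S" and \<sigma>: "is_monad_morphism SET S T \<sigma>"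
    and A: "small A" and B: "small B" and f: "\<And>a. a \<in> A \<Longrightarrow> f a \<in> B" and t: "t \<in> TO S A"
  shows "fn (\<sigma> B) (tmap S A B f t) = tmap T A B f (fn (\<sigma> A) t)"
proof -
  let ?f = "Arrow A B (restrict f A)"
  have fh: "?f \<in> hom SET A B" using A B f by auto
  have "Cmp SET (\<sigma> B) (FA (endo S) ?f) = Cmp SET (FA (endo T) ?f) (\<sigma> A)"
    using \<sigma> hom_ArrD[OF fh] unfolding is_monad_morphism_def is_nat_trans_def by auto
  then have "fn (Cmp SET (\<sigma> B) (FA (endo S) ?f)) t = fn (Cmp SET (FA (endo T) ?f) (\<sigma> A)) t" by simp
  then show ?thesis
    unfolding fn_Cmp_set_cat[OF endo_hom[OF S fh] t] fn_Cmp_set_cat[OF monad_morphism_hom[OF \<sigma> A] t] tmap_def .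
qed

lemma monad_morphism_eta:
  assumes S: "is_monad SET S" and T: "is_monad SET T" and \<sigma>: "is_monad_morphism SET S T \<sigma>"
    and A: "small A" and x: "x \<in> A"
  shows "fn (\<sigma> A) (eta S A x) = eta T A x"
proof -
  have "Cmp SET (\<sigma> A) (unit S A) = unit T A"
    using \<sigma> A by (simp add: is_monad_morphism_def)
  then show ?thesis using fn_Cmp_set_cat[OF unit_hom[OF S A] x, of "\<sigma> A"] by (simp add: eta_def)
qed

text \<open>Naturality and compatibility with \<open>mult\<close> merge into a single law for
  \<open>bind\<close>, the form in which morphisms are composed and checked from here on.\<close>

lemma monad_morphism_bind:
  assumes S: "is_monad SET S" and T: "is_monad SET T" and \<sigma>: "is_monad_morphism SET S T \<sigma>"
    and A: "small A" and B: "small B" and g: "\<And>a. a \<in> A \<Longrightarrow> g a \<in> TO S B" and t: "t \<in> TO S A"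
  shows "fn (\<sigma> B) (bind S A B g t) = bind T A B (\<lambda>a. fn (\<sigma> B) (g a)) (fn (\<sigma> A) t)"
proof -
  note C = is_category_set_cat and h = monad_morphism_hom[OF \<sigma>]
  let ?u = "tmap S A (TO S B) g t"
  have u: "?u \<in> TO S (TO S B)" by (rule tmap_in[OF S A small_TO[OF S B] g t])
  have SB: "small (TO S B)" "small (TO T B)" using small_TO S T B by auto
  note m = mult_hom[OF S B]
  have "Cmp SET (\<sigma> B) (mult S B) =
      Cmp SET (mult T B) (Cmp SET (\<sigma> (TO T B)) (FA (endo S) (\<sigma> B)))"
    using \<sigma> B by (auto simp: is_monad_morphism_def TO_def)
  then have "fn (Cmp SET (\<sigma> B) (mult S B)) ?u =
      fn (Cmp SET (mult T B) (Cmp SET (\<sigma> (TO T B)) (FA (endo S) (\<sigma> B)))) ?u" by simp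
  then have "fn (\<sigma> B) (bind S A B g t) = mu T B (fn (\<sigma> (TO T B)) (fn (FA (endo S) (\<sigma> B)) ?u))"
    using fn_Cmp_set_cat[OF m u] fn_Cmp_set_cat[OF endo_hom[OF S h[OF B]] u]
      fn_Cmp_set_cat[OF Cmp_hom[OF C endo_hom[OF S h[OF B]] h[OF SB(2)]] u]
    by (simp add: bind_def mu_def)
  also have "fn (FA (endo S) (\<sigma> B)) ?u = tmap S A (TO T B) (\<lambda>a. fn (\<sigma> B) (g a)) t"
    unfolding fn_endo[OF S h[OF B]]
    by (rule tmap_tmap[OF S A SB g]) (use hom_set_catD(7)[OF h[OF B]] t in auto)
  also have "fn (\<sigma> (TO T B)) \<dots> = tmap T A (TO T B) (\<lambda>a. fn (\<sigma> B) (g a)) (fn (\<sigma> A) t)"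
    by (rule monad_morphism_tmap[OF S \<sigma> A SB(2) _ t]) (use g hom_set_catD(7)[OF h[OF B]] in auto)
  finally show ?thesis by (simp add: bind_def)
qed

text \<open>Naturality follows from the two laws, since \<open>tmap\<close> along \<open>f\<close>
  is \<open>bind\<close> along the unit after \<open>f\<close>; this is \<open>s_tmap\<close>
  below.\<close>

lemma is_monad_morphismI:
  assumes S: "is_monad SET S" and T: "is_monad SET T"
    and s: "\<And>A t. small A \<Longrightarrow> t \<in> TO S A \<Longrightarrow> s A t \<in> TO T A"
    and s_eta: "\<And>A x. small A \<Longrightarrow> x \<in> A \<Longrightarrow> s A (eta S A x) = eta T A x"
    and s_bind: "\<And>A B g t. small A \<Longrightarrow> small B \<Longrightarrow> (\<And>a. a \<in> A \<Longrightarrow> g a \<in> TO S B) \<Longrightarrow> t \<in> TO S A \<Longrightarrow>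
      s B (bind S A B g t) = bind T A B (\<lambda>a. s B (g a)) (s A t)"
  shows "is_monad_morphism SET S T (\<lambda>A\<in>Obj SET. Arrow (TO S A) (TO T A) (restrict (s A) (TO S A)))"
    (is "is_monad_morphism _ _ _ ?\<sigma>")
proof -
  note C = is_category_set_cat
  have fn_s: "fn (?\<sigma> A) t = s A t" if "small A" "t \<in> TO S A" for A t using that by simp
  have h: "?\<sigma> A \<in> hom SET (TO S A) (TO T A)" if "small A" for A
    using that s small_TO S T by auto
  have s_tmap: "s B (tmap S A B f t) = tmap T A B f (s A t)"
    if A: "small A" and B: "small B" and f: "\<And>a. a \<in> A \<Longrightarrow> f a \<in> B" and t: "t \<in> TO S A" for A B f t
  proof -
    have "s B (tmap S A B f t) = s B (bind S A B (\<lambda>a. eta S B (f a)) t)"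
      by (simp add: bind_eta_tmap[OF S A B f t])
    also have "\<dots> = bind T A B (\<lambda>a. s B (eta S B (f a))) (s A t)"
      by (rule s_bind[OF A B _ t]) (use f B eta_in[OF S] in auto)
    also have "\<dots> = bind T A B (\<lambda>a. eta T B (f a)) (s A t)"
      by (rule bind_cong) (use s_eta f B in auto)
    also have "\<dots> = tmap T A B f (s A t)"
      by (rule bind_eta_tmap[OF T A B f s[OF A t]])
    finally show ?thesis .
  qed
  have nat: "Cmp SET (?\<sigma> B) (FA (endo S) f) = Cmp SET (FA (endo T) f) (?\<sigma> A)" if f: "f \<in> hom SET A B" for f A B
  proof -
    note d = hom_set_catD[OF f]
    show ?thesis
    proof (rule set_arrow_eqI[OF Cmp_hom[OF C endo_hom[OF S f] h[OF d(4)]] Cmp_hom[OF C h[OF d(3)] endo_hom[OF T f]]])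
      fix t assume t: "t \<in> TO S A"
      show "fn (Cmp SET (?\<sigma> B) (FA (endo S) f)) t = fn (Cmp SET (FA (endo T) f) (?\<sigma> A)) t"
        unfolding fn_Cmp_set_cat[OF endo_hom[OF S f] t] fn_Cmp_set_cat[OF h[OF d(3)] t] fn_s[OF d(3) t]
          fn_endo[OF S f] fn_endo[OF T f]
        using s_tmap[OF d(3,4,7) t] tmap_in[OF S d(3,4,7) t] d(4) by simp
    qed
  qed
  have "is_nat_trans SET SET (endo S) (endo T) ?\<sigma>"
    unfolding is_nat_trans_def
  proof (intro conjI ballI)
    fix f assume f: "f \<in> Arr SET"
    show "Cmp SET (?\<sigma> (Cod SET f)) (FA (endo S) f) = Cmp SET (FA (endo T) f) (?\<sigma> (Dom SET f))"
      by (rule nat[OF hom_self[OF f]])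
  next
    fix x assume "x \<in> Obj SET"
    then show "?\<sigma> x \<in> hom SET (FO (endo S) x) (FO (endo T) x)" using h unfolding TO_def by simp
  qed (use endo_functor S T in auto)
  moreover have "Cmp SET (?\<sigma> A) (unit S A) = unit T A" if A: "small A" for A
  proof (rule set_arrow_eqI[OF Cmp_hom[OF C unit_hom[OF S A] h[OF A]] unit_hom[OF T A]])
    fix x assume x: "x \<in> A"
    have e: "fn (unit S A) x = eta S A x" "fn (unit T A) x = eta T A x" by (simp_all add: eta_def)
    show "fn (Cmp SET (?\<sigma> A) (unit S A)) x = fn (unit T A) x"
      unfolding fn_Cmp_set_cat[OF unit_hom[OF S A] x] e fn_s[OF A eta_in[OF S A x]]
      by (rule s_eta[OF A x])
  qed
  moreover have "Cmp SET (?\<sigma> A) (mult S A) =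
      Cmp SET (mult T A) (Cmp SET (?\<sigma> (TO T A)) (FA (endo S) (?\<sigma> A)))" if A: "small A" for A
  proof -
    note SA = small_TO[OF S A] and TA = small_TO[OF T A]
    note sh = endo_hom[OF S h[OF A]]
    show ?thesis
    proof (rule set_arrow_eqI[OF Cmp_hom[OF C mult_hom[OF S A] h[OF A]]
          Cmp_hom[OF C Cmp_hom[OF C sh h[OF TA]] mult_hom[OF T A]]])
      fix t assume t: "t \<in> TO S (TO S A)"
      have m: "fn (mult S A) t = mu S A t" for t by (simp add: mu_def)
      have m': "fn (mult T A) t = mu T A t" for t by (simp add: mu_def)
      have u: "tmap S (TO S A) (TO T A) (fn (?\<sigma> A)) t = tmap S (TO S A) (TO T A) (s A) t"
        by (rule tmap_cong[OF fn_s[OF A]])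
      \<comment> \<open>\<open>mu\<close> is \<open>bind\<close> along the identity, so the law for
        \<open>mult\<close> is an instance of \<open>s_bind\<close>; naturality then moves
        \<open>s\<close> past the map inside.\<close>
      have "s A (mu S A t) = s A (bind S (TO S A) A (\<lambda>x. x) t)" by (simp add: bind_id[OF S A t])
      also have "\<dots> = bind T (TO S A) A (s A) (s (TO S A) t)"
        by (rule s_bind[OF SA A _ t]) simp
      also have "\<dots> = mu T A (s (TO T A) (tmap S (TO S A) (TO T A) (s A) t))"
        unfolding bind_def by (subst s_tmap[OF SA TA s[OF A] t]) auto
      finally show "fn (Cmp SET (?\<sigma> A) (mult S A)) t =
        fn (Cmp SET (mult T A) (Cmp SET (?\<sigma> (TO T A)) (FA (endo S) (?\<sigma> A)))) t"
        unfolding fn_Cmp_set_cat[OF mult_hom[OF S A] t] fn_Cmp_set_cat[OF Cmp_hom[OF C sh h[OF TA]] t]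
          fn_Cmp_set_cat[OF sh t] m m' fn_s[OF A mu_in[OF S A t]] fn_endo[OF S h[OF A]] u
        using tmap_in[OF S SA TA s[OF A] t] TA by simp
    qed
  qed
  ultimately show ?thesis
    unfolding is_monad_morphism_def TO_def by simp
qed

end

section \<open>Filtered colimits of sets\<close>

context coded_universe
begin

lemma is_coconeD:
  assumes "is_cocone J SET K L c"
  shows "small L" "j \<in> Obj J \<Longrightarrow> c j \<in> hom SET (FO K j) L"
    "j \<in> Obj J \<Longrightarrow> x \<in> FO K j \<Longrightarrow> fn (c j) x \<in> L"
  using assms by (auto simp: is_cocone_def intro: hom_set_catD(7))

lemma cocone_fn:
  assumes K: "is_functor J SET K" and c: "is_cocone J SET K L c" and u: "u \<in> hom J j k" and x: "x \<in> FO K j"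
  shows "fn (c k) (fn (FA K u) x) = fn (c j) x"
proof -
  have "Cmp SET (c k) (FA K u) = c j" using c u by (auto simp: is_cocone_def hom_def)
  then show ?thesis using fn_Cmp_set_cat[OF functor_hom[OF K u] x, of "c k"] by simp
qed

lemma is_coconeI:
  assumes J: "is_category J" and K: "is_functor J SET K" and L: "small L" and c: "\<And>j. j \<in> Obj J \<Longrightarrow> c j \<in> hom SET (FO K j) L"
    and "\<And>u j k x. u \<in> hom J j k \<Longrightarrow> x \<in> FO K j \<Longrightarrow> fn (c k) (fn (FA K u) x) = fn (c j) x"
  shows "is_cocone J SET K L c"
  unfolding is_cocone_def
proof (intro conjI ballI)
  fix u assume u: "u \<in> Arr J"
  note u' = hom_self[OF u] and Ku = functor_hom[OF K hom_self[OF u]]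
  have o: "Dom J u \<in> Obj J" "Cod J u \<in> Obj J" using hom_Obj[OF J u'] by auto
  show "Cmp SET (c (Cod J u)) (FA K u) = c (Dom J u)"
    by (rule set_arrow_eqI[OF Cmp_hom[OF is_category_set_cat Ku c[OF o(2)]] c[OF o(1)]])
      (simp add: fn_Cmp_set_cat[OF Ku] assms(5)[OF u'])
qed (use L c in auto)

text \<open>Compare two maps from \<open>L\<close> to a two-element set: a constant one, and the one
  that takes the other value exactly off the joint image. They agree on all stages, so uniqueness of
  mediating maps makes them equal.\<close>

lemma colimit_jointly_surjective:
  assumes J: "is_category J" and K: "is_functor J SET K" and c: "is_colimit J SET K L c" and y: "y \<in> L"
  shows "\<exists>j\<in>Obj J. \<exists>x\<in>FO K j. y = fn (c j) x"
proof -
  have cc: "is_cocone J SET K L c" using c by (simp add: is_colimit_def)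
  note C = is_category_set_cat
  define d where "d j = Arrow (FO K j) (fin 2) (\<lambda>x\<in>FO K j. \<iota> 0)" for j
  have sK: "\<And>j. j \<in> Obj J \<Longrightarrow> small (FO K j)" using functor_Obj[OF K] by simp
  have "is_cocone J SET K (fin 2) d"
    by (rule is_coconeI[OF J K]) (use sK hom_Obj[OF J] hom_set_catD(7)[OF functor_hom[OF K]] in \<open>auto simp: d_def\<close>)
  then have ex: "\<exists>!h. h \<in> hom SET L (fin 2) \<and> (\<forall>j\<in>Obj J. Cmp SET h (c j) = d j)"
    using c by (simp add: is_colimit_def)
  define P where "P y \<longleftrightarrow> (\<exists>j\<in>Obj J. \<exists>x\<in>FO K j. y = fn (c j) x)" for y
  define h1 where "h1 = Arrow L (fin 2) (\<lambda>y\<in>L. \<iota> 0)"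
  define h2 where "h2 = Arrow L (fin 2) (\<lambda>y\<in>L. if P y then \<iota> 0 else \<iota> 1)"
  have hh: "h1 \<in> hom SET L (fin 2)" "h2 \<in> hom SET L (fin 2)"
    using is_coconeD(1)[OF cc] by (auto simp: h1_def h2_def)
  have "Cmp SET h1 (c j) = d j \<and> Cmp SET h2 (c j) = d j" if j: "j \<in> Obj J" for j
  proof -
    note cj = is_coconeD(2)[OF cc j]
    have dj: "d j \<in> hom SET (FO K j) (fin 2)" using sK[OF j] by (auto simp: d_def)
    have "P (fn (c j) x)" if "x \<in> FO K j" for x using that j by (auto simp: P_def)
    then show ?thesis
      by (intro conjI set_arrow_eqI[OF Cmp_hom[OF C cj hh(1)] dj] set_arrow_eqI[OF Cmp_hom[OF C cj hh(2)] dj])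
        (auto simp: fn_Cmp_set_cat[OF cj] h1_def h2_def d_def hom_set_catD(7)[OF cj])
  qed
  then have "h1 = h2" using ex hh by blast
  then have "P y" using y by (auto simp: h1_def h2_def fun_eq_iff restrict_def split: if_splits)
  then show ?thesis by (simp add: P_def)
qed

lemma filteredE:
  assumes "is_filtered J" "x \<in> Obj J" "y \<in> Obj J"
  obtains z u v where "z \<in> Obj J" "u \<in> hom J x z" "v \<in> hom J y z"
  using assms unfolding is_filtered_def by blast

lemma filtered_coequalizeE:
  assumes "is_filtered J" "is_category J" "f \<in> hom J x y" "g \<in> hom J x y"
  obtains z h where "z \<in> Obj J" "h \<in> hom J y z" "Cmp J h f = Cmp J h g"
  using assms(1,3,4) hom_Obj[OF assms(2,3)] unfolding is_filtered_def by blast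

lemma functor_fn_Cmp:
  assumes "is_functor J SET K" "u \<in> hom J j k" "v \<in> hom J k l" "x \<in> FO K j"
  shows "fn (FA K (Cmp J v u)) x = fn (FA K v) (fn (FA K u) x)"
  using functor_Cmp[OF assms(1-3)] fn_Cmp_set_cat[OF functor_hom[OF assms(1,2)] assms(4)] by simp

text \<open>To separate elements that no stage identifies, it is enough to test against a cocone with a
  two-element vertex.\<close>

lemma colimit_separates:
  assumes J: "is_category J" and fil: "is_filtered J" and K: "is_functor J SET K" and c: "is_colimit J SET K L c"
    and j: "j \<in> Obj J" and k: "k \<in> Obj J" and x: "x \<in> FO K j" and y: "y \<in> FO K k"
    and eq: "fn (c j) x = fn (c k) y"
  shows "\<exists>z u v. u \<in> hom J j z \<and> v \<in> hom J k z \<and> fn (FA K u) x = fn (FA K v) y"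
proof -
  \<comment> \<open>Some stage identifies \<open>y\<close> with the fixed element \<open>x\<close>.
    The indicator of this property is a cocone because the property is invariant along the arrows of
    \<open>J\<close>, and it holds of \<open>x\<close> itself.\<close>
  define P where "P k y \<longleftrightarrow> (\<exists>z u v. u \<in> hom J j z \<and> v \<in> hom J k z \<and> fn (FA K u) x = fn (FA K v) y)" for k y
  define d where "d k = Arrow (FO K k) (fin 2) (\<lambda>y\<in>FO K k. if P k y then \<iota> 0 else \<iota> 1)" for k
  have cc: "is_cocone J SET K L c" using c by (simp add: is_colimit_def)
  have sK: "\<And>j. j \<in> Obj J \<Longrightarrow> small (FO K j)" using functor_Obj[OF K] by simp
  have P: "P m (fn (FA K w) a) \<longleftrightarrow> P l a" if w: "w \<in> hom J l m" and a: "a \<in> FO K l" for w l m a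
  proof
    assume "P m (fn (FA K w) a)"
    then obtain z u v where "u \<in> hom J j z" and v: "v \<in> hom J m z" and "fn (FA K u) x = fn (FA K v) (fn (FA K w) a)"
      unfolding P_def by blast
    then show "P l a"
      unfolding P_def using functor_fn_Cmp[OF K w v a] Cmp_hom[OF J w v] by metis
  next
    assume "P l a"
    then obtain z u v where u: "u \<in> hom J j z" and v: "v \<in> hom J l z" and e: "fn (FA K u) x = fn (FA K v) a"
      unfolding P_def by blast
    \<comment> \<open>At an upper bound of \<open>z\<close> and \<open>m\<close> the two paths out
      of \<open>l\<close> need not agree; a further arrow \<open>r\<close> makes them equal, and
      both elements are compared at its target.\<close>
    obtain z' p q where p: "p \<in> hom J z z'" and q: "q \<in> hom J m z'"
      using filteredE[OF fil] hom_Obj[OF J u] hom_Obj[OF J w] by metis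
    obtain z'' r where r: "r \<in> hom J z' z''" and req: "Cmp J r (Cmp J p v) = Cmp J r (Cmp J q w)"
      using filtered_coequalizeE[OF fil J Cmp_hom[OF J v p] Cmp_hom[OF J w q]] by metis
    have wa: "fn (FA K w) a \<in> FO K m" using hom_set_catD(7)[OF functor_hom[OF K w] a] .
    have "fn (FA K (Cmp J r (Cmp J p u))) x = fn (FA K r) (fn (FA K p) (fn (FA K u) x))"
      using functor_fn_Cmp[OF K Cmp_hom[OF J u p] r x] functor_fn_Cmp[OF K u p x] by simp
    also have "\<dots> = fn (FA K (Cmp J r (Cmp J p v))) a"
      unfolding e using functor_fn_Cmp[OF K Cmp_hom[OF J v p] r a] functor_fn_Cmp[OF K v p a] by simp
    also have "\<dots> = fn (FA K r) (fn (FA K q) (fn (FA K w) a))"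
      unfolding req using functor_fn_Cmp[OF K Cmp_hom[OF J w q] r a] functor_fn_Cmp[OF K w q a] by simp
    also have "\<dots> = fn (FA K (Cmp J r q)) (fn (FA K w) a)"
      using functor_fn_Cmp[OF K q r wa] by simp
    finally show "P m (fn (FA K w) a)"
      unfolding P_def using Cmp_hom[OF J Cmp_hom[OF J u p] r] Cmp_hom[OF J q r] by blast
  qed
  have "is_cocone J SET K (fin 2) d"
  proof (rule is_coconeI[OF J K])
    fix u l m a assume "u \<in> hom J l m" "a \<in> FO K l"
    then show "fn (d m) (fn (FA K u) a) = fn (d l) a"
      using P hom_set_catD(7)[OF functor_hom[OF K]] by (simp add: d_def)
  qed (use sK in \<open>auto simp: d_def\<close>)
  then obtain h where h: "\<forall>j\<in>Obj J. Cmp SET h (c j) = d j"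
    using c unfolding is_colimit_def by meson
  have "fn (d j) x = fn (d k) y"
    using h j k fn_Cmp_set_cat[OF is_coconeD(2)[OF cc j] x, of h] fn_Cmp_set_cat[OF is_coconeD(2)[OF cc k] y, of h] eq
    by simp
  moreover have "P j x" unfolding P_def using Idn_hom[OF J j] by blast
  ultimately have "P k y" using x y by (simp add: d_def split: if_splits)
  then show ?thesis unfolding P_def .
qed

text \<open>The mediating map picks, for every element of \<open>L\<close>, a preimage at some
  stage; \<open>sep\<close> makes its value independent of the pick.\<close>

lemma is_colimitI:
  assumes J: "is_category J" and K: "is_functor J SET K" and c: "is_cocone J SET K L c"
    and surj: "\<And>y. y \<in> L \<Longrightarrow> \<exists>j\<in>Obj J. \<exists>x\<in>FO K j. y = fn (c j) x"
    and sep: "\<And>j k x y. j \<in> Obj J \<Longrightarrow> k \<in> Obj J \<Longrightarrow> x \<in> FO K j \<Longrightarrow> y \<in> FO K k \<Longrightarrow> fn (c j) x = fn (c k) y \<Longrightarrow>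
      \<exists>z u v. u \<in> hom J j z \<and> v \<in> hom J k z \<and> fn (FA K u) x = fn (FA K v) y"
  shows "is_colimit J SET K L c"
  unfolding is_colimit_def
proof (intro conjI allI impI c)
  fix M d assume d: "is_cocone J SET K M d"
  obtain J' X where JX: "\<And>y. y \<in> L \<Longrightarrow> J' y \<in> Obj J \<and> X y \<in> FO K (J' y) \<and> y = fn (c (J' y)) (X y)"
    using surj by metis
  define h where "h = Arrow L M (\<lambda>y\<in>L. fn (d (J' y)) (X y))"
  have h: "h \<in> hom SET L M"
    using is_coconeD(1)[OF c] is_coconeD[OF d] JX by (auto simp: h_def)
  have hc: "fn h (fn (c j) x) = fn (d j) x" if j: "j \<in> Obj J" and x: "x \<in> FO K j" for j x
  proof -
    let ?y = "fn (c j) x"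
    have y: "?y \<in> L" using is_coconeD(3)[OF c j x] .
    note s = JX[OF y]
    obtain z u v where u: "u \<in> hom J (J' ?y) z" and v: "v \<in> hom J j z" and "fn (FA K u) (X ?y) = fn (FA K v) x"
      using sep[of "J' ?y" j "X ?y" x] s j x by metis
    then have "fn (d (J' ?y)) (X ?y) = fn (d j) x"
      using cocone_fn[OF K d u] cocone_fn[OF K d v x] s by metis
    then show ?thesis using y by (simp add: h_def)
  qed
  show "\<exists>!h. h \<in> hom SET L M \<and> (\<forall>j\<in>Obj J. Cmp SET h (c j) = d j)"
  proof (rule ex1I[of _ h], intro conjI ballI h)
    fix j assume j: "j \<in> Obj J"
    note cj = is_coconeD(2)[OF c j]
    show "Cmp SET h (c j) = d j"
      by (rule set_arrow_eqI[OF Cmp_hom[OF is_category_set_cat cj h] is_coconeD(2)[OF d j]])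
        (simp add: fn_Cmp_set_cat[OF cj] hc[OF j])
  next
    fix g assume g: "g \<in> hom SET L M \<and> (\<forall>j\<in>Obj J. Cmp SET g (c j) = d j)"
    show "g = h"
    proof (rule set_arrow_eqI[OF conjunct1[OF g] h])
      fix y assume "y \<in> L"
      then obtain j x where j: "j \<in> Obj J" and x: "x \<in> FO K j" and y: "y = fn (c j) x" using surj by blast
      have "fn (Cmp SET g (c j)) x = fn (d j) x" using g j by simp
      then show "fn g y = fn h y"
        unfolding y hc[OF j x] fn_Cmp_set_cat[OF is_coconeD(2)[OF c j] x] .
    qed
  qed
qed

section \<open>Finite data in a filtered colimit\<close>

context
  fixes J :: "('u, 'u) category" and K L c
  assumes J: "is_category J" and fil: "is_filtered J" and K: "is_functor J SET K" and c: "is_colimit J SET K L c"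
begin

lemma colimit_cocone: "is_cocone J SET K L c"
  using c by (simp add: is_colimit_def)

text \<open>Induction on the length: the stage found so far and a stage for the new entry have a
  common upper bound, to which everything is moved. Here the finiteness of arities meets
  filteredness.\<close>

lemma colimit_lift_tuple:
  assumes "\<And>i. i < (n :: nat) \<Longrightarrow> xs i \<in> L"
  shows "\<exists>j\<in>Obj J. \<exists>ys. \<forall>i<n. ys i \<in> FO K j \<and> xs i = fn (c j) (ys i)"
  using assms
proof (induction n)
  case 0
  then show ?case using fil by (auto simp: is_filtered_def)
next
  case (Suc n)
  obtain j ys where j: "j \<in> Obj J" and ys: "\<And>i. i < n \<Longrightarrow> ys i \<in> FO K j \<and> xs i = fn (c j) (ys i)"
    using Suc.IH Suc.prems by (meson less_Suc_eq)
  obtain k y where k: "k \<in> Obj J" and y: "y \<in> FO K k" "xs n = fn (c k) y"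
    using colimit_jointly_surjective[OF J K c] Suc.prems by (meson lessI)
  obtain z u v where z: "z \<in> Obj J" and u: "u \<in> hom J j z" and v: "v \<in> hom J k z"
    using filteredE[OF fil j k] by metis
  let ?ys = "\<lambda>i. if i < n then fn (FA K u) (ys i) else fn (FA K v) y"
  have "?ys i \<in> FO K z \<and> xs i = fn (c z) (?ys i)" if i: "i < Suc n" for i
  proof (cases "i < n")
    case True
    then show ?thesis
      using ys[OF True] hom_set_catD(7)[OF functor_hom[OF K u], of "ys i"] cocone_fn[OF K colimit_cocone u, of "ys i"] by simp
  next
    case False
    then have "i = n" using i by simp
    then show ?thesis
      using y hom_set_catD(7)[OF functor_hom[OF K v], of y] cocone_fn[OF K colimit_cocone v, of y] by simp
  qed
  then show ?case by (intro bexI[OF _ z] exI[of _ ?ys]) blast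
qed

text \<open>The pairs are treated one after the other; an identification once made persists along
  every further arrow.\<close>

lemma colimit_identify_pairs:
  assumes "finite R" "j \<in> Obj J" "\<And>x y. (x, y) \<in> R \<Longrightarrow> x \<in> FO K j \<and> y \<in> FO K j \<and> fn (c j) x = fn (c j) y"
  shows "\<exists>z. \<exists>u\<in>hom J j z. \<forall>(x, y)\<in>R. fn (FA K u) x = fn (FA K u) y"
  using assms(1,3)
proof (induction R)
  case empty
  then show ?case using Idn_hom[OF J assms(2)] by auto
next
  case (insert p R)
  have "\<exists>z. \<exists>u\<in>hom J j z. \<forall>(x, y)\<in>R. fn (FA K u) x = fn (FA K u) y"
    by (rule insert.IH) (use insert.prems in auto)
  then obtain z u where u: "u \<in> hom J j z" and eq: "\<And>x y. (x, y) \<in> R \<Longrightarrow> fn (FA K u) x = fn (FA K u) y"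
    by blast
  obtain x y where p: "p = (x, y)" by (cases p)
  have xy: "x \<in> FO K j" "y \<in> FO K j" "fn (c j) x = fn (c j) y" using insert.prems p by auto
  note uK = hom_set_catD(7)[OF functor_hom[OF K u]]
  have z: "z \<in> Obj J" using hom_Obj[OF J u] by simp
  have "fn (c z) (fn (FA K u) x) = fn (c z) (fn (FA K u) y)"
    using xy cocone_fn[OF K colimit_cocone u] by simp
  then obtain w a b where a: "a \<in> hom J z w" and b: "b \<in> hom J z w"
    and ab: "fn (FA K a) (fn (FA K u) x) = fn (FA K b) (fn (FA K u) y)"
    using colimit_separates[OF J fil K c z z uK uK] xy by blast
  \<comment> \<open>Separation yields two arrows \<open>a\<close> and \<open>b\<close> out of
    \<open>z\<close>, but one arrow has to serve both components; composing with \<open>r\<close>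
    makes the two equal.\<close>
  obtain w' r where r: "r \<in> hom J w w'" and rab: "Cmp J r a = Cmp J r b"
    using filtered_coequalizeE[OF fil J a b] by metis
  define s where "s = Cmp J r a"
  have s: "s \<in> hom J z w'" unfolding s_def by (rule Cmp_hom[OF J a r])
  have "fn (FA K s) (fn (FA K u) x) = fn (FA K r) (fn (FA K a) (fn (FA K u) x))"
    unfolding s_def using functor_fn_Cmp[OF K a r uK] xy by simp
  also have "\<dots> = fn (FA K s) (fn (FA K u) y)"
    unfolding s_def rab ab using functor_fn_Cmp[OF K b r uK] xy by simp
  finally have "fn (FA K (Cmp J s u)) x = fn (FA K (Cmp J s u)) y"
    using functor_fn_Cmp[OF K u s] xy by simp
  moreover have "fn (FA K (Cmp J s u)) x' = fn (FA K (Cmp J s u)) y'" if "(x', y') \<in> R" for x' y'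
    using eq[OF that] functor_fn_Cmp[OF K u s] insert.prems[of x' y'] that by simp
  ultimately show ?case using Cmp_hom[OF J u s] p by blast
qed

end

section \<open>Finitary monads are those whose elements have finite support\<close>

text \<open>An element of \<open>T (fin n)\<close> is read as an \<open>n\<close>-ary operation;
  \<open>nmap\<close> puts the entries of \<open>xs\<close> in place of its formal
  variables.\<close>

definition nmap :: "'u set_monad \<Rightarrow> nat \<Rightarrow> 'u set \<Rightarrow> (nat \<Rightarrow> 'u) \<Rightarrow> 'u \<Rightarrow> 'u" where
  "nmap T n A xs t = tmap T (fin n) A (\<lambda>u. xs (idx u)) t"

text \<open>This is surjectivity of the comparison map to \<open>T A\<close> from the coend over
  \<open>n\<close> of \<open>T (fin n)\<close> times the \<open>n\<close>-tuples in
  \<open>A\<close>. Its injectivity is the content of \<open>finitary_lift\<close>.\<close>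

definition finitely_supported :: "'u set_monad \<Rightarrow> bool" where
  "finitely_supported T \<longleftrightarrow> (\<forall>A. small A \<longrightarrow> (\<forall>t\<in>TO T A.
     \<exists>n xs s. s \<in> TO T (fin n) \<and> (\<forall>i<n. xs i \<in> A) \<and> t = nmap T n A xs s))"

lemma finitely_supportedE:
  assumes "finitely_supported T" "small A" "t \<in> TO T A"
  obtains n xs s where "s \<in> TO T (fin n)" "\<And>i. i < n \<Longrightarrow> xs i \<in> A" "t = nmap T n A xs s"
  using assms unfolding finitely_supported_def by blast

lemma nmap_cong: "(\<And>i. i < n \<Longrightarrow> xs i = ys i) \<Longrightarrow> nmap T n A xs t = nmap T n A ys t"
  unfolding nmap_def by (rule tmap_cong) auto

lemma nmap_in:
  "is_monad SET T \<Longrightarrow> small A \<Longrightarrow> (\<And>i. i < n \<Longrightarrow> xs i \<in> A) \<Longrightarrow> t \<in> TO T (fin n) \<Longrightarrow> nmap T n A xs t \<in> TO T A"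
  unfolding nmap_def by (rule tmap_in) auto

lemma tmap_nmap:
  assumes "is_monad SET T" "small A" "small B" "\<And>i. i < n \<Longrightarrow> xs i \<in> A" "\<And>a. a \<in> A \<Longrightarrow> f a \<in> B" "t \<in> TO T (fin n)"
  shows "tmap T A B f (nmap T n A xs t) = nmap T n B (\<lambda>i. f (xs i)) t"
  unfolding nmap_def by (rule tmap_tmap) (use assms in auto)

lemma \<iota>_idx [simp]: "u \<in> fin n \<Longrightarrow> \<iota> (idx u) = u"
  by (auto simp: fin_def)

lemma nmap_\<iota>: "is_monad SET T \<Longrightarrow> t \<in> TO T (fin n) \<Longrightarrow> nmap T n (fin n) \<iota> t = t"
  unfolding nmap_def using tmap_cong[of "fin n" "\<lambda>u. \<iota> (idx u)" "\<lambda>u. u" T "fin n" t] tmap_id[of T "fin n" t]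
  by simp

lemma nmap_nmap:
  assumes "is_monad SET T" "small A" "\<And>i. i < k \<Longrightarrow> xs i \<in> A" "\<And>i. i < n \<Longrightarrow> f i < k" "t \<in> TO T (fin n)"
  shows "nmap T k A xs (nmap T n (fin k) (\<lambda>i. \<iota> (f i)) t) = nmap T n A (\<lambda>i. xs (f i)) t"
  using tmap_nmap[of T "fin k" A n "\<lambda>i. \<iota> (f i)" "\<lambda>u. xs (idx u)" t] assms by (simp add: nmap_def)

text \<open>The colimit used here is that of the finite subsets of \<open>A\<close>, indexed by the lists over \<open>A\<close>.\<close>

lemma finitely_supported_if_preserves:
  assumes T: "is_monad SET T" and fin: "preserves_filtered_colimits small SET SET (endo T)"
  shows "finitely_supported T"
  unfolding finitely_supported_def
proof (intro allI impI ballI)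
  fix A t assume A: "small A" and t: "t \<in> TO T A"
  define P where "P = code ` {xs. set xs \<subseteq> A}"
  define E where "E x = set (decode x)" for x
  \<comment> \<open>The preorder of lists under inclusion of their sets of entries. Lists stand in
    for finite subsets because the objects of a small category must be elements of
    \<open>'u\<close>; an arrow is coded by the pair of its ends.\<close>
  define J :: "('u, 'u) category" where "J = \<lparr>Obj = P,
     Arr = {code [x, y] |x y. x \<in> P \<and> y \<in> P \<and> E x \<subseteq> E y},
     Dom = \<lambda>f. decode f ! 0, Cod = \<lambda>f. decode f ! 1, Idn = \<lambda>x. code [x, x],
     Cmp = \<lambda>g f. code [decode f ! 0, decode g ! 1]\<rparr>"
  have Jsel: "Obj J = P" "Arr J = {code [x, y] |x y. x \<in> P \<and> y \<in> P \<and> E x \<subseteq> E y}"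
    "Dom J f = decode f ! 0" "Cod J f = decode f ! 1" "Idn J x = code [x, x]"
    "Cmp J g f = code [decode f ! 0, decode g ! 1]" for f g x by (simp_all add: J_def)
  have Jhom: "f \<in> hom J x y \<longleftrightarrow> f = code [x, y] \<and> x \<in> P \<and> y \<in> P \<and> E x \<subseteq> E y" for f x y
    by (auto simp: hom_def Jsel)
  have EP: "E x \<subseteq> A" "finite (E x)" if "x \<in> P" for x using that by (auto simp: P_def E_def)
  have sE: "small (E x)" for x unfolding E_def by (rule small_finite) simp
  have Jcat: "is_category J"
    by (rule is_categoryI) (auto simp: Jhom, auto simp: Jsel)
  have P1: "code [a] \<in> P" "E (code [a]) = {a}" if "a \<in> A" for a using that by (auto simp: P_def E_def)
  have Jfil: "is_filtered J"
    unfolding is_filtered_def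
  proof (intro conjI ballI)
    have "code [] \<in> Obj J" by (simp add: Jsel P_def)
    then show "Obj J \<noteq> {}" by blast
  next
    fix x y assume "x \<in> Obj J" "y \<in> Obj J"
    then obtain xs ys where "x = code xs" "y = code ys" "set xs \<subseteq> A" "set ys \<subseteq> A"
      by (auto simp: Jsel P_def)
    then show "\<exists>z\<in>Obj J. hom J x z \<noteq> {} \<and> hom J y z \<noteq> {}"
      by (intro bexI[of _ "code (xs @ ys)"]) (auto simp: Jhom E_def P_def Jsel(1))
  next
    fix x y f g assume "y \<in> Obj J" "f \<in> hom J x y" "g \<in> hom J x y"
    then show "\<exists>z\<in>Obj J. \<exists>h\<in>hom J y z. Cmp J h f = Cmp J h g"
      by (intro bexI[of _ y] bexI[of _ "code [y, y]"]) (auto simp: Jhom Jsel(1))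
  qed
  have sP: "small P" unfolding P_def by (rule small_code_lists[OF A])
  have "Arr J \<subseteq> code ` {xs. set xs \<subseteq> P}" by (auto simp: Jsel)
  then have sArr: "small (Arr J)" by (rule small_subset[OF small_code_lists[OF sP]])
  define K where "K = \<lparr>FO = (\<lambda>x\<in>Obj J. E x),
     FA = (\<lambda>f\<in>Arr J. Arrow (E (Dom J f)) (E (Cod J f)) (\<lambda>a\<in>E (Dom J f). a))\<rparr>"
  have KO: "FO K x = E x" if "x \<in> P" for x using that by (simp add: K_def Jsel)
  have KA: "FA K f = Arrow (E x) (E y) (\<lambda>a\<in>E x. a)" if "f \<in> hom J x y" for f x y
    using that by (auto simp: K_def hom_def)
  have K: "is_functor J SET K"
  proof (rule is_functorI)
    fix f g x y z assume f: "f \<in> hom J x y" and g: "g \<in> hom J y z"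
    show "FA K (Cmp J g f) = Cmp SET (FA K g) (FA K f)"
      unfolding KA[OF f] KA[OF g] KA[OF Cmp_hom[OF Jcat f g]] Cmp_set_cat
      using f g by (auto simp: Jhom compose_def fun_eq_iff)
  next
    fix x assume x: "x \<in> Obj J"
    show "FA K (Idn J x) = Idn SET (FO K x)"
      using x by (simp add: KA[OF Idn_hom[OF Jcat x]] KO Jsel(1) Idn_set_cat)
  next
    fix f x y assume f: "f \<in> hom J x y"
    show "FA K f \<in> hom SET (FO K x) (FO K y)"
      unfolding KA[OF f] using f sE by (auto simp: KO Jhom)
  qed (auto simp: K_def sE)
  define c where "c x = Arrow (E x) A (\<lambda>a\<in>E x. a)" for x
  have c: "is_cocone J SET K A c"
    by (rule is_coconeI[OF Jcat K A]) (use A sE EP in \<open>auto simp: c_def Jsel(1) KO KA Jhom\<close>)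
  have "is_colimit J SET K A c"
  proof (rule is_colimitI[OF Jcat K c])
    fix a assume a: "a \<in> A"
    have o: "code [a] \<in> Obj J" using P1(1)[OF a] by (simp add: Jsel(1))
    have "a \<in> FO K (code [a])" "a = fn (c (code [a])) a"
      using P1[OF a] by (simp_all add: KO c_def)
    then show "\<exists>j\<in>Obj J. \<exists>x\<in>FO K j. a = fn (c j) x" by (intro bexI[OF _ o] bexI)
  next
    fix j k x y
    assume jk: "j \<in> Obj J" "k \<in> Obj J" and x: "x \<in> FO K j" and y: "y \<in> FO K k" and eq: "fn (c j) x = fn (c k) y"
    let ?z = "code (decode j @ decode k)"
    have u: "code [j, ?z] \<in> hom J j ?z" and v: "code [k, ?z] \<in> hom J k ?z"
      using jk by (auto simp: Jhom Jsel(1) P_def E_def)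
    have "fn (FA K (code [j, ?z])) x = fn (FA K (code [k, ?z])) y"
      unfolding KA[OF u] KA[OF v] using x y jk eq by (simp add: c_def KO Jsel(1))
    then show "\<exists>z u v. u \<in> hom J j z \<and> v \<in> hom J k z \<and> fn (FA K u) x = fn (FA K v) y"
      using u v by blast
  qed
  then have Tc: "is_colimit J SET (comp_functor J (endo T) K) (FO (endo T) A) (\<lambda>j. FA (endo T) (c j))"
    using fin Jcat sP sArr Jfil K unfolding preserves_filtered_colimits_def Jsel(1)[symmetric] by blast
  obtain j s where j: "j \<in> P" and s: "s \<in> TO T (E j)" and ts: "t = fn (FA (endo T) (c j)) s"
    using colimit_jointly_surjective[OF Jcat is_functor_comp_functor[OF Jcat K endo_functor[OF T]] Tc, of t] t
    by (auto simp: TO_def Jsel(1) KO)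
  define xs where "xs = decode j"
  have xs: "E j = set xs" "set xs \<subseteq> A" using EP[OF j] by (auto simp: xs_def E_def)
  let ?n = "length xs"
  \<comment> \<open>The list may repeat entries, so \<open>p\<close> fixes one position for every
    element of the set.\<close>
  have "\<exists>i. i < ?n \<and> xs ! i = b" if "b \<in> set xs" for b using that by (simp add: in_set_conv_nth)
  then obtain p where p: "\<And>b. b \<in> set xs \<Longrightarrow> p b < ?n \<and> xs ! p b = b" by metis
  let ?s = "tmap T (E j) (fin ?n) (\<lambda>b. \<iota> (p b)) s"
  have s': "?s \<in> TO T (fin ?n)" by (rule tmap_in[OF T sE small_fin _ s]) (use p xs in auto)
  have "nmap T ?n A ((!) xs) ?s = tmap T (E j) A (\<lambda>b. xs ! p b) s"
    unfolding nmap_def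
    by (subst tmap_tmap[OF T sE small_fin A _ _ s]) (use p xs(2) in \<open>auto simp: xs(1)\<close>)
  also have "\<dots> = tmap T (E j) A (\<lambda>b. b) s"
    by (rule tmap_cong) (use p in \<open>auto simp: xs(1)\<close>)
  also have "\<dots> = t" unfolding ts c_def tmap_def ..
  finally have "t = nmap T ?n A ((!) xs) ?s" ..
  moreover have "\<forall>i<?n. xs ! i \<in> A" using xs(2) nth_mem by blast
  ultimately show "\<exists>n xs s. s \<in> TO T (fin n) \<and> (\<forall>i<n. xs i \<in> A) \<and> t = nmap T n A xs s"
    using s' by blast
qed

text \<open>Joint surjectivity: the variables of a representation lift to one stage. Separation: two
  elements at a stage involve finitely many variables, and at a later stage \<open>w\<close> those
  of them that agree in \<open>L\<close> already agree. Then a map \<open>r\<close> from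
  \<open>L\<close> back to \<open>w\<close> undoes the coprojection on these variables, and
  \<open>T r\<close> carries the equality in \<open>T L\<close> to one at \<open>w\<close>.\<close>

lemma preserves_if_finitely_supported:
  assumes T: "is_monad SET T" and fin: "finitely_supported T"
  shows "preserves_filtered_colimits small SET SET (endo T)"
  unfolding preserves_filtered_colimits_def
proof (intro allI impI)
  fix J :: "('u, 'u) category" and K L c
  assume "is_category J \<and> small (Obj J) \<and> small (Arr J) \<and> is_filtered J"
    and "is_functor J SET K \<and> is_colimit J SET K L c"
  then have J: "is_category J" and fil: "is_filtered J" and K: "is_functor J SET K" and c: "is_colimit J SET K L c"
    by auto
  note cc = colimit_cocone[OF J fil K c]
  note TK = is_functor_comp_functor[OF J K endo_functor[OF T]]
  have L: "small L" using is_coconeD(1)[OF cc] .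
  have sK: "\<And>j. j \<in> Obj J \<Longrightarrow> small (FO K j)" using functor_Obj[OF K] by simp
  have cin: "fn (c j) x \<in> L" if "j \<in> Obj J" "x \<in> FO K j" for j x using is_coconeD(3)[OF cc that] .
  have TKO: "FO (comp_functor J (endo T) K) j = TO T (FO K j)" if "j \<in> Obj J" for j
    using that by (simp add: TO_def)
  have TKA: "fn (FA (comp_functor J (endo T) K) u) t = tmap T (FO K j) (FO K k) (fn (FA K u)) t"
    if u: "u \<in> hom J j k" for u j k t
    using hom_ArrD[OF u] by (simp add: fn_endo[OF T functor_hom[OF K u]])
  have Tc: "fn (FA (endo T) (c j)) t = tmap T (FO K j) L (fn (c j)) t" if "j \<in> Obj J" for j t
    by (rule fn_endo[OF T is_coconeD(2)[OF cc that]])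
  have cone: "is_cocone J SET (comp_functor J (endo T) K) (TO T L) (\<lambda>j. FA (endo T) (c j))"
  proof (rule is_coconeI[OF J TK small_TO[OF T L]])
    fix j assume j: "j \<in> Obj J"
    show "FA (endo T) (c j) \<in> hom SET (FO (comp_functor J (endo T) K) j) (TO T L)"
      unfolding TKO[OF j] by (rule endo_hom[OF T is_coconeD(2)[OF cc j]])
  next
    fix u j k t assume u: "u \<in> hom J j k" and t: "t \<in> FO (comp_functor J (endo T) K) j"
    have o: "j \<in> Obj J" "k \<in> Obj J" using hom_Obj[OF J u] by auto
    have t: "t \<in> TO T (FO K j)" using t TKO[OF o(1)] by simp
    have "tmap T (FO K k) L (fn (c k)) (tmap T (FO K j) (FO K k) (fn (FA K u)) t) =
        tmap T (FO K j) L (\<lambda>x. fn (c k) (fn (FA K u) x)) t"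
      by (rule tmap_tmap[OF T sK[OF o(1)] sK[OF o(2)] L hom_set_catD(7)[OF functor_hom[OF K u]] cin[OF o(2)] t])
    also have "\<dots> = tmap T (FO K j) L (fn (c j)) t"
      by (rule tmap_cong) (rule cocone_fn[OF K cc u])
    finally show "fn (FA (endo T) (c k)) (fn (FA (comp_functor J (endo T) K) u) t) = fn (FA (endo T) (c j)) t"
      unfolding TKA[OF u] Tc[OF o(1)] Tc[OF o(2)] .
  qed
  have "is_colimit J SET (comp_functor J (endo T) K) (TO T L) (\<lambda>j. FA (endo T) (c j))"
  proof (rule is_colimitI[OF J TK cone])
    fix y assume "y \<in> TO T L"
    then obtain n xs s where s: "s \<in> TO T (fin n)" and xs: "\<And>i. i < n \<Longrightarrow> xs i \<in> L" and y: "y = nmap T n L xs s"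
      using finitely_supportedE[OF fin L] by metis
    have "\<exists>j\<in>Obj J. \<exists>ys. \<forall>i<n. ys i \<in> FO K j \<and> xs i = fn (c j) (ys i)"
      by (rule colimit_lift_tuple[OF J fil K c xs])
    then obtain j ys where j: "j \<in> Obj J" and ys: "\<And>i. i < n \<Longrightarrow> ys i \<in> FO K j \<and> xs i = fn (c j) (ys i)"
      by blast
    have "nmap T n (FO K j) ys s \<in> TO T (FO K j)" by (rule nmap_in[OF T sK[OF j] _ s]) (use ys in auto)
    moreover have "y = fn (FA (endo T) (c j)) (nmap T n (FO K j) ys s)"
      unfolding y Tc[OF j] using ys nmap_cong[of n xs "\<lambda>i. fn (c j) (ys i)"]
      by (subst tmap_nmap[OF T sK[OF j] L _ cin[OF j] s]) auto
    ultimately show "\<exists>j\<in>Obj J. \<exists>x\<in>FO (comp_functor J (endo T) K) j. y = fn (FA (endo T) (c j)) x"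
      using j TKO by blast
  next
    fix j k x y
    assume j: "j \<in> Obj J" and k: "k \<in> Obj J" and x: "x \<in> FO (comp_functor J (endo T) K) j"
      and y: "y \<in> FO (comp_functor J (endo T) K) k" and eq: "fn (FA (endo T) (c j)) x = fn (FA (endo T) (c k)) y"
    obtain z u v where z: "z \<in> Obj J" and u: "u \<in> hom J j z" and v: "v \<in> hom J k z"
      using filteredE[OF fil j k] by metis
    define t where "t = fn (FA (comp_functor J (endo T) K) u) x"
    define s where "s = fn (FA (comp_functor J (endo T) K) v) y"
    have ts: "t \<in> TO T (FO K z)" "s \<in> TO T (FO K z)"
      using hom_set_catD(7)[OF functor_hom[OF TK u] x] hom_set_catD(7)[OF functor_hom[OF TK v] y] TKO[OF z]
      by (auto simp: t_def s_def)
    have "fn (FA (endo T) (c z)) t = fn (FA (endo T) (c z)) s"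
      unfolding t_def s_def using cocone_fn[OF TK cone u x] cocone_fn[OF TK cone v y] eq by simp
    then have teq: "tmap T (FO K z) L (fn (c z)) t = tmap T (FO K z) L (fn (c z)) s" by (simp add: Tc[OF z])
    obtain n xs t0 where t0: "t0 \<in> TO T (fin n)" and xs: "\<And>i. i < n \<Longrightarrow> xs i \<in> FO K z" and t: "t = nmap T n (FO K z) xs t0"
      using finitely_supportedE[OF fin sK[OF z] ts(1)] by metis
    obtain m ys s0 where s0: "s0 \<in> TO T (fin m)" and ys: "\<And>i. i < m \<Longrightarrow> ys i \<in> FO K z" and s: "s = nmap T m (FO K z) ys s0"
      using finitely_supportedE[OF fin sK[OF z] ts(2)] by metis
    \<comment> \<open>All variables that occur in \<open>t\<close> or \<open>s\<close>. Their
      finiteness gives one arrow that identifies all pairs among them which agree in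
      \<open>L\<close>.\<close>
    define D where "D = xs ` {..<n} \<union> ys ` {..<m}"
    have D: "finite D" "D \<subseteq> FO K z" using xs ys by (auto simp: D_def)
    let ?R = "{(a, b). a \<in> D \<and> b \<in> D \<and> fn (c z) a = fn (c z) b}"
    have "finite ?R" by (rule finite_subset[of _ "D \<times> D"]) (use D in auto)
    then obtain w0 p0 where p0: "p0 \<in> hom J z w0" and p0R: "\<forall>(a, b)\<in>?R. fn (FA K p0) a = fn (FA K p0) b"
      using colimit_identify_pairs[OF J fil K c _ z, of ?R] D by blast
    have w0: "w0 \<in> Obj J" using hom_Obj[OF J p0] by simp
    \<comment> \<open>The map \<open>r\<close> below needs a default value at its target stage, so
      that stage is moved on until it is inhabited, unless \<open>L\<close> is empty.\<close>
    have "\<exists>w p. p \<in> hom J w0 w \<and> (L \<noteq> {} \<longrightarrow> FO K w \<noteq> {})"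
    proof (cases "L = {}")
      case True then show ?thesis using Idn_hom[OF J w0] by blast
    next
      case False
      then obtain l a where l: "l \<in> Obj J" and a: "a \<in> FO K l" using colimit_jointly_surjective[OF J K c] by blast
      obtain w p q where "p \<in> hom J w0 w" and q: "q \<in> hom J l w" using filteredE[OF fil w0 l] by metis
      then show ?thesis using hom_set_catD(7)[OF functor_hom[OF K q] a] by blast
    qed
    then obtain w p1 where p1: "p1 \<in> hom J w0 w" and ne: "L \<noteq> {} \<Longrightarrow> FO K w \<noteq> {}" by blast
    define p where "p = Cmp J p1 p0"
    have p: "p \<in> hom J z w" unfolding p_def by (rule Cmp_hom[OF J p0 p1])
    have w: "w \<in> Obj J" using hom_Obj[OF J p] by simp
    have pD: "fn (FA K p) a = fn (FA K p) b" if ab: "a \<in> D" "b \<in> D" "fn (c z) a = fn (c z) b" for a b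
    proof -
      have "fn (FA K p0) a = fn (FA K p0) b" "a \<in> FO K z" "b \<in> FO K z" using p0R ab D by blast+
      then show ?thesis
        unfolding p_def using functor_fn_Cmp[OF K p0 p1, of a] functor_fn_Cmp[OF K p0 p1, of b] by simp
    qed
    \<comment> \<open>On the images of \<open>D\<close> this is the transition map \<open>p\<close>,
      well defined by \<open>pD\<close>; elsewhere any element of the stage will do.\<close>
    define r where "r l = (if \<exists>a\<in>D. fn (c z) a = l then fn (FA K p) (SOME a. a \<in> D \<and> fn (c z) a = l)
      else SOME a. a \<in> FO K w)" for l
    note pK = hom_set_catD(7)[OF functor_hom[OF K p]]
    have rc: "r (fn (c z) a) = fn (FA K p) a" if "a \<in> D" for a
    proof -
      have "(SOME b. b \<in> D \<and> fn (c z) b = fn (c z) a) \<in> D \<and> fn (c z) (SOME b. b \<in> D \<and> fn (c z) b = fn (c z) a) = fn (c z) a"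
        by (rule someI[of _ a]) (use that in simp)
      moreover have "\<exists>b\<in>D. fn (c z) b = fn (c z) a" using that by blast
      ultimately show ?thesis unfolding r_def by (simp add: pD[OF _ that])
    qed
    have rL: "r l \<in> FO K w" if l: "l \<in> L" for l
    proof (cases "\<exists>a\<in>D. fn (c z) a = l")
      case True
      then obtain a where "a \<in> D" "l = fn (c z) a" by auto
      then show ?thesis using rc[of a] pK[of a] D by auto
    next
      case False
      have "\<exists>a. a \<in> FO K w" using ne l by auto
      from someI_ex[OF this] show ?thesis unfolding r_def using False by simp
    qed
    \<comment> \<open>On elements with variables in \<open>D\<close>, going to \<open>L\<close> and
      returning by \<open>r\<close> has the same effect as \<open>p\<close>.\<close>
    have push: "tmap T L (FO K w) r (tmap T (FO K z) L (fn (c z)) (nmap T q (FO K z) zs t')) =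
        tmap T (FO K z) (FO K w) (fn (FA K p)) (nmap T q (FO K z) zs t')"
      if t': "t' \<in> TO T (fin q)" and zs: "\<And>i. i < q \<Longrightarrow> zs i \<in> D" for q zs t'
    proof -
      have zs': "zs i \<in> FO K z" if "i < q" for i using zs[OF that] D by auto
      have "tmap T L (FO K w) r (tmap T (FO K z) L (fn (c z)) (nmap T q (FO K z) zs t')) =
          nmap T q (FO K w) (\<lambda>i. r (fn (c z) (zs i))) t'"
        using tmap_nmap[OF T sK[OF z] L zs' cin[OF z] t']
          tmap_nmap[OF T L sK[OF w] cin[OF z zs'] rL t'] by simp
      also have "\<dots> = nmap T q (FO K w) (\<lambda>i. fn (FA K p) (zs i)) t'"
        by (rule nmap_cong) (use rc zs in auto)
      also have "\<dots> = tmap T (FO K z) (FO K w) (fn (FA K p)) (nmap T q (FO K z) zs t')"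
        using tmap_nmap[OF T sK[OF z] sK[OF w] zs' pK t'] by simp
      finally show ?thesis .
    qed
    have D': "\<And>i. i < n \<Longrightarrow> xs i \<in> D" "\<And>i. i < m \<Longrightarrow> ys i \<in> D" by (auto simp: D_def)
    have "tmap T (FO K z) (FO K w) (fn (FA K p)) t = tmap T (FO K z) (FO K w) (fn (FA K p)) s"
      using push[OF t0, of xs] push[OF s0, of ys] D' teq unfolding t s by simp
    then have "fn (FA (comp_functor J (endo T) K) p) t = fn (FA (comp_functor J (endo T) K) p) s"
      by (simp add: TKA[OF p])
    then have "fn (FA (comp_functor J (endo T) K) (Cmp J p u)) x = fn (FA (comp_functor J (endo T) K) (Cmp J p v)) y"
      unfolding functor_fn_Cmp[OF TK u p x] functor_fn_Cmp[OF TK v p y] t_def s_def .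
    then show "\<exists>z u v. u \<in> hom J j z \<and> v \<in> hom J k z \<and>
        fn (FA (comp_functor J (endo T) K) u) x = fn (FA (comp_functor J (endo T) K) v) y"
      using Cmp_hom[OF J u p] Cmp_hom[OF J v p] by blast
  qed
  then show "is_colimit J SET (comp_functor J (endo T) K) (FO (endo T) L) (\<lambda>j. FA (endo T) (c j))"
    by (simp add: TO_def)
qed

text \<open>Two finite supports of an element of \<open>T A\<close> are compared inside a nonempty finite subset of
  \<open>A\<close>, which is a retract of \<open>A\<close>.\<close>

lemma finitary_lift:
  assumes T: "is_monad SET T" and A: "small A"
    and cong: "\<And>n xs ys s. (\<And>i. i < n \<Longrightarrow> xs i = ys i) \<Longrightarrow> s \<in> TO T (fin n) \<Longrightarrow> (\<And>i. i < n \<Longrightarrow> xs i \<in> A) \<Longrightarrow> r n xs s = r n ys s"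
    and compat: "\<And>n k f xs s. s \<in> TO T (fin n) \<Longrightarrow> (\<And>i. i < n \<Longrightarrow> f i < k) \<Longrightarrow> (\<And>i. i < k \<Longrightarrow> xs i \<in> A) \<Longrightarrow>
      r k xs (nmap T n (fin k) (\<lambda>i. \<iota> (f i)) s) = r n (\<lambda>i. xs (f i)) s"
  shows "\<exists>h. \<forall>n xs s. s \<in> TO T (fin n) \<longrightarrow> (\<forall>i<n. xs i \<in> A) \<longrightarrow> h (nmap T n A xs s) = r n xs s"
proof -
  have key: "r n xs s = r m ys t"
    if s: "s \<in> TO T (fin n)" and xs: "\<And>i. i < n \<Longrightarrow> xs i \<in> A" and t: "t \<in> TO T (fin m)" and ys: "\<And>i. i < m \<Longrightarrow> ys i \<in> A"
      and eq: "nmap T n A xs s = nmap T m A ys t" for n xs s m ys t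
  proof (cases "A = {}")
    case True
    \<comment> \<open>Without variables both arities are 0, and \<open>A\<close> is
      \<open>fin 0\<close> itself, where \<open>nmap\<close> is the identity.\<close>
    then have nm: "n = 0" "m = 0" using xs ys by fastforce+
    have 0: "A = fin 0" using True by (simp add: fin_def)
    have "s = t"
      using eq nmap_cong[of 0 xs \<iota> T A s] nmap_cong[of 0 ys \<iota> T A t] nmap_\<iota>[OF T s] nmap_\<iota>[OF T t]
      by (simp add: nm 0)
    then show ?thesis using cong[of n xs ys s] nm s by simp
  next
    case False
    then obtain a where a: "a \<in> A" by auto
    \<comment> \<open>The extra entry \<open>a\<close> keeps the list nonempty even when both tuples
      are empty, so that the retraction \<open>\<rho>\<close> has the default value
      \<open>\<iota> 0\<close>.\<close>
    define zs where "zs = a # map xs [0..<n] @ map ys [0..<m]"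
    let ?k = "length zs"
    have zA: "set zs \<subseteq> A" using a xs ys by (auto simp: zs_def)
    have "\<exists>i. i < ?k \<and> zs ! i = b" if "b \<in> set zs" for b using that by (simp add: in_set_conv_nth)
    then obtain p where p: "\<And>b. b \<in> set zs \<Longrightarrow> p b < ?k \<and> zs ! p b = b" by metis
    define \<rho> where "\<rho> b = (if b \<in> set zs then \<iota> (p b) else \<iota> 0)" for b
    have k0: "0 < ?k" by (simp add: zs_def)
    have \<rho>: "\<rho> b \<in> fin ?k" for b using p k0 by (auto simp: \<rho>_def)
    \<comment> \<open>The retraction turns an element of \<open>T A\<close> into an operation on the
      positions of \<open>zs\<close>, and \<open>compat\<close> says that \<open>r\<close> does not
      notice. The right-hand side sees the representation only through the element it
      represents.\<close>
    have red: "r q ws s' = r ?k ((!) zs) (tmap T A (fin ?k) \<rho> (nmap T q A ws s'))"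
      if s': "s' \<in> TO T (fin q)" and ws: "\<And>i. i < q \<Longrightarrow> ws i \<in> set zs" for q ws s'
    proof -
      have wA: "\<And>i. i < q \<Longrightarrow> ws i \<in> A" using ws zA by auto
      have "tmap T A (fin ?k) \<rho> (nmap T q A ws s') = nmap T q (fin ?k) (\<lambda>i. \<rho> (ws i)) s'"
        by (rule tmap_nmap[OF T A small_fin wA \<rho> s'])
      also have "\<dots> = nmap T q (fin ?k) (\<lambda>i. \<iota> (p (ws i))) s'"
        by (rule nmap_cong) (use ws in \<open>auto simp: \<rho>_def\<close>)
      finally have "r ?k ((!) zs) (tmap T A (fin ?k) \<rho> (nmap T q A ws s')) = r q (\<lambda>i. zs ! p (ws i)) s'"
        using compat[of s' q "\<lambda>i. p (ws i)" ?k "(!) zs"] s' p ws zA by (simp add: nth_mem subset_iff)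
      also have "\<dots> = r q ws s'" by (rule cong[OF _ s']) (use p ws wA in auto)
      finally show ?thesis ..
    qed
    show ?thesis
      using red[OF s, of xs] red[OF t, of ys] eq by (auto simp: zs_def)
  qed
  \<comment> \<open>Choice of some representation of \<open>y\<close>; by \<open>key\<close> the
    value does not depend on which. Off the represented elements it is arbitrary.\<close>
  define h where "h y = (SOME z. \<exists>n xs s. s \<in> TO T (fin n) \<and> (\<forall>i<n. xs i \<in> A) \<and> y = nmap T n A xs s \<and> z = r n xs s)" for y
  have "h (nmap T n A xs s) = r n xs s" if s: "s \<in> TO T (fin n)" and xs: "\<forall>i<n. xs i \<in> A" for n xs s
  proof -
    have "\<exists>z. \<exists>m ys t. t \<in> TO T (fin m) \<and> (\<forall>i<m. ys i \<in> A) \<and> nmap T n A xs s = nmap T m A ys t \<and> z = r m ys t"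
      using s xs by blast
    from someI_ex[OF this] obtain m ys t where "t \<in> TO T (fin m)" "\<forall>i<m. ys i \<in> A"
      "nmap T n A xs s = nmap T m A ys t" "h (nmap T n A xs s) = r m ys t"
      unfolding h_def by blast
    then show ?thesis using key[OF s _ _ _, of xs t m ys] xs by simp
  qed
  then show ?thesis by blast
qed

end

section \<open>Powers and finite products\<close>

lemma is_productD:
  assumes "is_product C n A P \<pi>"
  shows "P \<in> Obj C" "i < n \<Longrightarrow> A i \<in> Obj C" "i < n \<Longrightarrow> \<pi> i \<in> hom C P (A i)"
  using assms by (auto simp: is_product_def)

lemma product_exists:
  assumes "is_product C n A P \<pi>" "Q \<in> Obj C" "\<And>i. i < n \<Longrightarrow> f i \<in> hom C Q (A i)"
  obtains h where "h \<in> hom C Q P" "\<And>i. i < n \<Longrightarrow> Cmp C (\<pi> i) h = f i"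
  using assms unfolding is_product_def by metis

lemma product_unique:
  assumes C: "is_category C" and P: "is_product C n A P \<pi>" and h: "h \<in> hom C Q P" and h': "h' \<in> hom C Q P"
    and eq: "\<And>i. i < n \<Longrightarrow> Cmp C (\<pi> i) h = Cmp C (\<pi> i) h'"
  shows "h = h'"
proof -
  have "Q \<in> Obj C" using hom_Obj[OF C h] by simp
  moreover have "\<forall>i<n. Cmp C (\<pi> i) h \<in> hom C Q (A i)"
    using Cmp_hom[OF C h] is_productD(3)[OF P] by blast
  moreover have "\<forall>Q\<in>Obj C. \<forall>f. (\<forall>i<n. f i \<in> hom C Q (A i)) \<longrightarrow>
      (\<exists>!h. h \<in> hom C Q P \<and> (\<forall>i<n. Cmp C (\<pi> i) h = f i))"
    using P unfolding is_product_def by (elim conjE)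
  ultimately have "\<exists>!k. k \<in> hom C Q P \<and> (\<forall>i<n. Cmp C (\<pi> i) k = Cmp C (\<pi> i) h)"
    by simp
  then show ?thesis using h h' eq by metis
qed

lemma is_productI:
  assumes "P \<in> Obj C" "\<And>i. i < n \<Longrightarrow> A i \<in> Obj C" "\<And>i. i < n \<Longrightarrow> \<pi> i \<in> hom C P (A i)"
    and "\<And>Q f. Q \<in> Obj C \<Longrightarrow> (\<And>i. i < n \<Longrightarrow> f i \<in> hom C Q (A i)) \<Longrightarrow>
      \<exists>h\<in>hom C Q P. \<forall>i<n. Cmp C (\<pi> i) h = f i"
    and "\<And>Q h h'. h \<in> hom C Q P \<Longrightarrow> h' \<in> hom C Q P \<Longrightarrow> (\<And>i. i < n \<Longrightarrow> Cmp C (\<pi> i) h = Cmp C (\<pi> i) h') \<Longrightarrow> h = h'"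
  shows "is_product C n A P \<pi>"
  unfolding is_product_def
proof (intro conjI ballI allI impI)
  fix Q f assume "Q \<in> Obj C" "\<forall>i<n. f i \<in> hom C Q (A i)"
  then obtain h where h: "h \<in> hom C Q P" "\<forall>i<n. Cmp C (\<pi> i) h = f i" using assms(4)[of Q f] by auto
  show "\<exists>!h. h \<in> hom C Q P \<and> (\<forall>i<n. Cmp C (\<pi> i) h = f i)"
    using h by (intro ex1I[of _ h]) (auto intro: assms(5)[of _ Q h])
qed (use assms in auto)

text \<open>\<open>b\<close> exhibits the power \<open>p N\<close> as a product of the powers \<open>p (d 0), \<dots>, p (d (n - 1))\<close>: the \<open>k\<close>-th
  coordinate of \<open>p N\<close> is coordinate \<open>snd (r k)\<close> of factor \<open>fst (r k)\<close>, and \<open>loc\<close> inverts \<open>r\<close>.\<close>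

definition power_blocks ::
    "('o, 'a) category \<Rightarrow> (nat \<Rightarrow> 'o) \<Rightarrow> (nat \<Rightarrow> nat \<Rightarrow> 'a) \<Rightarrow> nat \<Rightarrow> (nat \<Rightarrow> nat)
      \<Rightarrow> nat \<Rightarrow> (nat \<Rightarrow> nat \<times> nat) \<Rightarrow> (nat \<times> nat \<Rightarrow> nat) \<Rightarrow> (nat \<Rightarrow> 'a) \<Rightarrow> bool" where
  "power_blocks C p pr n d N r loc b \<longleftrightarrow>
     (\<forall>k<N. fst (r k) < n \<and> snd (r k) < d (fst (r k)) \<and> loc (r k) = k) \<and>
     (\<forall>i<n. b i \<in> hom C (p N) (p (d i)) \<and>
        (\<forall>j<d i. loc (i, j) < N \<and> r (loc (i, j)) = (i, j) \<and> Cmp C (pr (d i) j) (b i) = pr N (loc (i, j))))"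

lemma power_blocksD:
  assumes "power_blocks C p pr n d N r loc b"
  shows "k < N \<Longrightarrow> fst (r k) < n" "k < N \<Longrightarrow> snd (r k) < d (fst (r k))" "k < N \<Longrightarrow> loc (r k) = k"
    "i < n \<Longrightarrow> b i \<in> hom C (p N) (p (d i))"
    "i < n \<Longrightarrow> j < d i \<Longrightarrow> loc (i, j) < N \<and> r (loc (i, j)) = (i, j)"
    "i < n \<Longrightarrow> j < d i \<Longrightarrow> Cmp C (pr (d i) j) (b i) = pr N (loc (i, j))"
  using assms by (simp_all add: power_blocks_def)

text \<open>A list \<open>ps\<close> enumerates the pairs of a factor \<open>i\<close> and a
  coordinate \<open>j < d i\<close> in an arbitrary order. The universal property of the power
  \<open>p (d i)\<close> collects the coordinates of \<open>p N\<close> that belong to factor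
  \<open>i\<close>.\<close>

lemma ex_power_blocks:
  assumes C: "is_category C" and P: "\<And>n. is_product C n (\<lambda>_. p 1) (p n) (pr n)"
  shows "\<exists>N r loc b. power_blocks C p pr n d N r loc b"
proof -
  obtain ps where ps: "set ps = Sigma {..<n} (\<lambda>i. {..<d i})" "distinct ps"
    using finite_distinct_list[of "Sigma {..<n} (\<lambda>i. {..<d i})"] by auto
  let ?N = "length ps"
  have "\<exists>k<?N. ps ! k = x" if "x \<in> set ps" for x using that by (auto simp: in_set_conv_nth)
  then obtain loc where loc: "\<And>x. x \<in> set ps \<Longrightarrow> loc x < ?N \<and> ps ! loc x = x" by metis
  have mem: "(i, j) \<in> set ps" if "i < n" "j < d i" for i j using that ps by auto
  have locn: "loc (ps ! k) = k" if "k < ?N" for k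
    using loc[OF nth_mem[OF that]] that ps(2) nth_eq_iff_index_eq by blast
  have psk: "fst (ps ! k) < n \<and> snd (ps ! k) < d (fst (ps ! k))" if "k < ?N" for k
  proof -
    obtain i j where ij: "ps ! k = (i, j)" by (cases "ps ! k")
    have "(i, j) \<in> Sigma {..<n} (\<lambda>i. {..<d i})" using nth_mem[OF that] unfolding ps(1) ij .
    then show ?thesis by (auto simp: ij)
  qed
  have "\<forall>i<n. \<exists>b\<in>hom C (p ?N) (p (d i)). \<forall>j<d i. Cmp C (pr (d i) j) b = pr ?N (loc (i, j))"
  proof (intro allI impI)
    fix i assume i: "i < n"
    have "pr ?N (loc (i, j)) \<in> hom C (p ?N) (p 1)" if "j < d i" for j
      using loc[OF mem[OF i that]] is_productD(3)[OF P] by simp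
    then obtain h where "h \<in> hom C (p ?N) (p (d i))" "\<And>j. j < d i \<Longrightarrow> Cmp C (pr (d i) j) h = pr ?N (loc (i, j))"
      using product_exists[OF P[of "d i"] is_productD(1)[OF P[of ?N]], of "\<lambda>j. pr ?N (loc (i, j))"] by auto
    then show "\<exists>b\<in>hom C (p ?N) (p (d i)). \<forall>j<d i. Cmp C (pr (d i) j) b = pr ?N (loc (i, j))" by blast
  qed
  then obtain b where "\<And>i. i < n \<Longrightarrow> b i \<in> hom C (p ?N) (p (d i))"
    "\<And>i j. i < n \<Longrightarrow> j < d i \<Longrightarrow> Cmp C (pr (d i) j) (b i) = pr ?N (loc (i, j))" by metis
  then have "power_blocks C p pr n d ?N ((!) ps) loc b"
    using psk loc[OF mem] locn by (simp add: power_blocks_def)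
  then show ?thesis by blast
qed

text \<open>Every object is a power, so a finite product of objects is again a power, with one
  coordinate for each coordinate of a factor. Existence and uniqueness of mediating arrows are
  checked on these coordinates.\<close>

lemma has_finite_products_if_powers:
  assumes C: "is_category C" and Obj: "Obj C = range p"
    and P: "\<And>n. is_product C n (\<lambda>_. p 1) (p n) (pr n)"
  shows "has_finite_products C"
  unfolding has_finite_products_def
proof (intro allI impI)
  fix n :: nat and A assume A: "\<forall>i<n. A i \<in> Obj C"
  then have "\<forall>i<n. \<exists>d. A i = p d" using Obj by auto
  then obtain d where d: "\<And>i. i < n \<Longrightarrow> A i = p (d i)" by metis
  obtain N r loc b where blocks: "power_blocks C p pr n d N r loc b" using ex_power_blocks[OF C P] by blast
  note psk = power_blocksD(1,2)[OF blocks] and locn = power_blocksD(3)[OF blocks] and b0 = power_blocksD(4)[OF blocks]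
    and l = power_blocksD(5)[OF blocks] and pb = power_blocksD(6)[OF blocks]
  have b: "b i \<in> hom C (p N) (A i)" if "i < n" for i using b0[OF that] d[OF that] by simp
  have prd: "pr (d i) j \<in> hom C (A i) (p 1)" if "i < n" "j < d i" for i j
    using is_productD(3)[OF P[of "d i"]] d that by simp
  have "is_product C n A (p N) b"
  proof (rule is_productI)
    fix Q f assume Q: "Q \<in> Obj C" and f: "\<And>i. i < n \<Longrightarrow> f i \<in> hom C Q (A i)"
    let ?g = "\<lambda>k. Cmp C (pr (d (fst (r k))) (snd (r k))) (f (fst (r k)))"
    have "?g k \<in> hom C Q (p 1)" if "k < N" for k
      by (rule Cmp_hom[OF C f prd]) (use psk[OF that] in auto)
    then obtain h where h: "h \<in> hom C Q (p N)" and ph: "\<And>k. k < N \<Longrightarrow> Cmp C (pr N k) h = ?g k"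
      using product_exists[OF P[of N] Q, of ?g] by metis
    have "Cmp C (b i) h = f i" if i: "i < n" for i
    proof (rule product_unique[OF C P[of "d i"]])
      show "Cmp C (b i) h \<in> hom C Q (p (d i))" using Cmp_hom[OF C h b[OF i]] d[OF i] by simp
      show "f i \<in> hom C Q (p (d i))" using f[OF i] d[OF i] by simp
      fix j assume j: "j < d i"
      show "Cmp C (pr (d i) j) (Cmp C (b i) h) = Cmp C (pr (d i) j) (f i)"
        unfolding Cmp_assoc[OF C h b[OF i] prd[OF i j]] pb[OF i j] using ph[of "loc (i, j)"] l[OF i j] by simp
    qed
    then show "\<exists>h\<in>hom C Q (p N). \<forall>i<n. Cmp C (b i) h = f i" using h by blast
  next
    fix Q h h' assume h: "h \<in> hom C Q (p N)" and h': "h' \<in> hom C Q (p N)"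
      and eq: "\<And>i. i < n \<Longrightarrow> Cmp C (b i) h = Cmp C (b i) h'"
    show "h = h'"
    proof (rule product_unique[OF C P[of N] h h'])
      fix k assume k: "k < N"
      define i j where "i = fst (r k)" and "j = snd (r k)"
      have ij: "i < n" "j < d i" using psk[OF k] by (simp_all add: i_def j_def)
      have "pr N k = Cmp C (pr (d i) j) (b i)"
        unfolding pb[OF ij] using locn[OF k] by (simp add: i_def j_def)
      then show "Cmp C (pr N k) h = Cmp C (pr N k) h'"
        using Cmp_assoc[OF C h b[OF ij(1)] prd[OF ij]] Cmp_assoc[OF C h' b[OF ij(1)] prd[OF ij]] eq[OF ij(1)]
        by simp
    qed
  qed (use A b is_productD(1)[OF P] in auto)
  then show "\<exists>P \<pi>. is_product C n A P \<pi>" by blast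
qed

section \<open>The category of Lawvere theories\<close>

lemma lawvere_theoryD:
  assumes "is_lawvere_theory small L"
  shows "is_category (lcat L)" "x \<in> Obj (lcat L) \<Longrightarrow> y \<in> Obj (lcat L) \<Longrightarrow> small (hom (lcat L) x y)"
    "pow L m = pow L n \<longleftrightarrow> m = n" "Obj (lcat L) = range (pow L)"
    "is_product (lcat L) n (\<lambda>_. pow L 1) (pow L n) (proj L n)"
    "proj L 1 0 = Idn (lcat L) (pow L 1)"
    "i < n \<Longrightarrow> proj L n i \<in> hom (lcat L) (pow L n) (pow L 1)"
    "pow L n \<in> Obj (lcat L)"
  using assms is_productD(3)[of "lcat L" n "\<lambda>_. pow L 1" "pow L n" "proj L n" i]
  by (auto simp: is_lawvere_theory_def inj_eq)

lemma Law_sel [simp]: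
  "Obj (Law small) = {L. is_lawvere_theory small L}" "Dom (Law small) = src" "Cod (Law small) = trg"
  "Idn (Law small) L = Arrow L L (id_functor (lcat L))"
  "Cmp (Law small) K H = Arrow (src H) (trg K) (comp_functor (lcat (src H)) (fn K) (fn H))"
  by (simp_all add: Law_def)

lemma hom_Law: "h \<in> hom (Law small) S T \<longleftrightarrow>
    (\<exists>H. h = Arrow S T H \<and> is_lawvere_theory small S \<and> is_lawvere_theory small T \<and> is_law_morphism S T H)"
  by (cases h) (auto simp: hom_def Law_def)

lemma law_morphismD:
  assumes "is_law_morphism S T H"
  shows "is_functor (lcat S) (lcat T) H" "FO H (pow S n) = pow T n" "i < n \<Longrightarrow> FA H (proj S n i) = proj T n i"
  using assms by (auto simp: is_law_morphism_def)

lemma is_law_morphism_id: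
  assumes "is_lawvere_theory small L" shows "is_law_morphism L L (id_functor (lcat L))"
  unfolding is_law_morphism_def
  using is_functor_id_functor[OF lawvere_theoryD(1)[OF assms]] lawvere_theoryD(8)[OF assms]
    hom_ArrD[OF lawvere_theoryD(7)[OF assms]] by simp

lemma is_law_morphism_comp:
  assumes L: "is_lawvere_theory small L" and H: "is_law_morphism L M H" and K: "is_law_morphism M N K"
  shows "is_law_morphism L N (comp_functor (lcat L) K H)"
  unfolding is_law_morphism_def
  using is_functor_comp_functor[OF lawvere_theoryD(1)[OF L] law_morphismD(1)[OF H] law_morphismD(1)[OF K]]
    lawvere_theoryD(8)[OF L] hom_ArrD[OF lawvere_theoryD(7)[OF L]] law_morphismD(2,3)[OF H] law_morphismD(2,3)[OF K]
  by simp

lemma is_category_Law: "is_category (Law small)"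
proof (rule is_categoryI)
  fix f assume "f \<in> Arr (Law small)"
  then show "Dom (Law small) f \<in> Obj (Law small) \<and> Cod (Law small) f \<in> Obj (Law small)"
    by (auto simp: Law_def)
next
  fix x assume "x \<in> Obj (Law small)"
  then show "Idn (Law small) x \<in> hom (Law small) x x" by (auto simp: hom_Law is_law_morphism_id)
next
  fix f g x y z assume "f \<in> hom (Law small) x y" "g \<in> hom (Law small) y z"
  then show "Cmp (Law small) g f \<in> hom (Law small) x z"
    by (auto simp: hom_Law intro: is_law_morphism_comp)
next
  fix f x y assume "f \<in> hom (Law small) x y"
  then show "Cmp (Law small) f (Idn (Law small) x) = f" "Cmp (Law small) (Idn (Law small) y) f = f"
    by (auto simp: hom_Law comp_functor_id_right[OF law_morphismD(1)] comp_functor_id_left[OF law_morphismD(1)])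
next
  fix f g h x y z w
  assume "f \<in> hom (Law small) x y" "g \<in> hom (Law small) y z" "h \<in> hom (Law small) z w"
  then show "Cmp (Law small) h (Cmp (Law small) g f) = Cmp (Law small) (Cmp (Law small) h g) f"
    by (auto simp: hom_Law comp_functor_assoc[OF law_morphismD(1)])
qed

section \<open>The category of finitary monads\<close>

context coded_universe
begin

lemma monad_morphism_eqI:
  assumes "is_monad_morphism SET S T \<sigma>" "is_monad_morphism SET S T \<tau>"
    and "\<And>A t. small A \<Longrightarrow> t \<in> TO S A \<Longrightarrow> fn (\<sigma> A) t = fn (\<tau> A) t"
  shows "\<sigma> = \<tau>"
proof (rule extensionalityI[of _ "Obj SET"])
  fix A assume "A \<in> Obj SET"
  then have A: "small A" by simp
  show "\<sigma> A = \<tau> A"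
    by (rule set_arrow_eqI[OF monad_morphism_hom[OF assms(1) A] monad_morphism_hom[OF assms(2) A] assms(3)[OF A]])
qed (use assms in \<open>auto simp: is_monad_morphism_def is_nat_trans_def\<close>)

lemma is_monad_morphism_Idn:
  assumes T: "is_monad SET T"
  shows "is_monad_morphism SET T T (\<lambda>A\<in>Obj SET. Idn SET (FO (endo T) A))"
proof -
  have "is_monad_morphism SET T T (\<lambda>A\<in>Obj SET. Arrow (TO T A) (TO T A) (restrict ((\<lambda>A x. x) A) (TO T A)))"
    by (rule is_monad_morphismI[OF T T]) (auto intro: bind_cong)
  then show ?thesis by (simp add: TO_def Idn_set_cat)
qed

lemma is_monad_morphism_Cmp:
  assumes S: "is_monad SET S" and T: "is_monad SET T" and U: "is_monad SET U"
    and \<sigma>: "is_monad_morphism SET S T \<sigma>" and \<tau>: "is_monad_morphism SET T U \<tau>"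
  shows "is_monad_morphism SET S U (\<lambda>A\<in>Obj SET. Cmp SET (\<tau> A) (\<sigma> A))"
proof -
  have in1: "fn (\<sigma> A) t \<in> TO T A" if "small A" "t \<in> TO S A" for A t
    using hom_set_catD(7)[OF monad_morphism_hom[OF \<sigma> that(1)] that(2)] .
  have in2: "fn (\<tau> A) t \<in> TO U A" if "small A" "t \<in> TO T A" for A t
    using hom_set_catD(7)[OF monad_morphism_hom[OF \<tau> that(1)] that(2)] .
  have "is_monad_morphism SET S U (\<lambda>A\<in>Obj SET. Arrow (TO S A) (TO U A)
      (restrict ((\<lambda>A x. fn (\<tau> A) (fn (\<sigma> A) x)) A) (TO S A)))"
  proof (rule is_monad_morphismI[OF S U])
    fix A B g t
    assume *: "small A" "small B" "\<And>a. a \<in> A \<Longrightarrow> g a \<in> TO S B" "t \<in> TO S A"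
    show "fn (\<tau> B) (fn (\<sigma> B) (bind S A B g t)) =
       bind U A B (\<lambda>a. fn (\<tau> B) (fn (\<sigma> B) (g a))) (fn (\<tau> A) (fn (\<sigma> A) t))"
      using monad_morphism_bind[OF S T \<sigma> *] monad_morphism_bind[OF T U \<tau> *(1,2), of "\<lambda>a. fn (\<sigma> B) (g a)" "fn (\<sigma> A) t"]
        in1 * by simp
  qed (use in1 in2 monad_morphism_eta[OF S T \<sigma>] monad_morphism_eta[OF T U \<tau>] in auto)
  moreover have "Cmp SET (\<tau> A) (\<sigma> A) = Arrow (TO S A) (TO U A) (restrict (\<lambda>x. fn (\<tau> A) (fn (\<sigma> A) x)) (TO S A))"
    if "small A" for A
    using hom_set_catD[OF monad_morphism_hom[OF \<sigma> that]] hom_set_catD[OF monad_morphism_hom[OF \<tau> that]]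
    by (simp add: Cmp_set_cat compose_def)
  ultimately show ?thesis by (simp cong: restrict_cong)
qed

lemma monad_category_sel [simp]:
  "Dom (monad_category C) = src" "Cod (monad_category C) = trg"
  "Obj (monad_category C) = {T. is_monad C T}"
  "Idn (monad_category C) T = Arrow T T (\<lambda>x\<in>Obj C. Idn C (FO (endo T) x))"
  "Cmp (monad_category C) \<tau> \<sigma> = Arrow (src \<sigma>) (trg \<tau>) (\<lambda>x\<in>Obj C. Cmp C (fn \<tau> x) (fn \<sigma> x))"
  by (simp_all add: monad_category_def)

lemma hom_monad_category: "h \<in> hom (monad_category C) S T \<longleftrightarrow>
    (\<exists>\<sigma>. h = Arrow S T \<sigma> \<and> is_monad C S \<and> is_monad C T \<and> is_monad_morphism C S T \<sigma>)"
  by (cases h) (auto simp: hom_def monad_category_def)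

lemma is_category_monad_category: "is_category (monad_category SET)"
proof (rule is_categoryI)
  fix f assume "f \<in> Arr (monad_category SET)"
  then show "Dom (monad_category SET) f \<in> Obj (monad_category SET) \<and> Cod (monad_category SET) f \<in> Obj (monad_category SET)"
    by (auto simp: monad_category_def)
next
  fix T assume "T \<in> Obj (monad_category SET)"
  then show "Idn (monad_category SET) T \<in> hom (monad_category SET) T T"
    using is_monad_morphism_Idn[of T] by (simp add: hom_monad_category)
next
  fix f g x y z assume "f \<in> hom (monad_category SET) x y" "g \<in> hom (monad_category SET) y z"
  then show "Cmp (monad_category SET) g f \<in> hom (monad_category SET) x z"
    using is_monad_morphism_Cmp[of x y z "fn f" "fn g"] by (auto simp: hom_monad_category)
next
  fix f S T assume f: "f \<in> hom (monad_category SET) S T"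
  then obtain \<sigma> where \<sigma>: "f = Arrow S T \<sigma>" "is_monad SET S" "is_monad SET T" "is_monad_morphism SET S T \<sigma>"
    by (auto simp: hom_monad_category)
  note h = monad_morphism_hom[OF \<sigma>(4)]
  have e: "\<sigma> \<in> extensional (Obj SET)" using \<sigma>(4) by (simp add: is_monad_morphism_def is_nat_trans_def)
  have "(\<lambda>x\<in>Obj SET. Cmp SET (\<sigma> x) (Idn SET (TO S x))) = \<sigma>" "(\<lambda>x\<in>Obj SET. Cmp SET (Idn SET (TO T x)) (\<sigma> x)) = \<sigma>"
    by (rule extensionalityI[OF _ e]; simp add: Cmp_Idn[OF is_category_set_cat h] Idn_Cmp[OF is_category_set_cat h])+
  then show "Cmp (monad_category SET) f (Idn (monad_category SET) S) = f"
    "Cmp (monad_category SET) (Idn (monad_category SET) T) f = f"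
    using \<sigma>(1) by (simp_all add: TO_def cong: restrict_cong)
next
  fix f g h S T U V
  assume "f \<in> hom (monad_category SET) S T" "g \<in> hom (monad_category SET) T U" "h \<in> hom (monad_category SET) U V"
  then show "Cmp (monad_category SET) h (Cmp (monad_category SET) g f) = Cmp (monad_category SET) (Cmp (monad_category SET) h g) f"
    by (auto simp: hom_monad_category fun_eq_iff restrict_def
        intro!: Cmp_assoc[OF is_category_set_cat monad_morphism_hom monad_morphism_hom monad_morphism_hom])
qed

text \<open>The elementwise condition that stands for preservation of filtered colimits from here
  on; \<open>Mnd_sel\<close> and \<open>hom_Mnd\<close> identify the two.\<close>

definition finitary_monad :: "'u set_monad \<Rightarrow> bool" where
  "finitary_monad T \<longleftrightarrow> is_monad SET T \<and> finitely_supported T"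

lemma finitary_monadD:
  "finitary_monad T \<Longrightarrow> is_monad SET T" "finitary_monad T \<Longrightarrow> finitely_supported T"
  by (auto simp: finitary_monad_def)

lemma Mnd_sel [simp]:
  "Obj (Mnd\<^sub>f small) = {T. finitary_monad T}" "Dom (Mnd\<^sub>f small) = src" "Cod (Mnd\<^sub>f small) = trg"
  "Idn (Mnd\<^sub>f small) T = Arrow T T (\<lambda>x\<in>Obj SET. Idn SET (FO (endo T) x))"
  "Cmp (Mnd\<^sub>f small) \<tau> \<sigma> = Arrow (src \<sigma>) (trg \<tau>) (\<lambda>x\<in>Obj SET. Cmp SET (fn \<tau> x) (fn \<sigma> x))"
  using finitely_supported_if_preserves preserves_if_finitely_supported
  by (auto simp: Mnd\<^sub>f_def finitary_monad_def)

lemma hom_Mnd: "h \<in> hom (Mnd\<^sub>f small) S T \<longleftrightarrow>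
    (\<exists>\<sigma>. h = Arrow S T \<sigma> \<and> finitary_monad S \<and> finitary_monad T \<and> is_monad_morphism SET S T \<sigma>)"
  using finitely_supported_if_preserves preserves_if_finitely_supported
  by (auto simp: Mnd\<^sub>f_def finitary_monad_def hom_full_subcategory hom_monad_category)

lemma hom_MndD:
  assumes "h \<in> hom (Mnd\<^sub>f small) S T"
  shows "is_monad SET S" "is_monad SET T" "is_monad_morphism SET S T (fn h)"
    "finitary_monad S" "finitary_monad T" "src h = S" "trg h = T"
  using assms by (auto simp: hom_Mnd finitary_monadD)

lemma is_category_Mnd: "is_category (Mnd\<^sub>f small)"
  unfolding Mnd\<^sub>f_def by (rule is_category_full_subcategory[OF is_category_monad_category])

lemma monad_morphism_nmap:
  assumes "is_monad SET S" "is_monad_morphism SET S T \<sigma>" "small A" "\<And>i. i < n \<Longrightarrow> xs i \<in> A" "t \<in> TO S (fin n)"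
  shows "fn (\<sigma> A) (nmap S n A xs t) = nmap T n A xs (fn (\<sigma> (fin n)) t)"
  unfolding nmap_def by (rule monad_morphism_tmap[OF assms(1,2) small_fin assms(3)]) (use assms(4,5) in auto)

text \<open>The variable tuples are concatenated, and operations of the later block are renamed by
  the shift \<open>k + j\<close>. One tuple of variables for finitely many elements is what turns
  \<open>bind\<close> into substitution between finite arities.\<close>

lemma common_support:
  assumes T: "is_monad SET T" and fin: "finitely_supported T" and A: "small A"
    and y: "\<And>i. i < (n :: nat) \<Longrightarrow> y i \<in> TO T A"
  shows "\<exists>k zs s. (\<forall>j<k. zs j \<in> A) \<and> (\<forall>i<n. s i \<in> TO T (fin k) \<and> y i = nmap T k A zs (s i))"
  using y
proof (induction n)
  case 0
  show ?case by (rule exI[of _ 0]) simp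
next
  case (Suc n)
  have "\<exists>k zs s. (\<forall>j<k. zs j \<in> A) \<and> (\<forall>i<n. s i \<in> TO T (fin k) \<and> y i = nmap T k A zs (s i))"
    by (rule Suc.IH, rule Suc.prems) simp
  then obtain k zs s where zs: "\<And>j. j < k \<Longrightarrow> zs j \<in> A" and s: "\<And>i. i < n \<Longrightarrow> s i \<in> TO T (fin k)"
    and ys: "\<And>i. i < n \<Longrightarrow> y i = nmap T k A zs (s i)"
    by blast
  obtain m ws s' where s': "s' \<in> TO T (fin m)" and ws: "\<And>i. i < m \<Longrightarrow> ws i \<in> A" and yn: "y n = nmap T m A ws s'"
    by (rule finitely_supportedE[OF fin A Suc.prems[OF lessI]]) (rule that; blast)
  define vs where "vs j = (if j < k then zs j else ws (j - k))" for j
  define r where "r i = (if i < n then nmap T k (fin (k + m)) \<iota> (s i) else nmap T m (fin (k + m)) (\<lambda>j. \<iota> (k + j)) s')" for i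
  have vs: "\<And>j. j < k + m \<Longrightarrow> vs j \<in> A" using zs ws by (auto simp: vs_def)
  have "r i \<in> TO T (fin (k + m)) \<and> y i = nmap T (k + m) A vs (r i)" if i: "i < Suc n" for i
  proof (cases "i < n")
    case True
    have "nmap T (k + m) A vs (nmap T k (fin (k + m)) (\<lambda>j. \<iota> j) (s i)) = nmap T k A vs (s i)"
      by (rule nmap_nmap[OF T A vs _ s[OF True]]) auto
    also have "\<dots> = nmap T k A zs (s i)" by (rule nmap_cong) (simp add: vs_def)
    finally show ?thesis using True ys[OF True] nmap_in[OF T _ _ s[OF True], of "fin (k + m)" \<iota>] by (simp add: r_def)
  next
    case False
    then have i: "i = n" using i by simp
    have "nmap T (k + m) A vs (nmap T m (fin (k + m)) (\<lambda>j. \<iota> (k + j)) s') = nmap T m A (\<lambda>j. vs (k + j)) s'"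
      by (rule nmap_nmap[OF T A vs _ s']) auto
    also have "\<dots> = nmap T m A ws s'" by (rule nmap_cong) (simp add: vs_def)
    finally show ?thesis using i yn nmap_in[OF T _ _ s', of "fin (k + m)" "\<lambda>j. \<iota> (k + j)"] by (simp add: r_def)
  qed
  then show ?case using vs by blast
qed

section \<open>The Lawvere theory of a finitary monad\<close>

text \<open>An arrow \<open>X\<^sup>m \<rightarrow> X\<^sup>n\<close> is an \<open>n\<close>-tuple of elements of \<open>T (fin m)\<close>; composition is
  substitution.\<close>

definition lsub :: "'u set_monad \<Rightarrow> nat \<Rightarrow> 'u list \<Rightarrow> 'u \<Rightarrow> 'u" where
  "lsub T m ts t = bind T (fin (length ts)) (fin m) (\<lambda>u. ts ! idx u) t"

text \<open>The domain is stored as the head of the list, since a tuple of elements of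
  \<open>T (fin m)\<close> need not determine \<open>m\<close>; the codomain is read off from the
  length of the tail.\<close>

definition law_of :: "'u set_monad \<Rightarrow> 'u lawvere" where
  "law_of T =
     \<lparr>lcat =
        \<lparr>Obj = range \<iota>,
         Arr = {code (\<iota> m # ts) |m ts. set ts \<subseteq> TO T (fin m)},
         Dom = \<lambda>f. hd (decode f),
         Cod = \<lambda>f. \<iota> (length (tl (decode f))),
         Idn = \<lambda>x. code (x # map (\<lambda>i. eta T (fin (idx x)) (\<iota> i)) [0..<idx x]),
         Cmp = \<lambda>g f. code (hd (decode f) # map (lsub T (idx (hd (decode f))) (tl (decode f))) (tl (decode g)))\<rparr>,
      pow = \<iota>,
      proj = \<lambda>n i. code [\<iota> n, eta T (fin n) (\<iota> i)]\<rparr>"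

lemma law_of_sel [simp]:
  "pow (law_of T) = \<iota>" "proj (law_of T) n i = code [\<iota> n, eta T (fin n) (\<iota> i)]"
  "Obj (lcat (law_of T)) = range \<iota>"
  "Idn (lcat (law_of T)) (\<iota> n) = code (\<iota> n # map (\<lambda>i. eta T (fin n) (\<iota> i)) [0..<n])"
  "Cmp (lcat (law_of T)) g (code (\<iota> m # ts)) = code (\<iota> m # map (lsub T m ts) (tl (decode g)))"
  "Dom (lcat (law_of T)) f = hd (decode f)" "Cod (lcat (law_of T)) f = \<iota> (length (tl (decode f)))"
  by (simp_all add: law_of_def)

lemma Arr_law_of: "f \<in> Arr (lcat (law_of T)) \<longleftrightarrow> (\<exists>m ts. f = code (\<iota> m # ts) \<and> set ts \<subseteq> TO T (fin m))"
  by (auto simp: law_of_def)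

lemma hom_law_of: "f \<in> hom (lcat (law_of T)) x y \<longleftrightarrow>
    (\<exists>m ts. x = \<iota> m \<and> y = \<iota> (length ts) \<and> f = code (\<iota> m # ts) \<and> set ts \<subseteq> TO T (fin m))"
  by (auto simp: hom_def Arr_law_of)

context
  fixes T :: "'u set_monad"
  assumes T: "is_monad SET T"
begin

lemma lsub_in: "set ts \<subseteq> TO T (fin m) \<Longrightarrow> t \<in> TO T (fin (length ts)) \<Longrightarrow> lsub T m ts t \<in> TO T (fin m)"
  unfolding lsub_def by (rule bind_in[OF T]) (auto simp: subset_iff nth_mem)

lemma lsub_eta: "set ts \<subseteq> TO T (fin m) \<Longrightarrow> i < length ts \<Longrightarrow> lsub T m ts (eta T (fin (length ts)) (\<iota> i)) = ts ! i"
  unfolding lsub_def by (subst bind_eta[OF T]) (auto simp: subset_iff nth_mem)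

text \<open>Renaming variables is substituting projections. Whatever respects projections and
  substitution thereby respects renaming.\<close>

lemma lsub_nmap_eta:
  assumes "\<And>i. i < n \<Longrightarrow> f i < m" "t \<in> TO T (fin n)"
  shows "lsub T m (map (\<lambda>i. eta T (fin m) (\<iota> (f i))) [0..<n]) t = nmap T n (fin m) (\<lambda>i. \<iota> (f i)) t"
proof -
  have "lsub T m (map (\<lambda>i. eta T (fin m) (\<iota> (f i))) [0..<n]) t =
      bind T (fin n) (fin m) (\<lambda>u. eta T (fin m) (\<iota> (f (idx u)))) t"
    unfolding lsub_def by simp (rule bind_cong, simp)
  also have "\<dots> = nmap T n (fin m) (\<lambda>i. \<iota> (f i)) t"
    unfolding nmap_def by (rule bind_eta_tmap[OF T]) (use assms in auto)
  finally show ?thesis .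
qed

lemma lsub_id: "t \<in> TO T (fin n) \<Longrightarrow> lsub T n (map (\<lambda>i. eta T (fin n) (\<iota> i)) [0..<n]) t = t"
  using lsub_nmap_eta[of n "\<lambda>i. i" n t] nmap_\<iota>[OF T] by simp

lemma lsub_lsub:
  assumes "set ts \<subseteq> TO T (fin m)" "set us \<subseteq> TO T (fin (length ts))" "t \<in> TO T (fin (length us))"
  shows "lsub T m ts (lsub T (length ts) us t) = lsub T m (map (lsub T m ts) us) t"
proof -
  have "lsub T m ts (lsub T (length ts) us t) = bind T (fin (length us)) (fin m) (\<lambda>u. lsub T m ts (us ! idx u)) t"
    unfolding lsub_def by (rule bind_bind[OF T]) (use assms in \<open>auto simp: subset_iff nth_mem\<close>)
  also have "\<dots> = lsub T m (map (lsub T m ts) us) t"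
    unfolding lsub_def[of T m "map (lsub T m ts) us"] by simp (rule bind_cong, simp)
  finally show ?thesis .
qed

text \<open>Once the values of \<open>g\<close> at the variables \<open>xs\<close> share the
  variables \<open>zs\<close>, \<open>bind\<close> over arbitrary sets is computed by substitution
  of operations.\<close>

lemma bind_nmap_lsub:
  assumes A: "small A" and B: "small B" and xs: "\<And>i. i < n \<Longrightarrow> xs i \<in> A" and g: "\<And>a. a \<in> A \<Longrightarrow> g a \<in> TO T B"
    and u: "u \<in> TO T (fin n)" and r: "\<And>i. i < n \<Longrightarrow> r i \<in> TO T (fin k)" and zs: "\<And>j. j < k \<Longrightarrow> zs j \<in> B"
    and gr: "\<And>i. i < n \<Longrightarrow> g (xs i) = nmap T k B zs (r i)"
  shows "bind T A B g (nmap T n A xs u) = nmap T k B zs (lsub T k (map r [0..<n]) u)"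
proof -
  have "bind T A B g (nmap T n A xs u) = bind T (fin n) B (\<lambda>v. g (xs (idx v))) u"
    unfolding nmap_def by (rule bind_tmap[OF T small_fin A B _ g u]) (use xs in auto)
  also have "\<dots> = bind T (fin n) B (\<lambda>v. nmap T k B zs (r (idx v))) u"
    by (rule bind_cong) (simp add: gr)
  also have "\<dots> = nmap T k B zs (bind T (fin n) (fin k) (\<lambda>v. r (idx v)) u)"
    unfolding nmap_def by (rule tmap_bind[OF T small_fin small_fin B _ _ u, symmetric]) (use r zs in auto)
  also have "bind T (fin n) (fin k) (\<lambda>v. r (idx v)) u = lsub T k (map r [0..<n]) u"
    unfolding lsub_def by simp (rule bind_cong, simp)
  finally show ?thesis .
qed

lemma is_category_law_of: "is_category (lcat (law_of T))"
proof (rule is_categoryI)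
  fix f assume "f \<in> Arr (lcat (law_of T))"
  then show "Dom (lcat (law_of T)) f \<in> Obj (lcat (law_of T)) \<and> Cod (lcat (law_of T)) f \<in> Obj (lcat (law_of T))"
    by (auto simp: Arr_law_of)
next
  fix x assume "x \<in> Obj (lcat (law_of T))"
  then show "Idn (lcat (law_of T)) x \<in> hom (lcat (law_of T)) x x"
    using eta_in[OF T small_fin] by (auto simp: hom_law_of)
next
  fix f g x y z assume "f \<in> hom (lcat (law_of T)) x y" "g \<in> hom (lcat (law_of T)) y z"
  then show "Cmp (lcat (law_of T)) g f \<in> hom (lcat (law_of T)) x z"
    using lsub_in by (fastforce simp: hom_law_of)
next
  fix f x y assume f: "f \<in> hom (lcat (law_of T)) x y"
  then obtain m ts where f: "x = \<iota> m" "y = \<iota> (length ts)" "f = code (\<iota> m # ts)" "set ts \<subseteq> TO T (fin m)"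
    by (auto simp: hom_law_of)
  have "map (lsub T m (map (\<lambda>i. eta T (fin m) (\<iota> i)) [0..<m])) ts = ts"
    using f(4) lsub_id by (intro map_idI) auto
  then show "Cmp (lcat (law_of T)) f (Idn (lcat (law_of T)) x) = f" unfolding f by simp
  have "map (lsub T m ts) (map (\<lambda>i. eta T (fin (length ts)) (\<iota> i)) [0..<length ts]) = ts"
    using lsub_eta[OF f(4)] by (intro nth_equalityI) auto
  then show "Cmp (lcat (law_of T)) (Idn (lcat (law_of T)) y) f = f" unfolding f by simp
next
  fix f g h x y z w
  assume "f \<in> hom (lcat (law_of T)) x y" "g \<in> hom (lcat (law_of T)) y z" "h \<in> hom (lcat (law_of T)) z w"
  then show "Cmp (lcat (law_of T)) h (Cmp (lcat (law_of T)) g f) = Cmp (lcat (law_of T)) (Cmp (lcat (law_of T)) h g) f"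
    using lsub_lsub by (fastforce simp: hom_law_of)
qed

text \<open>Composition with the \<open>i\<close>-th projection picks the \<open>i\<close>-th entry,
  by the unit law \<open>lsub_eta\<close>; so a cone of \<open>n\<close> arrows to
  \<open>\<iota> 1\<close> is literally a tuple.\<close>

lemma law_of_power:
  "is_product (lcat (law_of T)) n (\<lambda>_. \<iota> 1) (\<iota> n) (\<lambda>i. code [\<iota> n, eta T (fin n) (\<iota> i)])"
proof (rule is_productI)
  fix i assume "i < n"
  then show "code [\<iota> n, eta T (fin n) (\<iota> i)] \<in> hom (lcat (law_of T)) (\<iota> n) (\<iota> 1)"
    using eta_in[OF T small_fin] by (auto simp: hom_law_of)
next
  fix Q f assume "Q \<in> Obj (lcat (law_of T))" and f: "\<And>i. i < n \<Longrightarrow> f i \<in> hom (lcat (law_of T)) Q (\<iota> 1)"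
  then obtain m where Q: "Q = \<iota> m" by auto
  have "\<exists>t\<in>TO T (fin m). f i = code [\<iota> m, t]" if "i < n" for i
    using f[OF that] Q by (auto simp: hom_law_of Suc_length_conv)
  then obtain t where t: "\<And>i. i < n \<Longrightarrow> t i \<in> TO T (fin m) \<and> f i = code [\<iota> m, t i]" by metis
  let ?ts = "map t [0..<n]"
  have s: "set ?ts \<subseteq> TO T (fin m)" using t by auto
  have "\<forall>i<n. Cmp (lcat (law_of T)) (code [\<iota> n, eta T (fin n) (\<iota> i)]) (code (\<iota> m # ?ts)) = f i"
    using lsub_eta[OF s] t by simp
  moreover have "code (\<iota> m # ?ts) \<in> hom (lcat (law_of T)) Q (\<iota> n)" using s by (auto simp: hom_law_of Q)
  ultimately show "\<exists>h\<in>hom (lcat (law_of T)) Q (\<iota> n).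
      \<forall>i<n. Cmp (lcat (law_of T)) (code [\<iota> n, eta T (fin n) (\<iota> i)]) h = f i" by blast
next
  fix Q h h'
  assume "h \<in> hom (lcat (law_of T)) Q (\<iota> n)" "h' \<in> hom (lcat (law_of T)) Q (\<iota> n)"
    and eq: "\<And>i. i < n \<Longrightarrow> Cmp (lcat (law_of T)) (code [\<iota> n, eta T (fin n) (\<iota> i)]) h =
      Cmp (lcat (law_of T)) (code [\<iota> n, eta T (fin n) (\<iota> i)]) h'"
  then obtain m ts us where h: "h = code (\<iota> m # ts)" "set ts \<subseteq> TO T (fin m)" "length ts = n"
    and h': "h' = code (\<iota> m # us)" "set us \<subseteq> TO T (fin m)" "length us = n"
    by (auto simp: hom_law_of)
  have "ts ! i = us ! i" if "i < n" for i
    using eq[OF that] lsub_eta[OF h(2), of i] lsub_eta[OF h'(2), of i] that h h' by simp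
  then have "ts = us" using h h' by (intro nth_equalityI) auto
  then show "h = h'" using h h' by simp
qed auto

lemma is_lawvere_theory_law_of: "is_lawvere_theory small (law_of T)"
  unfolding is_lawvere_theory_def
proof (intro conjI ballI allI)
  show "has_finite_products (lcat (law_of T))"
    by (rule has_finite_products_if_powers[OF is_category_law_of law_of_sel(3) law_of_power])
  show "is_product (lcat (law_of T)) n (\<lambda>_. pow (law_of T) 1) (pow (law_of T) n) (proj (law_of T) n)" for n
    using law_of_power[of n] by (simp add: law_of_def)
  fix x y assume "x \<in> Obj (lcat (law_of T))" "y \<in> Obj (lcat (law_of T))"
  then obtain m where x: "x = \<iota> m" by auto
  have "hom (lcat (law_of T)) x y \<subseteq> (\<lambda>u. code (\<iota> m # decode u)) ` code ` {ts. set ts \<subseteq> TO T (fin m)}"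
    by (auto simp: hom_law_of x image_image)
  then show "small (hom (lcat (law_of T)) x y)"
    using small_subset small_image small_code_lists small_TO[OF T small_fin] by metis
qed (use inj_\<iota> is_category_law_of in auto)

end

section \<open>The theory functor on monad morphisms\<close>

text \<open>Identity on objects, which is possible because all theories \<open>law_of T\<close> have
  the objects \<open>range \<iota>\<close>; on arrows the component at \<open>fin m\<close> acts
  entrywise.\<close>

definition law_map :: "'u set_monad \<Rightarrow> ('u set \<Rightarrow> 'u set_arrow) \<Rightarrow> ('u, 'u, 'u, 'u) cfunctor" where
  "law_map S \<sigma> = \<lparr>FO = (\<lambda>x\<in>Obj (lcat (law_of S)). x),
     FA = (\<lambda>f\<in>Arr (lcat (law_of S)).
       code (hd (decode f) # map (fn (\<sigma> (fin (idx (hd (decode f)))))) (tl (decode f))))\<rparr>"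

lemma law_map_sel:
  "FO (law_map S \<sigma>) (\<iota> n) = \<iota> n"
  "set ts \<subseteq> TO S (fin m) \<Longrightarrow> FA (law_map S \<sigma>) (code (\<iota> m # ts)) = code (\<iota> m # map (fn (\<sigma> (fin m))) ts)"
  by (auto simp: law_map_def Arr_law_of)

lemma is_law_morphism_law_map:
  assumes S: "is_monad SET S" and T: "is_monad SET T" and \<sigma>: "is_monad_morphism SET S T \<sigma>"
  shows "is_law_morphism (law_of S) (law_of T) (law_map S \<sigma>)"
proof -
  have in1: "fn (\<sigma> (fin m)) t \<in> TO T (fin m)" if "t \<in> TO S (fin m)" for m t
    using hom_set_catD(7)[OF monad_morphism_hom[OF \<sigma> small_fin] that] .
  have fsub: "fn (\<sigma> (fin m)) (lsub S m ts t) = lsub T m (map (fn (\<sigma> (fin m))) ts) (fn (\<sigma> (fin (length ts))) t)"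
    if ts: "set ts \<subseteq> TO S (fin m)" and t: "t \<in> TO S (fin (length ts))" for m ts t
  proof -
    have "fn (\<sigma> (fin m)) (lsub S m ts t) =
        bind T (fin (length ts)) (fin m) (\<lambda>u. fn (\<sigma> (fin m)) (ts ! idx u)) (fn (\<sigma> (fin (length ts))) t)"
      unfolding lsub_def by (rule monad_morphism_bind[OF S T \<sigma> small_fin small_fin _ t]) (use ts in \<open>auto simp: subset_iff nth_mem\<close>)
    also have "\<dots> = lsub T m (map (fn (\<sigma> (fin m))) ts) (fn (\<sigma> (fin (length ts))) t)"
      unfolding lsub_def by simp (rule bind_cong, simp)
    finally show ?thesis .
  qed
  have "is_functor (lcat (law_of S)) (lcat (law_of T)) (law_map S \<sigma>)"
  proof (rule is_functorI)
    fix f x y assume "f \<in> hom (lcat (law_of S)) x y"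
    then show "FA (law_map S \<sigma>) f \<in> hom (lcat (law_of T)) (FO (law_map S \<sigma>) x) (FO (law_map S \<sigma>) y)"
      using in1 by (fastforce simp: hom_law_of law_map_sel)
  next
    fix x assume "x \<in> Obj (lcat (law_of S))"
    then obtain n where x: "x = \<iota> n" by auto
    have "set (map (\<lambda>i. eta S (fin n) (\<iota> i)) [0..<n]) \<subseteq> TO S (fin n)" using eta_in[OF S small_fin] by auto
    then show "FA (law_map S \<sigma>) (Idn (lcat (law_of S)) x) = Idn (lcat (law_of T)) (FO (law_map S \<sigma>) x)"
      using monad_morphism_eta[OF S T \<sigma> small_fin, of _ n] by (simp add: x law_map_sel)
  next
    fix f g x y z assume "f \<in> hom (lcat (law_of S)) x y" "g \<in> hom (lcat (law_of S)) y z"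
    then obtain m ts us where f: "f = code (\<iota> m # ts)" "set ts \<subseteq> TO S (fin m)"
      and g: "g = code (\<iota> (length ts) # us)" "set us \<subseteq> TO S (fin (length ts))"
      by (auto simp: hom_law_of)
    have "set (map (lsub S m ts) us) \<subseteq> TO S (fin m)" using lsub_in[OF S f(2)] g(2) by auto
    then show "FA (law_map S \<sigma>) (Cmp (lcat (law_of S)) g f) = Cmp (lcat (law_of T)) (FA (law_map S \<sigma>) g) (FA (law_map S \<sigma>) f)"
      using f g fsub[OF f(2)] by (auto simp: law_map_sel subset_iff)
  qed (auto simp: law_map_def)
  moreover have "FA (law_map S \<sigma>) (proj (law_of S) n i) = proj (law_of T) n i" if "i < n" for n i
    using that eta_in[OF S small_fin, of "\<iota> i" n] monad_morphism_eta[OF S T \<sigma> small_fin, of "\<iota> i" n]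
    by (simp add: law_map_sel)
  ultimately show ?thesis by (simp add: is_law_morphism_def law_map_sel)
qed

definition law_functor ::
    "('u set_monad, ('u set, 'u set_arrow) monad_arrow, 'u lawvere, 'u law_arrow) cfunctor" where
  "law_functor = \<lparr>FO = (\<lambda>T\<in>Obj (Mnd\<^sub>f small). law_of T),
     FA = (\<lambda>a\<in>Arr (Mnd\<^sub>f small). Arrow (law_of (src a)) (law_of (trg a)) (law_map (src a) (fn a)))\<rparr>"

lemma law_functor_FO [simp]: "finitary_monad T \<Longrightarrow> FO law_functor T = law_of T"
  by (simp add: law_functor_def)

lemma law_functor_FA: "f \<in> hom (Mnd\<^sub>f small) S T \<Longrightarrow>
    FA law_functor f = Arrow (law_of S) (law_of T) (law_map S (fn f))"
  by (auto simp: law_functor_def hom_def)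

lemma law_functor_hom:
  assumes "f \<in> hom (Mnd\<^sub>f small) S T"
  shows "FA law_functor f \<in> hom (Law small) (law_of S) (law_of T)"
  unfolding law_functor_FA[OF assms] using assms
  by (auto simp: hom_Law hom_Mnd finitary_monadD is_lawvere_theory_law_of is_law_morphism_law_map)

lemma is_functor_law_functor: "is_functor (Mnd\<^sub>f small) (Law small) law_functor"
proof (rule is_functorI)
  fix T assume "T \<in> Obj (Mnd\<^sub>f small)"
  then have T: "finitary_monad T" by simp
  note T' = finitary_monadD(1)[OF T]
  show "FO law_functor T \<in> Obj (Law small)" using T by (simp add: is_lawvere_theory_law_of[OF T'])
  have i: "Idn (Mnd\<^sub>f small) T \<in> hom (Mnd\<^sub>f small) T T" by (rule Idn_hom[OF is_category_Mnd]) (simp add: T)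
  have "law_map T (fn (Idn (Mnd\<^sub>f small) T)) = id_functor (lcat (law_of T))"
  proof (rule functor_eqI[OF law_morphismD(1)[OF is_law_morphism_law_map[OF T' T']] is_functor_id_functor[OF is_category_law_of[OF T']]])
    show "is_monad_morphism SET T T (fn (Idn (Mnd\<^sub>f small) T))" using i by (auto simp: hom_Mnd)
  next
    fix f assume f: "f \<in> Arr (lcat (law_of T))"
    then obtain m ts where "f = code (\<iota> m # ts)" "set ts \<subseteq> TO T (fin m)" by (auto simp: Arr_law_of)
    then show "FA (law_map T (fn (Idn (Mnd\<^sub>f small) T))) f = FA (id_functor (lcat (law_of T))) f"
      using f by (auto simp: law_map_sel TO_def subset_iff intro!: map_idI)
  qed (auto simp: law_map_sel)
  then show "FA law_functor (Idn (Mnd\<^sub>f small) T) = Idn (Law small) (FO law_functor T)"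
    using T by (simp only: law_functor_FA[OF i] law_functor_FO Law_sel)
next
  fix f S T assume f: "f \<in> hom (Mnd\<^sub>f small) S T"
  then have "finitary_monad S" "finitary_monad T" by (auto simp: hom_Mnd)
  then show "FA law_functor f \<in> hom (Law small) (FO law_functor S) (FO law_functor T)"
    using law_functor_hom[OF f] by simp
next
  fix f g S T U assume f: "f \<in> hom (Mnd\<^sub>f small) S T" and g: "g \<in> hom (Mnd\<^sub>f small) T U"
  note gf = Cmp_hom[OF is_category_Mnd f g]
  have m: "is_monad SET S" "is_monad SET T" "is_monad SET U" and
    mm: "is_monad_morphism SET S T (fn f)" "is_monad_morphism SET T U (fn g)" "is_monad_morphism SET S U (fn (Cmp (Mnd\<^sub>f small) g f))"
    using hom_MndD[OF f] hom_MndD[OF g] hom_MndD[OF gf] by blast+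
  have "law_map S (fn (Cmp (Mnd\<^sub>f small) g f)) = comp_functor (lcat (law_of S)) (law_map T (fn g)) (law_map S (fn f))"
  proof (rule functor_eqI[OF law_morphismD(1)[OF is_law_morphism_law_map[OF m(1,3) mm(3)]]
        is_functor_comp_functor[OF is_category_law_of[OF m(1)] law_morphismD(1)[OF is_law_morphism_law_map[OF m(1,2) mm(1)]]
          law_morphismD(1)[OF is_law_morphism_law_map[OF m(2,3) mm(2)]]]])
    fix h assume h: "h \<in> Arr (lcat (law_of S))"
    then obtain k ts where k: "h = code (\<iota> k # ts)" "set ts \<subseteq> TO S (fin k)" by (auto simp: Arr_law_of)
    have "set (map (fn (fn f (fin k))) ts) \<subseteq> TO T (fin k)"
      using k(2) hom_set_catD(7)[OF monad_morphism_hom[OF mm(1) small_fin]] by auto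
    then show "FA (law_map S (fn (Cmp (Mnd\<^sub>f small) g f))) h = FA (comp_functor (lcat (law_of S)) (law_map T (fn g)) (law_map S (fn f))) h"
      using h k fn_Cmp_set_cat[OF monad_morphism_hom[OF mm(1) small_fin]] by (auto simp: law_map_sel subset_iff)
  qed (auto simp: law_map_sel)
  then show "FA law_functor (Cmp (Mnd\<^sub>f small) g f) = Cmp (Law small) (FA law_functor g) (FA law_functor f)"
    by (simp only: law_functor_FA[OF f] law_functor_FA[OF g] law_functor_FA[OF gf] Law_sel arrow.sel)
qed (auto simp: law_functor_def)

section \<open>The theory functor is fully faithful\<close>

text \<open>One-entry arrows show that \<open>law_map\<close> records every component at
  \<open>fin n\<close>; by naturality and finite support these determine all components.\<close>

lemma law_functor_faithful: "inj_on (FA law_functor) (hom (Mnd\<^sub>f small) S T)"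
proof (rule inj_onI)
  fix f g assume f: "f \<in> hom (Mnd\<^sub>f small) S T" and g: "g \<in> hom (Mnd\<^sub>f small) S T" and eq: "FA law_functor f = FA law_functor g"
  obtain \<sigma> \<tau> where f': "f = Arrow S T \<sigma>" and g': "g = Arrow S T \<tau>" and S: "finitary_monad S" and T: "is_monad SET T"
    and \<sigma>: "is_monad_morphism SET S T \<sigma>" and \<tau>: "is_monad_morphism SET S T \<tau>"
    using f g by (auto simp: hom_Mnd finitary_monadD)
  note S' = finitary_monadD[OF S]
  have lm: "law_map S \<sigma> = law_map S \<tau>" using eq law_functor_FA[OF f] law_functor_FA[OF g] by (simp add: f' g')
  have base: "fn (\<sigma> (fin n)) s = fn (\<tau> (fin n)) s" if "s \<in> TO S (fin n)" for n s
    using law_map_sel(2)[of "[s]" S n \<sigma>] law_map_sel(2)[of "[s]" S n \<tau>] lm that by simp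
  have "\<sigma> = \<tau>"
  proof (rule monad_morphism_eqI[OF \<sigma> \<tau>])
    fix A t assume A: "small A" and "t \<in> TO S A"
    then obtain n xs s where s: "s \<in> TO S (fin n)" and xs: "\<And>i. i < n \<Longrightarrow> xs i \<in> A" and t: "t = nmap S n A xs s"
      using finitely_supportedE[OF S'(2)] by metis
    show "fn (\<sigma> A) t = fn (\<tau> A) t"
      using monad_morphism_nmap[OF S'(1) \<sigma> A xs s] monad_morphism_nmap[OF S'(1) \<tau> A xs s] base[OF s] t by simp
  qed
  then show "f = g" by (simp add: f' g')
qed

text \<open>\<open>H\<close> amounts to a family of maps \<open>\<phi> m\<close> from
  \<open>S (fin m)\<close> to \<open>T (fin m)\<close> that respects projections and substitution.
  \<open>finitary_lift\<close> extends it to every small \<open>A\<close>, and the laws of a monad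
  morphism are verified on representations.\<close>

lemma law_functor_full:
  assumes S: "finitary_monad S" and T: "finitary_monad T" and h: "h \<in> hom (Law small) (law_of S) (law_of T)"
  shows "\<exists>f\<in>hom (Mnd\<^sub>f small) S T. FA law_functor f = h"
proof -
  note S1 = finitary_monadD(1)[OF S] and T1 = finitary_monadD(1)[OF T] and S2 = finitary_monadD(2)[OF S]
  obtain H where h: "h = Arrow (law_of S) (law_of T) H" and H: "is_law_morphism (law_of S) (law_of T) H"
    using h by (auto simp: hom_Law)
  note Hf = law_morphismD(1)[OF H]
  have HO: "FO H (\<iota> n) = \<iota> n" for n using law_morphismD(2)[OF H, of n] by simp
  \<comment> \<open>Entry 0 of the code is the domain, so entry 1 is the operation.\<close>
  define \<phi> where "\<phi> m t = decode (FA H (code [\<iota> m, t])) ! 1" for m t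
  have single: "code [\<iota> m, t] \<in> hom (lcat (law_of S)) (\<iota> m) (\<iota> 1)" if "t \<in> TO S (fin m)" for m t
    using that by (auto simp: hom_law_of)
  have \<phi>: "FA H (code [\<iota> m, t]) = code [\<iota> m, \<phi> m t]" "\<phi> m t \<in> TO T (fin m)" if "t \<in> TO S (fin m)" for m t
    using functor_hom[OF Hf single[OF that]] by (auto simp: HO hom_law_of \<phi>_def Suc_length_conv)
  have projH: "FA H (code [\<iota> n, eta S (fin n) (\<iota> i)]) = code [\<iota> n, eta T (fin n) (\<iota> i)]" if "i < n" for n i
    using law_morphismD(3)[OF H that] by simp
  have \<phi>_eta: "\<phi> n (eta S (fin n) (\<iota> i)) = eta T (fin n) (\<iota> i)" if "i < n" for n i
    using projH[OF that] by (simp add: \<phi>_def)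
  \<comment> \<open>An arrow into a power is determined by its composites with the projections, and
    \<open>H\<close> preserves these; hence \<open>H\<close> acts entrywise.\<close>
  have H_code: "FA H (code (\<iota> m # ts)) = code (\<iota> m # map (\<phi> m) ts)" if ts: "set ts \<subseteq> TO S (fin m)" for m ts
  proof -
    have f: "code (\<iota> m # ts) \<in> hom (lcat (law_of S)) (\<iota> m) (\<iota> (length ts))" using ts by (auto simp: hom_law_of)
    obtain us where us: "FA H (code (\<iota> m # ts)) = code (\<iota> m # us)" "set us \<subseteq> TO T (fin m)" "length us = length ts"
      using functor_hom[OF Hf f] by (auto simp: HO hom_law_of)
    have "us ! i = \<phi> m (ts ! i)" if i: "i < length ts" for i
    proof -
      have pr: "code [\<iota> (length ts), eta S (fin (length ts)) (\<iota> i)] \<in> hom (lcat (law_of S)) (\<iota> (length ts)) (\<iota> 1)"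
        by (rule single) (use i eta_in[OF S1 small_fin] in auto)
      have "code [\<iota> m, \<phi> m (ts ! i)] = FA H (code [\<iota> m, ts ! i])"
        using \<phi>(1)[of "ts ! i" m] ts nth_mem[OF i] by auto
      also have "\<dots> = Cmp (lcat (law_of T)) (code [\<iota> (length ts), eta T (fin (length ts)) (\<iota> i)]) (code (\<iota> m # us))"
        using functor_Cmp[OF Hf f pr] lsub_eta[OF S1 ts i] us(1) projH[OF i] by simp
      also have "\<dots> = code [\<iota> m, us ! i]" using lsub_eta[OF T1 us(2), of i] i us(3) by simp
      finally show ?thesis by simp
    qed
    then have "us = map (\<phi> m) ts" using us by (intro nth_equalityI) auto
    then show ?thesis using us by simp
  qed
  have \<phi>_lsub: "\<phi> m (lsub S m ts t) = lsub T m (map (\<phi> m) ts) (\<phi> (length ts) t)"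
    if ts: "set ts \<subseteq> TO S (fin m)" and t: "t \<in> TO S (fin (length ts))" for m ts t
  proof -
    have f: "code (\<iota> m # ts) \<in> hom (lcat (law_of S)) (\<iota> m) (\<iota> (length ts))" using ts by (auto simp: hom_law_of)
    have "code [\<iota> m, \<phi> m (lsub S m ts t)] = FA H (code [\<iota> m, lsub S m ts t])"
      using \<phi>(1)[OF lsub_in[OF S1 ts t]] by simp
    also have "\<dots> = code [\<iota> m, lsub T m (map (\<phi> m) ts) (\<phi> (length ts) t)]"
      using functor_Cmp[OF Hf f single[OF t]] H_code[OF ts] \<phi>(1)[OF t] by simp
    finally show ?thesis by simp
  qed
  \<comment> \<open>Renaming is substitution of projections. This is the compatibility under which
    the family extends from the sets \<open>fin n\<close>.\<close>
  have \<phi>_nmap: "\<phi> k (nmap S n (fin k) (\<lambda>i. \<iota> (f i)) s) = nmap T n (fin k) (\<lambda>i. \<iota> (f i)) (\<phi> n s)"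
    if s: "s \<in> TO S (fin n)" and f: "\<And>i. i < n \<Longrightarrow> f i < k" for n k f s
  proof -
    let ?es = "\<lambda>T. map (\<lambda>i. eta T (fin k) (\<iota> (f i))) [0..<n]"
    have e: "set (?es S) \<subseteq> TO S (fin k)" using f eta_in[OF S1 small_fin] by auto
    have es: "map (\<phi> k) (?es S) = ?es T" using f \<phi>_eta by auto
    have "\<phi> k (lsub S k (?es S) s) = lsub T k (?es T) (\<phi> n s)" using \<phi>_lsub[OF e, of s] s unfolding es by simp
    then show ?thesis using lsub_nmap_eta[OF S1 f s] lsub_nmap_eta[OF T1 f \<phi>(2)[OF s]] by simp
  qed
  have "\<forall>A. \<exists>h. small A \<longrightarrow> (\<forall>n xs s. s \<in> TO S (fin n) \<longrightarrow> (\<forall>i<n. xs i \<in> A) \<longrightarrow> h (nmap S n A xs s) = nmap T n A xs (\<phi> n s))"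
  proof
    fix A
    have "\<exists>h. \<forall>n xs s. s \<in> TO S (fin n) \<longrightarrow> (\<forall>i<n. xs i \<in> A) \<longrightarrow> h (nmap S n A xs s) = nmap T n A xs (\<phi> n s)"
      if A: "small A"
    proof (rule finitary_lift[OF S1 A])
      fix n k f xs s
      assume s: "s \<in> TO S (fin n)" and f: "\<And>i. i < n \<Longrightarrow> f i < (k :: nat)" and xs: "\<And>i. i < k \<Longrightarrow> xs i \<in> A"
      show "nmap T k A xs (\<phi> k (nmap S n (fin k) (\<lambda>i. \<iota> (f i)) s)) = nmap T n A (\<lambda>i. xs (f i)) (\<phi> n s)"
        using \<phi>_nmap[of s n f k] nmap_nmap[OF T1 A, of k xs n f "\<phi> n s"] \<phi>(2)[OF s] s f xs by simp
    qed (rule nmap_cong)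
    then show "\<exists>h. small A \<longrightarrow> (\<forall>n xs s. s \<in> TO S (fin n) \<longrightarrow> (\<forall>i<n. xs i \<in> A) \<longrightarrow> h (nmap S n A xs s) = nmap T n A xs (\<phi> n s))"
      by blast
  qed
  then obtain s where s: "\<And>A n xs t. small A \<Longrightarrow> t \<in> TO S (fin n) \<Longrightarrow> (\<And>i. i < n \<Longrightarrow> xs i \<in> A) \<Longrightarrow>
      s A (nmap S n A xs t) = nmap T n A xs (\<phi> n t)" by metis
  define \<sigma> where "\<sigma> = (\<lambda>A\<in>Obj SET. Arrow (TO S A) (TO T A) (restrict (s A) (TO S A)))"
  have s_in: "s A t \<in> TO T A" if A: "small A" and t: "t \<in> TO S A" for A t
  proof -
    obtain n xs u where u: "u \<in> TO S (fin n)" and xs: "\<And>i. i < n \<Longrightarrow> xs i \<in> A" and t: "t = nmap S n A xs u"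
      using finitely_supportedE[OF S2 A t] by metis
    show ?thesis unfolding t using s[OF A u, of xs] nmap_in[OF T1 A, of n xs] \<phi>(2)[OF u] xs by simp
  qed
  have \<sigma>: "is_monad_morphism SET S T \<sigma>"
    unfolding \<sigma>_def
  proof (rule is_monad_morphismI[OF S1 T1 s_in])
    fix A x assume A: "small A" and x: "x \<in> A"
    \<comment> \<open>The unit at \<open>A\<close> is the only projection of arity 1 applied to
      \<open>x\<close>, and \<open>\<phi>\<close> respects projections.\<close>
    have e: "eta U A x = nmap U 1 A (\<lambda>_. x) (eta U (fin 1) (\<iota> 0))" if "is_monad SET U" for U
      unfolding nmap_def using tmap_eta[OF that small_fin A, of 1 "\<lambda>_. x" "\<iota> 0"] x by simp
    have "s A (eta S A x) = nmap T 1 A (\<lambda>_. x) (\<phi> 1 (eta S (fin 1) (\<iota> 0)))"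
      unfolding e[OF S1] by (rule s[OF A]) (use x eta_in[OF S1 small_fin] in auto)
    then show "s A (eta S A x) = eta T A x" using \<phi>_eta[of 0 1] e[OF T1] by simp
  next
    fix A B g t
    assume A: "small A" and B: "small B" and g: "\<And>a. a \<in> A \<Longrightarrow> g a \<in> TO S B" and t: "t \<in> TO S A"
    obtain n xs u where u: "u \<in> TO S (fin n)" and xs: "\<And>i. i < n \<Longrightarrow> xs i \<in> A" and t': "t = nmap S n A xs u"
      using finitely_supportedE[OF S2 A t] by metis
    \<comment> \<open>Only the values of \<open>g\<close> at the finitely many \<open>xs i\<close>
      matter; with common variables for them, \<open>bind\<close> turns into \<open>lsub\<close>,
      which \<open>\<phi>\<close> respects.\<close>
    have "\<exists>k zs r. (\<forall>j<k. zs j \<in> B) \<and> (\<forall>i<n. r i \<in> TO S (fin k) \<and> g (xs i) = nmap S k B zs (r i))"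
      by (rule common_support[OF S1 S2 B]) (use g xs in auto)
    then obtain k zs r where zs: "\<And>j. j < k \<Longrightarrow> zs j \<in> B" and r: "\<And>i. i < n \<Longrightarrow> r i \<in> TO S (fin k)"
      and gr: "\<And>i. i < n \<Longrightarrow> g (xs i) = nmap S k B zs (r i)" by metis
    have rs: "set (map r [0..<n]) \<subseteq> TO S (fin k)" using r by auto
    have "s B (bind S A B g t) = s B (nmap S k B zs (lsub S k (map r [0..<n]) u))"
      unfolding t' using bind_nmap_lsub[OF S1 A B, of n xs g u r k zs] xs zs g u r gr by simp
    also have "\<dots> = nmap T k B zs (\<phi> k (lsub S k (map r [0..<n]) u))"
      by (rule s[OF B lsub_in[OF S1 rs] zs]) (use u in auto)
    also have "\<phi> k (lsub S k (map r [0..<n]) u) = lsub T k (map (\<lambda>i. \<phi> k (r i)) [0..<n]) (\<phi> n u)"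
      using \<phi>_lsub[OF rs, of u] u by (simp add: comp_def)
    also have "nmap T k B zs \<dots> = bind T A B (\<lambda>a. s B (g a)) (nmap T n A xs (\<phi> n u))"
    proof (rule bind_nmap_lsub[OF T1 A B xs _ \<phi>(2)[OF u] _ zs, symmetric])
      fix i assume i: "i < n"
      show "\<phi> k (r i) \<in> TO T (fin k)" by (rule \<phi>(2)[OF r[OF i]])
      show "s B (g (xs i)) = nmap T k B zs (\<phi> k (r i))" unfolding gr[OF i] by (rule s[OF B r[OF i] zs])
    qed (use s_in[OF B] g in auto)
    also have "nmap T n A xs (\<phi> n u) = s A t" unfolding t' using s[OF A u, of xs] xs by simp
    finally show "s B (bind S A B g t) = bind T A B (\<lambda>a. s B (g a)) (s A t)" .
  qed
  \<comment> \<open>Over \<open>fin m\<close> every \<open>t\<close> is represented by itself with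
    the tuple \<open>\<iota>\<close>, so the extension restricts to \<open>\<phi>\<close>.\<close>
  have \<sigma>_fin: "fn (\<sigma> (fin m)) t = \<phi> m t" if t: "t \<in> TO S (fin m)" for m t
    using s[OF small_fin t, of \<iota> m] nmap_\<iota>[OF S1 t] nmap_\<iota>[OF T1 \<phi>(2)[OF t]] t by (simp add: \<sigma>_def)
  have f: "Arrow S T \<sigma> \<in> hom (Mnd\<^sub>f small) S T" using S T \<sigma> by (simp add: hom_Mnd)
  have "law_map S \<sigma> = H"
  proof (rule functor_eqI[OF law_morphismD(1)[OF is_law_morphism_law_map[OF S1 T1 \<sigma>]] Hf])
    fix f assume "f \<in> Arr (lcat (law_of S))"
    then obtain m ts where "f = code (\<iota> m # ts)" "set ts \<subseteq> TO S (fin m)" by (auto simp: Arr_law_of)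
    then show "FA (law_map S \<sigma>) f = FA H f" by (auto simp: law_map_sel H_code \<sigma>_fin subset_iff)
  qed (auto simp: law_map_sel HO)
  then have "FA law_functor (Arrow S T \<sigma>) = h" unfolding law_functor_FA[OF f] h by simp
  then show ?thesis using f by blast
qed

end

section \<open>Every Lawvere theory comes from a finitary monad\<close>

text \<open>The inverse functions on objects and arrows form a functor because \<open>F\<close> is
  injective on both and respects all operations. An isomorphism of categories is wanted here, as
  isomorphisms in \<open>Law\<close> are strict.\<close>

lemma functor_inverse:
  assumes C: "is_category C" and D: "is_category D" and F: "is_functor C D F"
    and bO: "bij_betw (FO F) (Obj C) (Obj D)" and bA: "bij_betw (FA F) (Arr C) (Arr D)"
  obtains G where "is_functor D C G" "comp_functor C G F = id_functor C" "comp_functor D F G = id_functor D"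
proof -
  define G where "G = \<lparr>FO = restrict (inv_into (Obj C) (FO F)) (Obj D), FA = restrict (inv_into (Arr C) (FA F)) (Arr D)\<rparr>"
  have GO: "FO G y \<in> Obj C" "FO F (FO G y) = y" if "y \<in> Obj D" for y
    using that bO inv_into_into[of y "FO F" "Obj C"] f_inv_into_f[of y "FO F" "Obj C"] by (auto simp: G_def bij_betw_def)
  have GA: "FA G g \<in> Arr C" "FA F (FA G g) = g" if "g \<in> Arr D" for g
    using that bA inv_into_into[of g "FA F" "Arr C"] f_inv_into_f[of g "FA F" "Arr C"] by (auto simp: G_def bij_betw_def)
  have iO: "x = x'" if "FO F x = FO F x'" "x \<in> Obj C" "x' \<in> Obj C" for x x'
    using bO that by (auto simp: bij_betw_def dest: inj_onD)
  have iA: "x = x'" if "FA F x = FA F x'" "x \<in> Arr C" "x' \<in> Arr C" for x x'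
    using bA that by (auto simp: bij_betw_def dest: inj_onD)
  have Ghom: "FA G g \<in> hom C (FO G x) (FO G y)" if g: "g \<in> hom D x y" for g x y
  proof -
    have ga: "g \<in> Arr D" using hom_ArrD[OF g] .
    have o: "x \<in> Obj D" "y \<in> Obj D" using hom_Obj[OF D g] by auto
    note h = hom_self[OF GA(1)[OF ga]]
    have "FO F (Dom C (FA G g)) = x" "FO F (Cod C (FA G g)) = y"
      using functor_hom[OF F h] GA(2)[OF ga] g by (auto simp: hom_def)
    then have "Dom C (FA G g) = FO G x" "Cod C (FA G g) = FO G y"
      using iO GO[OF o(1)] GO[OF o(2)] hom_Obj[OF C h] by auto
    then show ?thesis using h by simp
  qed
  have G: "is_functor D C G"
  proof (rule is_functorI)
    fix x assume x: "x \<in> Obj D"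
    show "FA G (Idn D x) = Idn C (FO G x)"
      by (rule iA)
        (simp_all add: functor_Idn[OF F GO(1)[OF x]] GO[OF x] GA hom_ArrD[OF Idn_hom[OF D x]] hom_ArrD[OF Idn_hom[OF C GO(1)[OF x]]])
  next
    fix f g x y z assume f: "f \<in> hom D x y" and g: "g \<in> hom D y z"
    show "FA G (Cmp D g f) = Cmp C (FA G g) (FA G f)"
      by (rule iA)
        (simp_all add: functor_Cmp[OF F Ghom[OF f] Ghom[OF g]] GA hom_ArrD[OF Cmp_hom[OF D f g]]
          hom_ArrD[OF f] hom_ArrD[OF g] hom_ArrD[OF Cmp_hom[OF C Ghom[OF f] Ghom[OF g]]])
  qed (use GO Ghom in \<open>auto simp: G_def\<close>)
  have FO: "FO F x \<in> Obj D" if "x \<in> Obj C" for x using functor_Obj[OF F that] .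
  have FA: "FA F f \<in> Arr D" if "f \<in> Arr C" for f using hom_ArrD[OF functor_hom[OF F hom_self[OF that]]] .
  have "comp_functor C G F = id_functor C"
    by (rule functor_eqI[OF is_functor_comp_functor[OF C F G] is_functor_id_functor[OF C]])
      (auto intro!: iO iA GO GA FO FA)
  moreover have "comp_functor D F G = id_functor D"
    by (rule functor_eqI[OF is_functor_comp_functor[OF D G F] is_functor_id_functor[OF D]])
      (simp_all add: GO GA)
  ultimately show ?thesis using that G by blast
qed

text \<open>Bijectivity on objects comes with the preservation of the chosen powers, which are
  distinct in each theory. The inverse preserves powers and projections because \<open>H\<close>
  hits them.\<close>

lemma law_isomorphism:
  assumes L: "is_lawvere_theory small L" and M: "is_lawvere_theory small M" and H: "is_law_morphism L M H"
    and bij: "bij_betw (FA H) (Arr (lcat L)) (Arr (lcat M))"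
  shows "is_iso (Law small) (Arrow L M H)"
proof -
  note C = lawvere_theoryD(1)[OF L] and D = lawvere_theoryD(1)[OF M] and HO = law_morphismD(2)[OF H]
  have "bij_betw (FO H) (Obj (lcat L)) (Obj (lcat M))"
    unfolding lawvere_theoryD(4)[OF L] lawvere_theoryD(4)[OF M]
    using lawvere_theoryD(3)[OF L] lawvere_theoryD(3)[OF M]
    by (auto simp: bij_betw_def inj_on_def HO image_image)
  then obtain G where G: "is_functor (lcat M) (lcat L) G" and GH: "comp_functor (lcat L) G H = id_functor (lcat L)"
    and HG: "comp_functor (lcat M) H G = id_functor (lcat M)"
    using functor_inverse[OF C D law_morphismD(1)[OF H] _ bij] by blast
  have "FO G (pow M n) = pow L n" for n
    using GH lawvere_theoryD(8)[OF L, of n] HO by (metis comp_functor_sel(1) id_functor_sel(1))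
  moreover have "FA G (proj M n i) = proj L n i" if "i < n" for n i
    using GH hom_ArrD[OF lawvere_theoryD(7)[OF L that]] law_morphismD(3)[OF H that]
    by (metis comp_functor_sel(2) id_functor_sel(2))
  ultimately have "is_law_morphism M L G" using G by (simp add: is_law_morphism_def)
  then show ?thesis
    using L M H GH HG by (intro is_isoI[of _ _ L M "Arrow M L G"]) (auto simp: hom_Law)
qed

section \<open>Terms over a Lawvere theory\<close>

locale lawvere = coded_universe small code \<iota> for small :: "'u set \<Rightarrow> bool" and code \<iota> +
  fixes L :: "'u lawvere"
  assumes L: "is_lawvere_theory small L"
begin

abbreviation C where "C \<equiv> lcat L"
abbreviation ops where "ops n \<equiv> hom C (pow L n) (pow L 1)"

text \<open>The arrow into a power with given components; \<open>product_unique\<close> makes the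
  choice harmless (\<open>tup_eqI\<close>).\<close>

definition tup :: "nat \<Rightarrow> 'u list \<Rightarrow> 'u" where
  "tup m fs = (SOME h. h \<in> hom C (pow L m) (pow L (length fs)) \<and>
     (\<forall>i<length fs. Cmp C (proj L (length fs) i) h = fs ! i))"

lemmas cat = lawvere_theoryD(1)[OF L]
lemmas power = lawvere_theoryD(5)[OF L]
lemmas proj_hom = lawvere_theoryD(7)[OF L]

lemma tup:
  assumes "set fs \<subseteq> ops m"
  shows tup_hom: "tup m fs \<in> hom C (pow L m) (pow L (length fs))"
    and proj_tup: "i < length fs \<Longrightarrow> Cmp C (proj L (length fs) i) (tup m fs) = fs ! i"
proof -
  have "fs ! i \<in> ops m" if "i < length fs" for i using assms nth_mem[OF that] by auto
  then obtain h where "h \<in> hom C (pow L m) (pow L (length fs))" "\<And>i. i < length fs \<Longrightarrow> Cmp C (proj L (length fs) i) h = fs ! i"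
    using product_exists[OF power lawvere_theoryD(8)[OF L], of "length fs" "\<lambda>i. fs ! i" m] by blast
  then have "\<exists>h. h \<in> hom C (pow L m) (pow L (length fs)) \<and> (\<forall>i<length fs. Cmp C (proj L (length fs) i) h = fs ! i)"
    by blast
  from someI_ex[OF this]
  show "tup m fs \<in> hom C (pow L m) (pow L (length fs))"
    "i < length fs \<Longrightarrow> Cmp C (proj L (length fs) i) (tup m fs) = fs ! i"
    unfolding tup_def by auto
qed

lemma tup_eqI:
  assumes fs: "set fs \<subseteq> ops m" and h: "h \<in> hom C (pow L m) (pow L (length fs))"
    and eq: "\<And>i. i < length fs \<Longrightarrow> Cmp C (proj L (length fs) i) h = fs ! i"
  shows "tup m fs = h"
  by (rule product_unique[OF cat power tup_hom[OF fs] h]) (simp add: eq proj_tup[OF fs])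

lemma tup_Cmp:
  assumes fs: "set fs \<subseteq> ops m" and f: "f \<in> hom C (pow L k) (pow L m)"
  shows "Cmp C (tup m fs) f = tup k (map (\<lambda>x. Cmp C x f) fs)"
proof (rule tup_eqI[symmetric])
  show "set (map (\<lambda>x. Cmp C x f) fs) \<subseteq> ops k" using fs Cmp_hom[OF cat f] by auto
  show "Cmp C (tup m fs) f \<in> hom C (pow L k) (pow L (length (map (\<lambda>x. Cmp C x f) fs)))"
    using Cmp_hom[OF cat f tup_hom[OF fs]] by simp
  fix i assume "i < length (map (\<lambda>x. Cmp C x f) fs)"
  then have i: "i < length fs" by simp
  show "Cmp C (proj L (length (map (\<lambda>x. Cmp C x f) fs)) i) (Cmp C (tup m fs) f) = map (\<lambda>x. Cmp C x f) fs ! i"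
    using Cmp_assoc[OF cat f tup_hom[OF fs] proj_hom[OF i]] proj_tup[OF fs i] i by simp
qed

lemma Cmp_tup_Cmp:
  assumes "\<theta> \<in> ops (length fs)" "set fs \<subseteq> ops m" "f \<in> hom C (pow L k) (pow L m)"
  shows "Cmp C (Cmp C \<theta> (tup m fs)) f = Cmp C \<theta> (tup k (map (\<lambda>x. Cmp C x f) fs))"
  using Cmp_assoc[OF cat assms(3) tup_hom[OF assms(2)] assms(1)] tup_Cmp[OF assms(2,3)] by simp

lemma tup_proj: "tup n (map (proj L n) [0..<n]) = Idn C (pow L n)"
  by (rule tup_eqI)
    (use proj_hom Idn_hom[OF cat lawvere_theoryD(8)[OF L]] Cmp_Idn[OF cat proj_hom] in auto)

lemma tup_single: assumes "f \<in> ops m" shows "tup m [f] = f"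
  by (rule tup_eqI) (use assms lawvere_theoryD(6)[OF L] Idn_Cmp[OF cat assms] in auto)

text \<open>A term over \<open>A\<close> is an operation applied to a list of variables from \<open>A\<close>. Two terms are identified
  when they agree under every valuation of the variables in the operations of some arity; these
  valuations suffice because a nonempty finite set of \<open>k\<close> variables has the projections as valuation.\<close>

definition terms :: "'u set \<Rightarrow> 'u set" where
  "terms A = {code (\<theta> # a) |\<theta> a. \<theta> \<in> ops (length a) \<and> set a \<subseteq> A}"

text \<open>Evaluation in the model represented by \<open>pow L k\<close>, whose carrier is
  \<open>ops k\<close>.\<close>

definition ev :: "nat \<Rightarrow> ('u \<Rightarrow> 'u) \<Rightarrow> 'u \<Rightarrow> 'u" where
  "ev k v u = Cmp C (hd (decode u)) (tup k (map v (tl (decode u))))"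

definition eqv :: "'u set \<Rightarrow> 'u \<Rightarrow> 'u \<Rightarrow> bool" where
  "eqv A u w \<longleftrightarrow> (\<forall>k v. (\<forall>x\<in>A. v x \<in> ops k) \<longrightarrow> ev k v u = ev k v w)"

text \<open>The class of a term must be an element of \<open>'u\<close>, so it is represented by a
  member. The choice sees \<open>u\<close> only through the predicate \<open>eqv A u\<close>, so
  equivalent terms get the same one.\<close>

definition nf :: "'u set \<Rightarrow> 'u \<Rightarrow> 'u" where
  "nf A u = (SOME w. w \<in> terms A \<and> eqv A u w)"

definition K :: "'u set \<Rightarrow> 'u set" where
  "K A = nf A ` terms A"

definition e :: "'u set \<Rightarrow> 'u \<Rightarrow> 'u" where
  "e A x = nf A (code [Idn C (pow L 1), x])"

text \<open>Substitution is specified by its values under all valuations, which determine an element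
  of \<open>K B\<close> by \<open>K_eqI\<close>. The monad laws then become computations with
  \<open>ev\<close>, without a formula for the substituted term.\<close>

definition b :: "'u set \<Rightarrow> 'u set \<Rightarrow> ('u \<Rightarrow> 'u) \<Rightarrow> 'u \<Rightarrow> 'u" where
  "b A B g t = (SOME w. w \<in> K B \<and>
     (\<forall>k v. (\<forall>x\<in>B. v x \<in> ops k) \<longrightarrow> ev k v w = ev k (\<lambda>a. ev k v (g a)) t))"

lemma ev_code [simp]: "ev k v (code (\<theta> # a)) = Cmp C \<theta> (tup k (map v a))"
  by (simp add: ev_def)

lemma termsE:
  assumes "u \<in> terms A" obtains \<theta> a where "u = code (\<theta> # a)" "\<theta> \<in> ops (length a)" "set a \<subseteq> A"
  using assms by (auto simp: terms_def)

lemma termsI: "\<theta> \<in> ops (length a) \<Longrightarrow> set a \<subseteq> A \<Longrightarrow> code (\<theta> # a) \<in> terms A"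
  by (auto simp: terms_def)

lemma ev_in:
  assumes "u \<in> terms A" "\<And>x. x \<in> A \<Longrightarrow> v x \<in> ops k" shows "ev k v u \<in> ops k"
  using assms(1)
proof (rule termsE)
  fix \<theta> a assume u: "u = code (\<theta> # a)" "\<theta> \<in> ops (length a)" "set a \<subseteq> A"
  have "set (map v a) \<subseteq> ops k" using assms(2) u(3) by auto
  moreover have "\<theta> \<in> ops (length (map v a))" using u(2) by simp
  ultimately show ?thesis using Cmp_hom[OF cat tup_hom] u(1) by simp
qed

lemma ev_cong: "u \<in> terms A \<Longrightarrow> (\<And>x. x \<in> A \<Longrightarrow> v x = w x) \<Longrightarrow> ev k v u = ev k w u"
  by (auto simp: terms_def subset_iff intro!: arg_cong[where f = "\<lambda>a. Cmp C _ (tup k a)"])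

lemma nf: assumes "u \<in> terms A" shows "nf A u \<in> terms A" "eqv A u (nf A u)"
proof -
  have "\<exists>w. w \<in> terms A \<and> eqv A u w" using assms by (auto simp: eqv_def)
  from someI_ex[OF this] show "nf A u \<in> terms A" "eqv A u (nf A u)" unfolding nf_def by auto
qed

lemma K_terms: "u \<in> K A \<Longrightarrow> u \<in> terms A"
  using nf(1) by (auto simp: K_def)

lemma nf_K: "u \<in> terms A \<Longrightarrow> nf A u \<in> K A"
  by (simp add: K_def)

lemma ev_nf: "u \<in> terms A \<Longrightarrow> (\<And>x. x \<in> A \<Longrightarrow> v x \<in> ops k) \<Longrightarrow> ev k v (nf A u) = ev k v u"
  using nf(2)[of u A] by (simp add: eqv_def)

text \<open>Both elements are normal forms; equal values make the predicates \<open>eqv\<close> of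
  the underlying terms equal, hence also the choices made from them.\<close>

lemma K_eqI:
  assumes "u \<in> K A" "w \<in> K A" "\<And>k v. (\<And>x. x \<in> A \<Longrightarrow> v x \<in> ops k) \<Longrightarrow> ev k v u = ev k v w"
  shows "u = w"
proof -
  obtain u' w' where uw: "u' \<in> terms A" "u = nf A u'" "w' \<in> terms A" "w = nf A w'"
    using assms(1,2) by (auto simp: K_def)
  have "eqv A u' = eqv A w'"
    using assms(3) ev_nf[OF uw(1)] ev_nf[OF uw(3)] by (auto simp: eqv_def fun_eq_iff uw(2,4))
  then show ?thesis unfolding uw nf_def by simp
qed

text \<open>Local smallness of the theory enters here: the operation of a term ranges over the small
  union of all \<open>ops n\<close>, its variables over finite lists in \<open>A\<close>.\<close>

lemma small_K: assumes A: "small A" shows "small (K A)"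
proof -
  have "small (\<Union>n. ops n)"
    by (rule small_UN_nat) (rule lawvere_theoryD(2)[OF L lawvere_theoryD(8)[OF L] lawvere_theoryD(8)[OF L]])
  then have "small (code ` {\<theta> # a |\<theta> a. \<theta> \<in> (\<Union>n. ops n) \<and> a \<in> {a. set a \<subseteq> A}})"
    by (rule small_code_Cons[OF _ small_code_lists[OF A]])
  then have "small (terms A)" by (rule small_subset) (auto simp: terms_def)
  then show ?thesis unfolding K_def by (rule small_image)
qed

lemma Idn_ops: "Idn C (pow L 1) \<in> ops 1"
  by (rule Idn_hom[OF cat lawvere_theoryD(8)[OF L]])

lemma e_in: "x \<in> A \<Longrightarrow> e A x \<in> K A"
  unfolding e_def by (rule nf_K, rule termsI) (use Idn_ops in auto)

lemma ev_e: assumes "x \<in> A" "\<And>x. x \<in> A \<Longrightarrow> v x \<in> ops k" shows "ev k v (e A x) = v x"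
proof -
  have "code [Idn C (pow L 1), x] \<in> terms A" by (rule termsI) (use Idn_ops assms in auto)
  then have "ev k v (e A x) = Cmp C (Idn C (pow L 1)) (tup k [v x])"
    unfolding e_def using ev_nf assms(2) by simp
  then show ?thesis using tup_single[OF assms(2)[OF assms(1)]] Idn_Cmp[OF cat assms(2)[OF assms(1)]] by simp
qed

text \<open>Adds dummy variables: the operation is composed with the tuple of projections onto the
  positions \<open>p x\<close> at which its variables occur in \<open>c\<close>.\<close>

lemma widen_term:
  assumes u: "u \<in> terms B" and c: "set c \<subseteq> B" "set (tl (decode u)) \<subseteq> set c"
  shows "\<exists>\<psi>\<in>ops (length c). \<forall>k v. (\<forall>x\<in>B. v x \<in> ops k) \<longrightarrow> Cmp C \<psi> (tup k (map v c)) = ev k v u"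
  using u
proof (rule termsE)
  fix \<phi> a assume u': "u = code (\<phi> # a)" "\<phi> \<in> ops (length a)" "set a \<subseteq> B"
  have "\<exists>i. i < length c \<and> c ! i = x" if "x \<in> set c" for x using that by (simp add: in_set_conv_nth)
  then obtain p where p: "\<And>x. x \<in> set c \<Longrightarrow> p x < length c \<and> c ! p x = x" by metis
  have ac: "set a \<subseteq> set c" using c(2) u' by simp
  let ?ps = "map (\<lambda>x. proj L (length c) (p x)) a"
  have ps: "set ?ps \<subseteq> ops (length c)" using p ac proj_hom by auto
  have \<phi>: "\<phi> \<in> ops (length ?ps)" using u' by simp
  have "Cmp C \<phi> (tup (length c) ?ps) \<in> ops (length c)" by (rule Cmp_hom[OF cat tup_hom[OF ps] \<phi>])
  moreover have "Cmp C (Cmp C \<phi> (tup (length c) ?ps)) (tup k (map v c)) = ev k v u" if v: "\<forall>x\<in>B. v x \<in> ops k" for k v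
  proof -
    have vc: "set (map v c) \<subseteq> ops k" using v c by auto
    have h: "tup k (map v c) \<in> hom C (pow L k) (pow L (length c))" using tup_hom[OF vc] by simp
    have "Cmp C (proj L (length c) (p x)) (tup k (map v c)) = v x" if "x \<in> set a" for x
      using proj_tup[OF vc, of "p x"] p[of x] ac that by auto
    then have m: "map (\<lambda>x. Cmp C x (tup k (map v c))) ?ps = map v a" by simp
    show ?thesis using Cmp_tup_Cmp[OF \<phi> ps h] u' unfolding m by simp
  qed
  ultimately show ?thesis by blast
qed

text \<open>Supplies a witness for the choice in \<open>b\<close>: all substituted terms are widened
  to one list of variables, after which substitution is composition in the theory.\<close>

lemma bind_term:
  assumes t: "t \<in> terms A" and g: "\<And>x. x \<in> A \<Longrightarrow> g x \<in> terms B"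
  shows "\<exists>w\<in>terms B. \<forall>k v. (\<forall>x\<in>B. v x \<in> ops k) \<longrightarrow> ev k v w = ev k (\<lambda>a. ev k v (g a)) t"
  using t
proof (rule termsE)
  fix \<theta> a assume t: "t = code (\<theta> # a)" "\<theta> \<in> ops (length a)" "set a \<subseteq> A"
  \<comment> \<open>The variables of all substituted terms in a row, repetitions included.\<close>
  define c where "c = concat (map (\<lambda>x. tl (decode (g x))) a)"
  have "set (tl (decode (g x))) \<subseteq> B" if "x \<in> A" for x using g[OF that] by (auto simp: terms_def)
  then have c: "set c \<subseteq> B" using t by (auto simp: c_def)
  have "\<forall>x\<in>set a. \<exists>\<psi>\<in>ops (length c). \<forall>k v. (\<forall>x\<in>B. v x \<in> ops k) \<longrightarrow> Cmp C \<psi> (tup k (map v c)) = ev k v (g x)"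
  proof
    fix x assume "x \<in> set a"
    then show "\<exists>\<psi>\<in>ops (length c). \<forall>k v. (\<forall>x\<in>B. v x \<in> ops k) \<longrightarrow> Cmp C \<psi> (tup k (map v c)) = ev k v (g x)"
      by (intro widen_term[OF g c]) (use t in \<open>auto simp: c_def\<close>)
  qed
  then obtain \<psi> where \<psi>: "\<And>x. x \<in> set a \<Longrightarrow> \<psi> x \<in> ops (length c)"
    and \<psi>_ev: "\<And>x k v. x \<in> set a \<Longrightarrow> (\<forall>x\<in>B. v x \<in> ops k) \<Longrightarrow> Cmp C (\<psi> x) (tup k (map v c)) = ev k v (g x)"
    by metis
  have s: "set (map \<psi> a) \<subseteq> ops (length c)" using \<psi> by auto
  have \<theta>: "\<theta> \<in> ops (length (map \<psi> a))" using t by simp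
  let ?w = "code (Cmp C \<theta> (tup (length c) (map \<psi> a)) # c)"
  have "?w \<in> terms B" by (rule termsI[OF Cmp_hom[OF cat tup_hom[OF s] \<theta>] c])
  moreover have "ev k v ?w = ev k (\<lambda>a. ev k v (g a)) t" if v: "\<forall>x\<in>B. v x \<in> ops k" for k v
  proof -
    have "set (map v c) \<subseteq> ops k" using v c by auto
    then have h: "tup k (map v c) \<in> hom C (pow L k) (pow L (length c))" using tup_hom[of "map v c"] by simp
    have m: "map (\<lambda>x. Cmp C x (tup k (map v c))) (map \<psi> a) = map (\<lambda>a. ev k v (g a)) a"
      using \<psi>_ev[OF _ v] by simp
    show ?thesis using Cmp_tup_Cmp[OF \<theta> s h] t unfolding m by simp
  qed
  ultimately show ?thesis by blast
qed

lemma b: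
  assumes t: "t \<in> K A" and g: "\<And>x. x \<in> A \<Longrightarrow> g x \<in> K B"
  shows b_in: "b A B g t \<in> K B"
    and ev_b: "(\<And>x. x \<in> B \<Longrightarrow> v x \<in> ops k) \<Longrightarrow> ev k v (b A B g t) = ev k (\<lambda>a. ev k v (g a)) t"
proof -
  have "\<exists>w\<in>terms B. \<forall>k v. (\<forall>x\<in>B. v x \<in> ops k) \<longrightarrow> ev k v w = ev k (\<lambda>a. ev k v (g a)) t"
    by (rule bind_term[OF K_terms[OF t]]) (rule K_terms[OF g])
  then obtain w where w: "w \<in> terms B" "\<forall>k v. (\<forall>x\<in>B. v x \<in> ops k) \<longrightarrow> ev k v w = ev k (\<lambda>a. ev k v (g a)) t"
    by blast
  then have "nf B w \<in> K B \<and> (\<forall>k v. (\<forall>x\<in>B. v x \<in> ops k) \<longrightarrow> ev k v (nf B w) = ev k (\<lambda>a. ev k v (g a)) t)"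
    using nf_K ev_nf by simp
  then have "b A B g t \<in> K B \<and> (\<forall>k v. (\<forall>x\<in>B. v x \<in> ops k) \<longrightarrow> ev k v (b A B g t) = ev k (\<lambda>a. ev k v (g a)) t)"
    unfolding b_def by (rule someI)
  then show "b A B g t \<in> K B"
    "(\<And>x. x \<in> B \<Longrightarrow> v x \<in> ops k) \<Longrightarrow> ev k v (b A B g t) = ev k (\<lambda>a. ev k v (g a)) t" by auto
qed

lemma b_cong:
  assumes t: "t \<in> K A" and gh: "\<And>x. x \<in> A \<Longrightarrow> g x = h x" shows "b A B g t = b A B h t"
proof -
  have "ev k (\<lambda>a. ev k v (g a)) t = ev k (\<lambda>a. ev k v (h a)) t" for k v
    by (rule ev_cong[OF K_terms[OF t]]) (simp add: gh)
  then show ?thesis unfolding b_def by simp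
qed

lemma K_ev_in: "u \<in> K A \<Longrightarrow> (\<And>x. x \<in> A \<Longrightarrow> v x \<in> ops k) \<Longrightarrow> ev k v u \<in> ops k"
  by (rule ev_in[OF K_terms])

lemma b_e: assumes g: "\<And>x. x \<in> A \<Longrightarrow> g x \<in> K B" and x: "x \<in> A" shows "b A B g (e A x) = g x"
proof (rule K_eqI)
  fix k v assume v: "\<And>x. x \<in> B \<Longrightarrow> v x \<in> ops k"
  have "ev k v (b A B g (e A x)) = ev k (\<lambda>a. ev k v (g a)) (e A x)"
    by (rule ev_b[OF e_in[OF x]]) (use g v in auto)
  also have "\<dots> = ev k v (g x)"
    by (rule ev_e[OF x], rule K_ev_in) (use g v in auto)
  finally show "ev k v (b A B g (e A x)) = ev k v (g x)" .
qed (use b_in[OF e_in[OF x]] g x in auto)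

lemma e_b: assumes t: "t \<in> K A" shows "b A A (e A) t = t"
proof (rule K_eqI[OF b_in[OF t e_in] t])
  fix k v assume v: "\<And>x. x \<in> A \<Longrightarrow> v x \<in> ops k"
  have "ev k v (b A A (e A) t) = ev k (\<lambda>a. ev k v (e A a)) t"
    by (rule ev_b[OF t]) (use e_in v in auto)
  also have "\<dots> = ev k v t" by (rule ev_cong[OF K_terms[OF t]]) (use ev_e v in auto)
  finally show "ev k v (b A A (e A) t) = ev k v t" .
qed

text \<open>Under any valuation both sides reduce to \<open>t\<close> evaluated at the values of the
  \<open>g x\<close>, these in turn evaluated at the values of the \<open>h y\<close>.\<close>

lemma b_b:
  assumes g: "\<And>x. x \<in> A \<Longrightarrow> g x \<in> K B" and h: "\<And>x. x \<in> B \<Longrightarrow> h x \<in> K D" and t: "t \<in> K A"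
  shows "b B D h (b A B g t) = b A D (\<lambda>x. b B D h (g x)) t"
proof (rule K_eqI)
  have gt: "b A B g t \<in> K B" by (rule b_in[OF t g])
  have bg: "b B D h (g x) \<in> K D" if "x \<in> A" for x by (rule b_in[OF g[OF that] h])
  show "b B D h (b A B g t) \<in> K D" by (rule b_in[OF gt h])
  show "b A D (\<lambda>x. b B D h (g x)) t \<in> K D" by (rule b_in[OF t bg])
  fix k v assume v: "\<And>x. x \<in> D \<Longrightarrow> v x \<in> ops k"
  have hv: "ev k v (h x) \<in> ops k" if "x \<in> B" for x by (rule K_ev_in[OF h[OF that] v])
  have "ev k v (b B D h (b A B g t)) = ev k (\<lambda>y. ev k v (h y)) (b A B g t)" by (rule ev_b[OF gt h v])
  also have "\<dots> = ev k (\<lambda>x. ev k (\<lambda>y. ev k v (h y)) (g x)) t" by (rule ev_b[OF t g hv])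
  also have "\<dots> = ev k (\<lambda>x. ev k v (b B D h (g x))) t"
    by (rule ev_cong[OF K_terms[OF t]]) (rule ev_b[OF g h v, symmetric])
  also have "\<dots> = ev k v (b A D (\<lambda>x. b B D h (g x)) t)" by (rule ev_b[OF t bg v, symmetric])
  finally show "ev k v (b B D h (b A B g t)) = ev k v (b A D (\<lambda>x. b B D h (g x)) t)" .
qed

section \<open>A theory is the theory of its monad of terms\<close>

definition T :: "'u set_monad" where "T = kleisli_monad K e b"

lemma T_monad: "is_monad SET T"
  unfolding T_def by (rule is_monad_kleisli) (rule small_K e_in b_in b_b b_e e_b b_cong; simp)+

lemma T_TO: "small A \<Longrightarrow> TO T A = K A"
  unfolding T_def by (rule kleisli_TO) (rule small_K e_in b_in b_b b_e e_b b_cong; simp)+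

lemma T_eta: "small A \<Longrightarrow> x \<in> A \<Longrightarrow> eta T A x = e A x"
  unfolding T_def by (rule kleisli_eta) (rule small_K e_in b_in b_b b_e e_b b_cong; simp)+

lemma T_bind: "small A \<Longrightarrow> small B \<Longrightarrow> (\<And>a. a \<in> A \<Longrightarrow> g a \<in> K B) \<Longrightarrow> t \<in> K A \<Longrightarrow> bind T A B g t = b A B g t"
  unfolding T_def by (rule kleisli_bind) (rule small_K e_in b_in b_b b_e e_b b_cong; simp)+

text \<open>An operation becomes a term in the standard variables; \<open>\<psi>\<close> returns by
  evaluating at the generic valuation, which sends the variables to the projections. The two are
  mutually inverse, by \<open>\<psi>_\<chi>\<close> and \<open>\<psi>_inj\<close>.\<close>

definition \<chi> :: "nat \<Rightarrow> 'u \<Rightarrow> 'u" where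
  "\<chi> n \<theta> = nf (fin n) (code (\<theta> # map \<iota> [0..<n]))"

definition \<psi> :: "nat \<Rightarrow> 'u \<Rightarrow> 'u" where
  "\<psi> n u = ev n (\<lambda>x. proj L n (idx x)) u"

lemma \<chi>_term: "\<theta> \<in> ops n \<Longrightarrow> code (\<theta> # map \<iota> [0..<n]) \<in> terms (fin n)"
  by (rule termsI) auto

lemma \<chi>_in: "\<theta> \<in> ops n \<Longrightarrow> \<chi> n \<theta> \<in> K (fin n)"
  unfolding \<chi>_def by (rule nf_K[OF \<chi>_term])

lemma proj_idx: "x \<in> fin n \<Longrightarrow> proj L n (idx x) \<in> ops n"
  by (rule proj_hom[OF idx_fin])

lemma \<psi>_in: "u \<in> K (fin n) \<Longrightarrow> \<psi> n u \<in> ops n"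
  unfolding \<psi>_def by (erule K_ev_in) (rule proj_idx)

lemma ev_\<chi>: "\<theta> \<in> ops n \<Longrightarrow> (\<And>x. x \<in> fin n \<Longrightarrow> v x \<in> ops k) \<Longrightarrow>
    ev k v (\<chi> n \<theta>) = Cmp C \<theta> (tup k (map (\<lambda>i. v (\<iota> i)) [0..<n]))"
  unfolding \<chi>_def by (subst ev_nf[OF \<chi>_term]) (auto simp: comp_def)

lemma \<psi>_\<chi>: assumes "\<theta> \<in> ops n" shows "\<psi> n (\<chi> n \<theta>) = \<theta>"
proof -
  have "\<psi> n (\<chi> n \<theta>) = Cmp C \<theta> (tup n (map (proj L n) [0..<n]))"
    unfolding \<psi>_def by (subst ev_\<chi>[OF assms proj_idx]) simp_all
  then show ?thesis using Cmp_Idn[OF cat assms] tup_proj by simp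
qed

text \<open>Every valuation on \<open>fin n\<close> is the generic one followed by composition with
  the tuple of its values. So the single value \<open>\<psi> n u\<close> determines all others, and
  with them \<open>u\<close>.\<close>

lemma ev_\<psi>:
  assumes u: "u \<in> K (fin n)" and v: "\<And>x. x \<in> fin n \<Longrightarrow> v x \<in> ops k"
  shows "ev k v u = Cmp C (\<psi> n u) (tup k (map (\<lambda>i. v (\<iota> i)) [0..<n]))"
  using K_terms[OF u]
proof (rule termsE)
  fix \<theta> a assume t: "u = code (\<theta> # a)" "\<theta> \<in> ops (length a)" "set a \<subseteq> fin n"
  let ?p = "map (\<lambda>x. proj L n (idx x)) a" and ?v = "map (\<lambda>i. v (\<iota> i)) [0..<n]"
  have p: "set ?p \<subseteq> ops n" using t proj_hom by auto
  have vs: "set ?v \<subseteq> ops k" using v by auto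
  have h: "tup k ?v \<in> hom C (pow L k) (pow L n)" using tup_hom[OF vs] by simp
  have "Cmp C (proj L n (idx x)) (tup k ?v) = v x" if "x \<in> set a" for x
    using proj_tup[OF vs, of "idx x"] t(3) that by auto
  then have m: "map (\<lambda>x. Cmp C x (tup k ?v)) ?p = map v a" by simp
  have "Cmp C (\<psi> n u) (tup k ?v) = Cmp C \<theta> (tup k (map (\<lambda>x. Cmp C x (tup k ?v)) ?p))"
    unfolding \<psi>_def t(1) ev_code by (rule Cmp_tup_Cmp[OF _ p h]) (use t in simp)
  then show ?thesis unfolding m using t by simp
qed

lemma \<psi>_inj: assumes "u \<in> K (fin n)" "w \<in> K (fin n)" "\<psi> n u = \<psi> n w" shows "u = w"
  by (rule K_eqI[OF assms(1,2)]) (simp add: ev_\<psi>[OF assms(1)] ev_\<psi>[OF assms(2)] assms(3))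

lemma \<psi>_e: "i < n \<Longrightarrow> \<psi> n (e (fin n) (\<iota> i)) = proj L n i"
  unfolding \<psi>_def by (subst ev_e[OF _ proj_idx]) simp_all

text \<open>Substitution of terms is evaluated at the generic valuation by \<open>ev_b\<close>, and
  \<open>ev_\<psi>\<close> rewrites the result as a composite in \<open>L\<close>.\<close>

lemma \<psi>_lsub:
  assumes ts: "set ts \<subseteq> K (fin m)" and t: "t \<in> K (fin (length ts))"
  shows "\<psi> m (lsub T m ts t) = Cmp C (\<psi> (length ts) t) (tup m (map (\<psi> m) ts))"
proof -
  have g: "\<And>x. x \<in> fin (length ts) \<Longrightarrow> ts ! idx x \<in> K (fin m)" using ts by (auto simp: subset_iff nth_mem)
  have "\<psi> m (lsub T m ts t) = \<psi> m (b (fin (length ts)) (fin m) (\<lambda>x. ts ! idx x) t)"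
    unfolding lsub_def by (simp add: T_bind g t)
  also have "\<dots> = ev m (\<lambda>x. \<psi> m (ts ! idx x)) t"
    unfolding \<psi>_def by (rule ev_b[OF t g proj_idx])
  also have "\<dots> = Cmp C (\<psi> (length ts) t) (tup m (map (\<lambda>i. \<psi> m (ts ! idx (\<iota> i))) [0..<length ts]))"
    by (rule ev_\<psi>[OF t]) (rule \<psi>_in[OF g])
  also have "map (\<lambda>i. \<psi> m (ts ! idx (\<iota> i))) [0..<length ts] = map (\<lambda>i. \<psi> m (ts ! i)) [0..<length ts]"
    by simp
  also have "map (\<lambda>i. \<psi> m (ts ! i)) [0..<length ts] = map (\<psi> m) ts"
    by (rule nth_equalityI) auto
  finally show ?thesis .
qed

text \<open>A term carries its own support: it is its operation, read by \<open>\<chi>\<close> as an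
  element over \<open>fin n\<close>, applied to its finite list of variables. The two are compared
  by evaluation.\<close>

lemma T_finitary: "finitary_monad T"
  unfolding finitary_monad_def finitely_supported_def
proof (intro conjI T_monad allI impI ballI)
  fix A t assume A: "small A" and "t \<in> TO T A"
  then have t: "t \<in> K A" by (simp add: T_TO)
  from K_terms[OF t] obtain \<theta> a where ta: "t = code (\<theta> # a)" "\<theta> \<in> ops (length a)" "set a \<subseteq> A" by (rule termsE)
  let ?n = "length a" and ?s = "\<chi> (length a) \<theta>"
  note s = \<chi>_in[OF ta(2)]
  have aA: "\<And>i. i < ?n \<Longrightarrow> a ! i \<in> A" using ta(3) nth_mem by blast
  have g: "\<And>x. x \<in> fin ?n \<Longrightarrow> e A (a ! idx x) \<in> K A" using aA e_in by simp
  have "nmap T ?n A ((!) a) ?s = bind T (fin ?n) A (\<lambda>x. eta T A (a ! idx x)) ?s"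
    unfolding nmap_def by (rule bind_eta_tmap[OF T_monad small_fin A, symmetric]) (use aA s in \<open>auto simp: T_TO\<close>)
  also have "\<dots> = bind T (fin ?n) A (\<lambda>x. e A (a ! idx x)) ?s"
    by (rule bind_cong) (use aA T_eta[OF A] in auto)
  also have "\<dots> = b (fin ?n) A (\<lambda>x. e A (a ! idx x)) ?s" by (rule T_bind[OF small_fin A g s])
  also have "\<dots> = t"
  proof (rule K_eqI[OF b_in[OF s g] t])
    fix k v assume v: "\<And>x. x \<in> A \<Longrightarrow> v x \<in> ops k"
    have "ev k v (b (fin ?n) A (\<lambda>x. e A (a ! idx x)) ?s) = ev k (\<lambda>x. ev k v (e A (a ! idx x))) ?s"
      by (rule ev_b[OF s g v])
    also have "\<dots> = ev k (\<lambda>x. v (a ! idx x)) ?s"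
      by (rule ev_cong[OF K_terms[OF s]]) (use ev_e v aA in auto)
    also have "\<dots> = Cmp C \<theta> (tup k (map (\<lambda>i. v (a ! i)) [0..<?n]))"
      by (subst ev_\<chi>[OF ta(2)]) (use v aA in auto)
    also have "map (\<lambda>i. v (a ! i)) [0..<?n] = map v a" by (rule nth_equalityI) auto
    finally show "ev k v (b (fin ?n) A (\<lambda>x. e A (a ! idx x)) ?s) = ev k v t" by (simp add: ta)
  qed
  finally have "t = nmap T ?n A ((!) a) ?s" by simp
  then show "\<exists>n xs s. s \<in> TO T (fin n) \<and> (\<forall>i<n. xs i \<in> A) \<and> t = nmap T n A xs s"
    using s aA T_TO[OF small_fin] by blast
qed

text \<open>An entry of an arrow of \<open>law_of T\<close> is a term over \<open>fin m\<close>;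
  \<open>\<psi>\<close> makes it an operation of \<open>L\<close>, and these operations are
  tupled.\<close>

definition H :: "('u, 'u, 'u, 'u) cfunctor" where
  "H = \<lparr>FO = (\<lambda>x\<in>Obj (lcat (law_of T)). pow L (idx x)),
     FA = (\<lambda>f\<in>Arr (lcat (law_of T)). tup (idx (hd (decode f))) (map (\<psi> (idx (hd (decode f)))) (tl (decode f))))\<rparr>"

lemma H_sel: "FO H (\<iota> n) = pow L n"
  "set ts \<subseteq> K (fin m) \<Longrightarrow> FA H (code (\<iota> m # ts)) = tup m (map (\<psi> m) ts)"
  by (auto simp: H_def Arr_law_of T_TO)

lemma \<psi>s: "set ts \<subseteq> K (fin m) \<Longrightarrow> set (map (\<psi> m) ts) \<subseteq> ops m"
  using \<psi>_in by auto

lemma H_law_morphism: "is_law_morphism (law_of T) L H"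
  unfolding is_law_morphism_def
proof (intro conjI allI impI)
  show "is_functor (lcat (law_of T)) (lcat L) H"
  proof (rule is_functorI)
    fix f x y assume "f \<in> hom (lcat (law_of T)) x y"
    then obtain m ts where "x = \<iota> m" "y = \<iota> (length ts)" "f = code (\<iota> m # ts)" and ts: "set ts \<subseteq> K (fin m)"
      by (auto simp: hom_law_of T_TO)
    then show "FA H f \<in> hom C (FO H x) (FO H y)" using tup_hom[OF \<psi>s[OF ts]] by (simp add: H_sel)
  next
    fix x assume "x \<in> Obj (lcat (law_of T))"
    then obtain n where x: "x = \<iota> n" by auto
    let ?es = "map (\<lambda>i. eta T (fin n) (\<iota> i)) [0..<n]"
    have es: "?es = map (\<lambda>i. e (fin n) (\<iota> i)) [0..<n]" by (simp add: T_eta)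
    have "set ?es \<subseteq> K (fin n)" unfolding es using e_in by auto
    moreover have "map (\<psi> n) ?es = map (proj L n) [0..<n]" unfolding es by (simp add: \<psi>_e)
    ultimately show "FA H (Idn (lcat (law_of T)) x) = Idn C (FO H x)"
      using tup_proj[of n] by (simp add: x H_sel del: map_map)
  next
    fix f g x y z assume "f \<in> hom (lcat (law_of T)) x y" "g \<in> hom (lcat (law_of T)) y z"
    then obtain m ts us where f: "f = code (\<iota> m # ts)" and ts: "set ts \<subseteq> K (fin m)"
      and g: "g = code (\<iota> (length ts) # us)" and us: "set us \<subseteq> K (fin (length ts))"
      by (auto simp: hom_law_of T_TO)
    have "set (map (lsub T m ts) us) \<subseteq> K (fin m)"
      using lsub_in[OF T_monad, of ts m] ts us by (auto simp: T_TO)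
    then have "FA H (Cmp (lcat (law_of T)) g f) = tup m (map (\<psi> m) (map (lsub T m ts) us))"
      by (simp add: f g H_sel)
    also have "map (\<psi> m) (map (lsub T m ts) us) = map (\<lambda>x. Cmp C x (tup m (map (\<psi> m) ts))) (map (\<psi> (length ts)) us)"
      using \<psi>_lsub[OF ts] us by auto
    also have "tup m \<dots> = Cmp C (FA H g) (FA H f)"
      using tup_Cmp[OF \<psi>s[OF us], of "tup m (map (\<psi> m) ts)" m] tup_hom[OF \<psi>s[OF ts]] ts us
      by (simp add: f g H_sel)
    finally show "FA H (Cmp (lcat (law_of T)) g f) = Cmp C (FA H g) (FA H f)" .
  qed (use lawvere_theoryD(8)[OF L] in \<open>auto simp: H_def\<close>)
next
  fix n i assume i: "i < (n :: nat)"
  then show "FA H (proj (law_of T) n i) = proj L n i"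
    using tup_single[OF proj_hom[OF i]] e_in[of "\<iota> i" "fin n"] by (simp add: T_eta H_sel \<psi>_e)
qed (simp add: H_sel)

text \<open>Injective because tuples are determined by their components and \<open>\<psi>\<close> is
  injective; surjective because every arrow of \<open>L\<close> is the tuple of its composites with
  the projections, each of which is in the image of \<open>\<psi>\<close>.\<close>

lemma H_bij: "bij_betw (FA H) (Arr (lcat (law_of T))) (Arr C)"
  unfolding bij_betw_def
proof (intro conjI)
  show "inj_on (FA H) (Arr (lcat (law_of T)))"
  proof (rule inj_onI)
    fix f g assume "f \<in> Arr (lcat (law_of T))" "g \<in> Arr (lcat (law_of T))" and eq: "FA H f = FA H g"
    then obtain m ts n us where f: "f = code (\<iota> m # ts)" and ts: "set ts \<subseteq> K (fin m)"
      and g: "g = code (\<iota> n # us)" and us: "set us \<subseteq> K (fin n)" by (auto simp: Arr_law_of T_TO)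
    have eq: "tup m (map (\<psi> m) ts) = tup n (map (\<psi> n) us)" using eq f g ts us by (simp add: H_sel)
    then have mn: "m = n" "length ts = length us"
      using tup_hom[OF \<psi>s[OF ts]] tup_hom[OF \<psi>s[OF us]] lawvere_theoryD(3)[OF L] by (auto simp: hom_def)
    have "ts ! i = us ! i" if i: "i < length ts" for i
    proof (rule \<psi>_inj)
      show "ts ! i \<in> K (fin n)" "us ! i \<in> K (fin n)" using ts us mn i nth_mem by (auto simp: subset_iff)
      show "\<psi> n (ts ! i) = \<psi> n (us ! i)"
        using proj_tup[OF \<psi>s[OF ts], of i] proj_tup[OF \<psi>s[OF us], of i] eq mn i by simp
    qed
    then have "ts = us" using mn by (intro nth_equalityI) auto
    then show "f = g" by (simp add: f g mn)
  qed
next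
  have "f \<in> FA H ` Arr (lcat (law_of T))" if f: "f \<in> Arr C" for f
  proof -
    obtain m n where f: "f \<in> hom C (pow L m) (pow L n)"
      using hom_self[OF f] hom_Obj[OF cat hom_self[OF f]] lawvere_theoryD(4)[OF L] by auto
    let ?fs = "map (\<lambda>i. Cmp C (proj L n i) f) [0..<n]"
    have fs: "set ?fs \<subseteq> ops m" using Cmp_hom[OF cat f proj_hom] by auto
    have "tup m ?fs = f" by (rule tup_eqI[OF fs]) (use f in auto)
    moreover have "map (\<psi> m) (map (\<chi> m) ?fs) = ?fs" using fs \<psi>_\<chi> by auto
    moreover have ks: "set (map (\<chi> m) ?fs) \<subseteq> K (fin m)" using fs \<chi>_in by auto
    ultimately have "f = FA H (code (\<iota> m # map (\<chi> m) ?fs))" using H_sel(2)[OF ks] by (simp only:)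
    moreover have "code (\<iota> m # map (\<chi> m) ?fs) \<in> Arr (lcat (law_of T))" using ks by (auto simp: Arr_law_of T_TO)
    ultimately show ?thesis by blast
  qed
  moreover have "FA H f \<in> Arr C" if "f \<in> Arr (lcat (law_of T))" for f
    using hom_ArrD[OF functor_hom[OF law_morphismD(1)[OF H_law_morphism] hom_self[OF that]]] .
  ultimately show "FA H ` Arr (lcat (law_of T)) = Arr C" by blast
qed

end

context coded_universe
begin

lemma law_functor_surj:
  assumes L: "is_lawvere_theory small L"
  shows "\<exists>T\<in>Obj (Mnd\<^sub>f small). \<exists>h\<in>hom (Law small) (FO law_functor T) L. is_iso (Law small) h"
proof -
  interpret lawvere small code \<iota> L by unfold_locales (rule L)
  note M = is_lawvere_theory_law_of[OF T_monad]
  have "Arrow (law_of T) L H \<in> hom (Law small) (FO law_functor T) L"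
    using T_finitary M L H_law_morphism by (simp add: hom_Law)
  then show ?thesis using law_isomorphism[OF M L H_law_morphism H_bij] T_finitary by auto
qed

lemma is_equivalence_law_functor: "is_equivalence (Mnd\<^sub>f small) (Law small) law_functor"
proof (rule is_equivalence_fully_faithful_surj[OF is_category_Mnd is_category_Law is_functor_law_functor law_functor_faithful])
  fix S T h assume "S \<in> Obj (Mnd\<^sub>f small)" "T \<in> Obj (Mnd\<^sub>f small)" "h \<in> hom (Law small) (FO law_functor S) (FO law_functor T)"
  then show "\<exists>f\<in>hom (Mnd\<^sub>f small) S T. FA law_functor f = h" using law_functor_full by simp
next
  fix L assume "L \<in> Obj (Law small)"
  then show "\<exists>T\<in>Obj (Mnd\<^sub>f small). \<exists>h\<in>hom (Law small) (FO law_functor T) L. is_iso (Law small) h"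
    using law_functor_surj by simp
qed

end

section \<open>Models of Lawvere theories\<close>

lemma functor_category_sel [simp]:
  "Obj (functor_category C D) = {F. is_functor C D F}"
  "Dom (functor_category C D) = src" "Cod (functor_category C D) = trg"
  "Idn (functor_category C D) F = Arrow F F (\<lambda>x\<in>Obj C. Idn D (FO F x))"
  "Cmp (functor_category C D) \<beta> \<alpha> = Arrow (src \<alpha>) (trg \<beta>) (\<lambda>x\<in>Obj C. Cmp D (fn \<beta> x) (fn \<alpha> x))"
  by (simp_all add: functor_category_def)

lemma hom_functor_category: "h \<in> hom (functor_category C D) F G \<longleftrightarrow> (\<exists>\<tau>. h = Arrow F G \<tau> \<and> is_nat_trans C D F G \<tau>)"
  by (cases h) (auto simp: hom_def functor_category_def)

lemma is_nat_transD:
  assumes "is_nat_trans C D F G \<tau>"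
  shows "is_functor C D F" "is_functor C D G" "\<tau> \<in> extensional (Obj C)"
    "x \<in> Obj C \<Longrightarrow> \<tau> x \<in> hom D (FO F x) (FO G x)"
    "f \<in> hom C x y \<Longrightarrow> Cmp D (\<tau> y) (FA F f) = Cmp D (FA G f) (\<tau> x)"
  using assms by (auto simp: is_nat_trans_def hom_def)

lemma is_nat_transI:
  assumes C: "is_category C" and "is_functor C D F" "is_functor C D G" "\<tau> \<in> extensional (Obj C)"
    "\<And>x. x \<in> Obj C \<Longrightarrow> \<tau> x \<in> hom D (FO F x) (FO G x)"
    "\<And>f x y. f \<in> hom C x y \<Longrightarrow> Cmp D (\<tau> y) (FA F f) = Cmp D (FA G f) (\<tau> x)"
  shows "is_nat_trans C D F G \<tau>"
  using assms by (auto simp: is_nat_trans_def hom_self)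

lemma is_nat_trans_Cmp:
  assumes C: "is_category C" and D: "is_category D" and \<sigma>: "is_nat_trans C D F G \<sigma>" and \<tau>: "is_nat_trans C D G H \<tau>"
  shows "is_nat_trans C D F H (\<lambda>x\<in>Obj C. Cmp D (\<tau> x) (\<sigma> x))"
proof (rule is_nat_transI[OF C is_nat_transD(1)[OF \<sigma>] is_nat_transD(2)[OF \<tau>]])
  fix x assume x: "x \<in> Obj C"
  then show "(\<lambda>x\<in>Obj C. Cmp D (\<tau> x) (\<sigma> x)) x \<in> hom D (FO F x) (FO H x)"
    using Cmp_hom[OF D is_nat_transD(4)[OF \<sigma> x] is_nat_transD(4)[OF \<tau> x]] by simp
next
  fix f x y assume f: "f \<in> hom C x y"
  have o: "x \<in> Obj C" "y \<in> Obj C" using hom_Obj[OF C f] by auto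
  note s = is_nat_transD[OF \<sigma>] and t = is_nat_transD[OF \<tau>]
  note Ff = functor_hom[OF s(1) f] and Gf = functor_hom[OF s(2) f] and Hf = functor_hom[OF t(2) f]
  have "Cmp D (Cmp D (\<tau> y) (\<sigma> y)) (FA F f) = Cmp D (\<tau> y) (Cmp D (FA G f) (\<sigma> x))"
    using Cmp_assoc[OF D Ff s(4)[OF o(2)] t(4)[OF o(2)]] s(5)[OF f] by simp
  also have "\<dots> = Cmp D (FA H f) (Cmp D (\<tau> x) (\<sigma> x))"
    using Cmp_assoc[OF D s(4)[OF o(1)] Gf t(4)[OF o(2)]] Cmp_assoc[OF D s(4)[OF o(1)] t(4)[OF o(1)] Hf] t(5)[OF f] by simp
  finally show "Cmp D ((\<lambda>x\<in>Obj C. Cmp D (\<tau> x) (\<sigma> x)) y) (FA F f) = Cmp D (FA H f) ((\<lambda>x\<in>Obj C. Cmp D (\<tau> x) (\<sigma> x)) x)"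
    using o by simp
qed simp

lemma is_category_functor_category:
  assumes C: "is_category C" and D: "is_category D"
  shows "is_category (functor_category C D)"
proof (rule is_categoryI)
  fix f assume "f \<in> Arr (functor_category C D)"
  then show "Dom (functor_category C D) f \<in> Obj (functor_category C D) \<and> Cod (functor_category C D) f \<in> Obj (functor_category C D)"
    by (auto simp: functor_category_def is_nat_trans_def)
next
  fix F assume "F \<in> Obj (functor_category C D)"
  then show "Idn (functor_category C D) F \<in> hom (functor_category C D) F F"
    using is_nat_iso_identity[OF C D, of F] by (simp add: hom_functor_category is_nat_iso_def)
next
  fix f g x y z assume "f \<in> hom (functor_category C D) x y" "g \<in> hom (functor_category C D) y z"
  then show "Cmp (functor_category C D) g f \<in> hom (functor_category C D) x z"
    using is_nat_trans_Cmp[OF C D] by (auto simp: hom_functor_category)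
next
  fix f F G assume "f \<in> hom (functor_category C D) F G"
  then obtain \<tau> where f: "f = Arrow F G \<tau>" and \<tau>: "is_nat_trans C D F G \<tau>" by (auto simp: hom_functor_category)
  note t = is_nat_transD[OF \<tau>]
  have "(\<lambda>x\<in>Obj C. Cmp D (\<tau> x) (Idn D (FO F x))) = \<tau>" "(\<lambda>x\<in>Obj C. Cmp D (Idn D (FO G x)) (\<tau> x)) = \<tau>"
    by (rule extensionalityI[OF _ t(3)]; simp add: Cmp_Idn[OF D t(4)] Idn_Cmp[OF D t(4)])+
  then show "Cmp (functor_category C D) f (Idn (functor_category C D) F) = f"
    "Cmp (functor_category C D) (Idn (functor_category C D) G) f = f"
    by (simp_all add: f cong: restrict_cong)
next
  fix f g h x y z w
  assume "f \<in> hom (functor_category C D) x y" "g \<in> hom (functor_category C D) y z" "h \<in> hom (functor_category C D) z w"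
  then obtain \<rho> \<sigma> \<tau> where fgh: "f = Arrow x y \<rho>" "g = Arrow y z \<sigma>" "h = Arrow z w \<tau>" and
    n: "is_nat_trans C D x y \<rho>" "is_nat_trans C D y z \<sigma>" "is_nat_trans C D z w \<tau>"
    by (auto simp: hom_functor_category)
  have "Cmp D (\<tau> i) (Cmp D (\<sigma> i) (\<rho> i)) = Cmp D (Cmp D (\<tau> i) (\<sigma> i)) (\<rho> i)" if "i \<in> Obj C" for i
    using Cmp_assoc[OF D is_nat_transD(4)[OF n(1) that] is_nat_transD(4)[OF n(2) that] is_nat_transD(4)[OF n(3) that]] .
  then show "Cmp (functor_category C D) h (Cmp (functor_category C D) g f) = Cmp (functor_category C D) (Cmp (functor_category C D) h g) f"
    by (simp add: fgh cong: restrict_cong)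
qed

context coded_universe
begin

text \<open>An element of a set is a map from the one-element set \<open>fin 1\<close>, so a tuple
  of elements is a cone.\<close>

lemma set_product_tuple:
  assumes P: "is_product SET n A P \<pi>" and x: "\<And>i. i < n \<Longrightarrow> x i \<in> A i"
  shows "\<exists>q\<in>P. \<forall>i<n. fn (\<pi> i) q = x i"
proof -
  let ?f = "\<lambda>i. Arrow (fin 1) (A i) (\<lambda>_\<in>fin 1. x i)"
  have "?f i \<in> hom SET (fin 1) (A i)" if "i < n" for i
    using is_productD(2)[OF P that] x[OF that] by simp
  then obtain h where h: "h \<in> hom SET (fin 1) P" "\<And>i. i < n \<Longrightarrow> Cmp SET (\<pi> i) h = ?f i"
    using product_exists[OF P, of "fin 1" ?f] by auto
  have "fn (\<pi> i) (fn h (\<iota> 0)) = x i" if "i < n" for i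
    using h(2)[OF that] fn_Cmp_set_cat[OF h(1), of "\<iota> 0" "\<pi> i"] by simp
  moreover have "fn h (\<iota> 0) \<in> P" using hom_set_catD(7)[OF h(1)] by simp
  ultimately show ?thesis by blast
qed

lemma set_product_unique:
  assumes P: "is_product SET n A P \<pi>" and q: "q \<in> P" "q' \<in> P" and eq: "\<And>i. i < n \<Longrightarrow> fn (\<pi> i) q = fn (\<pi> i) q'"
  shows "q = q'"
proof -
  have sP: "small P" using is_productD(1)[OF P] by simp
  let ?h = "\<lambda>q. Arrow (fin 1) P (\<lambda>_\<in>fin 1. q)"
  have h: "?h q \<in> hom SET (fin 1) P" "?h q' \<in> hom SET (fin 1) P" using q sP by auto
  have "?h q = ?h q'"
  proof (rule product_unique[OF is_category_set_cat P h])
    fix i assume i: "i < n"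
    note pi = is_productD(3)[OF P i]
    show "Cmp SET (\<pi> i) (?h q) = Cmp SET (\<pi> i) (?h q')"
      by (rule set_arrow_eqI[OF Cmp_hom[OF is_category_set_cat h(1) pi] Cmp_hom[OF is_category_set_cat h(2) pi]])
        (simp add: fn_Cmp_set_cat[OF h(1)] fn_Cmp_set_cat[OF h(2)] eq[OF i] del: One_nat_def)
  qed
  then have "(\<lambda>_\<in>fin 1. q) (\<iota> 0) = (\<lambda>_\<in>fin 1. q') (\<iota> 0)" by simp
  then show ?thesis by simp
qed

lemma set_productI:
  assumes P: "small P" and \<pi>: "\<And>i. i < n \<Longrightarrow> \<pi> i \<in> hom SET P (A i)"
    and ex: "\<And>x. (\<And>i. i < n \<Longrightarrow> x i \<in> A i) \<Longrightarrow> \<exists>q\<in>P. \<forall>i<n. fn (\<pi> i) q = x i"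
    and un: "\<And>q q'. q \<in> P \<Longrightarrow> q' \<in> P \<Longrightarrow> (\<And>i. i < n \<Longrightarrow> fn (\<pi> i) q = fn (\<pi> i) q') \<Longrightarrow> q = q'"
  shows "is_product SET n A P \<pi>"
proof (rule is_productI)
  fix Q f assume "Q \<in> Obj SET" and f: "\<And>i. i < n \<Longrightarrow> f i \<in> hom SET Q (A i)"
  then have Q: "small Q" by simp
  have "\<forall>y\<in>Q. \<exists>q\<in>P. \<forall>i<n. fn (\<pi> i) q = fn (f i) y"
  proof
    fix y assume y: "y \<in> Q"
    show "\<exists>q\<in>P. \<forall>i<n. fn (\<pi> i) q = fn (f i) y" by (rule ex) (rule hom_set_catD(7)[OF f y])
  qed
  then obtain h where h: "\<And>y. y \<in> Q \<Longrightarrow> h y \<in> P \<and> (\<forall>i<n. fn (\<pi> i) (h y) = fn (f i) y)" by metis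
  have hh: "Arrow Q P (restrict h Q) \<in> hom SET Q P" using h P Q by auto
  have "Cmp SET (\<pi> i) (Arrow Q P (restrict h Q)) = f i" if i: "i < n" for i
    by (rule set_arrow_eqI[OF Cmp_hom[OF is_category_set_cat hh \<pi>[OF i]] f[OF i]])
      (simp add: fn_Cmp_set_cat[OF hh] h i)
  then show "\<exists>h\<in>hom SET Q P. \<forall>i<n. Cmp SET (\<pi> i) h = f i" using hh by blast
next
  fix Q h h' assume h: "h \<in> hom SET Q P" and h': "h' \<in> hom SET Q P"
    and eq: "\<And>i. i < n \<Longrightarrow> Cmp SET (\<pi> i) h = Cmp SET (\<pi> i) h'"
  show "h = h'"
  proof (rule set_arrow_eqI[OF h h'], rule un)
    fix y i assume "y \<in> Q" "i < n"
    then show "fn (\<pi> i) (fn h y) = fn (\<pi> i) (fn h' y)"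
      using eq[of i] fn_Cmp_set_cat[OF h, of y "\<pi> i"] fn_Cmp_set_cat[OF h', of y "\<pi> i"] by simp
  qed (use hom_set_catD(7)[OF h] hom_set_catD(7)[OF h'] in auto)
qed (use P hom_set_catD(4)[OF \<pi>] \<pi> in auto)

text \<open>Tests only the chosen powers of the generating object; \<open>Obj_Mod\<close> shows that
  this is membership in \<open>Mod\<close>.\<close>

definition is_model :: "'u lawvere \<Rightarrow> 'u model \<Rightarrow> bool" where
  "is_model L M \<longleftrightarrow> is_functor (lcat L) SET M \<and>
     (\<forall>n. is_product SET n (\<lambda>_. FO M (pow L 1)) (FO M (pow L n)) (\<lambda>i. FA M (proj L n i)))"

text \<open>A product of powers of \<open>X\<close> is a retract of a power, by a retraction compatible with the
  projections, so preserving the powers is enough.\<close>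

lemma is_model_preserves:
  assumes L: "is_lawvere_theory small L" and M: "is_model L M"
  shows "preserves_finite_products (lcat L) SET M"
  unfolding preserves_finite_products_def
proof (intro allI impI)
  fix n A P \<pi> assume P: "is_product (lcat L) n A P \<pi>"
  let ?C = "lcat L" and ?pr = "proj L"
  note C = lawvere_theoryD(1)[OF L] and pw = lawvere_theoryD(5)[OF L] and prh = lawvere_theoryD(7)[OF L]
  have Mf: "is_functor ?C SET M" and Mp: "\<And>n. is_product SET n (\<lambda>_. FO M (pow L 1)) (FO M (pow L n)) (\<lambda>i. FA M (?pr n i))"
    using M by (auto simp: is_model_def)
  have "\<forall>i<n. \<exists>d. A i = pow L d" using is_productD(2)[OF P] lawvere_theoryD(4)[OF L] by auto
  then obtain d where d: "\<And>i. i < n \<Longrightarrow> A i = pow L (d i)" by metis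
  obtain N r loc b where blocks: "power_blocks ?C (pow L) ?pr n d N r loc b" using ex_power_blocks[OF C pw] by blast
  note psk = power_blocksD(1,2)[OF blocks] and b0 = power_blocksD(4)[OF blocks]
    and l = power_blocksD(5)[OF blocks] and pb = power_blocksD(6)[OF blocks]
  have b: "b i \<in> hom ?C (pow L N) (A i)" if "i < n" for i using b0[OF that] d[OF that] by simp
  have prd: "?pr (d i) j \<in> hom ?C (A i) (pow L 1)" if "i < n" "j < d i" for i j
    using prh d that by simp
  obtain h where h: "h \<in> hom ?C (pow L N) P" and \<pi>h: "\<And>i. i < n \<Longrightarrow> Cmp ?C (\<pi> i) h = b i"
    using product_exists[OF P lawvere_theoryD(8)[OF L, of N], of b] b by auto
  note \<pi> = is_productD(3)[OF P]
  let ?g = "\<lambda>k. Cmp ?C (?pr (d (fst (r k))) (snd (r k))) (\<pi> (fst (r k)))"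
  have "?g k \<in> hom ?C P (pow L 1)" if "k < N" for k
    by (rule Cmp_hom[OF C \<pi> prd]) (use psk[OF that] in auto)
  then obtain h' where h': "h' \<in> hom ?C P (pow L N)" and ph': "\<And>k. k < N \<Longrightarrow> Cmp ?C (?pr N k) h' = ?g k"
    using product_exists[OF pw[of N] is_productD(1)[OF P], of ?g] by auto
  \<comment> \<open>\<open>P\<close> is a retract of the power \<open>pow L N\<close>:
    \<open>h\<close> collects the blocks, \<open>h'\<close> lists all coordinates of all factors,
    and the composite has the same projections as the identity.\<close>
  have hh': "Cmp ?C h h' = Idn ?C P"
  proof (rule product_unique[OF C P Cmp_hom[OF C h' h] Idn_hom[OF C is_productD(1)[OF P]]])
    fix i assume i: "i < n"
    have "Cmp ?C (b i) h' = \<pi> i"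
    proof (rule product_unique[OF C pw[of "d i"]])
      show "Cmp ?C (b i) h' \<in> hom ?C P (pow L (d i))" using Cmp_hom[OF C h' b[OF i]] d[OF i] by simp
      show "\<pi> i \<in> hom ?C P (pow L (d i))" using \<pi>[OF i] d[OF i] by simp
      fix j assume j: "j < d i"
      show "Cmp ?C (?pr (d i) j) (Cmp ?C (b i) h') = Cmp ?C (?pr (d i) j) (\<pi> i)"
        unfolding Cmp_assoc[OF C h' b[OF i] prd[OF i j]] pb[OF i j] using ph' l[OF i j] by simp
    qed
    then show "Cmp ?C (\<pi> i) (Cmp ?C h h') = Cmp ?C (\<pi> i) (Idn ?C P)"
      unfolding Cmp_assoc[OF C h' h \<pi>[OF i]] \<pi>h[OF i] using Cmp_Idn[OF C \<pi>[OF i]] by simp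
  qed
  have Mh': "fn (FA M h') q \<in> FO M (pow L N)" if "q \<in> FO M P" for q
    using hom_set_catD(7)[OF functor_hom[OF Mf h'] that] .
  show "is_product SET n (\<lambda>i. FO M (A i)) (FO M P) (\<lambda>i. FA M (\<pi> i))"
  proof (rule set_productI)
    show "small (FO M P)" using functor_Obj[OF Mf is_productD(1)[OF P]] by simp
    show "FA M (\<pi> i) \<in> hom SET (FO M P) (FO M (A i))" if "i < n" for i by (rule functor_hom[OF Mf \<pi>[OF that]])
  next
    fix x assume x: "\<And>i. i < n \<Longrightarrow> x i \<in> FO M (A i)"
    \<comment> \<open>The given entries are split into their coordinates, joined in the image of the
      power, and sent to the image of \<open>P\<close> by \<open>h\<close>.\<close>
    let ?y = "\<lambda>k. fn (FA M (?pr (d (fst (r k))) (snd (r k)))) (x (fst (r k)))"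
    have "?y k \<in> FO M (pow L 1)" if "k < N" for k
      by (rule hom_set_catD(7)[OF functor_hom[OF Mf prd] x]) (use psk[OF that] in auto)
    then obtain q where q: "q \<in> FO M (pow L N)" and Mq: "\<And>k. k < N \<Longrightarrow> fn (FA M (?pr N k)) q = ?y k"
      using set_product_tuple[OF Mp[of N], of ?y] by blast
    have "fn (FA M (\<pi> i)) (fn (FA M h) q) = x i" if i: "i < n" for i
    proof -
      have 1: "fn (FA M (\<pi> i)) (fn (FA M h) q) = fn (FA M (b i)) q"
        using functor_fn_Cmp[OF Mf h \<pi>[OF i] q] \<pi>h[OF i] by simp
      have "fn (FA M (b i)) q = x i"
      proof (rule set_product_unique[OF Mp[of "d i"]])
        show "fn (FA M (b i)) q \<in> FO M (pow L (d i))"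
          using hom_set_catD(7)[OF functor_hom[OF Mf b[OF i]] q] d[OF i] by simp
        show "x i \<in> FO M (pow L (d i))" using x[OF i] d[OF i] by simp
        fix j assume j: "j < d i"
        show "fn (FA M (?pr (d i) j)) (fn (FA M (b i)) q) = fn (FA M (?pr (d i) j)) (x i)"
          using functor_fn_Cmp[OF Mf b[OF i] prd[OF i j] q] pb[OF i j] Mq l[OF i j] by simp
      qed
      then show ?thesis using 1 by simp
    qed
    then show "\<exists>q\<in>FO M P. \<forall>i<n. fn (FA M (\<pi> i)) q = x i"
      using hom_set_catD(7)[OF functor_hom[OF Mf h] q] by blast
  next
    fix q q' assume q: "q \<in> FO M P" and q': "q' \<in> FO M P"
      and eq: "\<And>i. i < n \<Longrightarrow> fn (FA M (\<pi> i)) q = fn (FA M (\<pi> i)) q'"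
    \<comment> \<open>\<open>FA M h'\<close> is injective by \<open>hh'\<close>, and its coordinates
      factor through the projections \<open>\<pi> i\<close>, on which \<open>q\<close> and
      \<open>q'\<close> agree.\<close>
    have "fn (FA M h') q = fn (FA M h') q'"
    proof (rule set_product_unique[OF Mp[of N] Mh'[OF q] Mh'[OF q']])
      fix k assume k: "k < N"
      note p = \<pi>[OF psk(1)[OF k]] prd[OF psk[OF k]]
      show "fn (FA M (?pr N k)) (fn (FA M h') q) = fn (FA M (?pr N k)) (fn (FA M h') q')"
        using functor_fn_Cmp[OF Mf h' prh[OF k] q] functor_fn_Cmp[OF Mf h' prh[OF k] q'] ph'[OF k]
          functor_fn_Cmp[OF Mf p q] functor_fn_Cmp[OF Mf p q'] eq[OF psk(1)[OF k]] by simp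
    qed
    then have "fn (FA M (Cmp ?C h h')) q = fn (FA M (Cmp ?C h h')) q'"
      using functor_fn_Cmp[OF Mf h' h q] functor_fn_Cmp[OF Mf h' h q'] by simp
    then show "q = q'"
      using q q' unfolding hh' functor_Idn[OF Mf is_productD(1)[OF P]] by simp
  qed
qed

lemma Mod_sel [simp]:
  "Dom (Mod small L) = src" "Cod (Mod small L) = trg"
  "Idn (Mod small L) M = Arrow M M (\<lambda>x\<in>Obj (lcat L). Idn SET (FO M x))"
  "Cmp (Mod small L) \<beta> \<alpha> = Arrow (src \<alpha>) (trg \<beta>) (\<lambda>x\<in>Obj (lcat L). Cmp SET (fn \<beta> x) (fn \<alpha> x))"
  by (simp_all add: Mod_def)

context
  fixes L :: "'u lawvere"
  assumes L: "is_lawvere_theory small L"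
begin

lemma Obj_Mod: "M \<in> Obj (Mod small L) \<longleftrightarrow> is_model L M"
proof
  assume "M \<in> Obj (Mod small L)"
  then have "is_functor (lcat L) SET M" "preserves_finite_products (lcat L) SET M" by (auto simp: Mod_def)
  then show "is_model L M"
    using lawvere_theoryD(5)[OF L] unfolding is_model_def preserves_finite_products_def by blast
next
  assume "is_model L M"
  then show "M \<in> Obj (Mod small L)"
    using is_model_preserves[OF L, of M] by (auto simp: Mod_def is_model_def)
qed

lemma hom_Mod: "h \<in> hom (Mod small L) M N \<longleftrightarrow>
    (\<exists>\<tau>. h = Arrow M N \<tau> \<and> is_model L M \<and> is_model L N \<and> is_nat_trans (lcat L) SET M N \<tau>)"
proof -
  have "is_model L M \<longleftrightarrow> is_functor (lcat L) SET M \<and> preserves_finite_products (lcat L) SET M" for M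
    using Obj_Mod[of M] by (auto simp: Mod_def)
  then show ?thesis
    unfolding Mod_def hom_full_subcategory hom_functor_category by (auto dest: is_nat_transD(1,2))
qed

lemma is_category_Mod: "is_category (Mod small L)"
  unfolding Mod_def
  by (rule is_category_full_subcategory[OF is_category_functor_category[OF lawvere_theoryD(1)[OF L] is_category_set_cat]])

end

section \<open>Restriction of models along morphisms of theories\<close>

context
  fixes S T H
  assumes S: "is_lawvere_theory small S" and T: "is_lawvere_theory small T" and H: "is_law_morphism S T H"
begin

lemma is_model_restrict:
  assumes M: "is_model T M" shows "is_model S (comp_functor (lcat S) M H)"
  unfolding is_model_def
proof (intro conjI allI)
  have Mf: "is_functor (lcat T) SET M" using M by (simp add: is_model_def)
  show "is_functor (lcat S) SET (comp_functor (lcat S) M H)"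
    by (rule is_functor_comp_functor[OF lawvere_theoryD(1)[OF S] law_morphismD(1)[OF H] Mf])
  fix n
  have Mp: "is_product SET n (\<lambda>_. FO M (pow T 1)) (FO M (pow T n)) (\<lambda>i. FA M (proj T n i))"
    using M by (simp add: is_model_def)
  have 1: "FO (comp_functor (lcat S) M H) (pow S n) = FO M (pow T n)" for n
    using lawvere_theoryD(8)[OF S] law_morphismD(2)[OF H] by simp
  have 2: "FA (comp_functor (lcat S) M H) (proj S n i) = FA M (proj T n i)" if "i < n" for i
    using hom_ArrD[OF lawvere_theoryD(7)[OF S that]] law_morphismD(3)[OF H that] by simp
  show "is_product SET n (\<lambda>_. FO (comp_functor (lcat S) M H) (pow S 1))
      (FO (comp_functor (lcat S) M H) (pow S n)) (\<lambda>i. FA (comp_functor (lcat S) M H) (proj S n i))"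
    \<comment> \<open>The two families of projections agree only for \<open>i < n\<close>, so the
      product is rebuilt from its elements instead of being rewritten.\<close>
    unfolding 1
    by (rule set_productI)
      (use is_productD[OF Mp] set_product_tuple[OF Mp] set_product_unique[OF Mp] in \<open>auto simp: 2\<close>)
qed

lemma is_nat_trans_restrict:
  assumes \<tau>: "is_nat_trans (lcat T) SET M N \<tau>"
  shows "is_nat_trans (lcat S) SET (comp_functor (lcat S) M H) (comp_functor (lcat S) N H) (compose (Obj (lcat S)) \<tau> (FO H))"
proof -
  note C = lawvere_theoryD(1)[OF S] and Hf = law_morphismD(1)[OF H] and t = is_nat_transD[OF \<tau>]
  show ?thesis
  proof (rule is_nat_transI[OF C is_functor_comp_functor[OF C Hf t(1)] is_functor_comp_functor[OF C Hf t(2)]])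
    fix x assume x: "x \<in> Obj (lcat S)"
    then show "compose (Obj (lcat S)) \<tau> (FO H) x \<in> hom SET (FO (comp_functor (lcat S) M H) x) (FO (comp_functor (lcat S) N H) x)"
      using t(4)[OF functor_Obj[OF Hf x]] by (simp add: compose_def)
  next
    fix f x y assume f: "f \<in> hom (lcat S) x y"
    show "Cmp SET (compose (Obj (lcat S)) \<tau> (FO H) y) (FA (comp_functor (lcat S) M H) f) =
       Cmp SET (FA (comp_functor (lcat S) N H) f) (compose (Obj (lcat S)) \<tau> (FO H) x)"
      using t(5)[OF functor_hom[OF Hf f]] hom_Obj[OF C f] hom_ArrD[OF f] by (simp add: compose_def)
  qed simp
qed

lemma mod_restrict_FO: "is_model T M \<Longrightarrow>
    FO (mod_restrict small (Arrow S T H)) M = comp_functor (lcat S) M H"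
  by (simp add: mod_restrict_def Let_def Obj_Mod[OF T])

lemma mod_restrict_FA: "t \<in> hom (Mod small T) M N \<Longrightarrow>
    FA (mod_restrict small (Arrow S T H)) t =
      Arrow (comp_functor (lcat S) M H) (comp_functor (lcat S) N H) (compose (Obj (lcat S)) (fn t) (FO H))"
  by (auto simp: mod_restrict_def Let_def hom_def)

lemma mod_restrict_hom: "t \<in> hom (Mod small T) M N \<Longrightarrow>
    FA (mod_restrict small (Arrow S T H)) t \<in> hom (Mod small S) (comp_functor (lcat S) M H) (comp_functor (lcat S) N H)"
  unfolding mod_restrict_FA using is_model_restrict is_nat_trans_restrict by (auto simp: hom_Mod[OF S] hom_Mod[OF T] mod_restrict_FA)

lemma is_functor_mod_restrict: "is_functor (Mod small T) (Mod small S) (mod_restrict small (Arrow S T H))"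
proof (rule is_functorI)
  show "FO (mod_restrict small (Arrow S T H)) \<in> extensional (Obj (Mod small T))"
    "FA (mod_restrict small (Arrow S T H)) \<in> extensional (Arr (Mod small T))"
    by (simp_all add: mod_restrict_def Let_def)
next
  fix M assume "M \<in> Obj (Mod small T)"
  then have M: "is_model T M" by (simp add: Obj_Mod[OF T])
  show "FO (mod_restrict small (Arrow S T H)) M \<in> Obj (Mod small S)"
    using is_model_restrict[OF M] by (simp add: mod_restrict_FO[OF M] Obj_Mod[OF S])
  have i: "Idn (Mod small T) M \<in> hom (Mod small T) M M"
    by (rule Idn_hom[OF is_category_Mod[OF T]]) (simp add: Obj_Mod[OF T] M)
  show "FA (mod_restrict small (Arrow S T H)) (Idn (Mod small T) M) =
      Idn (Mod small S) (FO (mod_restrict small (Arrow S T H)) M)"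
    using functor_Obj[OF law_morphismD(1)[OF H]]
    unfolding mod_restrict_FA[OF i] mod_restrict_FO[OF M] by (auto simp: compose_def fun_eq_iff)
next
  fix t M N assume t: "t \<in> hom (Mod small T) M N"
  then have "is_model T M" "is_model T N" by (auto simp: hom_Mod[OF T])
  then show "FA (mod_restrict small (Arrow S T H)) t \<in> hom (Mod small S)
      (FO (mod_restrict small (Arrow S T H)) M) (FO (mod_restrict small (Arrow S T H)) N)"
    using mod_restrict_hom[OF t] by (simp add: mod_restrict_FO)
next
  fix s t M N P assume s: "s \<in> hom (Mod small T) M N" and t: "t \<in> hom (Mod small T) N P"
  note ts = Cmp_hom[OF is_category_Mod[OF T] s t]
  show "FA (mod_restrict small (Arrow S T H)) (Cmp (Mod small T) t s) =
      Cmp (Mod small S) (FA (mod_restrict small (Arrow S T H)) t) (FA (mod_restrict small (Arrow S T H)) s)"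
    using functor_Obj[OF law_morphismD(1)[OF H]]
    unfolding mod_restrict_FA[OF s] mod_restrict_FA[OF t] mod_restrict_FA[OF ts]
    by (auto simp: compose_def fun_eq_iff)
qed

end

text \<open>Precomposition is strictly functorial: composition of extensional functors is
  associative and unital up to equality.\<close>

lemma is_cat_valued_functor_Mod: "is_cat_valued_functor (Law small) (Mod_functor small)"
  unfolding is_cat_valued_functor_def
proof (intro conjI ballI impI)
  fix h assume "h \<in> Arr (Law small)"
  then obtain S T H where h: "h = Arrow S T H" and S: "is_lawvere_theory small S" and T: "is_lawvere_theory small T"
    and H: "is_law_morphism S T H"
    by (auto simp: Law_def)
  show "is_functor (fiber (Mod_functor small) (Cod (Law small) h)) (fiber (Mod_functor small) (Dom (Law small) h))
      (reindex (Mod_functor small) h)"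
    using is_functor_mod_restrict[OF S T H] by (simp add: h Mod_functor_def)
  fix k assume "k \<in> Arr (Law small)" "Cod (Law small) h = Dom (Law small) k"
  then obtain U K where k: "k = Arrow T U K" and U: "is_lawvere_theory small U" and K: "is_law_morphism T U K"
    using h by (auto simp: Law_def)
  note KH = is_law_morphism_comp[OF S H K]
  have "mod_restrict small (Arrow S U (comp_functor (lcat S) K H)) =
    comp_functor (Mod small U) (mod_restrict small h) (mod_restrict small k)"
    unfolding h k
  proof (rule functor_eqI[OF is_functor_mod_restrict[OF S U KH]
        is_functor_comp_functor[OF is_category_Mod[OF U] is_functor_mod_restrict[OF T U K] is_functor_mod_restrict[OF S T H]]])
    fix M assume M': "M \<in> Obj (Mod small U)"
    then have M: "is_model U M" by (simp add: Obj_Mod[OF U])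
    show "FO (mod_restrict small (Arrow S U (comp_functor (lcat S) K H))) M =
        FO (comp_functor (Mod small U) (mod_restrict small (Arrow S T H)) (mod_restrict small (Arrow T U K))) M"
      using M' comp_functor_assoc[OF law_morphismD(1)[OF H]]
      by (simp add: mod_restrict_FO[OF S U KH M] mod_restrict_FO[OF T U K M] mod_restrict_FO[OF S T H is_model_restrict[OF T U K M]])
  next
    fix t assume t': "t \<in> Arr (Mod small U)"
    obtain M N where t: "t \<in> hom (Mod small U) M N" using hom_self[OF t'] by blast
    note r = mod_restrict_hom[OF T U K t]
    have "compose (Obj (lcat S)) (fn t) (FO (comp_functor (lcat S) K H)) =
        compose (Obj (lcat S)) (compose (Obj (lcat T)) (fn t) (FO K)) (FO H)"
      using functor_Obj[OF law_morphismD(1)[OF H]] by (auto simp: compose_def fun_eq_iff)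
    then show "FA (mod_restrict small (Arrow S U (comp_functor (lcat S) K H))) t =
        FA (comp_functor (Mod small U) (mod_restrict small (Arrow S T H)) (mod_restrict small (Arrow T U K))) t"
      using t' by (simp add: comp_functor_assoc[OF law_morphismD(1)[OF H]] mod_restrict_FA[OF S U KH t] mod_restrict_FA[OF S T H r, unfolded mod_restrict_FA[OF T U K t]] mod_restrict_FA[OF T U K t])
  qed
  then show "reindex (Mod_functor small) (Cmp (Law small) k h) =
      comp_functor (fiber (Mod_functor small) (Cod (Law small) k)) (reindex (Mod_functor small) h) (reindex (Mod_functor small) k)"
    by (simp add: Mod_functor_def h k)
next
  fix L assume "L \<in> Obj (Law small)"
  then have L: "is_lawvere_theory small L" by simp
  show "is_category (fiber (Mod_functor small) L)" using is_category_Mod[OF L] by (simp add: Mod_functor_def)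
  note I = is_law_morphism_id[OF L]
  have "mod_restrict small (Arrow L L (id_functor (lcat L))) = id_functor (Mod small L)"
  proof (rule functor_eqI[OF is_functor_mod_restrict[OF L L I] is_functor_id_functor[OF is_category_Mod[OF L]]])
    fix M assume M': "M \<in> Obj (Mod small L)"
    then have M: "is_model L M" by (simp add: Obj_Mod[OF L])
    then have "is_functor (lcat L) SET M" by (simp add: is_model_def)
    then show "FO (mod_restrict small (Arrow L L (id_functor (lcat L)))) M = FO (id_functor (Mod small L)) M"
      using M' by (simp add: mod_restrict_FO[OF L L I M] comp_functor_id_right)
  next
    fix t assume t': "t \<in> Arr (Mod small L)"
    obtain M N where t: "t \<in> hom (Mod small L) M N" using hom_self[OF t'] by blast
    then obtain \<tau> where t1: "t = Arrow M N \<tau>" and \<tau>: "is_nat_trans (lcat L) SET M N \<tau>" by (auto simp: hom_Mod[OF L])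
    note n = is_nat_transD[OF \<tau>]
    have "compose (Obj (lcat L)) \<tau> (FO (id_functor (lcat L))) = \<tau>"
      using n(3) by (auto simp: compose_def fun_eq_iff extensional_def)
    then show "FA (mod_restrict small (Arrow L L (id_functor (lcat L)))) t = FA (id_functor (Mod small L)) t"
      unfolding mod_restrict_FA[OF L L I t] using t' by (simp add: t1 comp_functor_id_right[OF n(1)] comp_functor_id_right[OF n(2)])
  qed
  then show "reindex (Mod_functor small) (Idn (Law small) L) = id_functor (fiber (Mod_functor small) L)"
    by (simp add: Mod_functor_def)
qed (rule is_category_Law)

section \<open>Algebras of monads\<close>

definition is_alg :: "'u set_monad \<Rightarrow> 'u set \<Rightarrow> ('u \<Rightarrow> 'u) \<Rightarrow> bool" where
  "is_alg T A a \<longleftrightarrow> small A \<and> a \<in> TO T A \<rightarrow>\<^sub>E A \<and> (\<forall>x\<in>A. a (eta T A x) = x) \<and>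
     (\<forall>t\<in>TO T (TO T A). a (tmap T (TO T A) A a t) = a (mu T A t))"

lemma Alg_sel [simp]:
  "Dom (Alg C T) = src" "Cod (Alg C T) = trg" "Idn (Alg C T) X = Arrow X X (Idn C (fst X))"
  "Cmp (Alg C T) g f = Arrow (src f) (trg g) (Cmp C (fn g) (fn f))"
  "Obj (Alg C T) = {X. is_algebra C T X}"
  by (simp_all add: Alg_def)

context
  fixes T :: "'u set_monad"
  assumes T: "is_monad SET T"
begin

lemma is_algebra_iff: "is_algebra SET T X \<longleftrightarrow> (\<exists>A a. X = (A, Arrow (TO T A) A a) \<and> is_alg T A a)"
proof -
  have "is_algebra SET T (A, f) \<longleftrightarrow> f = Arrow (TO T A) A (fn f) \<and> is_alg T A (fn f)" for A f
  proof (cases "small A \<and> f \<in> hom SET (TO T A) A")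
    case False
    then show ?thesis
      using small_TO[OF T] by (auto simp: is_algebra_def is_alg_def TO_def hom_set_cat)
  next
    case True
    then have A: "small A" and f: "f \<in> hom SET (TO T A) A" by auto
    note C = is_category_set_cat and u = unit_hom[OF T A] and m = mult_hom[OF T A] and Ff = endo_hom[OF T f]
    have "Cmp SET f (unit T A) = Idn SET A \<longleftrightarrow> (\<forall>x\<in>A. fn f (eta T A x) = x)"
    proof
      assume "Cmp SET f (unit T A) = Idn SET A"
      then show "\<forall>x\<in>A. fn f (eta T A x) = x"
        using fn_Cmp_set_cat[OF u, of _ f] by (auto simp: eta_def)
    next
      assume "\<forall>x\<in>A. fn f (eta T A x) = x"
      then show "Cmp SET f (unit T A) = Idn SET A"
        by (intro set_arrow_eqI[OF Cmp_hom[OF C u f] Idn_hom[OF C]]) (use A in \<open>auto simp: fn_Cmp_set_cat[OF u] eta_def\<close>)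
    qed
    moreover have "Cmp SET f (FA (endo T) f) = Cmp SET f (mult T A) \<longleftrightarrow>
        (\<forall>t\<in>TO T (TO T A). fn f (tmap T (TO T A) A (fn f) t) = fn f (mu T A t))"
    proof
      assume eq: "Cmp SET f (FA (endo T) f) = Cmp SET f (mult T A)"
      show "\<forall>t\<in>TO T (TO T A). fn f (tmap T (TO T A) A (fn f) t) = fn f (mu T A t)"
      proof
        fix t assume t: "t \<in> TO T (TO T A)"
        have "fn (Cmp SET f (FA (endo T) f)) t = fn (Cmp SET f (mult T A)) t" using eq by simp
        then show "fn f (tmap T (TO T A) A (fn f) t) = fn f (mu T A t)"
          unfolding fn_Cmp_set_cat[OF Ff t] fn_Cmp_set_cat[OF m t] fn_endo[OF T f] mu_def .
      qed
    next
      assume "\<forall>t\<in>TO T (TO T A). fn f (tmap T (TO T A) A (fn f) t) = fn f (mu T A t)"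
      then show "Cmp SET f (FA (endo T) f) = Cmp SET f (mult T A)"
        by (intro set_arrow_eqI[OF Cmp_hom[OF C Ff f] Cmp_hom[OF C m f]])
          (simp add: fn_Cmp_set_cat[OF Ff] fn_Cmp_set_cat[OF m] fn_endo[OF T f] mu_def)
    qed
    moreover have "f = Arrow (TO T A) A (fn f)" "fn f \<in> TO T A \<rightarrow>\<^sub>E A" using hom_set_catD[OF f] by auto
    ultimately show ?thesis using A f by (auto simp: is_algebra_def is_alg_def TO_def)
  qed
  then show ?thesis by (cases X) force
qed

lemma hom_Alg: "h \<in> hom (Alg SET T) X Y \<longleftrightarrow>
    (\<exists>A a B b f. X = (A, Arrow (TO T A) A a) \<and> Y = (B, Arrow (TO T B) B b) \<and> is_alg T A a \<and> is_alg T B b \<and>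
       h = Arrow X Y (Arrow A B f) \<and> f \<in> A \<rightarrow>\<^sub>E B \<and> (\<forall>t\<in>TO T A. f (a t) = b (tmap T A B f t)))"
  (is "?l \<longleftrightarrow> ?r")
proof -
  have key: "Cmp SET g (Arrow (TO T A) A a) = Cmp SET (Arrow (TO T B) B b) (FA (endo T) g) \<longleftrightarrow>
      (\<forall>t\<in>TO T A. fn g (a t) = b (tmap T A B (fn g) t))"
    if a: "is_alg T A a" and b: "is_alg T B b" and g: "g \<in> hom SET A B" for A a B b g
  proof -
    note C = is_category_set_cat
    have ah: "Arrow (TO T A) A a \<in> hom SET (TO T A) A" and bh: "Arrow (TO T B) B b \<in> hom SET (TO T B) B"
      using a b small_TO[OF T] by (auto simp: is_alg_def)
    show ?thesis
    proof
      assume eq: "Cmp SET g (Arrow (TO T A) A a) = Cmp SET (Arrow (TO T B) B b) (FA (endo T) g)"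
      show "\<forall>t\<in>TO T A. fn g (a t) = b (tmap T A B (fn g) t)"
      proof
        fix t assume t: "t \<in> TO T A"
        have "fn (Cmp SET g (Arrow (TO T A) A a)) t = fn (Cmp SET (Arrow (TO T B) B b) (FA (endo T) g)) t" using eq by simp
        then show "fn g (a t) = b (tmap T A B (fn g) t)"
          unfolding fn_Cmp_set_cat[OF ah t] fn_Cmp_set_cat[OF endo_hom[OF T g] t] fn_endo[OF T g] by simp
      qed
    next
      assume "\<forall>t\<in>TO T A. fn g (a t) = b (tmap T A B (fn g) t)"
      then show "Cmp SET g (Arrow (TO T A) A a) = Cmp SET (Arrow (TO T B) B b) (FA (endo T) g)"
        by (intro set_arrow_eqI[OF Cmp_hom[OF C ah g] Cmp_hom[OF C endo_hom[OF T g] bh]])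
          (simp add: fn_Cmp_set_cat[OF ah] fn_Cmp_set_cat[OF endo_hom[OF T g]] fn_endo[OF T g])
    qed
  qed
  have "?l \<longleftrightarrow> (\<exists>g. h = Arrow X Y g \<and> is_algebra SET T X \<and> is_algebra SET T Y \<and> g \<in> hom SET (fst X) (fst Y) \<and>
      Cmp SET g (snd X) = Cmp SET (snd Y) (FA (endo T) g))"
    by (cases h) (auto simp: hom_def Alg_def)
  also have "\<dots> \<longleftrightarrow> (\<exists>A a B b g. X = (A, Arrow (TO T A) A a) \<and> Y = (B, Arrow (TO T B) B b) \<and> is_alg T A a \<and> is_alg T B b \<and>
       h = Arrow X Y g \<and> g \<in> hom SET A B \<and> (\<forall>t\<in>TO T A. fn g (a t) = b (tmap T A B (fn g) t)))"
    unfolding is_algebra_iff using key by fastforce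
  also have "\<dots> \<longleftrightarrow> ?r"
    unfolding hom_set_cat by (force simp: is_alg_def)
  finally show ?thesis .
qed

lemma is_category_Alg: "is_category (Alg SET T)"
proof (rule is_categoryI)
  fix f assume "f \<in> Arr (Alg SET T)"
  then show "Dom (Alg SET T) f \<in> Obj (Alg SET T) \<and> Cod (Alg SET T) f \<in> Obj (Alg SET T)"
    by (auto simp: Alg_def)
next
  fix X assume "X \<in> Obj (Alg SET T)"
  then obtain A a where "X = (A, Arrow (TO T A) A a)" and a: "is_alg T A a" by (auto simp: is_algebra_iff)
  moreover have "tmap T A A (\<lambda>x\<in>A. x) t = t" if "t \<in> TO T A" for t
    using tmap_cong[of A "\<lambda>x\<in>A. x" "\<lambda>x. x" T A t] tmap_id[OF T _ that] a by (simp add: is_alg_def)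
  moreover have "a t \<in> A" if "t \<in> TO T A" for t using a that by (auto simp: is_alg_def)
  ultimately show "Idn (Alg SET T) X \<in> hom (Alg SET T) X X"
    by (auto simp: hom_Alg Idn_set_cat)
next
  fix f g X Y Z assume "f \<in> hom (Alg SET T) X Y" "g \<in> hom (Alg SET T) Y Z"
  then obtain A a B b D d p q where X: "X = (A, Arrow (TO T A) A a)" "Y = (B, Arrow (TO T B) B b)" "Z = (D, Arrow (TO T D) D d)"
    and alg: "is_alg T A a" "is_alg T B b" "is_alg T D d" and f: "f = Arrow X Y (Arrow A B p)" and g: "g = Arrow Y Z (Arrow B D q)"
    and p: "p \<in> A \<rightarrow>\<^sub>E B" "\<And>t. t \<in> TO T A \<Longrightarrow> p (a t) = b (tmap T A B p t)"
    and q: "q \<in> B \<rightarrow>\<^sub>E D" "\<And>t. t \<in> TO T B \<Longrightarrow> q (b t) = d (tmap T B D q t)"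
    by (auto simp: hom_Alg)
  have sm: "small A" "small B" "small D" using alg by (auto simp: is_alg_def)
  have pB: "\<And>x. x \<in> A \<Longrightarrow> p x \<in> B" and qD: "\<And>x. x \<in> B \<Longrightarrow> q x \<in> D" using p(1) q(1) by auto
  have "compose A q p (a t) = d (tmap T A D (compose A q p) t)" if t: "t \<in> TO T A" for t
  proof -
    have "a t \<in> A" using alg(1) t by (auto simp: is_alg_def)
    then have "compose A q p (a t) = d (tmap T B D q (tmap T A B p t))"
      using p(2)[OF t] q(2)[OF tmap_in[OF T sm(1,2) pB t]] by (simp add: compose_def)
    also have "\<dots> = d (tmap T A D (compose A q p) t)"
      using tmap_tmap[OF T sm, of p q t] pB qD t tmap_cong[of A "\<lambda>a. q (p a)" "compose A q p" T D t] by (simp add: compose_def)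
    finally show ?thesis .
  qed
  moreover have "compose A q p \<in> A \<rightarrow>\<^sub>E D" by (rule compose_PiE[OF p(1) q(1)])
  ultimately show "Cmp (Alg SET T) g f \<in> hom (Alg SET T) X Z"
    using alg by (simp add: hom_Alg f g X Cmp_set_cat)
next
  fix f X Y assume "f \<in> hom (Alg SET T) X Y"
  then obtain A B p where f: "f = Arrow X Y p" "fst X = A" "fst Y = B" and p: "p \<in> hom SET A B"
    by (auto simp: hom_Alg is_alg_def)
  then show "Cmp (Alg SET T) f (Idn (Alg SET T) X) = f" "Cmp (Alg SET T) (Idn (Alg SET T) Y) f = f"
    using Cmp_Idn[OF is_category_set_cat p] Idn_Cmp[OF is_category_set_cat p] by auto
next
  fix f g h X Y Z W
  assume "f \<in> hom (Alg SET T) X Y" "g \<in> hom (Alg SET T) Y Z" "h \<in> hom (Alg SET T) Z W"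
  then obtain p q r where "f = Arrow X Y p" "g = Arrow Y Z q" "h = Arrow Z W r"
    and "p \<in> hom SET (fst X) (fst Y)" "q \<in> hom SET (fst Y) (fst Z)" "r \<in> hom SET (fst Z) (fst W)"
    by (auto simp: hom_Alg is_alg_def)
  then show "Cmp (Alg SET T) h (Cmp (Alg SET T) g f) = Cmp (Alg SET T) (Cmp (Alg SET T) h g) f"
    using Cmp_assoc[OF is_category_set_cat] by simp
qed

end

section \<open>Restriction of algebras along monad morphisms\<close>

context
  fixes S T \<sigma>
  assumes S: "is_monad SET S" and T: "is_monad SET T" and \<sigma>: "is_monad_morphism SET S T \<sigma>"
begin

text \<open>For associativity, naturality moves \<open>\<sigma>\<close> past \<open>tmap\<close>,
  associativity of \<open>a\<close> then turns the nested application into \<open>bind\<close>, and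
  the morphism law for \<open>bind\<close> along the identity produces
  \<open>mu S A t\<close>.\<close>

lemma is_alg_restrict:
  assumes a: "is_alg T A a"
  shows "is_alg S A (compose (TO S A) a (fn (\<sigma> A)))"
proof -
  have A: "small A" and aA: "\<And>t. t \<in> TO T A \<Longrightarrow> a t \<in> A" and a_eta: "\<And>x. x \<in> A \<Longrightarrow> a (eta T A x) = x"
    and a_mu: "\<And>t. t \<in> TO T (TO T A) \<Longrightarrow> a (tmap T (TO T A) A a t) = a (mu T A t)"
    using a by (auto simp: is_alg_def)
  let ?b = "compose (TO S A) a (fn (\<sigma> A))" and ?s = "fn (\<sigma> A)"
  note SA = small_TO[OF S A] and TA = small_TO[OF T A]
  have b: "?b t = a (?s t)" if "t \<in> TO S A" for t using that by (simp add: compose_def)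
  have bA: "?b t \<in> A" if "t \<in> TO S A" for t using b aA monad_morphism_in[OF \<sigma> A] that by simp
  have "?b (tmap S (TO S A) A ?b t) = ?b (mu S A t)" if t: "t \<in> TO S (TO S A)" for t
  proof -
    note ts = monad_morphism_in[OF \<sigma> SA t]
    have "?b (tmap S (TO S A) A ?b t) = a (tmap T (TO S A) A ?b (fn (\<sigma> (TO S A)) t))"
      using b[OF tmap_in[OF S SA A _ t, of ?b]] monad_morphism_tmap[OF S \<sigma> SA A _ t, of ?b] bA by simp
    also have "\<dots> = a (tmap T (TO S A) A (\<lambda>x. a (?s x)) (fn (\<sigma> (TO S A)) t))"
      using tmap_cong[of "TO S A" ?b "\<lambda>x. a (?s x)"] b by metis
    also have "\<dots> = a (tmap T (TO T A) A a (tmap T (TO S A) (TO T A) ?s (fn (\<sigma> (TO S A)) t)))"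
      by (subst tmap_tmap[OF T SA TA A monad_morphism_in[OF \<sigma> A] aA ts]) auto
    also have "\<dots> = a (bind T (TO S A) A ?s (fn (\<sigma> (TO S A)) t))"
      unfolding bind_def by (rule a_mu) (rule tmap_in[OF T SA TA monad_morphism_in[OF \<sigma> A] ts])
    also have "\<dots> = a (?s (mu S A t))"
      using monad_morphism_bind[OF S T \<sigma> SA A, of "\<lambda>x. x" t] t bind_id[OF S A t] by simp
    finally show ?thesis using b mu_in[OF S A t] by simp
  qed
  moreover have "?b (eta S A x) = x" if "x \<in> A" for x
    using b[OF eta_in[OF S A that]] monad_morphism_eta[OF S T \<sigma> A that] a_eta[OF that] by simp
  ultimately show ?thesis using A bA by (simp add: is_alg_def compose_def Pi_def extensional_def PiE_def)
qed

lemma alg_restrict_FO: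
  assumes "is_alg T A a"
  shows "FO (alg_restrict SET (Arrow S T \<sigma>)) (A, Arrow (TO T A) A a) =
    (A, Arrow (TO S A) A (compose (TO S A) a (fn (\<sigma> A))))"
proof -
  have "is_algebra SET T (A, Arrow (TO T A) A a)" using assms by (simp add: is_algebra_iff[OF T])
  moreover have "small A" using assms by (simp add: is_alg_def)
  ultimately show ?thesis
    using hom_set_catD[OF monad_morphism_hom[OF \<sigma>]] by (simp add: alg_restrict_def Let_def Cmp_set_cat)
qed

lemma alg_restrict_FA:
  "h \<in> hom (Alg SET T) X Y \<Longrightarrow> FA (alg_restrict SET (Arrow S T \<sigma>)) h =
    Arrow (FO (alg_restrict SET (Arrow S T \<sigma>)) X) (FO (alg_restrict SET (Arrow S T \<sigma>)) Y) (fn h)"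
  using hom_Obj[OF is_category_Alg[OF T], of h X Y] by (auto simp: alg_restrict_def Let_def hom_def)

lemma alg_restrict_hom:
  assumes h: "h \<in> hom (Alg SET T) X Y"
  shows "FA (alg_restrict SET (Arrow S T \<sigma>)) h \<in> hom (Alg SET S)
    (FO (alg_restrict SET (Arrow S T \<sigma>)) X) (FO (alg_restrict SET (Arrow S T \<sigma>)) Y)"
proof -
  obtain A a B b p where X: "X = (A, Arrow (TO T A) A a)" "Y = (B, Arrow (TO T B) B b)"
    and alg: "is_alg T A a" "is_alg T B b" and h': "h = Arrow X Y (Arrow A B p)"
    and p: "p \<in> A \<rightarrow>\<^sub>E B" "\<And>t. t \<in> TO T A \<Longrightarrow> p (a t) = b (tmap T A B p t)"
    using h by (auto simp: hom_Alg[OF T])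
  have sm: "small A" "small B" using alg by (auto simp: is_alg_def)
  have pB: "\<And>x. x \<in> A \<Longrightarrow> p x \<in> B" using p(1) by auto
  have "p (compose (TO S A) a (fn (\<sigma> A)) t) = compose (TO S B) b (fn (\<sigma> B)) (tmap S A B p t)" if t: "t \<in> TO S A" for t
    using t tmap_in[OF S sm pB t] p(2)[OF monad_morphism_in[OF \<sigma> sm(1) t]] monad_morphism_tmap[OF S \<sigma> sm pB t] by (simp add: compose_def)
  then show ?thesis
    unfolding alg_restrict_FA[OF h] unfolding X alg_restrict_FO[OF alg(1)] alg_restrict_FO[OF alg(2)] h'
    using is_alg_restrict[OF alg(1)] is_alg_restrict[OF alg(2)] p(1) by (simp add: hom_Alg[OF S])
qed

lemma is_functor_alg_restrict: "is_functor (Alg SET T) (Alg SET S) (alg_restrict SET (Arrow S T \<sigma>))"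
proof (rule is_functorI)
  show "FO (alg_restrict SET (Arrow S T \<sigma>)) \<in> extensional (Obj (Alg SET T))"
    "FA (alg_restrict SET (Arrow S T \<sigma>)) \<in> extensional (Arr (Alg SET T))"
    by (simp_all add: alg_restrict_def Let_def)
next
  fix X assume XO: "X \<in> Obj (Alg SET T)"
  then obtain A a where X: "X = (A, Arrow (TO T A) A a)" and a: "is_alg T A a" by (auto simp: is_algebra_iff[OF T])
  show "FO (alg_restrict SET (Arrow S T \<sigma>)) X \<in> Obj (Alg SET S)"
    unfolding X alg_restrict_FO[OF a] using is_alg_restrict[OF a] by (simp add: is_algebra_iff[OF S])
  show "FA (alg_restrict SET (Arrow S T \<sigma>)) (Idn (Alg SET T) X) = Idn (Alg SET S) (FO (alg_restrict SET (Arrow S T \<sigma>)) X)"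
    unfolding alg_restrict_FA[OF Idn_hom[OF is_category_Alg[OF T] XO]] unfolding X alg_restrict_FO[OF a] by simp
next
  fix f g X Y Z assume f: "f \<in> hom (Alg SET T) X Y" and g: "g \<in> hom (Alg SET T) Y Z"
  show "FA (alg_restrict SET (Arrow S T \<sigma>)) (Cmp (Alg SET T) g f) =
      Cmp (Alg SET S) (FA (alg_restrict SET (Arrow S T \<sigma>)) g) (FA (alg_restrict SET (Arrow S T \<sigma>)) f)"
    unfolding alg_restrict_FA[OF Cmp_hom[OF is_category_Alg[OF T] f g]] alg_restrict_FA[OF f] alg_restrict_FA[OF g] by simp
qed (rule alg_restrict_hom)

end

lemma is_cat_valued_functor_Alg: "is_cat_valued_functor (Mnd\<^sub>f small) (Alg_functor small)"
  unfolding is_cat_valued_functor_def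
proof (intro conjI ballI impI)
  fix h assume "h \<in> Arr (Mnd\<^sub>f small)"
  from hom_self[OF this] obtain S T \<sigma> where h: "h = Arrow S T \<sigma>" and S: "is_monad SET S" and T: "is_monad SET T"
    and \<sigma>: "is_monad_morphism SET S T \<sigma>"
    by (auto simp: hom_Mnd finitary_monadD)
  show "is_functor (fiber (Alg_functor small) (Cod (Mnd\<^sub>f small) h)) (fiber (Alg_functor small) (Dom (Mnd\<^sub>f small) h))
      (reindex (Alg_functor small) h)"
    using is_functor_alg_restrict[OF S T \<sigma>] by (simp add: h Alg_functor_def)
  fix k assume k0: "k \<in> Arr (Mnd\<^sub>f small)" "Cod (Mnd\<^sub>f small) h = Dom (Mnd\<^sub>f small) k"
  from hom_self[OF k0(1)] k0(2) obtain U \<tau> where k: "k = Arrow T U \<tau>" and U: "is_monad SET U" and \<tau>: "is_monad_morphism SET T U \<tau>"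
    by (auto simp: hom_Mnd finitary_monadD h)
  note \<tau>\<sigma> = is_monad_morphism_Cmp[OF S T U \<sigma> \<tau>]
  let ?m = "Arrow S U (\<lambda>A\<in>Obj SET. Cmp SET (\<tau> A) (\<sigma> A))"
  have FO: "FO (alg_restrict SET ?m) X = FO (alg_restrict SET (Arrow S T \<sigma>)) (FO (alg_restrict SET (Arrow T U \<tau>)) X)"
    if XO: "X \<in> Obj (Alg SET U)" for X
  proof -
    obtain A a where X: "X = (A, Arrow (TO U A) A a)" and a: "is_alg U A a" using XO by (auto simp: is_algebra_iff[OF U])
    have A: "small A" using a by (simp add: is_alg_def)
    have "compose (TO S A) a (fn (Cmp SET (\<tau> A) (\<sigma> A))) = compose (TO S A) (compose (TO T A) a (fn (\<tau> A))) (fn (\<sigma> A))"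
      using hom_set_catD(7)[OF monad_morphism_hom[OF \<sigma> A]] fn_Cmp_set_cat[OF monad_morphism_hom[OF \<sigma> A]]
      by (auto simp: compose_def fun_eq_iff)
    then show ?thesis
      unfolding X alg_restrict_FO[OF S U \<tau>\<sigma> a] alg_restrict_FO[OF T U \<tau> a] alg_restrict_FO[OF S T \<sigma> is_alg_restrict[OF T U \<tau> a]]
      using A by simp
  qed
  have "alg_restrict SET ?m = comp_functor (Alg SET U) (alg_restrict SET h) (alg_restrict SET k)"
    unfolding h k
  proof (rule functor_eqI[OF is_functor_alg_restrict[OF S U \<tau>\<sigma>]
        is_functor_comp_functor[OF is_category_Alg[OF U] is_functor_alg_restrict[OF T U \<tau>] is_functor_alg_restrict[OF S T \<sigma>]]])
    fix f assume f': "f \<in> Arr (Alg SET U)"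
    obtain X Y where f: "f \<in> hom (Alg SET U) X Y" using hom_self[OF f'] by blast
    show "FA (alg_restrict SET ?m) f = FA (comp_functor (Alg SET U) (alg_restrict SET (Arrow S T \<sigma>)) (alg_restrict SET (Arrow T U \<tau>))) f"
      unfolding alg_restrict_FA[OF S U \<tau>\<sigma> f] comp_functor_sel(2)[OF f'] alg_restrict_FA[OF S T \<sigma> alg_restrict_hom[OF T U \<tau> f]]
        FO[OF conjunct1[OF hom_Obj[OF is_category_Alg[OF U] f]]] FO[OF conjunct2[OF hom_Obj[OF is_category_Alg[OF U] f]]]
      unfolding alg_restrict_FA[OF T U \<tau> f] by simp
  next
    fix X assume X: "X \<in> Obj (Alg SET U)"
    show "FO (alg_restrict SET ?m) X = FO (comp_functor (Alg SET U) (alg_restrict SET (Arrow S T \<sigma>)) (alg_restrict SET (Arrow T U \<tau>))) X"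
      unfolding comp_functor_sel(1)[OF X] by (rule FO[OF X])
  qed
  then show "reindex (Alg_functor small) (Cmp (Mnd\<^sub>f small) k h) =
      comp_functor (fiber (Alg_functor small) (Cod (Mnd\<^sub>f small) k)) (reindex (Alg_functor small) h) (reindex (Alg_functor small) k)"
    by (simp add: Alg_functor_def h k)
next
  fix T assume "T \<in> Obj (Mnd\<^sub>f small)"
  then have T: "is_monad SET T" by (simp add: finitary_monadD)
  show "is_category (fiber (Alg_functor small) T)" using is_category_Alg[OF T] by (simp add: Alg_functor_def)
  note I = is_monad_morphism_Idn[OF T]
  let ?m = "Arrow T T (\<lambda>A\<in>Obj SET. Idn SET (FO (endo T) A))"
  have FO: "FO (alg_restrict SET ?m) X = X" if XO: "X \<in> Obj (Alg SET T)" for X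
  proof -
    obtain A a where X: "X = (A, Arrow (TO T A) A a)" and a: "is_alg T A a" using XO by (auto simp: is_algebra_iff[OF T])
    have "small A" "a \<in> extensional (TO T A)" using a by (auto simp: is_alg_def PiE_def)
    then have "compose (TO T A) a (fn ((\<lambda>A\<in>Obj SET. Idn SET (FO (endo T) A)) A)) = a"
      by (auto simp: compose_def fun_eq_iff extensional_def TO_def)
    then show ?thesis unfolding X alg_restrict_FO[OF T T I a] by simp
  qed
  have "alg_restrict SET ?m = id_functor (Alg SET T)"
  proof (rule functor_eqI[OF is_functor_alg_restrict[OF T T I] is_functor_id_functor[OF is_category_Alg[OF T]]])
    fix f assume f': "f \<in> Arr (Alg SET T)"
    obtain X Y where f: "f \<in> hom (Alg SET T) X Y" using hom_self[OF f'] by blast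
    have "f = Arrow X Y (fn f)" using f by (auto simp: hom_Alg[OF T])
    then show "FA (alg_restrict SET ?m) f = FA (id_functor (Alg SET T)) f"
      unfolding alg_restrict_FA[OF T T I f] id_functor_sel(2)[OF f']
        FO[OF conjunct1[OF hom_Obj[OF is_category_Alg[OF T] f]]] FO[OF conjunct2[OF hom_Obj[OF is_category_Alg[OF T] f]]]
      by simp
  next
    fix X assume X: "X \<in> Obj (Alg SET T)"
    show "FO (alg_restrict SET ?m) X = FO (id_functor (Alg SET T)) X"
      unfolding id_functor_sel(1)[OF X] by (rule FO[OF X])
  qed
  then show "reindex (Alg_functor small) (Idn (Mnd\<^sub>f small) T) = id_functor (fiber (Alg_functor small) T)"
    by (simp add: Alg_functor_def)
qed (rule is_category_Mnd)

end

section \<open>Strictly natural families of functors\<close>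

lemma is_cat_valued_functor_precomp:
  assumes C: "is_category C" and F: "is_functor C D F" and \<Phi>: "is_cat_valued_functor D \<Phi>"
  shows "is_cat_valued_functor C (precomp_cat_valued \<Phi> F)"
proof -
  have FA: "FA F f \<in> Arr D" "Dom D (FA F f) = FO F (Dom C f)" "Cod D (FA F f) = FO F (Cod C f)" if "f \<in> Arr C" for f
    using functor_hom[OF F hom_self[OF that]] by (auto simp: hom_def)
  show ?thesis
    unfolding is_cat_valued_functor_def
  proof (intro conjI ballI impI)
    fix f g assume fg: "f \<in> Arr C" "g \<in> Arr C" "Cod C f = Dom C g"
    have "FA F (Cmp C g f) = Cmp D (FA F g) (FA F f)"
      by (rule functor_Cmp[OF F hom_self[OF fg(1)]]) (simp add: hom_def fg)
    then show "reindex (precomp_cat_valued \<Phi> F) (Cmp C g f) =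
        comp_functor (fiber (precomp_cat_valued \<Phi> F) (Cod C g)) (reindex (precomp_cat_valued \<Phi> F) f) (reindex (precomp_cat_valued \<Phi> F) g)"
      using \<Phi> FA[OF fg(1)] FA[OF fg(2)] fg(3) by (simp add: is_cat_valued_functor_def precomp_cat_valued_def)
  next
    fix f assume f: "f \<in> Arr C"
    have "is_functor (fiber \<Phi> (Cod D (FA F f))) (fiber \<Phi> (Dom D (FA F f))) (reindex \<Phi> (FA F f))"
      using \<Phi> FA(1)[OF f] by (simp add: is_cat_valued_functor_def)
    then show "is_functor (fiber (precomp_cat_valued \<Phi> F) (Cod C f)) (fiber (precomp_cat_valued \<Phi> F) (Dom C f)) (reindex (precomp_cat_valued \<Phi> F) f)"
      using FA[OF f] by (simp add: precomp_cat_valued_def)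
  qed (use C \<Phi> functor_Obj[OF F] functor_Idn[OF F] in \<open>auto simp: is_cat_valued_functor_def precomp_cat_valued_def\<close>)
qed

text \<open>If the squares commute up to equality, identity cells do. They are restricted to the
  objects of the source fiber to be extensional, and coherence says that a composite of identities
  is an identity.\<close>

lemma is_pseudonatural_strict:
  assumes \<Phi>: "is_cat_valued_functor C \<Phi>" and \<Psi>: "is_cat_valued_functor C \<Psi>"
    and E: "\<And>x. x \<in> Obj C \<Longrightarrow> is_functor (fiber \<Phi> x) (fiber \<Psi> x) (E x)"
    and strict: "\<And>f x y. f \<in> hom C x y \<Longrightarrow>
      comp_functor (fiber \<Phi> y) (reindex \<Psi> f) (E y) = comp_functor (fiber \<Phi> y) (E x) (reindex \<Phi> f)"
  shows "is_pseudonatural C \<Phi> \<Psi> E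
    (\<lambda>f. \<lambda>a\<in>Obj (fiber \<Phi> (Cod C f)). Idn (fiber \<Psi> (Dom C f)) (FO (E (Dom C f)) (FO (reindex \<Phi> f) a)))"
    (is "is_pseudonatural _ _ _ _ ?\<theta>")
proof -
  have C: "is_category C" and cat\<Phi>: "\<And>x. x \<in> Obj C \<Longrightarrow> is_category (fiber \<Phi> x)" and cat\<Psi>: "\<And>x. x \<in> Obj C \<Longrightarrow> is_category (fiber \<Psi> x)"
    and r\<Phi>: "\<And>f. f \<in> Arr C \<Longrightarrow> is_functor (fiber \<Phi> (Cod C f)) (fiber \<Phi> (Dom C f)) (reindex \<Phi> f)"
    and r\<Psi>: "\<And>f. f \<in> Arr C \<Longrightarrow> is_functor (fiber \<Psi> (Cod C f)) (fiber \<Psi> (Dom C f)) (reindex \<Psi> f)"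
    and I\<Phi>: "\<And>x. x \<in> Obj C \<Longrightarrow> reindex \<Phi> (Idn C x) = id_functor (fiber \<Phi> x)"
    and C\<Phi>: "\<And>f g. f \<in> Arr C \<Longrightarrow> g \<in> Arr C \<Longrightarrow> Cod C f = Dom C g \<Longrightarrow>
        reindex \<Phi> (Cmp C g f) = comp_functor (fiber \<Phi> (Cod C g)) (reindex \<Phi> f) (reindex \<Phi> g)"
    using \<Phi> \<Psi> by (auto simp: is_cat_valued_functor_def)
  have o: "Dom C f \<in> Obj C" "Cod C f \<in> Obj C" if "f \<in> Arr C" for f using hom_Obj[OF C hom_self[OF that]] by auto
  show ?thesis
    unfolding is_pseudonatural_def
  proof (intro conjI ballI impI \<Phi> \<Psi> E)
    fix f assume f: "f \<in> Arr C"
    have EF: "is_functor (fiber \<Phi> (Cod C f)) (fiber \<Psi> (Dom C f)) (comp_functor (fiber \<Phi> (Cod C f)) (E (Dom C f)) (reindex \<Phi> f))"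
      by (rule is_functor_comp_functor[OF cat\<Phi>[OF o(2)[OF f]] r\<Phi>[OF f] E[OF o(1)[OF f]]])
    have "?\<theta> f = (\<lambda>a\<in>Obj (fiber \<Phi> (Cod C f)). Idn (fiber \<Psi> (Dom C f)) (FO (comp_functor (fiber \<Phi> (Cod C f)) (E (Dom C f)) (reindex \<Phi> f)) a))"
      by (rule restrict_ext) simp
    then show "is_nat_iso (fiber \<Phi> (Cod C f)) (fiber \<Psi> (Dom C f))
        (comp_functor (fiber \<Phi> (Cod C f)) (reindex \<Psi> f) (E (Cod C f)))
        (comp_functor (fiber \<Phi> (Cod C f)) (E (Dom C f)) (reindex \<Phi> f)) (?\<theta> f)"
      using is_nat_iso_identity[OF cat\<Phi>[OF o(2)[OF f]] cat\<Psi>[OF o(1)[OF f]] EF] strict[OF hom_self[OF f]] by simp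
  next
    fix x a assume x: "x \<in> Obj C" and a: "a \<in> Obj (fiber \<Phi> x)"
    have "Dom C (Idn C x) = x" "Cod C (Idn C x) = x" using Idn_hom[OF C x] by (auto simp: hom_def)
    then show "?\<theta> (Idn C x) a = Idn (fiber \<Psi> x) (FO (E x) a)" using a I\<Phi>[OF x] by simp
  next
    fix f g a assume f: "f \<in> Arr C" and g: "g \<in> Arr C" and fg: "Cod C f = Dom C g" and a: "a \<in> Obj (fiber \<Phi> (Cod C g))"
    let ?x = "Dom C f" and ?y = "Dom C g" and ?b = "FO (reindex \<Phi> g) a"
    have gf: "Dom C (Cmp C g f) = ?x" "Cod C (Cmp C g f) = Cod C g"
      using Cmp_hom[OF C hom_self[OF f], of g "Cod C g"] g fg by (auto simp: hom_def)
    have b: "?b \<in> Obj (fiber \<Phi> ?y)" using functor_Obj[OF r\<Phi>[OF g] a] .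
    let ?z = "FO (E ?x) (FO (reindex \<Phi> f) ?b)"
    have z: "?z \<in> Obj (fiber \<Psi> ?x)"
      by (rule functor_Obj[OF E[OF o(1)[OF f]]], rule functor_Obj[OF r\<Phi>[OF f]]) (use b fg in simp)
    have Eb: "FO (E ?y) ?b \<in> Obj (fiber \<Psi> ?y)" by (rule functor_Obj[OF E[OF o(1)[OF g]] b])
    \<comment> \<open>Strictness at the object \<open>?b\<close> shows that the two cells to be
      composed are identities of the same object \<open>?z\<close>.\<close>
    have "FO (comp_functor (fiber \<Phi> ?y) (reindex \<Psi> f) (E ?y)) ?b = FO (comp_functor (fiber \<Phi> ?y) (E ?x) (reindex \<Phi> f)) ?b"
      using strict[OF hom_self[OF f]] fg by simp
    then have s: "FO (reindex \<Psi> f) (FO (E ?y) ?b) = ?z" using b by simp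
    have "FA (reindex \<Psi> f) (?\<theta> g a) = Idn (fiber \<Psi> ?x) ?z"
      using functor_Idn[OF r\<Psi>[OF f], of "FO (E ?y) ?b"] Eb fg a s by simp
    moreover have "?\<theta> f ?b = Idn (fiber \<Psi> ?x) ?z" using b fg by simp
    moreover have "?\<theta> (Cmp C g f) a = Idn (fiber \<Psi> ?x) ?z" using a by (simp add: gf C\<Phi>[OF f g fg])
    ultimately show "?\<theta> (Cmp C g f) a = Cmp (fiber \<Psi> ?x) (?\<theta> f ?b) (FA (reindex \<Psi> f) (?\<theta> g a))"
      using Cmp_Idn[OF cat\<Psi>[OF o(1)[OF f]] Idn_hom[OF cat\<Psi>[OF o(1)[OF f]] z]] by simp
  qed
qed

section \<open>Algebras of a finitary monad are models of its theory\<close>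

text \<open>Naturality of the pointwise inverses follows by inserting an identity on one side of the
  square and cancelling on the other; it makes a pointwise bijective map of models invertible in
  \<open>Mod\<close>.\<close>

lemma nat_trans_inverse:
  assumes C: "is_category C" and D: "is_category D" and \<tau>: "is_nat_trans C D F G \<tau>"
    and iso: "\<And>x. x \<in> Obj C \<Longrightarrow> is_iso D (\<tau> x)"
  obtains \<sigma> where "is_nat_trans C D G F \<sigma>" "\<And>x. x \<in> Obj C \<Longrightarrow> Cmp D (\<sigma> x) (\<tau> x) = Idn D (FO F x)"
    "\<And>x. x \<in> Obj C \<Longrightarrow> Cmp D (\<tau> x) (\<sigma> x) = Idn D (FO G x)"
proof -
  note t = is_nat_transD[OF \<tau>]
  have "\<forall>x\<in>Obj C. \<exists>s\<in>hom D (FO G x) (FO F x). Cmp D s (\<tau> x) = Idn D (FO F x) \<and> Cmp D (\<tau> x) s = Idn D (FO G x)"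
    using is_isoE[OF iso t(4)] by metis
  then obtain s where s: "\<And>x. x \<in> Obj C \<Longrightarrow> s x \<in> hom D (FO G x) (FO F x)"
    and st: "\<And>x. x \<in> Obj C \<Longrightarrow> Cmp D (s x) (\<tau> x) = Idn D (FO F x)" and ts: "\<And>x. x \<in> Obj C \<Longrightarrow> Cmp D (\<tau> x) (s x) = Idn D (FO G x)"
    by metis
  have "is_nat_trans C D G F (\<lambda>x\<in>Obj C. s x)"
  proof (rule is_nat_transI[OF C t(2,1)])
    fix f x y assume f: "f \<in> hom C x y"
    have o: "x \<in> Obj C" "y \<in> Obj C" using hom_Obj[OF C f] by auto
    note Ff = functor_hom[OF t(1) f] and Gf = functor_hom[OF t(2) f]
    note sG = Cmp_hom[OF D Gf s[OF o(2)]]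
    have "Cmp D (s y) (FA G f) = Cmp D (Cmp D (s y) (FA G f)) (Cmp D (\<tau> x) (s x))"
      using ts[OF o(1)] Cmp_Idn[OF D sG] by simp
    also have "\<dots> = Cmp D (Cmp D (s y) (Cmp D (FA G f) (\<tau> x))) (s x)"
      using Cmp_assoc[OF D s[OF o(1)] t(4)[OF o(1)] sG] Cmp_assoc[OF D t(4)[OF o(1)] Gf s[OF o(2)]] by simp
    also have "\<dots> = Cmp D (FA F f) (s x)"
      using t(5)[OF f] Cmp_assoc[OF D Ff t(4)[OF o(2)] s[OF o(2)]] st[OF o(2)] Idn_Cmp[OF D Ff] by simp
    finally show "Cmp D ((\<lambda>x\<in>Obj C. s x) y) (FA G f) = Cmp D (FA F f) ((\<lambda>x\<in>Obj C. s x) x)" using o by simp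
  qed (auto simp: s)
  then show ?thesis using that st ts by simp
qed

context coded_universe
begin

lemma is_iso_set_cat:
  assumes f: "f \<in> hom SET A B" and inj: "inj_on (fn f) A" and surj: "fn f ` A = B"
  shows "is_iso SET f"
proof (rule is_isoI[OF f])
  note d = hom_set_catD[OF f]
  let ?g = "Arrow B A (restrict (inv_into A (fn f)) B)"
  show g: "?g \<in> hom SET B A" using d surj by (auto intro: inv_into_into)
  show "Cmp SET ?g f = Idn SET A"
    by (rule set_arrow_eqI[OF Cmp_hom[OF is_category_set_cat f g] Idn_hom[OF is_category_set_cat]])
      (use d inj in \<open>auto simp: fn_Cmp_set_cat[OF f]\<close>)
  show "Cmp SET f ?g = Idn SET B"
    by (rule set_arrow_eqI[OF Cmp_hom[OF is_category_set_cat g f] Idn_hom[OF is_category_set_cat]])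
      (use d surj in \<open>auto simp: fn_Cmp_set_cat[OF g] f_inv_into_f\<close>)
qed

section \<open>The model of an algebra\<close>

text \<open>Used for \<open>n = 1\<close> as well: the value of a model at \<open>\<iota> 1\<close>
  consists of codes of one-element lists and not of the elements of \<open>A\<close> themselves,
  which keeps all powers uniform.\<close>

definition tuples :: "'u set \<Rightarrow> nat \<Rightarrow> 'u set" where
  "tuples A n = code ` {xs. set xs \<subseteq> A \<and> length xs = n}"

lemma code_tuples [simp]: "code xs \<in> tuples A n \<longleftrightarrow> set xs \<subseteq> A \<and> length xs = n"
  by (auto simp: tuples_def)

lemma tuplesE: assumes "q \<in> tuples A n" obtains xs where "q = code xs" "set xs \<subseteq> A" "length xs = n"
  using assms by (auto simp: tuples_def)

lemma small_tuples: "small A \<Longrightarrow> small (tuples A n)"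
  unfolding tuples_def by (rule small_code_lists_length)

text \<open>The operation on \<open>A\<close> that the structure map \<open>a\<close> assigns to
  \<open>t\<close>, an element of \<open>T (fin n)\<close>.\<close>

definition interp :: "'u set_monad \<Rightarrow> 'u set \<Rightarrow> ('u \<Rightarrow> 'u) \<Rightarrow> 'u list \<Rightarrow> 'u \<Rightarrow> 'u" where
  "interp T A a xs t = a (nmap T (length xs) A ((!) xs) t)"

definition tuple_map :: "('u \<Rightarrow> 'u) \<Rightarrow> 'u set \<Rightarrow> 'u set \<Rightarrow> nat \<Rightarrow> 'u set_arrow" where
  "tuple_map p A B n = Arrow (tuples A n) (tuples B n) (\<lambda>q\<in>tuples A n. code (map p (decode q)))"

definition model_of :: "'u set_monad \<Rightarrow> 'u set \<times> 'u set_arrow \<Rightarrow> 'u model" where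
  "model_of T X = \<lparr>FO = (\<lambda>x\<in>Obj (lcat (law_of T)). tuples (fst X) (idx x)),
     FA = (\<lambda>f\<in>Arr (lcat (law_of T)).
       Arrow (tuples (fst X) (idx (hd (decode f)))) (tuples (fst X) (length (tl (decode f))))
         (\<lambda>q\<in>tuples (fst X) (idx (hd (decode f))).
            code (map (interp T (fst X) (fn (snd X)) (decode q)) (tl (decode f)))))\<rparr>"

lemma model_of_sel:
  "FO (model_of T (A, \<alpha>)) (\<iota> n) = tuples A n"
  "set ts \<subseteq> TO T (fin m) \<Longrightarrow> FA (model_of T (A, \<alpha>)) (code (\<iota> m # ts)) =
    Arrow (tuples A m) (tuples A (length ts)) (\<lambda>q\<in>tuples A m. code (map (interp T A (fn \<alpha>) (decode q)) ts))"
  by (auto simp: model_of_def Arr_law_of)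

lemma tuple_map_hom:
  assumes "small A" "small B" "\<And>x. x \<in> A \<Longrightarrow> p x \<in> B"
  shows "tuple_map p A B n \<in> hom SET (tuples A n) (tuples B n)"
proof -
  have "code (map p (decode q)) \<in> tuples B n" if "q \<in> tuples A n" for q
    using that by (rule tuplesE) (use assms(3) in \<open>auto simp: subset_iff\<close>)
  then show ?thesis using assms(1,2) by (simp add: tuple_map_def small_tuples)
qed

lemma tuple_map_code: "set xs \<subseteq> A \<Longrightarrow> length xs = n \<Longrightarrow> fn (tuple_map p A B n) (code xs) = code (map p xs)"
  by (simp add: tuple_map_def)

definition alg_model ::
    "'u set_monad \<Rightarrow> ('u set \<times> 'u set_arrow, ('u set, 'u set_arrow) alg_arrow, 'u model, 'u model_arrow) cfunctor" where
  "alg_model T = \<lparr>FO = (\<lambda>X\<in>Obj (Alg SET T). model_of T X),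
     FA = (\<lambda>h\<in>Arr (Alg SET T). Arrow (model_of T (src h)) (model_of T (trg h))
       (\<lambda>x\<in>Obj (lcat (law_of T)). tuple_map (fn (fn h)) (fst (src h)) (fst (trg h)) (idx x)))\<rparr>"

context
  fixes T :: "'u set_monad"
  assumes T: "is_monad SET T"
begin

context
  fixes A a
  assumes a: "is_alg T A a"
begin

lemma alg_small: "small A" and alg_in: "t \<in> TO T A \<Longrightarrow> a t \<in> A" and alg_eta: "x \<in> A \<Longrightarrow> a (eta T A x) = x"
  and alg_mu: "t \<in> TO T (TO T A) \<Longrightarrow> a (tmap T (TO T A) A a t) = a (mu T A t)"
  using a by (auto simp: is_alg_def)

lemma interp_in: "set xs \<subseteq> A \<Longrightarrow> t \<in> TO T (fin (length xs)) \<Longrightarrow> interp T A a xs t \<in> A"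
  unfolding interp_def by (rule alg_in, rule nmap_in[OF T alg_small]) (auto simp: subset_iff)

lemma interp_eta: "set xs \<subseteq> A \<Longrightarrow> i < length xs \<Longrightarrow> interp T A a xs (eta T (fin (length xs)) (\<iota> i)) = xs ! i"
  unfolding interp_def nmap_def using alg_small
  by (subst tmap_eta[OF T small_fin]) (auto simp: subset_iff alg_eta)

text \<open>The associativity law of an algebra in terms of \<open>bind\<close>: substituting and
  evaluating gives the same as evaluating what is substituted first.\<close>

lemma alg_bind:
  assumes X: "small X" and g: "\<And>x. x \<in> X \<Longrightarrow> g x \<in> TO T A" and t: "t \<in> TO T X"
  shows "a (bind T X A g t) = a (tmap T X A (\<lambda>x. a (g x)) t)"
proof -
  have "a (bind T X A g t) = a (tmap T (TO T A) A a (tmap T X (TO T A) g t))"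
    unfolding bind_def by (rule alg_mu[symmetric]) (rule tmap_in[OF T X small_TO[OF T alg_small] g t])
  also have "tmap T (TO T A) A a (tmap T X (TO T A) g t) = tmap T X A (\<lambda>x. a (g x)) t"
    by (rule tmap_tmap[OF T X small_TO[OF T alg_small] alg_small g alg_in t])
  finally show ?thesis .
qed

text \<open>This is what makes \<open>model_of\<close> respect composition: substitution in the
  theory becomes composition of the interpreted operations.\<close>

lemma interp_lsub:
  assumes xs: "set xs \<subseteq> A" and ts: "set ts \<subseteq> TO T (fin (length xs))" and u: "u \<in> TO T (fin (length ts))"
  shows "interp T A a xs (lsub T (length xs) ts u) = interp T A a (map (interp T A a xs) ts) u"
proof -
  have xA: "\<And>i. i < length xs \<Longrightarrow> xs ! i \<in> A" using xs by (auto simp: subset_iff)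
  have tT: "\<And>i. i < length ts \<Longrightarrow> ts ! i \<in> TO T (fin (length xs))" using ts by (auto simp: subset_iff)
  have "nmap T (length xs) A ((!) xs) (lsub T (length xs) ts u) =
      bind T (fin (length ts)) A (\<lambda>v. nmap T (length xs) A ((!) xs) (ts ! idx v)) u"
    unfolding lsub_def nmap_def by (rule tmap_bind[OF T small_fin small_fin alg_small _ _ u]) (use xA tT in auto)
  then have "interp T A a xs (lsub T (length xs) ts u) =
      a (tmap T (fin (length ts)) A (\<lambda>v. a (nmap T (length xs) A ((!) xs) (ts ! idx v))) u)"
    unfolding interp_def using alg_bind[OF small_fin _ u, of "\<lambda>v. nmap T (length xs) A ((!) xs) (ts ! idx v)"]
      nmap_in[OF T alg_small] xA tT by simp
  also have "\<dots> = interp T A a (map (interp T A a xs) ts) u"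
    unfolding interp_def nmap_def by simp (rule arg_cong[where f = a], rule tmap_cong, simp)
  finally show ?thesis .
qed

abbreviation (input) \<alpha> where "\<alpha> \<equiv> Arrow (TO T A) A a"

lemma model_of_code:
  "set ts \<subseteq> TO T (fin m) \<Longrightarrow> set xs \<subseteq> A \<Longrightarrow> length xs = m \<Longrightarrow>
    fn (FA (model_of T (A, \<alpha>)) (code (\<iota> m # ts))) (code xs) = code (map (interp T A a xs) ts)"
  by (simp add: model_of_sel)

lemma is_functor_model_of: "is_functor (lcat (law_of T)) SET (model_of T (A, \<alpha>))"
proof (rule is_functorI)
  have hom: "FA (model_of T (A, \<alpha>)) (code (\<iota> m # ts)) \<in> hom SET (tuples A m) (tuples A (length ts))"
    if ts: "set ts \<subseteq> TO T (fin m)" for m ts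
  proof -
    have "code (map (interp T A a (decode q)) ts) \<in> tuples A (length ts)" if "q \<in> tuples A m" for q
      using that by (rule tuplesE) (use interp_in ts in \<open>auto simp: subset_iff\<close>)
    then show ?thesis by (simp add: model_of_sel(2)[OF ts] small_tuples alg_small)
  qed
  {
    fix f x y assume "f \<in> hom (lcat (law_of T)) x y"
    then show "FA (model_of T (A, \<alpha>)) f \<in> hom SET (FO (model_of T (A, \<alpha>)) x) (FO (model_of T (A, \<alpha>)) y)"
      using hom by (auto simp: hom_law_of model_of_sel(1))
  next
    fix x assume "x \<in> Obj (lcat (law_of T))"
    then obtain n where x: "x = \<iota> n" by auto
    let ?es = "map (\<lambda>i. eta T (fin n) (\<iota> i)) [0..<n]"
    have es: "set ?es \<subseteq> TO T (fin n)" using eta_in[OF T small_fin] by auto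
    have "FA (model_of T (A, \<alpha>)) (code (\<iota> n # ?es)) = Idn SET (tuples A n)"
    proof (rule set_arrow_eqI[OF hom[OF es]])
      show "Idn SET (tuples A n) \<in> hom SET (tuples A n) (tuples A (length ?es))"
        using Idn_hom[OF is_category_set_cat, of "tuples A n"] small_tuples[OF alg_small] by simp
      fix q assume q: "q \<in> tuples A n"
      then obtain xs where xs: "q = code xs" "set xs \<subseteq> A" "length xs = n" by (rule tuplesE)
      have "map (interp T A a xs) ?es = xs"
        by (rule nth_equalityI) (use xs interp_eta[OF xs(2)] in auto)
      then show "fn (FA (model_of T (A, \<alpha>)) (code (\<iota> n # ?es))) q = fn (Idn SET (tuples A n)) q"
        using q model_of_code[OF es xs(2,3)] xs(1) by (simp del: map_map)
    qed
    then show "FA (model_of T (A, \<alpha>)) (Idn (lcat (law_of T)) x) = Idn SET (FO (model_of T (A, \<alpha>)) x)"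
      by (simp add: x model_of_sel(1))
  next
    fix f g x y z assume "f \<in> hom (lcat (law_of T)) x y" "g \<in> hom (lcat (law_of T)) y z"
    then obtain m ts us where f: "f = code (\<iota> m # ts)" and ts: "set ts \<subseteq> TO T (fin m)"
      and g: "g = code (\<iota> (length ts) # us)" and us: "set us \<subseteq> TO T (fin (length ts))" by (auto simp: hom_law_of)
    have ls: "set (map (lsub T m ts) us) \<subseteq> TO T (fin m)" using lsub_in[OF T ts] us by auto
    have "FA (model_of T (A, \<alpha>)) (code (\<iota> m # map (lsub T m ts) us)) =
      Cmp SET (FA (model_of T (A, \<alpha>)) g) (FA (model_of T (A, \<alpha>)) f)"
    proof (rule set_arrow_eqI[OF hom[OF ls]])
      show "Cmp SET (FA (model_of T (A, \<alpha>)) g) (FA (model_of T (A, \<alpha>)) f) \<in>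
          hom SET (tuples A m) (tuples A (length (map (lsub T m ts) us)))"
        using Cmp_hom[OF is_category_set_cat hom[OF ts] hom[OF us]] by (simp add: f g)
      fix q assume q: "q \<in> tuples A m"
      then obtain xs where xs: "q = code xs" "set xs \<subseteq> A" "length xs = m" by (rule tuplesE)
      have ys: "set (map (interp T A a xs) ts) \<subseteq> A" using interp_in[OF xs(2)] ts xs(3) by auto
      have "map (interp T A a xs) (map (lsub T m ts) us) = map (interp T A a (map (interp T A a xs) ts)) us"
        using interp_lsub[OF xs(2), of ts] ts us xs(3) by auto
      then show "fn (FA (model_of T (A, \<alpha>)) (code (\<iota> m # map (lsub T m ts) us))) q =
          fn (Cmp SET (FA (model_of T (A, \<alpha>)) g) (FA (model_of T (A, \<alpha>)) f)) q"
        unfolding f g fn_Cmp_set_cat[OF hom[OF ts] q] unfolding xs(1) model_of_code[OF ls xs(2,3)] model_of_code[OF ts xs(2,3)]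
        using model_of_code[OF us ys] by simp
    qed
    then show "FA (model_of T (A, \<alpha>)) (Cmp (lcat (law_of T)) g f) =
        Cmp SET (FA (model_of T (A, \<alpha>)) g) (FA (model_of T (A, \<alpha>)) f)"
      by (simp add: f g)
  }
qed (auto simp: model_of_def small_tuples alg_small)

lemma single_eta: "i < n \<Longrightarrow> set [eta T (fin n) (\<iota> i)] \<subseteq> TO T (fin n)"
  using eta_in[OF T small_fin] by simp

lemma model_of_proj:
  assumes "i < n" "set xs \<subseteq> A" "length xs = n"
  shows "fn (FA (model_of T (A, \<alpha>)) (code [\<iota> n, eta T (fin n) (\<iota> i)])) (code xs) = code [xs ! i]"
  using model_of_code[OF single_eta[OF assms(1)] assms(2,3)] interp_eta[OF assms(2), of i] assms by simp

text \<open>By the unit law of the algebra a projection is interpreted as a coordinate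
  (\<open>model_of_proj\<close>), and lists are determined by their coordinates.\<close>

lemma is_model_model_of: "is_model (law_of T) (model_of T (A, \<alpha>))"
  unfolding is_model_def
proof (intro conjI allI is_functor_model_of)
  fix n
  let ?M = "model_of T (A, \<alpha>)"
  have "is_product SET n (\<lambda>_. tuples A 1) (tuples A n) (\<lambda>i. FA ?M (code [\<iota> n, eta T (fin n) (\<iota> i)]))"
  proof (rule set_productI[OF small_tuples[OF alg_small]])
    fix i assume i: "i < n"
    have "code [\<iota> n, eta T (fin n) (\<iota> i)] \<in> hom (lcat (law_of T)) (\<iota> n) (\<iota> 1)"
      using single_eta[OF i] by (auto simp: hom_law_of)
    from functor_hom[OF is_functor_model_of this]
    show "FA ?M (code [\<iota> n, eta T (fin n) (\<iota> i)]) \<in> hom SET (tuples A n) (tuples A 1)" by (simp add: model_of_sel(1))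
  next
    fix x assume x: "\<And>i. i < n \<Longrightarrow> x i \<in> tuples A 1"
    have "\<exists>y\<in>A. x i = code [y]" if "i < n" for i
      using x[OF that] by (auto simp: tuples_def Suc_length_conv length_Suc_conv)
    then obtain y where y: "\<And>i. i < n \<Longrightarrow> y i \<in> A \<and> x i = code [y i]" by metis
    show "\<exists>q\<in>tuples A n. \<forall>i<n. fn (FA ?M (code [\<iota> n, eta T (fin n) (\<iota> i)])) q = x i"
    proof (intro bexI[of _ "code (map y [0..<n])"] allI impI)
      have s: "set (map y [0..<n]) \<subseteq> A" "length (map y [0..<n]) = n" using y by auto
      then show "code (map y [0..<n]) \<in> tuples A n" by simp
      fix i assume i: "i < n"
      show "fn (FA ?M (code [\<iota> n, eta T (fin n) (\<iota> i)])) (code (map y [0..<n])) = x i"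
        unfolding model_of_proj[OF i s] using i y by simp
    qed
  next
    fix q q' assume "q \<in> tuples A n" "q' \<in> tuples A n"
      and eq: "\<And>i. i < n \<Longrightarrow> fn (FA ?M (code [\<iota> n, eta T (fin n) (\<iota> i)])) q = fn (FA ?M (code [\<iota> n, eta T (fin n) (\<iota> i)])) q'"
    then obtain xs ys where xs: "q = code xs" "set xs \<subseteq> A" "length xs = n" and ys: "q' = code ys" "set ys \<subseteq> A" "length ys = n"
      by (auto elim!: tuplesE)
    have "xs ! i = ys ! i" if i: "i < n" for i
      using eq[OF i] unfolding xs(1) ys(1) model_of_proj[OF i xs(2,3)] model_of_proj[OF i ys(2,3)] by simp
    then show "q = q'" using xs ys by (auto intro: nth_equalityI)
  qed
  then show "is_product SET n (\<lambda>_. FO ?M (pow (law_of T) 1)) (FO ?M (pow (law_of T) n)) (\<lambda>i. FA ?M (proj (law_of T) n i))"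
    by (simp add: model_of_sel(1))
qed

end

lemma alg_model_FO: "is_alg T A a \<Longrightarrow> FO (alg_model T) (A, Arrow (TO T A) A a) = model_of T (A, Arrow (TO T A) A a)"
  by (simp add: alg_model_def is_algebra_iff[OF T])

lemma alg_model_FA:
  "h \<in> hom (Alg SET T) X Y \<Longrightarrow> FA (alg_model T) h =
    Arrow (model_of T X) (model_of T Y) (\<lambda>x\<in>Obj (lcat (law_of T)). tuple_map (fn (fn h)) (fst X) (fst Y) (idx x))"
  by (auto simp: alg_model_def hom_def)

lemmas law = is_lawvere_theory_law_of[OF T]

lemma hom_AlgE:
  assumes "h \<in> hom (Alg SET T) X Y"
  obtains A a B b p where "X = (A, Arrow (TO T A) A a)" "Y = (B, Arrow (TO T B) B b)" "is_alg T A a" "is_alg T B b"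
    "h = Arrow X Y (Arrow A B p)" "p \<in> A \<rightarrow>\<^sub>E B" "\<And>t. t \<in> TO T A \<Longrightarrow> p (a t) = b (tmap T A B p t)"
  using assms by (auto simp: hom_Alg[OF T])

lemma alg_model_hom:
  assumes h: "h \<in> hom (Alg SET T) X Y"
  shows "FA (alg_model T) h \<in> hom (Mod small (law_of T)) (model_of T X) (model_of T Y)"
  using h
proof (rule hom_AlgE)
  fix A a B b p
  assume X: "X = (A, Arrow (TO T A) A a)" "Y = (B, Arrow (TO T B) B b)" and a: "is_alg T A a" and b: "is_alg T B b"
    and h': "h = Arrow X Y (Arrow A B p)" and p: "p \<in> A \<rightarrow>\<^sub>E B" and pab: "\<And>t. t \<in> TO T A \<Longrightarrow> p (a t) = b (tmap T A B p t)"
  have A: "small A" and B: "small B" using a b by (auto simp: is_alg_def)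
  have pB: "\<And>x. x \<in> A \<Longrightarrow> p x \<in> B" using p by auto
  let ?M = "model_of T (A, Arrow (TO T A) A a)" and ?N = "model_of T (B, Arrow (TO T B) B b)"
  let ?\<tau> = "\<lambda>x\<in>Obj (lcat (law_of T)). tuple_map p A B (idx x)"
  have tm: "tuple_map p A B k \<in> hom SET (tuples A k) (tuples B k)" for k by (rule tuple_map_hom[OF A B pB])
  \<comment> \<open>A homomorphism commutes with every interpreted operation; this is naturality,
    one entry at a time.\<close>
  have interp: "p (interp T A a xs t) = interp T B b (map p xs) t" if xs: "set xs \<subseteq> A" and t: "t \<in> TO T (fin (length xs))" for xs t
  proof -
    have xA: "\<And>i. i < length xs \<Longrightarrow> xs ! i \<in> A" using xs by (auto simp: subset_iff)
    have "p (interp T A a xs t) = b (tmap T A B p (nmap T (length xs) A ((!) xs) t))"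
      unfolding interp_def by (rule pab) (rule nmap_in[OF T A xA t])
    also have "\<dots> = b (nmap T (length xs) B (\<lambda>i. p (xs ! i)) t)"
      using tmap_nmap[OF T A B, of "length xs" "(!) xs" p t] xA pB t by simp
    also have "\<dots> = interp T B b (map p xs) t"
      unfolding interp_def by simp (rule arg_cong[where f = b], rule nmap_cong, simp)
    finally show ?thesis .
  qed
  have "is_nat_trans (lcat (law_of T)) SET ?M ?N ?\<tau>"
  proof (rule is_nat_transI[OF is_category_law_of[OF T] is_functor_model_of[OF a] is_functor_model_of[OF b]])
    fix x assume "x \<in> Obj (lcat (law_of T))"
    then show "?\<tau> x \<in> hom SET (FO ?M x) (FO ?N x)" using tm by (auto simp: model_of_sel(1))
  next
    fix f x y assume f0: "f \<in> hom (lcat (law_of T)) x y"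
    then obtain m ts where x: "x = \<iota> m" "y = \<iota> (length ts)" and f: "f = code (\<iota> m # ts)" and ts: "set ts \<subseteq> TO T (fin m)"
      by (auto simp: hom_law_of)
    have Mf: "FA ?M f \<in> hom SET (tuples A m) (tuples A (length ts))" and Nf: "FA ?N f \<in> hom SET (tuples B m) (tuples B (length ts))"
      using functor_hom[OF is_functor_model_of[OF a] f0] functor_hom[OF is_functor_model_of[OF b] f0] x by (auto simp: model_of_sel(1))
    have "Cmp SET (tuple_map p A B (length ts)) (FA ?M f) = Cmp SET (FA ?N f) (tuple_map p A B m)"
    proof (rule set_arrow_eqI[OF Cmp_hom[OF is_category_set_cat Mf tm] Cmp_hom[OF is_category_set_cat tm Nf]])
      fix q assume q: "q \<in> tuples A m"
      then obtain xs where xs: "q = code xs" "set xs \<subseteq> A" "length xs = m" by (rule tuplesE)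
      have ys: "set (map (interp T A a xs) ts) \<subseteq> A" using interp_in[OF a xs(2)] ts xs(3) by auto
      have pxs: "set (map p xs) \<subseteq> B" "length (map p xs) = m" using pB xs by auto
      have "map p (map (interp T A a xs) ts) = map (interp T B b (map p xs)) ts" using interp[OF xs(2)] ts xs(3) by auto
      then show "fn (Cmp SET (tuple_map p A B (length ts)) (FA ?M f)) q = fn (Cmp SET (FA ?N f) (tuple_map p A B m)) q"
        unfolding fn_Cmp_set_cat[OF Mf q] fn_Cmp_set_cat[OF tm q] unfolding xs(1) f model_of_code[OF a ts xs(2,3)]
          tuple_map_code[OF xs(2,3)] model_of_code[OF b ts pxs]
        using tuple_map_code[OF ys, of "length ts" p B] by simp
    qed
    then show "Cmp SET (?\<tau> y) (FA ?M f) = Cmp SET (FA ?N f) (?\<tau> x)" using x by simp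
  qed simp
  then show ?thesis
    unfolding alg_model_FA[OF h] using is_model_model_of[OF a] is_model_model_of[OF b]
    by (simp add: X h' hom_Mod[OF law])
qed

lemma is_functor_alg_model: "is_functor (Alg SET T) (Mod small (law_of T)) (alg_model T)"
proof (rule is_functorI)
  show "FO (alg_model T) \<in> extensional (Obj (Alg SET T))" "FA (alg_model T) \<in> extensional (Arr (Alg SET T))"
    by (simp_all add: alg_model_def)
next
  fix X assume XO: "X \<in> Obj (Alg SET T)"
  then obtain A a where X: "X = (A, Arrow (TO T A) A a)" and a: "is_alg T A a" by (auto simp: is_algebra_iff[OF T])
  show "FO (alg_model T) X \<in> Obj (Mod small (law_of T))"
    unfolding X alg_model_FO[OF a] Obj_Mod[OF law] by (rule is_model_model_of[OF a])
  have A: "small A" using a by (simp add: is_alg_def)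
  have "tuple_map (fn (Idn SET A)) A A n = Idn SET (tuples A n)" for n
  proof (rule set_arrow_eqI[OF tuple_map_hom[OF A A] Idn_hom[OF is_category_set_cat]])
    fix q assume q: "q \<in> tuples A n"
    then obtain xs where xs: "q = code xs" "set xs \<subseteq> A" "length xs = n" by (rule tuplesE)
    have "map (fn (Idn SET A)) xs = xs" using xs(2) by (intro map_idI) auto
    then show "fn (tuple_map (fn (Idn SET A)) A A n) q = fn (Idn SET (tuples A n)) q"
      using q tuple_map_code[OF xs(2,3), of "fn (Idn SET A)" A] xs(1) by simp
  qed (use A small_tuples in auto)
  then show "FA (alg_model T) (Idn (Alg SET T) X) = Idn (Mod small (law_of T)) (FO (alg_model T) X)"
    unfolding alg_model_FA[OF Idn_hom[OF is_category_Alg[OF T] XO]] unfolding X alg_model_FO[OF a]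
    by (auto simp: model_of_def restrict_def fun_eq_iff)
next
  fix h X Y assume h: "h \<in> hom (Alg SET T) X Y"
  have "FO (alg_model T) X = model_of T X" "FO (alg_model T) Y = model_of T Y"
    using hom_Obj[OF is_category_Alg[OF T] h] by (auto simp: alg_model_def)
  then show "FA (alg_model T) h \<in> hom (Mod small (law_of T)) (FO (alg_model T) X) (FO (alg_model T) Y)"
    using alg_model_hom[OF h] by simp
next
  fix f g X Y Z assume f: "f \<in> hom (Alg SET T) X Y" and g: "g \<in> hom (Alg SET T) Y Z"
  obtain A B D p q where X: "fst X = A" "fst Y = B" "fst Z = D" and sm: "small A" "small B" "small D"
    and fg: "f = Arrow X Y (Arrow A B p)" "g = Arrow Y Z (Arrow B D q)" and p: "p \<in> A \<rightarrow>\<^sub>E B" and q: "q \<in> B \<rightarrow>\<^sub>E D"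
    using f g by (auto simp: hom_Alg[OF T] is_alg_def)
  have pq: "\<And>x. x \<in> A \<Longrightarrow> p x \<in> B" "\<And>x. x \<in> B \<Longrightarrow> q x \<in> D" using p q by auto
  have tp: "tuple_map p A B k \<in> hom SET (tuples A k) (tuples B k)" for k by (rule tuple_map_hom[OF sm(1,2) pq(1)])
  have tq: "tuple_map q B D k \<in> hom SET (tuples B k) (tuples D k)" for k by (rule tuple_map_hom[OF sm(2,3) pq(2)])
  have "tuple_map (compose A q p) A D n = Cmp SET (tuple_map q B D n) (tuple_map p A B n)" for n
  proof (rule set_arrow_eqI[OF tuple_map_hom[OF sm(1,3)] Cmp_hom[OF is_category_set_cat tp tq]])
    fix r assume r: "r \<in> tuples A n"
    then obtain xs where xs: "r = code xs" "set xs \<subseteq> A" "length xs = n" by (rule tuplesE)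
    have pxs: "set (map p xs) \<subseteq> B" "length (map p xs) = n" using xs pq by auto
    have "map (compose A q p) xs = map q (map p xs)" using xs(2) by (auto simp: compose_def)
    then show "fn (tuple_map (compose A q p) A D n) r = fn (Cmp SET (tuple_map q B D n) (tuple_map p A B n)) r"
      unfolding fn_Cmp_set_cat[OF tp r] unfolding xs(1) tuple_map_code[OF xs(2,3)] tuple_map_code[OF pxs] by simp
  qed (use pq in \<open>auto simp: compose_def\<close>)
  then show "FA (alg_model T) (Cmp (Alg SET T) g f) = Cmp (Mod small (law_of T)) (FA (alg_model T) g) (FA (alg_model T) f)"
    unfolding alg_model_FA[OF f] alg_model_FA[OF g] alg_model_FA[OF Cmp_hom[OF is_category_Alg[OF T] f g]]
    by (auto simp: fg X Cmp_set_cat restrict_def fun_eq_iff)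
qed

section \<open>Algebras and models are equivalent\<close>

lemma alg_model_faithful: "inj_on (FA (alg_model T)) (hom (Alg SET T) X Y)"
proof (rule inj_onI)
  fix f g assume f: "f \<in> hom (Alg SET T) X Y" and g: "g \<in> hom (Alg SET T) X Y" and eq: "FA (alg_model T) f = FA (alg_model T) g"
  obtain A B p q where X: "fst X = A" "fst Y = B" and fg: "f = Arrow X Y (Arrow A B p)" "g = Arrow X Y (Arrow A B q)"
    and p: "p \<in> A \<rightarrow>\<^sub>E B" and q: "q \<in> A \<rightarrow>\<^sub>E B"
    using f g by (auto simp: hom_Alg[OF T])
  have "(\<lambda>x\<in>Obj (lcat (law_of T)). tuple_map p A B (idx x)) (\<iota> 1) = (\<lambda>x\<in>Obj (lcat (law_of T)). tuple_map q A B (idx x)) (\<iota> 1)"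
    using eq unfolding alg_model_FA[OF f] alg_model_FA[OF g] by (simp add: fg X)
  then have "tuple_map p A B 1 = tuple_map q A B 1" by simp
  then have "p x = q x" if "x \<in> A" for x
    using tuple_map_code[of "[x]" A 1 p B] tuple_map_code[of "[x]" A 1 q B] that by simp
  then have "p = q" by (rule PiE_ext[OF p q])
  then show "f = g" by (simp add: fg)
qed

lemma law_of_single: "t \<in> TO T (fin n) \<Longrightarrow> code [\<iota> n, t] \<in> hom (lcat (law_of T)) (\<iota> n) (\<iota> 1)"
  by (auto simp: hom_law_of)

text \<open>The component at \<open>\<iota> 1\<close> gives a map \<open>p\<close> of carriers.
  Naturality against projections makes the other components coordinatewise \<open>p\<close>, and
  naturality against operations makes \<open>p\<close> a homomorphism, as finite support reaches
  every element of \<open>T A\<close>.\<close>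

lemma alg_model_full:
  assumes fin: "finitely_supported T" and X: "X \<in> Obj (Alg SET T)" and Y: "Y \<in> Obj (Alg SET T)"
    and g: "g \<in> hom (Mod small (law_of T)) (FO (alg_model T) X) (FO (alg_model T) Y)"
  shows "\<exists>f\<in>hom (Alg SET T) X Y. FA (alg_model T) f = g"
proof -
  obtain A a B b where X: "X = (A, Arrow (TO T A) A a)" and a: "is_alg T A a" and Y: "Y = (B, Arrow (TO T B) B b)" and b: "is_alg T B b"
    using X Y by (auto simp: is_algebra_iff[OF T])
  let ?M = "model_of T (A, Arrow (TO T A) A a)" and ?N = "model_of T (B, Arrow (TO T B) B b)"
  have A: "small A" and B: "small B" using a b by (auto simp: is_alg_def)
  obtain \<tau> where g: "g = Arrow ?M ?N \<tau>" and \<tau>: "is_nat_trans (lcat (law_of T)) SET ?M ?N \<tau>"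
    using g unfolding X Y alg_model_FO[OF a] alg_model_FO[OF b] by (auto simp: hom_Mod[OF law])
  note n = is_nat_transD[OF \<tau>]
  have \<tau>h: "\<tau> (\<iota> k) \<in> hom SET (tuples A k) (tuples B k)" for k using n(4)[of "\<iota> k"] by (simp add: model_of_sel(1))
  have nat: "fn (\<tau> (\<iota> 1)) (fn (FA ?M f) q) = fn (FA ?N f) (fn (\<tau> (\<iota> k)) q)"
    if f: "f \<in> hom (lcat (law_of T)) (\<iota> k) (\<iota> 1)" and q: "q \<in> tuples A k" for f k q
  proof -
    have Mf: "FA ?M f \<in> hom SET (tuples A k) (tuples A 1)"
      using functor_hom[OF is_functor_model_of[OF a] f] by (simp add: model_of_sel(1))
    have "fn (Cmp SET (\<tau> (\<iota> 1)) (FA ?M f)) q = fn (Cmp SET (FA ?N f) (\<tau> (\<iota> k))) q" using n(5)[OF f] by simp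
    then show ?thesis unfolding fn_Cmp_set_cat[OF Mf q] fn_Cmp_set_cat[OF \<tau>h q] .
  qed
  \<comment> \<open>Elements of the carrier occur as one-element lists; \<open>p\<close> strips off
    that coding.\<close>
  define p where "p = (\<lambda>x\<in>A. hd (decode (fn (\<tau> (\<iota> 1)) (code [x]))))"
  have p: "fn (\<tau> (\<iota> 1)) (code [x]) = code [p x]" "p x \<in> B" if x: "x \<in> A" for x
  proof -
    have "fn (\<tau> (\<iota> 1)) (code [x]) \<in> tuples B 1" using hom_set_catD(7)[OF \<tau>h] x by simp
    then obtain y where "fn (\<tau> (\<iota> 1)) (code [x]) = code [y]" "y \<in> B"
      by (auto simp: tuples_def Suc_length_conv length_Suc_conv)
    then show "fn (\<tau> (\<iota> 1)) (code [x]) = code [p x]" "p x \<in> B" using x by (auto simp: p_def)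
  qed
  \<comment> \<open>The \<open>i\<close>-th entry of the image is found by naturality against the
    \<open>i\<close>-th projection.\<close>
  have \<tau>_code: "fn (\<tau> (\<iota> k)) (code xs) = code (map p xs)" if xs: "set xs \<subseteq> A" "length xs = k" for k xs
  proof -
    have "fn (\<tau> (\<iota> k)) (code xs) \<in> tuples B k" using hom_set_catD(7)[OF \<tau>h] xs by simp
    then obtain ys where ys: "fn (\<tau> (\<iota> k)) (code xs) = code ys" "set ys \<subseteq> B" "length ys = k" by (rule tuplesE)
    have "ys ! i = map p xs ! i" if i: "i < k" for i
    proof -
      have "code [p (xs ! i)] = fn (\<tau> (\<iota> 1)) (fn (FA ?M (code [\<iota> k, eta T (fin k) (\<iota> i)])) (code xs))"
        unfolding model_of_proj[OF a i xs] using p(1)[of "xs ! i"] i xs nth_mem by (simp add: subset_iff)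
      also have "\<dots> = fn (FA ?N (code [\<iota> k, eta T (fin k) (\<iota> i)])) (code ys)"
        using nat[OF law_of_single, of "eta T (fin k) (\<iota> i)" k "code xs"] eta_in[OF T small_fin, of "\<iota> i" k] i xs ys(1) by simp
      also have "\<dots> = code [ys ! i]" by (rule model_of_proj[OF b i ys(2,3)])
      finally show ?thesis using i xs by simp
    qed
    then have "ys = map p xs" using xs ys by (intro nth_equalityI) auto
    then show ?thesis using ys by simp
  qed
  have pE: "p \<in> A \<rightarrow>\<^sub>E B" using p(2) by (auto simp: p_def)
  \<comment> \<open>Naturality against the operation \<open>s\<close> that represents
    \<open>t\<close>, at the tuple of its variables.\<close>
  have pab: "p (a t) = b (tmap T A B p t)" if t: "t \<in> TO T A" for t
  proof -
    obtain k ys s where s: "s \<in> TO T (fin k)" and ys: "\<And>i. i < k \<Longrightarrow> ys i \<in> A" and t': "t = nmap T k A ys s"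
      using finitely_supportedE[OF fin A t] by metis
    let ?xs = "map ys [0..<k]"
    have xs: "set ?xs \<subseteq> A" "length ?xs = k" using ys by auto
    have pxs: "set (map p ?xs) \<subseteq> B" "length (map p ?xs) = k" using p(2) ys by auto
    have ss: "set [s] \<subseteq> TO T (fin k)" using s by simp
    have 1: "interp T A a ?xs s = a t"
      unfolding interp_def t' by simp (rule arg_cong[where f = a], rule nmap_cong, simp)
    have "tmap T A B p t = nmap T k B (\<lambda>i. p (ys i)) s"
      unfolding t' using tmap_nmap[OF T A B, of k ys p s] ys p(2) s by simp
    also have "\<dots> = nmap T k B ((!) (map p ?xs)) s" by (rule nmap_cong) simp
    finally have 2: "interp T B b (map p ?xs) s = b (tmap T A B p t)" unfolding interp_def using pxs(2) by simp
    have "code [p (a t)] = fn (\<tau> (\<iota> 1)) (fn (FA ?M (code [\<iota> k, s])) (code ?xs))"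
      unfolding model_of_code[OF a ss xs] using p(1)[OF alg_in[OF a t]] 1 by simp
    also have "\<dots> = fn (FA ?N (code [\<iota> k, s])) (code (map p ?xs))"
      using nat[OF law_of_single[OF s], of "code ?xs"] xs \<tau>_code[OF xs] by simp
    also have "\<dots> = code [b (tmap T A B p t)]" unfolding model_of_code[OF b ss pxs] using 2 by simp
    finally show ?thesis by simp
  qed
  have f: "Arrow X Y (Arrow A B p) \<in> hom (Alg SET T) X Y"
    using X Y a b pE pab by (simp add: hom_Alg[OF T])
  have "(\<lambda>x\<in>Obj (lcat (law_of T)). tuple_map p A B (idx x)) = \<tau>"
  proof (rule extensionalityI[OF _ n(3)])
    fix x assume "x \<in> Obj (lcat (law_of T))"
    then obtain k where x: "x = \<iota> k" by auto
    have "tuple_map p A B k = \<tau> (\<iota> k)"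
    proof (rule set_arrow_eqI[OF tuple_map_hom[OF A B p(2)] \<tau>h])
      fix q assume "q \<in> tuples A k"
      then obtain xs where xs: "q = code xs" "set xs \<subseteq> A" "length xs = k" by (rule tuplesE)
      show "fn (tuple_map p A B k) q = fn (\<tau> (\<iota> k)) q" using tuple_map_code[OF xs(2,3)] \<tau>_code[OF xs(2,3)] xs(1) by simp
    qed
    then show "(\<lambda>x\<in>Obj (lcat (law_of T)). tuple_map p A B (idx x)) x = \<tau> x" by (simp add: x)
  qed simp
  then have "FA (alg_model T) (Arrow X Y (Arrow A B p)) = g"
    unfolding alg_model_FA[OF f] g by (simp add: X Y)
  then show ?thesis using f by blast
qed

text \<open>The carrier is the value of \<open>M\<close> at \<open>\<iota> 1\<close>. An operation
  \<open>s\<close> acts on a tuple by lifting it to the value at the power and applying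
  \<open>M\<close> to \<open>s\<close>; \<open>finitary_lift\<close> joins these actions to one
  structure map. The tupling maps are the isomorphism to \<open>M\<close>.\<close>

lemma alg_model_surj:
  assumes fin: "finitely_supported T" and M: "M \<in> Obj (Mod small (law_of T))"
  shows "\<exists>X\<in>Obj (Alg SET T). \<exists>e\<in>hom (Mod small (law_of T)) (FO (alg_model T) X) M. is_iso (Mod small (law_of T)) e"
proof -
  have Mm: "is_model (law_of T) M" using M Obj_Mod[OF law] by simp
  have Mf: "is_functor (lcat (law_of T)) SET M" using Mm by (simp add: is_model_def)
  let ?pr = "\<lambda>n i. code [\<iota> n, eta T (fin n) (\<iota> i)]"
  have Mp: "is_product SET n (\<lambda>_. FO M (\<iota> 1)) (FO M (\<iota> n)) (\<lambda>i. FA M (?pr n i))" for n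
    using Mm unfolding is_model_def by simp
  define A where "A = FO M (\<iota> 1)"
  have A: "small A" using functor_Obj[OF Mf, of "\<iota> 1"] by (simp add: A_def)
  \<comment> \<open>The inverse of the comparison between the value at a power and the tuples in
    \<open>A\<close>; it exists and is unique because \<open>M\<close> preserves the power.\<close>
  define tp where "tp n xs = (SOME q. q \<in> FO M (\<iota> n) \<and> (\<forall>i<n. fn (FA M (?pr n i)) q = xs i))" for n xs
  have tp: "tp n xs \<in> FO M (\<iota> n)" "\<And>i. i < n \<Longrightarrow> fn (FA M (?pr n i)) (tp n xs) = xs i"
    if "\<And>i. i < n \<Longrightarrow> xs i \<in> A" for n xs
  proof -
    have "\<exists>q. q \<in> FO M (\<iota> n) \<and> (\<forall>i<n. fn (FA M (?pr n i)) q = xs i)"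
      using set_product_tuple[OF Mp[of n], of xs] that by (auto simp: A_def)
    from someI_ex[OF this] show "tp n xs \<in> FO M (\<iota> n)" "\<And>i. i < n \<Longrightarrow> fn (FA M (?pr n i)) (tp n xs) = xs i"
      unfolding tp_def by auto
  qed
  have tp_eqI: "tp n xs = q" if "q \<in> FO M (\<iota> n)" "\<And>i. i < n \<Longrightarrow> fn (FA M (?pr n i)) q = xs i" "\<And>i. i < n \<Longrightarrow> xs i \<in> A" for n xs q
    using set_product_unique[OF Mp[of n] tp(1)[of n xs] that(1)] tp(2)[of n xs] that(2,3) by simp
  have tp_cong: "tp n xs = tp n ys" if "\<And>i. i < n \<Longrightarrow> xs i = ys i" for n xs ys
  proof -
    have "(\<lambda>q. q \<in> FO M (\<iota> n) \<and> (\<forall>i<n. fn (FA M (?pr n i)) q = xs i)) = (\<lambda>q. q \<in> FO M (\<iota> n) \<and> (\<forall>i<n. fn (FA M (?pr n i)) q = ys i))"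
      using that by auto
    then show ?thesis unfolding tp_def by simp
  qed
  have prh: "?pr n i \<in> hom (lcat (law_of T)) (\<iota> n) (\<iota> 1)" if "i < n" for n i
    by (rule law_of_single) (use that eta_in[OF T small_fin] in auto)
  \<comment> \<open>An arrow acts through its entries, since composing it with a projection picks an
    entry.\<close>
  have act: "fn (FA M (code (\<iota> m # ts))) (tp m xs) = tp (length ts) (\<lambda>i. fn (FA M (code [\<iota> m, ts ! i])) (tp m xs))"
    if ts: "set ts \<subseteq> TO T (fin m)" and xs: "\<And>i. i < m \<Longrightarrow> xs i \<in> A" for m ts xs
  proof (rule tp_eqI[symmetric])
    have f: "code (\<iota> m # ts) \<in> hom (lcat (law_of T)) (\<iota> m) (\<iota> (length ts))" using ts by (auto simp: hom_law_of)
    note t = tp(1)[of m xs, OF xs]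
    show "fn (FA M (code (\<iota> m # ts))) (tp m xs) \<in> FO M (\<iota> (length ts))"
      using hom_set_catD(7)[OF functor_hom[OF Mf f] t] .
    fix i assume i: "i < length ts"
    have tsi: "ts ! i \<in> TO T (fin m)" using ts i by (auto simp: subset_iff)
    show "fn (FA M (code [\<iota> m, ts ! i])) (tp m xs) \<in> A"
      unfolding A_def using hom_set_catD(7)[OF functor_hom[OF Mf law_of_single[OF tsi]] t] .
    show "fn (FA M (?pr (length ts) i)) (fn (FA M (code (\<iota> m # ts))) (tp m xs)) = fn (FA M (code [\<iota> m, ts ! i])) (tp m xs)"
      using functor_fn_Cmp[OF Mf f prh[OF i] t] lsub_eta[OF T ts i] by simp
  qed
  have pr_tp: "fn (FA M (code [\<iota> m, eta T (fin m) (\<iota> i)])) (tp m xs) = xs i" if "i < m" "\<And>i. i < m \<Longrightarrow> xs i \<in> A" for m i xs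
    using tp(2)[of m xs i] that by simp
  \<comment> \<open>The actions respect renaming because a renaming is itself an arrow of the
    theory, and \<open>act\<close> evaluates \<open>M\<close> on it.\<close>
  have "\<exists>h. \<forall>n xs s. s \<in> TO T (fin n) \<longrightarrow> (\<forall>i<n. xs i \<in> A) \<longrightarrow> h (nmap T n A xs s) = fn (FA M (code [\<iota> n, s])) (tp n xs)"
  proof (rule finitary_lift[OF T A])
    fix n k f xs s
    assume s: "s \<in> TO T (fin n)" and f: "\<And>i. i < n \<Longrightarrow> f i < (k :: nat)" and xs: "\<And>i. i < k \<Longrightarrow> xs i \<in> A"
    let ?es = "map (\<lambda>i. eta T (fin k) (\<iota> (f i))) [0..<n]"
    have es: "set ?es \<subseteq> TO T (fin k)" using f eta_in[OF T small_fin] by auto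
    have eh: "code (\<iota> k # ?es) \<in> hom (lcat (law_of T)) (\<iota> k) (\<iota> n)" using es by (auto simp: hom_law_of)
    note tk = tp(1)[of k xs, OF xs]
    have "fn (FA M (code [\<iota> k, nmap T n (fin k) (\<lambda>i. \<iota> (f i)) s])) (tp k xs) =
        fn (FA M (code [\<iota> n, s])) (fn (FA M (code (\<iota> k # ?es))) (tp k xs))"
      using functor_fn_Cmp[OF Mf eh law_of_single[OF s] tk] lsub_nmap_eta[OF T, of n f k s] f s by simp
    also have "fn (FA M (code (\<iota> k # ?es))) (tp k xs) = tp n (\<lambda>i. fn (FA M (code [\<iota> k, ?es ! i])) (tp k xs))"
      using act[OF es, of xs] xs by simp
    also have "\<dots> = tp n (\<lambda>i. xs (f i))" by (rule tp_cong) (use pr_tp[of _ k xs] f xs in auto)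
    finally show "fn (FA M (code [\<iota> k, nmap T n (fin k) (\<lambda>i. \<iota> (f i)) s])) (tp k xs) =
        fn (FA M (code [\<iota> n, s])) (tp n (\<lambda>i. xs (f i)))" .
  next
    fix n xs ys s assume "\<And>i. i < (n :: nat) \<Longrightarrow> xs i = (ys i :: 'u)"
    then show "fn (FA M (code [\<iota> n, s])) (tp n xs) = fn (FA M (code [\<iota> n, s])) (tp n ys)" using tp_cong[of n xs ys] by simp
  qed
  then obtain h where h: "\<And>n xs s. s \<in> TO T (fin n) \<Longrightarrow> (\<And>i. i < n \<Longrightarrow> xs i \<in> A) \<Longrightarrow>
      h (nmap T n A xs s) = fn (FA M (code [\<iota> n, s])) (tp n xs)" by blast
  define a where "a = restrict h (TO T A)"
  have a: "a (nmap T n A xs s) = fn (FA M (code [\<iota> n, s])) (tp n xs)"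
    if "s \<in> TO T (fin n)" "\<And>i. i < n \<Longrightarrow> xs i \<in> A" for n xs s
    using h[of s n xs] nmap_in[OF T A, of n xs s] that by (simp add: a_def)
  have act_in: "fn (FA M (code [\<iota> n, s])) (tp n xs) \<in> A" if "s \<in> TO T (fin n)" "\<And>i. i < n \<Longrightarrow> xs i \<in> A" for n xs s
    unfolding A_def by (rule hom_set_catD(7)[OF functor_hom[OF Mf law_of_single[OF that(1)]] tp(1)]) (rule that(2))
  have aA: "a t \<in> A" if "t \<in> TO T A" for t
  proof -
    obtain n xs s where s: "s \<in> TO T (fin n)" and xs: "\<And>i. i < n \<Longrightarrow> xs i \<in> A" and t: "t = nmap T n A xs s"
      using finitely_supportedE[OF fin A \<open>t \<in> TO T A\<close>] by metis
    show ?thesis unfolding t using a[of s n xs] act_in[of s n xs] s xs by simp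
  qed
  have alg: "is_alg T A a"
    unfolding is_alg_def
  proof (intro conjI ballI A)
    show "a \<in> TO T A \<rightarrow>\<^sub>E A" using aA by (auto simp: a_def)
  next
    fix x assume x: "x \<in> A"
    have "eta T A x = nmap T 1 A (\<lambda>_. x) (eta T (fin 1) (\<iota> 0))"
      unfolding nmap_def using tmap_eta[OF T small_fin A, of 1 "\<lambda>_. x" "\<iota> 0"] x by simp
    then show "a (eta T A x) = x"
      using a[of "eta T (fin 1) (\<iota> 0)" 1 "\<lambda>_. x"] eta_in[OF T small_fin, of "\<iota> 0" 1] pr_tp[of 0 1 "\<lambda>_. x"] x by simp
  next
    fix t assume t: "t \<in> TO T (TO T A)"
    note TA = small_TO[OF T A]
    obtain n ys s where s: "s \<in> TO T (fin n)" and ys: "\<And>i. i < n \<Longrightarrow> ys i \<in> TO T A" and t': "t = nmap T n (TO T A) ys s"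
      using finitely_supportedE[OF fin TA t] by metis
    \<comment> \<open>With common variables for all \<open>ys i\<close>, both sides of the
      associativity law become the action of \<open>s\<close> after the arrow with entries
      \<open>r i\<close>; functoriality of \<open>M\<close> equates them.\<close>
    have "\<exists>k zs r. (\<forall>j<k. zs j \<in> A) \<and> (\<forall>i<n. r i \<in> TO T (fin k) \<and> ys i = nmap T k A zs (r i))"
      by (rule common_support[OF T fin A]) (rule ys)
    then obtain k zs r where zs: "\<And>j. j < k \<Longrightarrow> zs j \<in> A" and r: "\<And>i. i < n \<Longrightarrow> r i \<in> TO T (fin k)"
      and yr: "\<And>i. i < n \<Longrightarrow> ys i = nmap T k A zs (r i)" by metis
    let ?rs = "map r [0..<n]"
    have rs: "set ?rs \<subseteq> TO T (fin k)" using r by auto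
    have rh: "code (\<iota> k # ?rs) \<in> hom (lcat (law_of T)) (\<iota> k) (\<iota> n)" using rs by (auto simp: hom_law_of)
    have ls: "lsub T k ?rs s \<in> TO T (fin k)" by (rule lsub_in[OF T rs]) (use s in simp)
    have "mu T A t = nmap T k A zs (lsub T k ?rs s)"
      using bind_nmap_lsub[OF T TA A, of n ys "\<lambda>x. x" s r k zs] bind_id[OF T A t] ys s r zs yr t' by simp
    then have "a (mu T A t) = fn (FA M (code [\<iota> k, lsub T k ?rs s])) (tp k zs)" using a[OF ls, of zs] zs by simp
    also have "\<dots> = fn (FA M (code [\<iota> n, s])) (fn (FA M (code (\<iota> k # ?rs))) (tp k zs))"
      using functor_fn_Cmp[OF Mf rh law_of_single[OF s], of "tp k zs"] tp(1)[of k zs] zs by simp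
    also have "fn (FA M (code (\<iota> k # ?rs))) (tp k zs) = tp n (\<lambda>i. fn (FA M (code [\<iota> k, ?rs ! i])) (tp k zs))"
      using act[OF rs, of zs] zs by simp
    also have "\<dots> = tp n (\<lambda>i. a (ys i))" by (rule tp_cong) (use a[of _ k zs] r zs yr in auto)
    also have "fn (FA M (code [\<iota> n, s])) \<dots> = a (nmap T n A (\<lambda>i. a (ys i)) s)"
      using a[OF s, of "\<lambda>i. a (ys i)"] aA ys by simp
    also have "nmap T n A (\<lambda>i. a (ys i)) s = tmap T (TO T A) A a t"
      unfolding t' using tmap_nmap[OF T TA A, of n ys a s] ys aA s by simp
    finally show "a (tmap T (TO T A) A a t) = a (mu T A t)" ..
  qed
  let ?X = "(A, Arrow (TO T A) A a)" and ?C = "lcat (law_of T)"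
  let ?N = "model_of T ?X"
  define e where "e n = Arrow (tuples A n) (FO M (\<iota> n)) (\<lambda>q\<in>tuples A n. tp n ((!) (decode q)))" for n
  have nthA: "xs ! i \<in> A" if "set xs \<subseteq> A" "length xs = n" "i < n" for xs :: "'u list" and i n
    using that by (auto simp: subset_iff)
  have Mo: "small (FO M (\<iota> n))" for n using functor_Obj[OF Mf, of "\<iota> n"] by simp
  have e_code: "fn (e n) (code xs) = tp n ((!) xs)" if "set xs \<subseteq> A" "length xs = n" for n xs
    using that by (simp add: e_def)
  have eh: "e n \<in> hom SET (tuples A n) (FO M (\<iota> n))" for n
    using Mo small_tuples[OF A] tp(1) nthA by (auto simp: e_def elim!: tuplesE)
  have einj: "inj_on (fn (e n)) (tuples A n)" for n
  proof (rule inj_onI)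
    fix q q' assume "q \<in> tuples A n" "q' \<in> tuples A n" and eq: "fn (e n) q = fn (e n) q'"
    then obtain xs ys where xs: "q = code xs" "set xs \<subseteq> A" "length xs = n" and ys: "q' = code ys" "set ys \<subseteq> A" "length ys = n"
      by (auto elim!: tuplesE)
    have "tp n ((!) xs) = tp n ((!) ys)" using eq e_code xs ys by simp
    then have "xs ! i = ys ! i" if "i < n" for i
      using tp(2)[of n "(!) xs" i] tp(2)[of n "(!) ys" i] nthA[OF xs(2,3)] nthA[OF ys(2,3)] that by simp
    then show "q = q'" using xs ys by (auto intro: nth_equalityI)
  qed
  have esurj: "fn (e n) ` tuples A n = FO M (\<iota> n)" for n
  proof
    show "fn (e n) ` tuples A n \<subseteq> FO M (\<iota> n)" using hom_set_catD(7)[OF eh] by auto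
    show "FO M (\<iota> n) \<subseteq> fn (e n) ` tuples A n"
    proof
      fix q assume q: "q \<in> FO M (\<iota> n)"
      let ?xs = "map (\<lambda>i. fn (FA M (?pr n i)) q) [0..<n]"
      have c: "fn (FA M (?pr n i)) q \<in> A" if "i < n" for i
        unfolding A_def by (rule hom_set_catD(7)[OF functor_hom[OF Mf prh[OF that]] q])
      have xs: "set ?xs \<subseteq> A" "length ?xs = n" using c by auto
      have eq: "fn (e n) (code ?xs) = q"
        unfolding e_code[OF xs] by (rule tp_eqI[OF q]) (use c in auto)
      have "code ?xs \<in> tuples A n" using xs by simp
      from imageI[OF this, of "fn (e n)"] show "q \<in> fn (e n) ` tuples A n" unfolding eq .
    qed
  qed
  define \<epsilon> where "\<epsilon> = (\<lambda>x\<in>Obj ?C. e (idx x))"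
  have \<epsilon>: "is_nat_trans ?C SET ?N M \<epsilon>"
  proof (rule is_nat_transI[OF is_category_law_of[OF T] is_functor_model_of[OF alg] Mf])
    fix x assume "x \<in> Obj ?C"
    then show "\<epsilon> x \<in> hom SET (FO ?N x) (FO M x)" using eh by (auto simp: \<epsilon>_def model_of_sel(1))
  next
    fix f x y assume f0: "f \<in> hom ?C x y"
    then obtain m ts where x: "x = \<iota> m" "y = \<iota> (length ts)" and f: "f = code (\<iota> m # ts)" and ts: "set ts \<subseteq> TO T (fin m)"
      by (auto simp: hom_law_of)
    have Nf: "FA ?N f \<in> hom SET (tuples A m) (tuples A (length ts))"
      using functor_hom[OF is_functor_model_of[OF alg] f0] x by (simp add: model_of_sel(1))
    have MfM: "FA M f \<in> hom SET (FO M (\<iota> m)) (FO M (\<iota> (length ts)))" using functor_hom[OF Mf f0] x by simp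
    have "Cmp SET (e (length ts)) (FA ?N f) = Cmp SET (FA M f) (e m)"
    proof (rule set_arrow_eqI[OF Cmp_hom[OF is_category_set_cat Nf eh] Cmp_hom[OF is_category_set_cat eh MfM]])
      fix q assume q: "q \<in> tuples A m"
      then obtain xs where xs: "q = code xs" "set xs \<subseteq> A" "length xs = m" by (rule tuplesE)
      have ys: "set (map (interp T A a xs) ts) \<subseteq> A" "length (map (interp T A a xs) ts) = length ts"
        using interp_in[OF alg xs(2)] ts xs(3) by auto
      have "map (interp T A a xs) ts ! i = fn (FA M (code [\<iota> m, ts ! i])) (tp m ((!) xs))" if i: "i < length ts" for i
        using a[of "ts ! i" m "(!) xs"] nthA[OF xs(2,3)] ts i xs(3) by (simp add: interp_def subset_iff)
      then have "tp (length ts) ((!) (map (interp T A a xs) ts)) = tp (length ts) (\<lambda>i. fn (FA M (code [\<iota> m, ts ! i])) (tp m ((!) xs)))"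
        by (rule tp_cong)
      also have "\<dots> = fn (FA M f) (tp m ((!) xs))" unfolding f using act[OF ts, of "(!) xs"] nthA[OF xs(2,3)] by simp
      finally show "fn (Cmp SET (e (length ts)) (FA ?N f)) q = fn (Cmp SET (FA M f) (e m)) q"
        unfolding fn_Cmp_set_cat[OF Nf q] fn_Cmp_set_cat[OF eh q] unfolding xs(1) e_code[OF xs(2,3)]
        unfolding f model_of_code[OF alg ts xs(2,3)] e_code[OF ys] .
    qed
    then show "Cmp SET (\<epsilon> y) (FA ?N f) = Cmp SET (FA M f) (\<epsilon> x)" by (simp add: \<epsilon>_def x)
  qed (simp add: \<epsilon>_def)
  have "is_iso SET (\<epsilon> x)" if "x \<in> Obj ?C" for x
    using that is_iso_set_cat[OF eh einj esurj] by (auto simp: \<epsilon>_def)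
  then obtain \<delta> where \<delta>: "is_nat_trans ?C SET M ?N \<delta>" and de: "\<And>x. x \<in> Obj ?C \<Longrightarrow> Cmp SET (\<delta> x) (\<epsilon> x) = Idn SET (FO ?N x)"
    and ed: "\<And>x. x \<in> Obj ?C \<Longrightarrow> Cmp SET (\<epsilon> x) (\<delta> x) = Idn SET (FO M x)"
    using nat_trans_inverse[OF is_category_law_of[OF T] is_category_set_cat \<epsilon>] by blast
  have Nm: "is_model (law_of T) ?N" by (rule is_model_model_of[OF alg])
  have eh': "Arrow ?N M \<epsilon> \<in> hom (Mod small (law_of T)) ?N M" and dh: "Arrow M ?N \<delta> \<in> hom (Mod small (law_of T)) M ?N"
    using Nm Mm \<epsilon> \<delta> by (auto simp: hom_Mod[OF law])
  have "is_iso (Mod small (law_of T)) (Arrow ?N M \<epsilon>)"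
    by (rule is_isoI[OF eh' dh]) (use de ed in \<open>auto simp: restrict_def fun_eq_iff\<close>)
  moreover have "?X \<in> Obj (Alg SET T)" using alg by (simp add: is_algebra_iff[OF T])
  ultimately show ?thesis using eh' alg_model_FO[OF alg] by (metis (no_types, lifting))
qed

lemma is_equivalence_alg_model:
  assumes fin: "finitely_supported T"
  shows "is_equivalence (Alg SET T) (Mod small (law_of T)) (alg_model T)"
  by (rule is_equivalence_fully_faithful_surj[OF is_category_Alg[OF T] is_category_Mod[OF law] is_functor_alg_model
        alg_model_faithful alg_model_full[OF fin] alg_model_surj[OF fin]])

end

section \<open>Strict naturality in the monad\<close>

text \<open>On objects both sides are \<open>tuples A n\<close>. On arrows the claim is that
  interpreting an operation by the restricted structure is interpreting its image under
  \<open>\<sigma>\<close>, which holds because \<open>\<sigma>\<close> commutes with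
  \<open>nmap\<close>.\<close>

lemma model_of_natural:
  assumes S: "is_monad SET S" and T: "is_monad SET T" and \<sigma>: "is_monad_morphism SET S T \<sigma>" and a: "is_alg T A a"
  shows "comp_functor (lcat (law_of S)) (model_of T (A, Arrow (TO T A) A a)) (law_map S \<sigma>) =
    model_of S (A, Arrow (TO S A) A (compose (TO S A) a (fn (\<sigma> A))))"
proof (rule functor_eqI[OF is_functor_comp_functor[OF is_category_law_of[OF S] law_morphismD(1)[OF is_law_morphism_law_map[OF S T \<sigma>]]
        is_functor_model_of[OF T a]] is_functor_model_of[OF S is_alg_restrict[OF S T \<sigma> a]]])
  fix x assume x: "x \<in> Obj (lcat (law_of S))"
  then show "FO (comp_functor (lcat (law_of S)) (model_of T (A, Arrow (TO T A) A a)) (law_map S \<sigma>)) x =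
      FO (model_of S (A, Arrow (TO S A) A (compose (TO S A) a (fn (\<sigma> A))))) x"
    by (auto simp: law_map_sel model_of_sel(1))
next
  let ?b = "compose (TO S A) a (fn (\<sigma> A))"
  fix f assume f': "f \<in> Arr (lcat (law_of S))"
  then obtain m ts where f: "f = code (\<iota> m # ts)" and ts: "set ts \<subseteq> TO S (fin m)" by (auto simp: Arr_law_of)
  have A: "small A" using a by (simp add: is_alg_def)
  have sts: "set (map (fn (\<sigma> (fin m))) ts) \<subseteq> TO T (fin m)" using monad_morphism_in[OF \<sigma> small_fin] ts by auto
  have "map (interp T A a (decode q)) (map (fn (\<sigma> (fin m))) ts) = map (interp S A ?b (decode q)) ts" if "q \<in> tuples A m" for q
    using that
  proof (rule tuplesE)
    fix xs assume xs: "q = code xs" "set xs \<subseteq> A" "length xs = m"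
    have xA: "\<And>i. i < m \<Longrightarrow> xs ! i \<in> A" using xs by (auto simp: subset_iff)
    have "interp T A a xs (fn (\<sigma> (fin m)) t) = interp S A ?b xs t" if "t \<in> set ts" for t
      using that ts monad_morphism_nmap[OF S \<sigma> A, of m "(!) xs" t] xA nmap_in[OF S A, of m "(!) xs" t] xs(3)
      by (auto simp: interp_def compose_def)
    then show ?thesis using xs(1) by simp
  qed
  then have "(\<lambda>q\<in>tuples A m. code (map (interp T A a (decode q)) (map (fn (\<sigma> (fin m))) ts))) =
      (\<lambda>q\<in>tuples A m. code (map (interp S A ?b (decode q)) ts))"
    by (intro restrict_ext) simp
  then show "FA (comp_functor (lcat (law_of S)) (model_of T (A, Arrow (TO T A) A a)) (law_map S \<sigma>)) f =
      FA (model_of S (A, Arrow (TO S A) A ?b)) f"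
    unfolding comp_functor_sel(2)[OF f'] unfolding f law_map_sel(2)[OF ts] model_of_sel(2)[OF ts] model_of_sel(2)[OF sts] by simp
qed

lemma alg_model_natural:
  assumes S: "is_monad SET S" and T: "is_monad SET T" and \<sigma>: "is_monad_morphism SET S T \<sigma>"
  shows "comp_functor (Alg SET T) (mod_restrict small (Arrow (law_of S) (law_of T) (law_map S \<sigma>))) (alg_model T) =
    comp_functor (Alg SET T) (alg_model S) (alg_restrict SET (Arrow S T \<sigma>))"
proof -
  note LS = is_lawvere_theory_law_of[OF S] and LT = is_lawvere_theory_law_of[OF T] and H = is_law_morphism_law_map[OF S T \<sigma>]
  note Hf = law_morphismD(1)[OF H]
  have FO: "comp_functor (lcat (law_of S)) (model_of T X) (law_map S \<sigma>) = FO (alg_model S) (FO (alg_restrict SET (Arrow S T \<sigma>)) X)"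
    "FO (alg_model S) (FO (alg_restrict SET (Arrow S T \<sigma>)) X) = model_of S (FO (alg_restrict SET (Arrow S T \<sigma>)) X)"
    "fst (FO (alg_restrict SET (Arrow S T \<sigma>)) X) = fst X" "is_model (law_of T) (model_of T X)" "FO (alg_model T) X = model_of T X"
    if XO: "X \<in> Obj (Alg SET T)" for X
  proof -
    obtain A a where X: "X = (A, Arrow (TO T A) A a)" and a: "is_alg T A a" using XO by (auto simp: is_algebra_iff[OF T])
    note b = is_alg_restrict[OF S T \<sigma> a]
    show "comp_functor (lcat (law_of S)) (model_of T X) (law_map S \<sigma>) = FO (alg_model S) (FO (alg_restrict SET (Arrow S T \<sigma>)) X)"
      unfolding X alg_restrict_FO[OF S T \<sigma> a] alg_model_FO[OF S b] by (rule model_of_natural[OF S T \<sigma> a])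
    show "FO (alg_model S) (FO (alg_restrict SET (Arrow S T \<sigma>)) X) = model_of S (FO (alg_restrict SET (Arrow S T \<sigma>)) X)"
      unfolding X alg_restrict_FO[OF S T \<sigma> a] by (rule alg_model_FO[OF S b])
    show "fst (FO (alg_restrict SET (Arrow S T \<sigma>)) X) = fst X" unfolding X alg_restrict_FO[OF S T \<sigma> a] by simp
    show "is_model (law_of T) (model_of T X)" unfolding X by (rule is_model_model_of[OF T a])
    show "FO (alg_model T) X = model_of T X" unfolding X by (rule alg_model_FO[OF T a])
  qed
  show ?thesis
  proof (rule functor_eqI[OF is_functor_comp_functor[OF is_category_Alg[OF T] is_functor_alg_model[OF T] is_functor_mod_restrict[OF LS LT H]]
        is_functor_comp_functor[OF is_category_Alg[OF T] is_functor_alg_restrict[OF S T \<sigma>] is_functor_alg_model[OF S]]])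
    fix X assume X: "X \<in> Obj (Alg SET T)"
    show "FO (comp_functor (Alg SET T) (mod_restrict small (Arrow (law_of S) (law_of T) (law_map S \<sigma>))) (alg_model T)) X =
        FO (comp_functor (Alg SET T) (alg_model S) (alg_restrict SET (Arrow S T \<sigma>))) X"
      unfolding comp_functor_sel(1)[OF X] FO(5)[OF X] mod_restrict_FO[OF LS LT H FO(4)[OF X]] by (rule FO(1)[OF X])
  next
    fix h assume h': "h \<in> Arr (Alg SET T)"
    obtain X Y where h: "h \<in> hom (Alg SET T) X Y" using hom_self[OF h'] by blast
    have X: "X \<in> Obj (Alg SET T)" and Y: "Y \<in> Obj (Alg SET T)" using hom_Obj[OF is_category_Alg[OF T] h] by auto
    \<comment> \<open>Precomposition with \<open>law_map\<close> leaves components indexed by arity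
      unchanged, since it fixes all objects.\<close>
    have cmp: "compose (Obj (lcat (law_of S))) (\<lambda>x\<in>Obj (lcat (law_of T)). F (idx x)) (FO (law_map S \<sigma>)) =
        (\<lambda>x\<in>Obj (lcat (law_of S)). F (idx x))" for F :: "nat \<Rightarrow> 'u set_arrow"
      by (auto simp: compose_def fun_eq_iff restrict_def law_map_def)
    show "FA (comp_functor (Alg SET T) (mod_restrict small (Arrow (law_of S) (law_of T) (law_map S \<sigma>))) (alg_model T)) h =
        FA (comp_functor (Alg SET T) (alg_model S) (alg_restrict SET (Arrow S T \<sigma>))) h"
      unfolding comp_functor_sel(2)[OF h'] mod_restrict_FA[OF LS LT H alg_model_hom[OF T h]]
        alg_model_FA[OF S alg_restrict_hom[OF S T \<sigma> h]]
      unfolding alg_model_FA[OF T h] alg_restrict_FA[OF S T \<sigma> h] FO(1)[OF X] FO(1)[OF Y] FO(2)[OF X] FO(2)[OF Y] FO(3)[OF X] FO(3)[OF Y]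
        arrow.sel cmp ..
  qed
qed

lemma Alg_pseudonaturally_equivalent_Mod:
  "pseudonaturally_equivalent (Mnd\<^sub>f small) (Alg_functor small) (precomp_cat_valued (Mod_functor small) law_functor)"
proof -
  let ?\<Psi> = "precomp_cat_valued (Mod_functor small) law_functor"
  have \<Psi>: "is_cat_valued_functor (Mnd\<^sub>f small) ?\<Psi>"
    by (rule is_cat_valued_functor_precomp[OF is_category_Mnd is_functor_law_functor is_cat_valued_functor_Mod])
  have fib: "fiber (Alg_functor small) T = Alg SET T" "finitary_monad T \<Longrightarrow> fiber ?\<Psi> T = Mod small (law_of T)" for T
    by (simp_all add: Alg_functor_def precomp_cat_valued_def Mod_functor_def)
  have eq: "is_equivalence (fiber (Alg_functor small) T) (fiber ?\<Psi> T) (alg_model T)" if "T \<in> Obj (Mnd\<^sub>f small)" for T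
    using that is_equivalence_alg_model[of T] by (simp add: fib finitary_monadD)
  have "\<exists>\<theta>. is_pseudonatural (Mnd\<^sub>f small) (Alg_functor small) ?\<Psi> alg_model \<theta>"
  proof (rule exI, rule is_pseudonatural_strict[OF is_cat_valued_functor_Alg \<Psi>])
    fix T assume "T \<in> Obj (Mnd\<^sub>f small)"
    then show "is_functor (fiber (Alg_functor small) T) (fiber ?\<Psi> T) (alg_model T)"
      using eq by (simp add: is_equivalence_def)
  next
    fix f S T assume f: "f \<in> hom (Mnd\<^sub>f small) S T"
    note m = hom_MndD[OF f]
    have f': "f = Arrow S T (fn f)" using m by (cases f) auto
    have "reindex ?\<Psi> f = mod_restrict small (Arrow (law_of S) (law_of T) (law_map S (fn f)))"
      by (simp add: precomp_cat_valued_def Mod_functor_def law_functor_FA[OF f])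
    moreover have "reindex (Alg_functor small) f = alg_restrict SET (Arrow S T (fn f))"
      using f' by (simp add: Alg_functor_def)
    ultimately show "comp_functor (fiber (Alg_functor small) T) (reindex ?\<Psi> f) (alg_model T) =
        comp_functor (fiber (Alg_functor small) T) (alg_model S) (reindex (Alg_functor small) f)"
      using alg_model_natural[OF m(1-3)] by (simp add: fib(1))
  qed
  then show ?thesis unfolding pseudonaturally_equivalent_def using eq by blast
qed

end

theorem proposition5p4:
  fixes small :: "'u set \<Rightarrow> bool"
  assumes "set_universe small"
  shows "\<exists>F. is_equivalence (Mnd\<^sub>f small) (Law small) F \<and>
     is_cat_valued_functor (Law small) (Mod_functor small) \<and>
     pseudonaturally_equivalent (Mnd\<^sub>f small)
       (Alg_functor small) (precomp_cat_valued (Mod_functor small) F)"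
proof -
  obtain code \<iota> where "coded_universe small code \<iota>"
    using set_universe.ex_coded_universe[OF assms] by blast
  then interpret coded_universe small code \<iota> .
  show ?thesis
    using is_equivalence_law_functor is_cat_valued_functor_Mod Alg_pseudonaturally_equivalent_Mod by blast
qed

end
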